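(* Let $\sigma$ be fixed and sufficiently large in the sense described in the context, let $u\in H^2(\Omega)$ be the strong solution of $$\sup_{\alpha\in\Lambda}\{A^\alpha:D^2u-f^\alpha\}=0\ \text{ a.e. in }\Omega,\qquad u=g\ \text{ on }\partial\Omega,$$ and let $g_h\in V_h$ be an approximation of $g$. There exists a positive constant $C_\sharp$, independent of $h$, such that if $u_h\in V_h$ satisfies $$a_h(u_h;v)=0\quad\forall v\in V_{h,0},\qquad u_h|_{\partial\Omega}=g_h|_{\partial\Omega},$$ then $$\|u-u_h\|_h\le C_\sharp\inf_{v\in V_h:\ v|_{\partial\Omega}=g_h|_{\partial\Omega}}\|u-v\|_h .$$
   Context: $\Omega\subset\mathbb R^d$, $d\in\{2,3\}$, is a bounded convex polytopal domain and $g\in H^2(\Omega)$. $\Lambda$ is a compact metric space and $A,f\in C(\overline\Omega\times\Lambda)$, with $A$ valued in symmetric $d\times d$ matrices and $f$ real-valued; $A^\alpha(x)=A(x,\alpha)$, $f^\alpha(x)=f(x,\alpha)$. (If $\Lambda$ is a singleton it is only assumed that $A\in L^\infty(\Omega)$, $f\in L^2(\Omega)$.) There are $0<\mu_1\le\mu_2$ and $\varepsilon\in(0,1]$ with $\mu_1|\xi|^2\le\xi^TA^\alpha\xi\le\mu_2|\xi|^2$ and $|A^\alpha|/\operatorname{Tr}(A^\alpha)\le 1/\sqrt{d-1+\varepsilon}$ a.e. in $\Omega$, for all $\xi\in\mathbb R^d$, $\alpha\in\Lambda$ (Frobenius norm and inner product $M:N$). Set $\gamma^\alpha:=\frac{A^\alpha:I}{A^\alpha:A^\alpha}$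 and $F_\gamma[u]:=\sup_{\alpha\in\Lambda}\{\gamma^\alpha(A^\alpha:D^2u-f^\alpha)\}$, where for piecewise $H^2$ functions $D^2$ is replaced by the piecewise Hessian $D^2_h$; $\Delta_h$ is the piecewise Laplacian. $\mathscr T_h$ ranges over a shape-regular family of conforming simplicial triangulations of $\Omega$ with mesh size $h$; $V_h\subset H^1(\Omega)$ is the continuous Lagrange finite element space of order $p\ge2$ on $\mathscr T_h$ and $V_{h,0}:=V_h\cap H^1_0(\Omega)$. $\mathscr E^i_h$ is the set of interior edges (faces if $d=3$) of $\mathscr T_h$, $h_e$ is the diameter of $e$, and $[\![\partial v/\partial n]\!]_e$ is the jump across $e$ of the normal derivative of $v$. For a constant $\sigma>0$, $$\|u\|_h^2:=\int_\Omega|D^2_hu|^2+\sum_{e\in\mathscr E^i_h}\frac{\sigma}{h_e}\big\|[\![\partial u/\partial n]\!]_e\big\|_{L^2(e)}^2,$$ $$a_h(u;v):=\int_\Omega F_\gamma[u]\,\Delta_hv+\sum_{e\in\mathscr E^i_h}\frac{\sigma}{h_e}\int_e[\![\partial u/\partial n]\!]_e[\![\partial v/\partial n]\!]_e .$$ "$\sigma$ sufficiently large" means: for some $\delta\in(0,1)$, $\sigma\ge\sigma_0(\delta)$, where $\sigma_0(\delta)$ is an $h$-independent threshold such that for all $\sigma\ge\sigma_0(\delta)$ one has $a_h(w;w-v)-a_h(v;w-v)\ge\delta(1-\sqrt{1-\varepsilon})\|w-v\|_h^2$ for all $h$ and all $w,v\in V_h$ with $w-v\in V_{h,0}$; in particular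 the discrete problem then has a unique solution $u_h$. *)

theory Defs
  imports "HOL-Analysis.Analysis"
begin

section \<open>Sobolev spaces\<close>

definition partial :: "'n::finite \<Rightarrow> (real^'n \<Rightarrow> real) \<Rightarrow> real^'n \<Rightarrow> real" where
  "partial i f x = frechet_derivative f (at x) (axis i 1)"

primrec Ck :: "nat \<Rightarrow> (real^'n::finite \<Rightarrow> real) \<Rightarrow> bool" where
  "Ck 0 f \<longleftrightarrow> continuous_on UNIV f"
| "Ck (Suc k) f \<longleftrightarrow> (\<forall>x. f differentiable (at x)) \<and> (\<forall>i. Ck k (partial i f))"

definition smooth :: "(real^'n::finite \<Rightarrow> real) \<Rightarrow> bool" where
  "smooth f \<longleftrightarrow> (\<forall>k. Ck k f)"

definition test_functions :: "(real^'n::finite) set \<Rightarrow> (real^'n \<Rightarrow> real) set" where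
  "test_functions S = {\<phi>. smooth \<phi> \<and> compact (closure {x. \<phi> x \<noteq> 0}) \<and> closure {x. \<phi> x \<noteq> 0} \<subseteq> S}"

definition locally_integrable :: "(real^'n::finite) set \<Rightarrow> (real^'n \<Rightarrow> real) \<Rightarrow> bool" where
  "locally_integrable S u \<longleftrightarrow> (\<forall>C. compact C \<and> C \<subseteq> S \<longrightarrow> integrable (lebesgue_on C) u)"

definition is_weak_partial ::
    "(real^'n::finite) set \<Rightarrow> 'n \<Rightarrow> (real^'n \<Rightarrow> real) \<Rightarrow> (real^'n \<Rightarrow> real) \<Rightarrow> bool" where
  "is_weak_partial S i u w \<longleftrightarrow>
     locally_integrable S u \<and> locally_integrable S w \<and>
     (\<forall>\<phi>\<in>test_functions S.
        integral\<^sup>L (lebesgue_on S) (\<lambda>x. u x * partial i \<phi> x) =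
        - integral\<^sup>L (lebesgue_on S) (\<lambda>x. w x * \<phi> x))"

text \<open>A representative of the weak derivative; it is determined almost everywhere in the open
  set \<open>S\<close>, and its values off \<open>S\<close> carry no information.\<close>

definition weak_partial ::
    "(real^'n::finite) set \<Rightarrow> 'n \<Rightarrow> (real^'n \<Rightarrow> real) \<Rightarrow> real^'n \<Rightarrow> real" where
  "weak_partial S i u = (SOME w. is_weak_partial S i u w)"

definition weak_hessian ::
    "(real^'n::finite) set \<Rightarrow> (real^'n \<Rightarrow> real) \<Rightarrow> real^'n \<Rightarrow> real^'n^'n" where
  "weak_hessian S u x = (\<chi> i j. weak_partial S j (weak_partial S i u) x)"

definition L2 :: "(real^'n::finite) set \<Rightarrow> (real^'n \<Rightarrow> real) set" where
  "L2 S = {u. u \<in> borel_measurable (lebesgue_on S) \<and> integrable (lebesgue_on S) (\<lambda>x. (u x)\<^sup>2)}"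

definition H1 :: "(real^'n::finite) set \<Rightarrow> (real^'n \<Rightarrow> real) set" where
  "H1 S = {u \<in> L2 S. \<forall>i. \<exists>w\<in>L2 S. is_weak_partial S i u w}"

definition H2 :: "(real^'n::finite) set \<Rightarrow> (real^'n \<Rightarrow> real) set" where
  "H2 S = {u \<in> H1 S. \<forall>i. weak_partial S i u \<in> H1 S}"

definition H1_norm :: "(real^'n::finite) set \<Rightarrow> (real^'n \<Rightarrow> real) \<Rightarrow> real" where
  "H1_norm S u = sqrt (integral\<^sup>L (lebesgue_on S) (\<lambda>x. (u x)\<^sup>2) +
     (\<Sum>i\<in>UNIV. integral\<^sup>L (lebesgue_on S) (\<lambda>x. (weak_partial S i u x)\<^sup>2)))"

definition H10 :: "(real^'n::finite) set \<Rightarrow> (real^'n \<Rightarrow> real) set" where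
  "H10 S = {u \<in> H1 S. \<forall>e>0. \<exists>\<phi>\<in>test_functions S. H1_norm S (\<lambda>x. u x - \<phi> x) < e}"


section \<open>Domain and triangulations\<close>

definition polytopal_domain :: "(real^'n::finite) set \<Rightarrow> bool" where
  "polytopal_domain \<Omega> \<longleftrightarrow> open \<Omega> \<and> \<Omega> \<noteq> {} \<and> bounded \<Omega> \<and> convex \<Omega> \<and> polytope (closure \<Omega>)"

text \<open>A mesh is the set of its closed top-dimensional simplices.\<close>

definition simplicial_mesh :: "(real^'n::finite) set \<Rightarrow> (real^'n) set set \<Rightarrow> bool" where
  "simplicial_mesh \<Omega> \<T> \<longleftrightarrow>
     triangulation \<T> \<and> (\<forall>K\<in>\<T>. int CARD('n) simplex K) \<and> \<Union>\<T> = closure \<Omega>"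

definition shape_regular :: "(real^'n::finite) set set set \<Rightarrow> bool" where
  "shape_regular \<TT> \<longleftrightarrow>
     (\<exists>\<kappa>>0. \<forall>\<T>\<in>\<TT>. \<forall>K\<in>\<T>. \<exists>x. \<exists>r>0. cball x r \<subseteq> K \<and> diameter K \<le> \<kappa> * r)"

definition interior_faces :: "(real^'n::finite) set set \<Rightarrow> (real^'n) set set" where
  "interior_faces \<T> = {e. \<exists>K\<in>\<T>. \<exists>K'\<in>\<T>. K \<noteq> K' \<and> e facet_of K \<and> e facet_of K'}"

text \<open>Outward unit normal of the full-dimensional simplex \<open>K\<close> on its facet \<open>e\<close>; taking
  \<open>y \<in> e\<close> below forces orthogonality to \<open>e\<close>.\<close>

definition outward_normal :: "(real^'n::finite) set \<Rightarrow> (real^'n) set \<Rightarrow> real^'n" where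
  "outward_normal K e = (THE n. norm n = 1 \<and> (\<forall>x\<in>e. \<forall>y\<in>K. (y - x) \<bullet> n \<le> 0))"

text \<open>The surface (that is, \<open>(d-1)\<close>-dimensional Lebesgue) measure on a facet \<open>e\<close>: the image,
  under orthogonal projection onto the hyperplane spanned by \<open>e\<close>, of Lebesgue measure on the
  right prism of height \<open>1\<close> over \<open>e\<close>. By Fubini, the surface measure of a Borel set
  \<open>B \<subseteq> e\<close> is the volume of the right prism of height \<open>1\<close> over \<open>B\<close>.\<close>

definition face_measure :: "(real^'n::finite) set \<Rightarrow> (real^'n) measure" where
  "face_measure e =
     (let \<pi> = closest_point (affine hull e)
      in distr (restrict_space lborel {y. \<pi> y \<in> e \<and> dist y (\<pi> y) \<le> 1/2}) borel \<pi>)"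


section \<open>Finite element space\<close>

definition polynomials_le :: "nat \<Rightarrow> (real^'n::finite \<Rightarrow> real) set" where
  "polynomials_le p =
     {q. \<exists>c :: ('n \<Rightarrow> nat) \<Rightarrow> real.
           q = (\<lambda>x. \<Sum>m | (\<Sum>i\<in>UNIV. m i) \<le> p. c m * (\<Prod>i\<in>UNIV. (x $ i) ^ m i))}"

definition V_h ::
    "(real^'n::finite) set \<Rightarrow> nat \<Rightarrow> (real^'n) set set \<Rightarrow> (real^'n \<Rightarrow> real) set" where
  "V_h \<Omega> p \<T> =
     {v. continuous_on (closure \<Omega>) v \<and> (\<forall>K\<in>\<T>. \<exists>q\<in>polynomials_le p. \<forall>x\<in>K. v x = q x)}"

definition V_h0 ::
    "(real^'n::finite) set \<Rightarrow> nat \<Rightarrow> (real^'n) set set \<Rightarrow> (real^'n \<Rightarrow> real) set" where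
  "V_h0 \<Omega> p \<T> = V_h \<Omega> p \<T> \<inter> H10 \<Omega>"


section \<open>Traces, jumps and piecewise derivatives\<close>

text \<open>The trace operator from \<open>H1 (interior K)\<close> to \<open>L\<^sup>2(e)\<close> as the continuous extension of the
  restriction map on functions that are smooth up to the boundary; the trace of \<open>w\<close> is determined
  almost everywhere on \<open>e\<close>.\<close>

definition is_face_trace ::
    "(real^'n::finite) set \<Rightarrow> (real^'n) set \<Rightarrow> (real^'n \<Rightarrow> real) \<Rightarrow> (real^'n \<Rightarrow> real) \<Rightarrow> bool" where
  "is_face_trace K e w t \<longleftrightarrow>
     w \<in> H1 (interior K) \<and>
     t \<in> borel_measurable borel \<and> integrable (face_measure e) (\<lambda>x. (t x)\<^sup>2) \<and>
     (\<exists>\<phi> :: nat \<Rightarrow> real^'n \<Rightarrow> real.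
        (\<forall>k. smooth (\<phi> k)) \<and>
        (\<lambda>k. H1_norm (interior K) (\<lambda>x. \<phi> k x - w x)) \<longlonglongrightarrow> 0 \<and>
        (\<lambda>k. integral\<^sup>L (face_measure e) (\<lambda>x. (\<phi> k x - t x)\<^sup>2)) \<longlonglongrightarrow> 0)"

definition face_trace ::
    "(real^'n::finite) set \<Rightarrow> (real^'n) set \<Rightarrow> (real^'n \<Rightarrow> real) \<Rightarrow> real^'n \<Rightarrow> real" where
  "face_trace K e w = (SOME t. is_face_trace K e w t)"

definition normal_derivative ::
    "(real^'n::finite) set \<Rightarrow> (real^'n) set \<Rightarrow> (real^'n \<Rightarrow> real) \<Rightarrow> real^'n \<Rightarrow> real" where
  "normal_derivative K e v x =
     (\<Sum>i\<in>UNIV. outward_normal K e $ i * face_trace K e (weak_partial (interior K) i v) x)"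

text \<open>On an interior face, shared by \<open>K\<^sub>+\<close> and \<open>K\<^sub>-\<close>, the two normals are opposite, so the sum
  of the outward normal derivatives is the jump of the normal derivative.\<close>

definition jump_normal ::
    "(real^'n::finite) set set \<Rightarrow> (real^'n) set \<Rightarrow> (real^'n \<Rightarrow> real) \<Rightarrow> real^'n \<Rightarrow> real" where
  "jump_normal \<T> e v x = (\<Sum>K | K \<in> \<T> \<and> e facet_of K. normal_derivative K e v x)"

definition hessian_h ::
    "(real^'n::finite) set set \<Rightarrow> (real^'n \<Rightarrow> real) \<Rightarrow> real^'n \<Rightarrow> real^'n^'n" where
  "hessian_h \<T> v x = (\<Sum>K\<in>\<T>. indicator (interior K) x *\<^sub>R weak_hessian (interior K) v x)"

definition laplacian_h ::
    "(real^'n::finite) set set \<Rightarrow> (real^'n \<Rightarrow> real) \<Rightarrow> real^'n \<Rightarrow> real" where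
  "laplacian_h \<T> v x = trace (hessian_h \<T> v x)"


section \<open>The Hamilton--Jacobi--Bellman problem\<close>

text \<open>On \<^typ>\<open>real^'n^'n\<close> the library's \<open>norm\<close> and \<open>\<bullet>\<close> are the Frobenius norm and inner product.\<close>

definition coefficients_regular ::
    "(real^'n::finite) set \<Rightarrow> 'l::metric_space set \<Rightarrow>
     (real^'n \<Rightarrow> 'l \<Rightarrow> real^'n^'n) \<Rightarrow> (real^'n \<Rightarrow> 'l \<Rightarrow> real) \<Rightarrow> bool" where
  "coefficients_regular \<Omega> \<Lambda> A f \<longleftrightarrow>
     (continuous_on (closure \<Omega> \<times> \<Lambda>) (\<lambda>(x, \<alpha>). A x \<alpha>) \<and>
      continuous_on (closure \<Omega> \<times> \<Lambda>) (\<lambda>(x, \<alpha>). f x \<alpha>) \<and>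
      (\<forall>x\<in>closure \<Omega>. \<forall>\<alpha>\<in>\<Lambda>. transpose (A x \<alpha>) = A x \<alpha>)) \<or>
     (\<exists>\<alpha>. \<Lambda> = {\<alpha>} \<and>
        (\<lambda>x. A x \<alpha>) \<in> borel_measurable (lebesgue_on \<Omega>) \<and>
        (\<exists>M. AE x in lebesgue_on \<Omega>. norm (A x \<alpha>) \<le> M) \<and>
        (\<lambda>x. f x \<alpha>) \<in> L2 \<Omega> \<and>
        (AE x in lebesgue_on \<Omega>. transpose (A x \<alpha>) = A x \<alpha>))"

definition uniformly_elliptic ::
    "(real^'n::finite) set \<Rightarrow> 'l set \<Rightarrow> (real^'n \<Rightarrow> 'l \<Rightarrow> real^'n^'n) \<Rightarrow> real \<Rightarrow> real \<Rightarrow> bool" where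
  "uniformly_elliptic \<Omega> \<Lambda> A \<mu>1 \<mu>2 \<longleftrightarrow>
     (AE x in lebesgue_on \<Omega>. \<forall>\<alpha>\<in>\<Lambda>. \<forall>\<xi>.
        \<mu>1 * (norm \<xi>)\<^sup>2 \<le> \<xi> \<bullet> (A x \<alpha> *v \<xi>) \<and> \<xi> \<bullet> (A x \<alpha> *v \<xi>) \<le> \<mu>2 * (norm \<xi>)\<^sup>2)"

definition cordes ::
    "(real^'n::finite) set \<Rightarrow> 'l set \<Rightarrow> (real^'n \<Rightarrow> 'l \<Rightarrow> real^'n^'n) \<Rightarrow> real \<Rightarrow> bool" where
  "cordes \<Omega> \<Lambda> A \<epsilon> \<longleftrightarrow>
     (AE x in lebesgue_on \<Omega>. \<forall>\<alpha>\<in>\<Lambda>.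
        norm (A x \<alpha>) / trace (A x \<alpha>) \<le> 1 / sqrt (real CARD('n) - 1 + \<epsilon>))"

definition strong_solution ::
    "(real^'n::finite) set \<Rightarrow> 'l set \<Rightarrow> (real^'n \<Rightarrow> 'l \<Rightarrow> real^'n^'n) \<Rightarrow>
     (real^'n \<Rightarrow> 'l \<Rightarrow> real) \<Rightarrow> (real^'n \<Rightarrow> real) \<Rightarrow> (real^'n \<Rightarrow> real) \<Rightarrow> bool" where
  "strong_solution \<Omega> \<Lambda> A f g u \<longleftrightarrow>
     u \<in> H2 \<Omega> \<and>
     (AE x in lebesgue_on \<Omega>. (SUP \<alpha>\<in>\<Lambda>. A x \<alpha> \<bullet> weak_hessian \<Omega> u x - f x \<alpha>) = 0) \<and>
     (\<lambda>x. u x - g x) \<in> H10 \<Omega>"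

definition gamma :: "real^'n^'n \<Rightarrow> real" where
  "gamma M = (M \<bullet> mat 1) / (M \<bullet> M)"

definition F_gamma ::
    "'l set \<Rightarrow> (real^'n::finite \<Rightarrow> 'l \<Rightarrow> real^'n^'n) \<Rightarrow> (real^'n \<Rightarrow> 'l \<Rightarrow> real) \<Rightarrow>
     (real^'n) set set \<Rightarrow> (real^'n \<Rightarrow> real) \<Rightarrow> real^'n \<Rightarrow> real" where
  "F_gamma \<Lambda> A f \<T> u x =
     (SUP \<alpha>\<in>\<Lambda>. gamma (A x \<alpha>) * (A x \<alpha> \<bullet> hessian_h \<T> u x - f x \<alpha>))"

definition norm_h ::
    "(real^'n::finite) set \<Rightarrow> real \<Rightarrow> (real^'n) set set \<Rightarrow> (real^'n \<Rightarrow> real) \<Rightarrow> real" where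
  "norm_h \<Omega> \<sigma> \<T> u = sqrt
     (integral\<^sup>L (lebesgue_on \<Omega>) (\<lambda>x. (norm (hessian_h \<T> u x))\<^sup>2) +
      (\<Sum>e\<in>interior_faces \<T>.
         \<sigma> / diameter e * integral\<^sup>L (face_measure e) (\<lambda>x. (jump_normal \<T> e u x)\<^sup>2)))"

definition a_h ::
    "(real^'n::finite) set \<Rightarrow> 'l set \<Rightarrow> (real^'n \<Rightarrow> 'l \<Rightarrow> real^'n^'n) \<Rightarrow>
     (real^'n \<Rightarrow> 'l \<Rightarrow> real) \<Rightarrow> real \<Rightarrow> (real^'n) set set \<Rightarrow>
     (real^'n \<Rightarrow> real) \<Rightarrow> (real^'n \<Rightarrow> real) \<Rightarrow> real" where
  "a_h \<Omega> \<Lambda> A f \<sigma> \<T> u v =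
     integral\<^sup>L (lebesgue_on \<Omega>) (\<lambda>x. F_gamma \<Lambda> A f \<T> u x * laplacian_h \<T> v x) +
     (\<Sum>e\<in>interior_faces \<T>.
        \<sigma> / diameter e *
        integral\<^sup>L (face_measure e) (\<lambda>x. jump_normal \<T> e u x * jump_normal \<T> e v x))"

text \<open>The penalty threshold does not depend on the mesh \<open>\<T>\<close> in the family \<open>\<TT>\<close>.\<close>

definition penalty_threshold ::
    "(real^'n::finite) set \<Rightarrow> 'l set \<Rightarrow> (real^'n \<Rightarrow> 'l \<Rightarrow> real^'n^'n) \<Rightarrow>
     (real^'n \<Rightarrow> 'l \<Rightarrow> real) \<Rightarrow> real \<Rightarrow> nat \<Rightarrow> (real^'n) set set set \<Rightarrow> real \<Rightarrow> real \<Rightarrow> bool" where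
  "penalty_threshold \<Omega> \<Lambda> A f \<epsilon> p \<TT> \<delta> \<sigma>0 \<longleftrightarrow>
     (\<forall>\<sigma>\<ge>\<sigma>0. \<forall>\<T>\<in>\<TT>. \<forall>w\<in>V_h \<Omega> p \<T>. \<forall>v\<in>V_h \<Omega> p \<T>.
        (\<lambda>x. w x - v x) \<in> V_h0 \<Omega> p \<T> \<longrightarrow>
        a_h \<Omega> \<Lambda> A f \<sigma> \<T> w (\<lambda>x. w x - v x) - a_h \<Omega> \<Lambda> A f \<sigma> \<T> v (\<lambda>x. w x - v x)
          \<ge> \<delta> * (1 - sqrt (1 - \<epsilon>)) * (norm_h \<Omega> \<sigma> \<T> (\<lambda>x. w x - v x))\<^sup>2)"

definition sufficiently_large ::
    "(real^'n::finite) set \<Rightarrow> 'l set \<Rightarrow> (real^'n \<Rightarrow> 'l \<Rightarrow> real^'n^'n) \<Rightarrow>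
     (real^'n \<Rightarrow> 'l \<Rightarrow> real) \<Rightarrow> real \<Rightarrow> nat \<Rightarrow> (real^'n) set set set \<Rightarrow> real \<Rightarrow> bool" where
  "sufficiently_large \<Omega> \<Lambda> A f \<epsilon> p \<TT> \<sigma> \<longleftrightarrow>
     (\<exists>\<delta>. 0 < \<delta> \<and> \<delta> < 1 \<and>
        (\<exists>\<sigma>0>0. penalty_threshold \<Omega> \<Lambda> A f \<epsilon> p \<TT> \<delta> \<sigma>0 \<and> \<sigma> \<ge> \<sigma>0))"

end

theory Submission
  imports Defs
begin

text \<open>The argument is Cea's lemma for a strongly monotone form. Let \<open>v\<close> be a competitor and
  \<open>w = u_h - v\<close>. Monotonicity and the discrete equation give \<open>c |w|\<^sup>2 \<le> - a_h(v; w)\<close> with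
  \<open>c = \<delta> (1 - sqrt (1 - \<epsilon>))\<close>. The supremum in the equation for \<open>u\<close> is attained, so the weights
  \<open>\<gamma> \<ge> 0\<close> do not affect it and \<open>F_\<gamma>[u] = 0\<close>; moreover \<open>|\<gamma> A| \<le> sqrt d\<close>, hence
  \<open>|F_\<gamma>[v]| \<le> sqrt d |D\<^sup>2 u - D\<^sup>2 v|\<close>, and the jumps of the normal derivative of \<open>u\<close> vanish.
  Young's inequality then bounds \<open>a_h(v; w)\<close> by \<open>|u - v|\<^sup>2\<close> and a part of \<open>|w|\<^sup>2\<close> that is absorbed.

  The jumps of \<open>u\<close> vanish because, on a convex domain, dilation and mollification give one sequence
  of smooth functions converging in \<open>H\<^sup>1\<close> to a first derivative of \<open>u\<close>; by the trace inequality it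
  converges to the traces from both sides. The function \<open>w\<close> is an admissible test function because,
  extended by zero, it is Lipschitz, and the mollifications of its dilations towards an interior
  point have compact support in the domain.\<close>

section \<open>Functions of class C^k and a mollifier\<close>

text \<open>Weak derivatives and traces, and with them \<open>hessian_h\<close> and
  \<open>jump_normal\<close>, are values of \<open>SOME\<close>, fixed only up to null sets. Even
  linearity holds just almost everywhere and rests on uniqueness: of weak derivatives by testing
  with mollified signs, of traces by the trace inequality. The Sobolev notions concern Lebesgue
  measurable functions, whereas translation, Tonelli and mollification are carried out for
  \<open>lborel\<close>; Borel representatives mediate.

  Plain mollification fails near the boundary because the averaging ball leaves the domain.
  Contracting towards an interior point opens a margin proportional to the contraction; expanding
  instead pulls a support inside. One operator \<open>mollify t b r\<close> covers both, with
  \<open>t < 1\<close> and \<open>t > 1\<close>.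

  The ratio d / c in the final constant comes from two pointwise factors sqrt d: the bound on
  \<gamma> A and |trace M| \<le> sqrt d |M|. The trace constants depend on the simplex, but they
  serve only to show that traces exist and agree, so they never reach the error bound.\<close>

lemma partial_eq:
  assumes "(f has_derivative D) (at x)"
  shows "partial i f x = D (axis i 1)"
  using frechet_derivative_at[OF assms] by (simp add: partial_def)

lemma Ck_Suc_imp: "Ck (Suc k) f \<Longrightarrow> Ck k f"
proof (induction k arbitrary: f)
  case 0
  then show ?case
    by (auto simp: continuous_on_eq_continuous_at intro: differentiable_imp_continuous_within)
next
  case (Suc k)
  then show ?case by auto
qed

lemma Ck_mono: "Ck k f \<Longrightarrow> m \<le> k \<Longrightarrow> Ck m f"
  by (induction k) (auto simp: le_Suc_eq dest: Ck_Suc_imp simp del: Ck.simps(2))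

text \<open>\<open>Ck\<close> recurses through \<open>partial\<close>, that is, through the chosen
  \<open>frechet_derivative\<close>. This rule lets an induction supply an explicit derivative
  formula instead.\<close>

lemma Ck_SucI:
  assumes "\<And>x. (f has_derivative D x) (at x)" "\<And>i. Ck k (\<lambda>x. D x (axis i 1))"
  shows "Ck (Suc k) f"
proof -
  have "partial i f = (\<lambda>x. D x (axis i 1))" for i
    using partial_eq[OF assms(1)] by auto
  with assms show ?thesis by (auto simp: differentiable_def)
qed

lemma differentiable_has_derivative_partial:
  fixes f :: "real^'n \<Rightarrow> real"
  assumes "f differentiable (at x)"
  shows "(f has_derivative (\<lambda>h. \<Sum>i\<in>UNIV. h $ i * partial i f x)) (at x)"
proof -
  let ?D = "frechet_derivative f (at x)"
  have D: "(f has_derivative ?D) (at x)"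
    using assms frechet_derivative_works by blast
  then interpret linear ?D by (rule has_derivative_linear)
  have "?D h = (\<Sum>i\<in>UNIV. h $ i * partial i f x)" for h
  proof -
    have "?D h = ?D (\<Sum>i\<in>UNIV. h $ i *s axis i 1)" by (simp add: basis_expansion)
    also have "\<dots> = (\<Sum>i\<in>UNIV. h $ i * partial i f x)"
      by (simp add: sum scale partial_def scalar_mult_eq_scaleR)
    finally show ?thesis .
  qed
  then have "?D = (\<lambda>h. \<Sum>i\<in>UNIV. h $ i * partial i f x)" by blast
  then show ?thesis using D by simp
qed

lemma Ck_const: "Ck k (\<lambda>x. c)"
proof (induction k arbitrary: c)
  case (Suc k)
  show ?case by (rule Ck_SucI[where D="\<lambda>_ _. 0"]) (auto simp: Suc)
qed simp

lemma Ck_add: "Ck k f \<Longrightarrow> Ck k g \<Longrightarrow> Ck k (\<lambda>x. f x + g x)"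
proof (induction k arbitrary: f g)
  case 0
  then show ?case by (auto intro: continuous_intros)
next
  case (Suc k)
  then have d: "f differentiable (at x)" "g differentiable (at x)" for x by auto
  show ?case
    by (rule Ck_SucI)
      (use Suc in \<open>auto intro!: has_derivative_add d[unfolded frechet_derivative_works] simp flip: partial_def\<close>)
qed

lemma Ck_mult: "Ck k f \<Longrightarrow> Ck k g \<Longrightarrow> Ck k (\<lambda>x. f x * g x)"
proof (induction k arbitrary: f g)
  case 0
  then show ?case by (auto intro: continuous_intros)
next
  case (Suc k)
  then have d: "f differentiable (at x)" "g differentiable (at x)" for x by auto
  \<comment> \<open>The product rule pairs a partial derivative of class \<open>Ck k\<close> with an
    undifferentiated factor of class \<open>Ck (Suc k)\<close>, which has to be lowered to
    match.\<close>
  have c: "Ck k f" "Ck k g" using Suc Ck_Suc_imp by blast+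
  show ?case
    by (rule Ck_SucI[OF has_derivative_mult[OF d[unfolded frechet_derivative_works]]])
      (use Suc c in \<open>auto intro!: Ck_add Suc.IH simp flip: partial_def\<close>)
qed

lemma Ck_cmult: "Ck k f \<Longrightarrow> Ck k (\<lambda>x. c * f x)"
  by (intro Ck_mult Ck_const)

lemma Ck_uminus: "Ck k f \<Longrightarrow> Ck k (\<lambda>x. - f x)"
  using Ck_cmult[of k f "-1"] by simp

lemma Ck_diff: "Ck k f \<Longrightarrow> Ck k g \<Longrightarrow> Ck k (\<lambda>x. f x - g x)"
  using Ck_add[of k f "\<lambda>x. - g x"] Ck_uminus[of k g] by simp

lemma Ck_sum: "(\<And>i. i \<in> I \<Longrightarrow> Ck k (f i)) \<Longrightarrow> Ck k (\<lambda>x. \<Sum>i\<in>I. f i x)"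
  by (induction I rule: infinite_finite_induct) (auto intro: Ck_const Ck_add)

lemma Ck_prod: "(\<And>i. i \<in> I \<Longrightarrow> Ck k (f i)) \<Longrightarrow> Ck k (\<lambda>x. \<Prod>i\<in>I. f i x)"
  by (induction I rule: infinite_finite_induct) (auto intro: Ck_const Ck_mult)

lemma Ck_power: "Ck k f \<Longrightarrow> Ck k (\<lambda>x. f x ^ m)"
  by (induction m) (auto intro: Ck_const Ck_mult)

lemma Ck_coord: "Ck k (\<lambda>x. x $ i)"
proof (cases k)
  case 0
  then show ?thesis by (auto intro: continuous_intros)
next
  case (Suc m)
  show ?thesis unfolding Suc
    by (rule Ck_SucI[where D="\<lambda>_ h. h $ i"]) (auto intro: Ck_const bounded_linear_imp_has_derivative bounded_linear_vec_nth)
qed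

lemma Ck_affine: "Ck k f \<Longrightarrow> Ck k (\<lambda>x. f (c *\<^sub>R x + b))"
proof (induction k arbitrary: f)
  case 0
  then have "continuous_on UNIV (f \<circ> (\<lambda>x. c *\<^sub>R x + b))"
    by (intro continuous_on_compose continuous_intros) (auto intro: continuous_on_subset)
  then show ?case by (simp add: o_def)
next
  case (Suc k)
  then have d: "f differentiable (at x)" for x by auto
  have D: "((\<lambda>x. f (c *\<^sub>R x + b)) has_derivative (\<lambda>h. frechet_derivative f (at (c *\<^sub>R x + b)) (c *\<^sub>R h))) (at x)" for x
    by (rule has_derivative_compose[where f="\<lambda>x. c *\<^sub>R x + b" and f'="\<lambda>h. c *\<^sub>R h"])
       (auto intro!: derivative_eq_intros d[unfolded frechet_derivative_works])
  have "frechet_derivative f (at y) (c *\<^sub>R axis i 1) = c * partial i f y" for y i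
    using linear_cmul[OF linear_frechet_derivative[OF d]] by (simp add: partial_def)
  then show ?case using Suc
    by (intro Ck_SucI[OF D]) (auto intro!: Ck_cmult)
qed

lemma partial_affine:
  assumes "Ck (Suc 0) f"
  shows "partial i (\<lambda>x. f (c *\<^sub>R x + b)) x = c * partial i f (c *\<^sub>R x + b)"
proof -
  have d: "f differentiable (at x)" for x using assms by auto
  have D: "((\<lambda>x. f (c *\<^sub>R x + b)) has_derivative (\<lambda>h. frechet_derivative f (at (c *\<^sub>R x + b)) (c *\<^sub>R h))) (at x)" for x
    by (rule has_derivative_compose[where f="\<lambda>x. c *\<^sub>R x + b" and f'="\<lambda>h. c *\<^sub>R h"])
       (auto intro!: derivative_eq_intros d[unfolded frechet_derivative_works])
  show ?thesis unfolding partial_eq[OF D]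
    using linear_cmul[OF linear_frechet_derivative[OF d]] by (simp add: partial_def)
qed

lemma partial_mult:
  assumes "Ck (Suc 0) f" "Ck (Suc 0) g"
  shows "partial i (\<lambda>x. f x * g x) x = f x * partial i g x + partial i f x * g x"
proof -
  have d: "f differentiable (at x)" "g differentiable (at x)" for x using assms by auto
  show ?thesis
    unfolding partial_eq[OF has_derivative_mult[OF d[unfolded frechet_derivative_works]]] by (simp add: partial_def)
qed

lemma smooth_Ck: "smooth f \<Longrightarrow> Ck k f"
  by (simp add: smooth_def)

lemma smooth_partial: "smooth f \<Longrightarrow> smooth (partial i f)"
  unfolding smooth_def by (metis Ck.simps(2))

lemma smooth_continuous: "smooth f \<Longrightarrow> continuous_on S f"
  using smooth_Ck[of f 0] by (auto intro: continuous_on_subset)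

lemma smooth_diff: "smooth f \<Longrightarrow> smooth g \<Longrightarrow> smooth (\<lambda>x. f x - g x)"
  by (simp add: smooth_def Ck_diff)

text \<open>The functions \<open>t\<^sup>-\<^sup>m exp (-1/t)\<close> for \<open>t > 0\<close>; their span is closed under differentiation.\<close>

definition flat_exp :: "nat \<Rightarrow> real \<Rightarrow> real" where
  "flat_exp m t = (if t > 0 then (1/t)^m * exp (- (1/t)) else 0)"

lemma flat_exp_derivative:
  "(flat_exp m has_real_derivative (flat_exp (m+2) t - real m * flat_exp (m+1) t)) (at t)"
proof -
  consider "t > 0" | "t < 0" | "t = 0" by linarith
  then show ?thesis
  proof cases
    case 1
    have i: "((\<lambda>t. 1/t) has_real_derivative (- 1 / t^2)) (at t)"
      using 1 by (auto intro!: derivative_eq_intros simp: power2_eq_square)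
    have "((\<lambda>t. (1/t)^m * exp (- (1/t))) has_real_derivative
       (1/t)^m * (exp (- (1/t)) * (1 / t^2)) + real m * (1/t)^(m-1) * (- 1 / t^2) * exp (- (1/t))) (at t)"
      by (rule derivative_eq_intros i refl)+ simp
    also have "(1/t)^m * (exp (- (1/t)) * (1 / t^2)) + real m * (1/t)^(m-1) * (- 1 / t^2) * exp (- (1/t))
       = flat_exp (m+2) t - real m * flat_exp (m+1) t"
      using 1 by (cases m) (simp_all add: flat_exp_def power2_eq_square field_simps)
    finally have "((\<lambda>t. (1/t)^m * exp (- (1/t))) has_real_derivative
       (flat_exp (m+2) t - real m * flat_exp (m+1) t)) (at t)" .
    then show ?thesis
      by (rule has_field_derivative_transform_within_open[where S="{0<..}"])
         (use 1 in \<open>auto simp: flat_exp_def\<close>)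
  next
    case 2
    have "((\<lambda>t. 0) has_real_derivative (flat_exp (m+2) t - real m * flat_exp (m+1) t)) (at t)"
      using 2 by (simp add: flat_exp_def)
    then show ?thesis
      by (rule has_field_derivative_transform_within_open[where S="{..<0}"])
         (use 2 in \<open>auto simp: flat_exp_def\<close>)
  next
    case 3
    \<comment> \<open>With \<open>s = 1/h\<close> the right-hand difference quotient
      \<open>flat_exp m h / h\<close> becomes \<open>s ^ (m+1) / exp s\<close>, and the exponential
      beats every power.\<close>
    have *: "((\<lambda>s::real. s ^ (m+1) / exp s) \<longlongrightarrow> 0) at_top"
      by (rule tendsto_power_div_exp_0)
    have "((\<lambda>h. (1/h) ^ (m+1) / exp (1/h)) \<longlongrightarrow> 0) (at_right (0::real))"
      by (rule filterlim_compose[OF *]) (simp add: filterlim_inverse_at_top_right divide_inverse)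
    then have r: "((\<lambda>h. flat_exp m h / h) \<longlongrightarrow> 0) (at_right 0)"
      by (rule Lim_transform_eventually)
         (auto simp: flat_exp_def eventually_at_filter exp_minus field_simps)
    have l: "((\<lambda>h. flat_exp m h / h) \<longlongrightarrow> 0) (at_left 0)"
      by (rule Lim_transform_eventually[OF tendsto_const])
         (auto simp: flat_exp_def eventually_at_filter)
    have "((\<lambda>h. flat_exp m h / h) \<longlongrightarrow> 0) (at 0)"
      using l r by (simp add: filterlim_split_at)
    then show ?thesis
      unfolding 3 DERIV_def by (simp add: flat_exp_def)
  qed
qed

text \<open>The index \<open>m\<close> is generalised in the induction because one derivative turns
  \<open>flat_exp m\<close> into a combination of \<open>flat_exp (m+1)\<close> and
  \<open>flat_exp (m+2)\<close>. For \<open>m = 0\<close> this is the standard bump exp (-1 / (1 -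
  |x|^2)) on the unit ball.\<close>

lemma Ck_flat_exp_bump: "Ck k (\<lambda>x::real^'n. flat_exp m (1 - x \<bullet> x))"
proof (induction k arbitrary: m)
  case 0
  have "isCont (flat_exp m) t" for t
    using flat_exp_derivative DERIV_isCont by blast
  then have "continuous_on UNIV (flat_exp m)"
    by (simp add: continuous_on_eq_continuous_at)
  then have "continuous_on UNIV (flat_exp m \<circ> (\<lambda>x::real^'n. 1 - x \<bullet> x))"
    by (intro continuous_on_compose continuous_intros) (auto intro: continuous_on_subset)
  then show ?case by (simp add: o_def)
next
  case (Suc k)
  have D: "((\<lambda>x::real^'n. flat_exp m (1 - x \<bullet> x)) has_derivative
     (\<lambda>h. (- (2 * (h \<bullet> x))) * (flat_exp (m+2) (1 - x \<bullet> x) - real m * flat_exp (m+1) (1 - x \<bullet> x)))) (at x)" for x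
    by (rule DERIV_compose_FDERIV[OF flat_exp_derivative])
       (auto intro!: derivative_eq_intros simp: inner_commute)
  show ?case
    by (rule Ck_SucI[OF D]) (auto simp: inner_axis' intro!: Ck_mult Ck_diff Ck_uminus Ck_const Suc Ck_coord)
qed

lemma exists_mollifier:
  obtains \<eta> :: "real^'n \<Rightarrow> real" where
    "smooth \<eta>" "\<And>x. \<eta> x \<ge> 0" "\<And>x. norm x \<ge> 1 \<Longrightarrow> \<eta> x = 0"
    "integrable lborel \<eta>" "integral\<^sup>L lborel \<eta> = 1"
proof -
  define b :: "real^'n \<Rightarrow> real" where "b x = flat_exp 0 (1 - x \<bullet> x)" for x
  have sm: "smooth b" unfolding smooth_def b_def using Ck_flat_exp_bump by blast
  have nn: "b x \<ge> 0" for x by (simp add: b_def flat_exp_def)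
  have z: "b x = 0 \<longleftrightarrow> norm x \<ge> 1" for x
    using real_sqrt_ge_1_iff[of "x \<bullet> x"] by (simp add: b_def flat_exp_def norm_eq_sqrt_inner not_less)
  have c: "continuous_on S b" for S using sm by (rule smooth_continuous)
  have "indicator (cball 0 1) x *\<^sub>R b x = b x" for x
    using z[of x] by (cases "norm x \<le> 1") auto
  then have "(\<lambda>x. indicator (cball 0 1) x *\<^sub>R b x) = b" by blast
  moreover have "integrable lborel (\<lambda>x. indicator (cball 0 1) x *\<^sub>R b x)"
    by (rule borel_integrable_compact[OF compact_cball c])
  ultimately have i: "integrable lborel b" by simp
  have "integral\<^sup>L lborel b \<noteq> 0"
  proof
    assume "integral\<^sup>L lborel b = 0"
    \<comment> \<open>The bump is positive exactly on the open unit ball. If it vanished almost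
      everywhere, that ball would be a null set, which no nonempty open set is.\<close>
    then have "AE x in lborel. b x = 0"
      using integral_nonneg_eq_0_iff_AE[OF i] nn by simp
    then have "AE x::real^'n in lborel. x \<notin> ball 0 1"
      by (rule eventually_mono) (use z in auto)
    then have "emeasure lborel (ball (0::real^'n) 1) = 0"
      by (subst (asm) AE_iff_measurable[of "ball 0 1"]) auto
    then have "emeasure lebesgue (ball (0::real^'n) 1) = 0" by simp
    then have "negligible (ball (0::real^'n) 1)"
      by (simp add: negligible_iff_null_sets null_sets_def)
    then show False using open_not_negligible[of "ball (0::real^'n) 1"] by auto
  qed
  moreover have "integral\<^sup>L lborel b \<ge> 0" using nn by simp
  ultimately have p: "integral\<^sup>L lborel b > 0" by simp
  show thesis
    by (rule that[of "\<lambda>x. (1 / integral\<^sup>L lborel b) * b x"])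
       (use sm nn z i p Ck_cmult[of _ b "1 / integral\<^sup>L lborel b"] in \<open>auto simp: smooth_def\<close>)
qed

section \<open>Square integrable functions and mollification\<close>

text \<open>\<open>L2 S\<close> is the case of \<open>lebesgue_on S\<close>. Leaving the measure
  free lets the same lemmas serve volume integrals, facet integrals, and both the Lebesgue and the
  Borel version of an integral.\<close>

definition square_integrable :: "'a measure \<Rightarrow> ('a \<Rightarrow> real) \<Rightarrow> bool" where
  "square_integrable M f \<longleftrightarrow> f \<in> borel_measurable M \<and> integrable M (\<lambda>x. (f x)\<^sup>2)"

lemma square_integrableD:
  assumes "square_integrable M f"
  shows "f \<in> borel_measurable M" "integrable M (\<lambda>x. (f x)\<^sup>2)"
  using assms by (auto simp: square_integrable_def)

lemma square_integrable_bound: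
  assumes "integrable M g" "f \<in> borel_measurable M" "AE x in M. (f x)\<^sup>2 \<le> g x"
  shows "square_integrable M f"
  using assms unfolding square_integrable_def
  by (auto intro!: Bochner_Integration.integrable_bound[OF assms(1)] elim!: eventually_mono)

lemma sum_square_le: "(a + b)\<^sup>2 \<le> 2 * a\<^sup>2 + 2 * b\<^sup>2" for a b :: real
  using zero_le_power2[of "a - b"] by (simp add: power2_eq_square algebra_simps)

lemma square_integrable_add:
  assumes "square_integrable M f" "square_integrable M g"
  shows "square_integrable M (\<lambda>x. f x + g x)"
proof -
  note [measurable] = square_integrableD(1)[OF assms(1)] square_integrableD(1)[OF assms(2)]
  show ?thesis
    by (rule square_integrable_bound[where g="\<lambda>x. 2 * (f x)\<^sup>2 + 2 * (g x)\<^sup>2"])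
       (use square_integrableD(2)[OF assms(1)] square_integrableD(2)[OF assms(2)] sum_square_le in auto)
qed

lemma square_integrable_cmult:
  assumes "square_integrable M f"
  shows "square_integrable M (\<lambda>x. c * f x)"
  using assms by (auto simp: square_integrable_def power_mult_distrib)

lemma square_integrable_diff:
  assumes "square_integrable M f" "square_integrable M g"
  shows "square_integrable M (\<lambda>x. f x - g x)"
  using square_integrable_add[OF assms(1) square_integrable_cmult[OF assms(2), of "-1"]] by simp

lemma square_integrable_zero: "square_integrable M (\<lambda>x. 0)"
  by (simp add: square_integrable_def)

lemma square_integrable_sum:
  assumes "\<And>i. i \<in> I \<Longrightarrow> square_integrable M (f i)"
  shows "square_integrable M (\<lambda>x. \<Sum>i\<in>I. f i x)"
  using assms by (induction I rule: infinite_finite_induct)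
    (auto intro: square_integrable_add square_integrable_zero)

lemma square_integrable_mult_integrable:
  assumes "square_integrable M f" "square_integrable M g"
  shows "integrable M (\<lambda>x. f x * g x)"
proof (rule Bochner_Integration.integrable_bound)
  show "integrable M (\<lambda>x. (f x)\<^sup>2 + (g x)\<^sup>2)"
    using assms by (auto simp: square_integrable_def)
  note [measurable] = square_integrableD(1)[OF assms(1)] square_integrableD(1)[OF assms(2)]
  show "(\<lambda>x. f x * g x) \<in> borel_measurable M" by measurable
  have "\<bar>a * b\<bar> \<le> a\<^sup>2 + b\<^sup>2" for a b :: real
  proof -
    have "2 * \<bar>a\<bar> * \<bar>b\<bar> \<le> a\<^sup>2 + b\<^sup>2" using sum_squares_bound[of "\<bar>a\<bar>" "\<bar>b\<bar>"] by simp
    moreover have "0 \<le> \<bar>a\<bar> * \<bar>b\<bar>" by simp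
    ultimately show ?thesis unfolding abs_mult by linarith
  qed
  then show "AE x in M. norm (f x * g x) \<le> norm ((f x)\<^sup>2 + (g x)\<^sup>2)" by simp
qed

text \<open>Stands in for the triangle inequality of the L2 norm: the factor 2 is harmless for
  limits, and no square roots have to be handled.\<close>

lemma integral_square_add_le:
  assumes "square_integrable M f" "square_integrable M g"
  shows "(\<integral>x. (f x + g x)\<^sup>2 \<partial>M) \<le> 2 * (\<integral>x. (f x)\<^sup>2 \<partial>M) + 2 * (\<integral>x. (g x)\<^sup>2 \<partial>M)"
proof -
  have "(\<integral>x. (f x + g x)\<^sup>2 \<partial>M) \<le> (\<integral>x. 2 * (f x)\<^sup>2 + 2 * (g x)\<^sup>2 \<partial>M)"
    by (rule integral_mono)
       (use square_integrable_add[OF assms] assms sum_square_le in \<open>auto simp: square_integrable_def\<close>)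
  also have "\<dots> = 2 * (\<integral>x. (f x)\<^sup>2 \<partial>M) + 2 * (\<integral>x. (g x)\<^sup>2 \<partial>M)"
    using assms by (simp add: square_integrable_def)
  finally show ?thesis .
qed

lemma integral_square_diff_le:
  assumes "square_integrable M f" "square_integrable M g"
  shows "(\<integral>x. (f x - g x)\<^sup>2 \<partial>M) \<le> 2 * (\<integral>x. (f x)\<^sup>2 \<partial>M) + 2 * (\<integral>x. (g x)\<^sup>2 \<partial>M)"
  using integral_square_add_le[OF assms(1) square_integrable_cmult[OF assms(2), of "-1"]] by simp

lemma (in finite_measure) square_integrable_imp_integrable:
  assumes "square_integrable M f"
  shows "integrable M f"
  using square_integrable_mult_integrable[OF assms, of "\<lambda>_. 1"] by (simp add: square_integrable_def)

lemma lborel_integral_affine: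
  fixes f :: "'a::euclidean_space \<Rightarrow> real"
  assumes "c \<noteq> 0" and [measurable]: "f \<in> borel_measurable borel"
  shows "integral\<^sup>L lborel f = \<bar>c\<bar> ^ DIM('a) * (\<integral>x. f (b + c *\<^sub>R x) \<partial>lborel)"
  by (subst lborel_affine[OF assms(1), of b]) (simp add: integral_density integral_distr)

lemma lborel_integrable_affine_iff:
  fixes f :: "'a::euclidean_space \<Rightarrow> real"
  assumes "c \<noteq> 0" and [measurable]: "f \<in> borel_measurable borel"
  shows "integrable lborel (\<lambda>x. f (b + c *\<^sub>R x)) \<longleftrightarrow> integrable lborel f"
  by (subst (2) lborel_affine[OF assms(1), of b])
     (use assms(1) in \<open>simp add: integrable_density integrable_distr_eq\<close>)

lemma bounded_support_square_integrable:
  fixes f :: "'a::euclidean_space \<Rightarrow> real"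
  assumes "f \<in> borel_measurable borel" "\<And>x. \<bar>f x\<bar> \<le> B" "\<And>x. norm x > R \<Longrightarrow> f x = 0"
  shows "square_integrable lborel f" and "(\<integral>x. (f x)\<^sup>2 \<partial>lborel) \<le> B\<^sup>2 * measure lborel (cball (0::'a) R)"
proof -
  have i: "integrable lborel (\<lambda>x. B\<^sup>2 * indicator (cball (0::'a) R) x)"
    by (intro integrable_mult_right integrable_real_indicator) (use emeasure_lborel_cball_finite[of "0::'a" R] in auto)
  have b: "(f x)\<^sup>2 \<le> B\<^sup>2 * indicator (cball 0 R) x" for x
    using assms(2)[of x] assms(3)[of x] by (cases "norm x > R") (auto intro: power2_le_iff_abs_le[THEN iffD2, OF order_trans[OF abs_ge_zero]])
  show s: "square_integrable lborel f"
    by (rule square_integrable_bound[OF i]) (use assms b in auto)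
  have "(\<integral>x. (f x)\<^sup>2 \<partial>lborel) \<le> (\<integral>x. B\<^sup>2 * indicator (cball (0::'a) R) x \<partial>lborel)"
    by (rule integral_mono) (use s i b in \<open>auto simp: square_integrable_def\<close>)
  then show "(\<integral>x. (f x)\<^sup>2 \<partial>lborel) \<le> B\<^sup>2 * measure lborel (cball (0::'a) R)" by simp
qed

section \<open>Density of continuous functions in L2 and continuity of affine changes of
  variable\<close>

lemma uniformly_continuous_compact_support:
  fixes f :: "'a::euclidean_space \<Rightarrow> real"
  assumes c: "continuous_on UNIV f" and z: "\<And>x. norm x > R \<Longrightarrow> f x = 0" and e: "e > 0"
  obtains d where "d > 0" "\<And>x y. dist x y < d \<Longrightarrow> \<bar>f x - f y\<bar> < e"
proof -
  have "uniformly_continuous_on (cball 0 (R+1)) f"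
    by (rule compact_uniformly_continuous) (use c in \<open>auto intro: continuous_on_subset\<close>)
  then obtain d where d: "d > 0" "\<And>x y. x \<in> cball 0 (R+1) \<Longrightarrow> y \<in> cball 0 (R+1) \<Longrightarrow> dist y x < d \<Longrightarrow> dist (f y) (f x) < e"
    using e unfolding uniformly_continuous_on_def by blast
  show thesis
  proof (rule that[of "min d 1"])
    fix x y :: 'a assume xy: "dist x y < min d 1"
    have n: "norm x \<le> norm y + dist x y" "norm y \<le> norm x + dist x y"
      using norm_triangle_ineq2[of x y] norm_triangle_ineq3[of x y] by (auto simp: dist_norm)
    \<comment> \<open>The two points are less than 1 apart, so if one of them leaves
      \<open>cball 0 (R+1)\<close> then both lie outside \<open>cball 0 R\<close>, where
      \<open>f\<close> vanishes.\<close>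
    show "\<bar>f x - f y\<bar> < e"
    proof (cases "x \<in> cball 0 (R+1) \<and> y \<in> cball 0 (R+1)")
      case True
      then show ?thesis using d(2)[of y x] xy by (simp add: dist_real_def)
    next
      case False
      then have "norm x > R" "norm y > R" using n xy by auto
      then show ?thesis using z e by simp
    qed
  qed (use d in simp)
qed

text \<open>A measurable function is an almost everywhere limit of continuous functions
  \<open>g n\<close>, but without any L2 control. Hence \<open>w\<close> is first clamped to [-m, m]
  and cut off outside a ball, and then, with \<open>m\<close> fixed, the same truncation is applied
  to \<open>g n\<close>. Each of the two stages is a dominated convergence, and truncating
  \<open>g n\<close> keeps it continuous.\<close>

lemma L2_dense_compact_support:
  fixes w :: "'a::euclidean_space \<Rightarrow> real"
  assumes w: "square_integrable lborel w" and e: "e > 0"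
  obtains f R where "continuous_on UNIV f" "\<And>x. norm x > R \<Longrightarrow> f x = 0" "R > 0"
     "square_integrable lborel f" "(\<integral>x. (w x - f x)\<^sup>2 \<partial>lborel) < e"
proof -
  have wm[measurable]: "w \<in> borel_measurable borel" using w by (simp add: square_integrable_def)
  have "w \<in> borel_measurable lebesgue" by (simp add: measurable_completion)
  then have "w measurable_on UNIV"
    by (rule lebesgue_measurable_imp_measurable_on) simp
  then obtain N g where N: "negligible N" and gc: "\<And>n. continuous_on UNIV (g n)"
    and gl: "\<And>x. x \<notin> N \<Longrightarrow> (\<lambda>n. g n x) \<longlonglongrightarrow> w x"
    unfolding measurable_on_def by auto
  have aeN: "AE x in lborel. x \<notin> N"
    using N AE_not_in[of N lebesgue] by (simp add: negligible_iff_null_sets AE_completion_iff)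
  define cut where "cut m x = max 0 (min 1 (real m + 1 - norm x))" for m :: nat and x :: 'a
  define cl where "cl m y = max (- real m) (min (real m) y)" for m :: nat and y :: real
  have cut: "0 \<le> cut m x" "cut m x \<le> 1" "norm x > real m + 1 \<Longrightarrow> cut m x = 0" "norm x \<le> m \<Longrightarrow> cut m x = 1" for m x
    by (auto simp: cut_def)
  have cl: "\<bar>cl m y\<bar> \<le> real m" "\<bar>y\<bar> \<le> m \<Longrightarrow> cl m y = y" for m y by (auto simp: cl_def)
  define h where "h m x = cut m x * cl m (w x)" for m x
  define f where "f m n x = cut m x * cl m (g n x)" for m n x
  have [measurable]: "g n \<in> borel_measurable borel" for n
    by (rule borel_measurable_continuous_onI[OF gc])
  have hm[measurable]: "h m \<in> borel_measurable borel" and fm[measurable]: "f m n \<in> borel_measurable borel" for m n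
    unfolding h_def f_def cut_def cl_def by measurable
  have hb: "\<bar>h m x\<bar> \<le> real m" "norm x > real m + 1 \<Longrightarrow> h m x = 0" for m x
    using mult_mono[OF cut(2)[of m x] cl(1)[of m "w x"]] cut cl by (auto simp: h_def abs_mult)
  have fb: "\<bar>f m n x\<bar> \<le> real m" "norm x > real m + 1 \<Longrightarrow> f m n x = 0" for m :: nat and n x
    using mult_mono[OF cut(2)[of m x] cl(1)[of m "g n x"]] cut cl by (auto simp: f_def abs_mult)
  have sh: "square_integrable lborel (h m)" for m
    by (rule bounded_support_square_integrable(1)[OF hm hb])
  have sf: "square_integrable lborel (f m n)" for m n
    by (rule bounded_support_square_integrable(1)[OF fm fb])
  have "(\<lambda>m. \<integral>x. (w x - h m x)\<^sup>2 \<partial>lborel) \<longlonglongrightarrow> (\<integral>x. 0 \<partial>(lborel::'a measure))"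
  proof (rule integral_dominated_convergence[where w="\<lambda>x. (w x)\<^sup>2"])
    show "AE x in lborel. (\<lambda>m. (w x - h m x)\<^sup>2) \<longlonglongrightarrow> 0"
    proof (rule AE_I2)
      fix x
      obtain k where k: "\<bar>w x\<bar> + norm x \<le> real k" using real_arch_simple by blast
      have "h m x = w x" if "m \<ge> k" for m
      proof -
        have "real k \<le> real m" using that by simp
        then have "cut m x = 1" "cl m (w x) = w x"
          using k abs_ge_zero[of "w x"] norm_ge_zero[of x] by (intro cut cl; linarith)+
        then show ?thesis by (simp add: h_def)
      qed
      then have "\<forall>\<^sub>F m in sequentially. (w x - h m x)\<^sup>2 = 0"
        by (intro eventually_sequentiallyI[of k]) simp
      then show "(\<lambda>m. (w x - h m x)\<^sup>2) \<longlonglongrightarrow> 0"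
        by (rule tendsto_eventually)
    qed
    show "AE x in lborel. norm ((w x - h m x)\<^sup>2) \<le> (w x)\<^sup>2" for m
    proof (rule AE_I2)
      fix x
      \<comment> \<open>The scaled clamp of \<open>y\<close> lies between 0 and \<open>y\<close>, so
        what remains is no larger than \<open>y\<close>; this makes \<open>(w x)\<^sup>2\<close> a
        dominating function.\<close>
      have "\<bar>y - c * cl m y\<bar> \<le> \<bar>y\<bar>" if "0 \<le> c" "c \<le> 1" for c y
      proof -
        have "\<bar>cl m y\<bar> \<le> \<bar>y\<bar>" "cl m y * y \<ge> 0"
          by (auto simp: cl_def zero_le_mult_iff max_def min_def)
        then have s: "0 \<le> y \<Longrightarrow> 0 \<le> cl m y \<and> cl m y \<le> y" "y \<le> 0 \<Longrightarrow> cl m y \<le> 0 \<and> y \<le> cl m y"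
          by (auto simp: cl_def)
        show ?thesis
        proof (cases "0 \<le> y")
          case True
          then have "0 \<le> c * cl m y" "c * cl m y \<le> y"
            using s that mult_mono[of c 1 "cl m y" y] by auto
          then show ?thesis by auto
        next
          case False
          then have "c * cl m y \<le> 0" "c * cl m y \<ge> y"
            using s that mult_mono[of c 1 "- cl m y" "-y"] by (auto simp: mult_le_0_iff)
          then show ?thesis by auto
        qed
      qed
      from this[OF cut(1,2), of "w x" m x] show "norm ((w x - h m x)\<^sup>2) \<le> (w x)\<^sup>2"
        by (simp add: h_def abs_le_square_iff)
    qed
  qed (use w in \<open>auto simp: square_integrable_def\<close>)
  then have "\<forall>\<^sub>F m in sequentially. (\<integral>x. (w x - h m x)\<^sup>2 \<partial>lborel) < e / 4"
    using e by (intro order_tendstoD(2)[where y=0]) auto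
  then obtain m where m: "(\<integral>x. (w x - h m x)\<^sup>2 \<partial>lborel) < e / 4"
    by (auto simp: eventually_sequentially)
  \<comment> \<open>With \<open>m\<close> fixed both functions are bounded by \<open>m\<close> and
    vanish outside one ball, so a constant on that ball dominates for all \<open>n\<close>.\<close>
  have "(\<lambda>n. \<integral>x. (h m x - f m n x)\<^sup>2 \<partial>lborel) \<longlonglongrightarrow> (\<integral>x. 0 \<partial>(lborel::'a measure))"
  proof (rule integral_dominated_convergence[where w="\<lambda>x. (2 * real m)\<^sup>2 * indicator (cball (0::'a) (real m + 1)) x"])
    show "AE x in lborel. (\<lambda>n. (h m x - f m n x)\<^sup>2) \<longlonglongrightarrow> 0"
      using aeN
    proof (rule eventually_mono)
      fix x assume "x \<notin> N"
      then have "(\<lambda>n. cut m x * cl m (w x) - cut m x * cl m (g n x)) \<longlonglongrightarrow> cut m x * cl m (w x) - cut m x * cl m (w x)"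
        unfolding cl_def by (intro tendsto_intros gl)
      then have "(\<lambda>n. (h m x - f m n x)\<^sup>2) \<longlonglongrightarrow> 0\<^sup>2"
        by (intro tendsto_power) (simp add: h_def f_def)
      then show "(\<lambda>n. (h m x - f m n x)\<^sup>2) \<longlonglongrightarrow> 0" by simp
    qed
    show "AE x in lborel. norm ((h m x - f m n x)\<^sup>2) \<le> (2 * real m)\<^sup>2 * indicator (cball 0 (real m + 1)) x" for n
    proof (rule AE_I2)
      fix x
      have "\<bar>h m x - f m n x\<bar> \<le> \<bar>2 * real m\<bar>" using hb(1)[of m x] fb(1)[of m n x] by auto
      then have "(h m x - f m n x)\<^sup>2 \<le> (2 * real m)\<^sup>2" by (simp only: abs_le_square_iff)
      then show "norm ((h m x - f m n x)\<^sup>2) \<le> (2 * real m)\<^sup>2 * indicator (cball 0 (real m + 1)) x"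
        using hb(2)[of m x] fb(2)[of m x n] by (cases "norm x \<le> real m + 1") auto
    qed
  qed (use emeasure_lborel_cball_finite[of "0::'a" "real m + 1"] in \<open>auto intro!: integrable_real_indicator\<close>)
  then have "\<forall>\<^sub>F n in sequentially. (\<integral>x. (h m x - f m n x)\<^sup>2 \<partial>lborel) < e / 4"
    using e by (intro order_tendstoD(2)[where y=0]) auto
  then obtain n where n: "(\<integral>x. (h m x - f m n x)\<^sup>2 \<partial>lborel) < e / 4"
    by (auto simp: eventually_sequentially)
  have "(\<integral>x. (w x - f m n x)\<^sup>2 \<partial>lborel) = (\<integral>x. ((w x - h m x) + (h m x - f m n x))\<^sup>2 \<partial>lborel)" by simp
  also have "\<dots> \<le> 2 * (\<integral>x. (w x - h m x)\<^sup>2 \<partial>lborel) + 2 * (\<integral>x. (h m x - f m n x)\<^sup>2 \<partial>lborel)"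
    by (intro integral_square_add_le square_integrable_diff w sh sf)
  also have "\<dots> < e" using m n by linarith
  finally have fin: "(\<integral>x. (w x - f m n x)\<^sup>2 \<partial>lborel) < e" .
  have "continuous_on UNIV (f m n)"
    unfolding f_def cut_def cl_def by (intro continuous_intros gc)
  then show thesis
    by (rule that[of "f m n" "real m + 1"]) (use fb sf fin in auto)
qed

text \<open>Three-term argument with a continuous \<open>f\<close> of compact support close to
  \<open>w\<close>: compare \<open>w\<close> with \<open>f\<close> after the affine map,
  \<open>f\<close> after the map with \<open>f\<close>, and \<open>f\<close> with \<open>w\<close>.
  The middle term is small by uniform continuity, the outer ones by the choice of
  \<open>f\<close>.\<close>

lemma L2_affine_continuity:
  fixes w :: "'a::euclidean_space \<Rightarrow> real"
  assumes w: "square_integrable lborel w" and e: "e > 0"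
  obtains d where "d > 0" "d \<le> 1/2"
     "\<And>t z. \<bar>t - 1\<bar> < d \<Longrightarrow> norm z < d \<Longrightarrow> square_integrable lborel (\<lambda>x. w (t *\<^sub>R x + z) - w x)"
     "\<And>t z. \<bar>t - 1\<bar> < d \<Longrightarrow> norm z < d \<Longrightarrow> (\<integral>x. (w (t *\<^sub>R x + z) - w x)\<^sup>2 \<partial>lborel) < e"
proof -
  let ?n = "DIM('a)"
  have [measurable]: "w \<in> borel_measurable borel" using w by (simp add: square_integrable_def)
  \<comment> \<open>Since \<open>t > 1/2\<close>, undoing the dilation costs at most the factor
    \<open>2 ^ ?n\<close>. Three errors of size \<open>e / 16\<close> enter with the weights 2, 4
    and 4, which stays below \<open>e\<close>.\<close>
  have e': "e / (16 * 2 ^ ?n) > 0" using e by simp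
  obtain f R where fc: "continuous_on UNIV f" and fz: "\<And>x. norm x > R \<Longrightarrow> f x = 0" and R: "R > 0"
    and fs: "square_integrable lborel f" and wf: "(\<integral>x. (w x - f x)\<^sup>2 \<partial>lborel) < e / (16 * 2 ^ ?n)"
    using L2_dense_compact_support[OF w e'] by metis
  have [measurable]: "f \<in> borel_measurable borel" using fs by (simp add: square_integrable_def)
  \<comment> \<open>For \<open>t > 1/2\<close> and \<open>norm z < 1\<close>, a point beyond this
    radius and its image under the affine map both lie outside the support of
    \<open>f\<close>.\<close>
  define R' where "R' = 2 * (R + 1)"
  define V where "V = measure lborel (cball (0::'a) R')"
  define \<eta> where "\<eta> = sqrt (e / (16 * (V + 1)))"
  have V: "V \<ge> 0" by (simp add: V_def)
  have \<eta>: "\<eta> > 0" and \<eta>2: "\<eta>\<^sup>2 = e / (16 * (V + 1))" using e V by (auto simp: \<eta>_def)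
  obtain d0 where d0: "d0 > 0" "\<And>x y. dist x y < d0 \<Longrightarrow> \<bar>f x - f y\<bar> < \<eta>"
    using uniformly_continuous_compact_support[OF fc fz \<eta>] by metis
  \<comment> \<open>On the ball of radius \<open>R'\<close> the affine map moves a point by at most
    \<open>d * R' + d\<close>, which this choice keeps below \<open>d0\<close>. The bound 1/2 yields
    \<open>t > 1/2\<close> and \<open>norm z < 1\<close>.\<close>
  define d where "d = min (1/2) (d0 / (2 * (R' + 1)))"
  have R': "R' > 0" using R by (simp add: R'_def)
  have d: "d > 0" using d0 R' by (simp add: d_def)
  have main: "square_integrable lborel (\<lambda>x. w (t *\<^sub>R x + z) - w x) \<and> (\<integral>x. (w (t *\<^sub>R x + z) - w x)\<^sup>2 \<partial>lborel) < e"
    if t: "\<bar>t - 1\<bar> < d" and z: "norm z < d" for t z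
  proof -
    have t2: "t > 1/2" using t unfolding d_def by linarith
    then have t0: "t \<noteq> 0" by simp
    have aff: "square_integrable lborel (\<lambda>x. u (t *\<^sub>R x + z))" if "square_integrable lborel u" for u
      using that lborel_integrable_affine_iff[of t "\<lambda>x. (u x)\<^sup>2" z] t0
      by (auto simp: square_integrable_def add.commute)
    have sw: "square_integrable lborel (\<lambda>x. w (t *\<^sub>R x + z) - f (t *\<^sub>R x + z))"
      using aff[OF square_integrable_diff[OF w fs]] by simp
    have sff: "square_integrable lborel (\<lambda>x. f (t *\<^sub>R x + z) - f x)"
      by (intro square_integrable_diff aff fs)
    have sfw: "square_integrable lborel (\<lambda>x. f x - w x)"
      by (intro square_integrable_diff w fs)
    define I where "I = (\<integral>x. (w (t *\<^sub>R x + z) - f (t *\<^sub>R x + z))\<^sup>2 \<partial>lborel)"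
    have "(\<integral>x. (w x - f x)\<^sup>2 \<partial>lborel) = t ^ ?n * I"
      using lborel_integral_affine[OF t0, of "\<lambda>x. (w x - f x)\<^sup>2" z] t2 by (simp add: add.commute I_def)
    then have "t ^ ?n * I < e / (16 * 2 ^ ?n)" using wf by simp
    moreover have "(1/2) ^ ?n * I \<le> t ^ ?n * I"
      using t2 by (intro mult_right_mono power_mono) (auto simp: I_def)
    ultimately have "I < e / 16"
      by (simp add: power_one_over field_simps)
    have fd: "\<bar>f (t *\<^sub>R x + z) - f x\<bar> \<le> \<eta>" if "norm x \<le> R'" for x
    proof -
      have "dist (t *\<^sub>R x + z) x = norm ((t - 1) *\<^sub>R x + z)"
        by (simp add: dist_norm algebra_simps)
      also have "\<dots> \<le> \<bar>t - 1\<bar> * norm x + norm z" by (rule norm_triangle_le) simp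
      also have "\<dots> \<le> d * R' + d"
        using t z that R' by (intro add_mono mult_mono) auto
      also have "\<dots> = d * (R' + 1)" by (simp add: algebra_simps)
      also have "\<dots> \<le> d0 / (2 * (R' + 1)) * (R' + 1)"
        using R' by (intro mult_right_mono) (auto simp: d_def)
      also have "\<dots> = d0 / 2" using R' by (simp add: divide_simps)
      also have "\<dots> < d0" using d0 by simp
      finally show ?thesis using d0(2) less_imp_le by blast
    qed
    have fo: "f (t *\<^sub>R x + z) - f x = 0" if x: "norm x > R'" for x
    proof -
      have "norm (t *\<^sub>R x) \<ge> (1/2) * norm x" using t2 mult_right_mono[of "1/2" t "norm x"] by simp
      then have "norm (t *\<^sub>R x) > R + 1" using x by (simp add: R'_def)
      moreover have "norm z < 1" using z by (simp add: d_def)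
      ultimately have "norm (t *\<^sub>R x + z) > R"
        using norm_triangle_ineq2[of "t *\<^sub>R x" "-z"] by simp
      moreover have "norm x > R" using x R by (simp add: R'_def)
      ultimately show ?thesis using fz by simp
    qed
    have fd': "\<bar>f (t *\<^sub>R x + z) - f x\<bar> \<le> \<eta>" for x
      using fd[of x] fo[of x] \<eta> by (cases "norm x \<le> R'") auto
    have "(\<integral>x. (f (t *\<^sub>R x + z) - f x)\<^sup>2 \<partial>lborel) \<le> \<eta>\<^sup>2 * V"
      unfolding V_def by (rule bounded_support_square_integrable(2)) (use fd' fo in auto)
    also have "\<dots> = (e / 16) * (V / (V + 1))" using \<eta>2 by simp
    also have "\<dots> \<le> (e / 16) * 1" using V e by (intro mult_left_mono) auto
    finally have J: "(\<integral>x. (f (t *\<^sub>R x + z) - f x)\<^sup>2 \<partial>lborel) \<le> e / 16" by simp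
    have "(1::real) \<le> 2 ^ ?n" by simp
    then have "e / (16 * 2 ^ ?n) \<le> e / 16" using e by (simp add: field_simps)
    then have L: "(\<integral>x. (f x - w x)\<^sup>2 \<partial>lborel) < e / 16" using wf by (simp add: power2_commute)
    have "(\<integral>x. (w (t *\<^sub>R x + z) - w x)\<^sup>2 \<partial>lborel)
      = (\<integral>x. ((w (t *\<^sub>R x + z) - f (t *\<^sub>R x + z)) + ((f (t *\<^sub>R x + z) - f x) + (f x - w x)))\<^sup>2 \<partial>lborel)" by simp
    also have "\<dots> \<le> 2 * I + 2 * (\<integral>x. ((f (t *\<^sub>R x + z) - f x) + (f x - w x))\<^sup>2 \<partial>lborel)"
      unfolding I_def by (intro integral_square_add_le square_integrable_add sw sff sfw)
    also have "\<dots> \<le> 2 * I + 2 * (2 * (\<integral>x. (f (t *\<^sub>R x + z) - f x)\<^sup>2 \<partial>lborel) + 2 * (\<integral>x. (f x - w x)\<^sup>2 \<partial>lborel))"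
      by (intro add_left_mono mult_left_mono integral_square_add_le sff sfw) simp
    also have "\<dots> < e"
    proof -
      have "2 * a + 2 * (2 * b + 2 * c) < e" if "a < e / 16" "b \<le> e / 16" "c < e / 16" for a b c
        using that e by (simp add: field_simps)
      then show ?thesis using \<open>I < e / 16\<close> J L by blast
    qed
    finally show ?thesis by (intro conjI square_integrable_diff aff w)
  qed
  show thesis by (rule that[OF d _ main[THEN conjunct1] main[THEN conjunct2]]) (unfold d_def, rule min.cobounded1)
qed


section \<open>Averages against one fixed smooth probability density\<close>

definition mollifier :: "real^'n \<Rightarrow> real" where
  "mollifier = (SOME \<eta>. smooth \<eta> \<and> (\<forall>x. \<eta> x \<ge> 0) \<and> (\<forall>x. norm x \<ge> 1 \<longrightarrow> \<eta> x = 0) \<and>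
     integrable lborel \<eta> \<and> integral\<^sup>L lborel \<eta> = 1)"

lemma mollifier:
  shows smooth_mollifier: "smooth (mollifier :: real^'n \<Rightarrow> real)"
    and mollifier_nonneg: "mollifier (x :: real^'n) \<ge> 0"
    and mollifier_outside: "norm (x :: real^'n) \<ge> 1 \<Longrightarrow> mollifier x = 0"
    and integrable_mollifier: "integrable lborel (mollifier :: real^'n \<Rightarrow> real)"
    and integral_mollifier: "integral\<^sup>L lborel (mollifier :: real^'n \<Rightarrow> real) = 1"
proof -
  have "\<exists>\<eta> :: real^'n \<Rightarrow> real. smooth \<eta> \<and> (\<forall>x. \<eta> x \<ge> 0) \<and> (\<forall>x. norm x \<ge> 1 \<longrightarrow> \<eta> x = 0) \<and>
     integrable lborel \<eta> \<and> integral\<^sup>L lborel \<eta> = 1"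
    using exists_mollifier by metis
  from someI_ex[OF this, folded mollifier_def]
  show "smooth (mollifier :: real^'n \<Rightarrow> real)" "mollifier (x :: real^'n) \<ge> 0"
    "norm (x :: real^'n) \<ge> 1 \<Longrightarrow> mollifier x = 0" "integrable lborel (mollifier :: real^'n \<Rightarrow> real)"
    "integral\<^sup>L lborel (mollifier :: real^'n \<Rightarrow> real) = 1" by auto
qed

lemma mollifier_measurable[measurable]: "mollifier \<in> borel_measurable borel"
  by (rule borel_measurable_continuous_onI[OF smooth_continuous[OF smooth_mollifier]])

lemma continuous_compact_support_bounded:
  fixes f :: "'a::euclidean_space \<Rightarrow> real"
  assumes "continuous_on UNIV f" "\<And>x. norm x > R \<Longrightarrow> f x = 0"
  obtains B where "B \<ge> 0" "\<And>x. \<bar>f x\<bar> \<le> B"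
proof -
  have "bounded (f ` cball 0 R)"
    by (intro compact_imp_bounded compact_continuous_image continuous_on_subset[OF assms(1)]) auto
  then obtain B where "\<forall>y\<in>f ` cball 0 R. norm y \<le> B"
    unfolding bounded_iff by blast
  then have B: "\<And>x. x \<in> cball 0 R \<Longrightarrow> \<bar>f x\<bar> \<le> B" by simp
  show thesis
  proof (rule that[of "max B 0"])
    show "\<bar>f x\<bar> \<le> max B 0" for x
      using B[of x] assms(2)[of x] by (cases "norm x \<le> R") auto
  qed simp
qed

lemma mollifier_bounded:
  obtains B where "B \<ge> 0" "\<And>x. (mollifier :: real^'n \<Rightarrow> real) x \<le> B"
proof -
  obtain B where "B \<ge> 0" "\<And>x::real^'n. \<bar>mollifier x\<bar> \<le> B"
    using continuous_compact_support_bounded[OF smooth_continuous[OF smooth_mollifier], of 1]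
      mollifier_outside less_imp_le by metis
  then show thesis using that abs_le_D1 by metis
qed

text \<open>The average of \<open>w\<close> over the ball of radius \<open>r\<close> about
  \<open>t *\<^sub>R x + b\<close>. The dilation and shift are part of the operator so that the
  averaging ball can be moved relative to the domain.\<close>

definition mollify :: "real \<Rightarrow> real^'n \<Rightarrow> real \<Rightarrow> (real^'n \<Rightarrow> real) \<Rightarrow> real^'n \<Rightarrow> real" where
  "mollify t b r w x = (\<integral>z. mollifier z * w (t *\<^sub>R x + b + r *\<^sub>R z) \<partial>lborel)"

text \<open>The mollifier is a probability density, so this is Jensen's inequality for the square,
  obtained from the nonnegativity of a variance. The extended integral on the right makes Tonelli's
  theorem applicable before integrability in \<open>x\<close> is known.\<close>

lemma mollify_Jensen:
  fixes w :: "real^'n \<Rightarrow> real"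
  assumes w: "square_integrable lborel w" and r: "r > 0"
  shows "ennreal ((mollify t b r w x - w x)\<^sup>2) \<le>
    (\<integral>\<^sup>+z. ennreal (mollifier z * (w (t *\<^sub>R x + b + r *\<^sub>R z) - w x)\<^sup>2) \<partial>lborel)"
proof -
  note [measurable] = square_integrableD(1)[OF w, simplified]
  obtain B where B: "B \<ge> 0" "\<And>x::real^'n. mollifier x \<le> B" using mollifier_bounded by metis
  define g where "g z = w (t *\<^sub>R x + b + r *\<^sub>R z)" for z
  have [measurable]: "g \<in> borel_measurable borel" unfolding g_def by measurable
  have g2: "integrable lborel (\<lambda>z. (g z)\<^sup>2)"
    using lborel_integrable_affine_iff[of r "\<lambda>x. (w x)\<^sup>2" "t *\<^sub>R x + b"] r square_integrableD(2)[OF w] by (simp add: g_def)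
  have i2: "integrable lborel (\<lambda>z. mollifier z * (g z)\<^sup>2)"
    by (rule Bochner_Integration.integrable_bound[OF integrable_mult_right[OF g2, of B]])
       (use B in \<open>auto simp: abs_mult mollifier_nonneg intro!: mult_right_mono AE_I2\<close>)
  have i1: "integrable lborel (\<lambda>z. mollifier z * g z)"
  proof (rule Bochner_Integration.integrable_bound[OF Bochner_Integration.integrable_add[OF integrable_mollifier i2]])
    have y: "\<bar>y\<bar> \<le> 1 + y\<^sup>2" for y :: real
    proof -
      have "2 * \<bar>y\<bar> \<le> 1 + y\<^sup>2" using sum_squares_bound[of 1 "\<bar>y\<bar>"] by simp
      then show ?thesis using abs_ge_zero[of y] by linarith
    qed
    have "\<bar>mollifier z * g z\<bar> \<le> mollifier z + mollifier z * (g z)\<^sup>2" for z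
      using mult_left_mono[OF y[of "g z"] mollifier_nonneg[of z]]
      by (simp add: abs_mult mollifier_nonneg distrib_left)
    then show "AE z in lborel. norm (mollifier z * g z) \<le> norm (mollifier z + mollifier z * (g z)\<^sup>2)"
      by (auto intro!: AE_I2 intro: order_trans[OF _ abs_ge_self])
  qed measurable
  define m where "m = (\<integral>z. mollifier z * g z \<partial>lborel)"
  have M: "mollify t b r w x = m" by (simp add: mollify_def m_def g_def)
  have e: "mollifier z * (g z - c)\<^sup>2 = mollifier z * (g z)\<^sup>2 - 2 * c * (mollifier z * g z) + c\<^sup>2 * mollifier z" for z c
    by (simp add: power2_eq_square algebra_simps)
  have ic: "integrable lborel (\<lambda>z. mollifier z * (g z - c)\<^sup>2)" for c
    unfolding e by (intro Bochner_Integration.integrable_add Bochner_Integration.integrable_diff integrable_mult_right i1 i2 integrable_mollifier)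
  \<comment> \<open>At \<open>c = m\<close> this is the variance, whose nonnegativity bounds
    \<open>m\<^sup>2\<close> by the second moment; at \<open>c = w x\<close> it is the quantity to
    be compared with.\<close>
  have v: "(\<integral>z. mollifier z * (g z - c)\<^sup>2 \<partial>lborel) = (\<integral>z. mollifier z * (g z)\<^sup>2 \<partial>lborel) - 2 * c * m + c\<^sup>2" for c
  proof -
    have "has_bochner_integral lborel (\<lambda>z. mollifier z * (g z)\<^sup>2 - 2 * c * (mollifier z * g z) + c\<^sup>2 * mollifier z)
       ((\<integral>z. mollifier z * (g z)\<^sup>2 \<partial>lborel) - 2 * c * m + c\<^sup>2 * integral\<^sup>L lborel (mollifier :: real^'n \<Rightarrow> real))"
      unfolding m_def
      by (intro has_bochner_integral_add has_bochner_integral_diff has_bochner_integral_mult_right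
          has_bochner_integral_integrable i1 i2 integrable_mollifier)
    from has_bochner_integral_integral_eq[OF this] show ?thesis
      unfolding e integral_mollifier by simp
  qed
  have "0 \<le> (\<integral>z. mollifier z * (g z - m)\<^sup>2 \<partial>lborel)"
    by (rule integral_nonneg_AE) (auto simp: mollifier_nonneg)
  then have "m\<^sup>2 \<le> (\<integral>z. mollifier z * (g z)\<^sup>2 \<partial>lborel)" unfolding v by (simp add: power2_eq_square)
  then have "(m - w x)\<^sup>2 \<le> (\<integral>z. mollifier z * (g z - w x)\<^sup>2 \<partial>lborel)"
    unfolding v by (simp add: power2_eq_square algebra_simps)
  then have "ennreal ((m - w x)\<^sup>2) \<le> ennreal (\<integral>z. mollifier z * (g z - w x)\<^sup>2 \<partial>lborel)"
    by (rule ennreal_leI)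
  also have "\<dots> = (\<integral>\<^sup>+z. ennreal (mollifier z * (g z - w x)\<^sup>2) \<partial>lborel)"
    by (rule nn_integral_eq_integral[symmetric, OF ic]) (auto simp: mollifier_nonneg)
  finally show ?thesis by (simp add: M g_def)
qed

text \<open>After Jensen and an exchange of integrals, the inner integral for each \<open>z\<close>
  is the L2 error of one affine map with shift \<open>b + r *\<^sub>R z\<close>. It is below
  \<open>e / 2\<close> uniformly in \<open>norm z < 1\<close>, and the mollifier has mass one. The
  shift splits into two parts below \<open>d / 2\<close>, which explains the final
  threshold.\<close>

lemma mollify_L2:
  fixes w :: "real^'n \<Rightarrow> real"
  assumes w: "square_integrable lborel w" and e: "e > 0"
  obtains d where "d > 0"
     "\<And>t b r. \<bar>t - 1\<bar> < d \<Longrightarrow> norm b < d \<Longrightarrow> 0 < r \<Longrightarrow> r < d \<Longrightarrow> square_integrable lborel (\<lambda>x. mollify t b r w x - w x)"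
     "\<And>t b r. \<bar>t - 1\<bar> < d \<Longrightarrow> norm b < d \<Longrightarrow> 0 < r \<Longrightarrow> r < d \<Longrightarrow> (\<integral>x. (mollify t b r w x - w x)\<^sup>2 \<partial>lborel) < e"
proof -
  note [measurable] = square_integrableD(1)[OF w, simplified]
  obtain d where d: "d > 0" and "d \<le> 1/2" and
     s: "\<And>t z. \<bar>t - 1\<bar> < d \<Longrightarrow> norm z < d \<Longrightarrow> square_integrable lborel (\<lambda>x. w (t *\<^sub>R x + z) - w x)" and
     i: "\<And>t z. \<bar>t - 1\<bar> < d \<Longrightarrow> norm z < d \<Longrightarrow> (\<integral>x. (w (t *\<^sub>R x + z) - w x)\<^sup>2 \<partial>lborel) < e / 2"
    by (rule L2_affine_continuity[OF w half_gt_zero[OF e]]) (rule that, assumption+)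
  have main: "square_integrable lborel (\<lambda>x. mollify t b r w x - w x) \<and> (\<integral>x. (mollify t b r w x - w x)\<^sup>2 \<partial>lborel) < e"
    if t: "\<bar>t - 1\<bar> < d/2" and b: "norm b < d/2" and r: "0 < r" "r < d/2" for t b r
  proof -
    have [measurable]: "mollify t b r w \<in> borel_measurable borel"
      unfolding mollify_def by measurable
    have "(\<integral>\<^sup>+x. ennreal ((mollify t b r w x - w x)\<^sup>2) \<partial>lborel)
       \<le> (\<integral>\<^sup>+x. \<integral>\<^sup>+z. ennreal (mollifier z * (w (t *\<^sub>R x + b + r *\<^sub>R z) - w x)\<^sup>2) \<partial>lborel \<partial>lborel)"
      by (intro nn_integral_mono mollify_Jensen w r)
    also have "\<dots> = (\<integral>\<^sup>+z. \<integral>\<^sup>+x. ennreal (mollifier z * (w (t *\<^sub>R x + b + r *\<^sub>R z) - w x)\<^sup>2) \<partial>lborel \<partial>lborel)"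
      by (rule lborel_pair.Fubini') measurable
    also have "\<dots> \<le> (\<integral>\<^sup>+z. ennreal (mollifier z * (e/2)) \<partial>(lborel :: (real^'n) measure))"
    proof (rule nn_integral_mono)
      fix z :: "real^'n"
      show "(\<integral>\<^sup>+x. ennreal (mollifier z * (w (t *\<^sub>R x + b + r *\<^sub>R z) - w x)\<^sup>2) \<partial>lborel) \<le> ennreal (mollifier z * (e/2))"
      proof (cases "norm z < 1")
        case False
        then show ?thesis by (simp add: mollifier_outside)
      next
        case True
        have "norm (b + r *\<^sub>R z) \<le> norm b + r * norm z" using r by (intro norm_triangle_le) simp
        also have "r * norm z \<le> r * 1" using True r by (intro mult_left_mono) auto
        finally have n: "norm (b + r *\<^sub>R z) < d" using b r by linarith
        have t': "\<bar>t - 1\<bar> < d" using t by linarith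
        have "(\<integral>\<^sup>+x. ennreal ((w (t *\<^sub>R x + b + r *\<^sub>R z) - w x)\<^sup>2) \<partial>lborel)
           = ennreal (\<integral>x. (w (t *\<^sub>R x + (b + r *\<^sub>R z)) - w x)\<^sup>2 \<partial>lborel)"
          using nn_integral_eq_integral[OF square_integrableD(2)[OF s[OF t' n]]] by (simp add: add.assoc)
        also have "\<dots> \<le> ennreal (e/2)" using i[OF t' n] by (intro ennreal_leI) simp
        finally have "ennreal (mollifier z) * (\<integral>\<^sup>+x. ennreal ((w (t *\<^sub>R x + b + r *\<^sub>R z) - w x)\<^sup>2) \<partial>lborel)
          \<le> ennreal (mollifier z) * ennreal (e/2)" by (rule mult_left_mono) simp
        then show ?thesis using e
          by (simp add: nn_integral_cmult[symmetric] ennreal_mult[symmetric] mollifier_nonneg)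
      qed
    qed
    also have "\<dots> = ennreal (e/2)"
    proof -
      have "(\<integral>\<^sup>+z. ennreal (mollifier z * (e/2)) \<partial>(lborel :: (real^'n) measure)) = ennreal (\<integral>z. mollifier z * (e/2) \<partial>(lborel :: (real^'n) measure))"
        by (rule nn_integral_eq_integral) (use e integrable_mollifier in \<open>auto simp: mollifier_nonneg\<close>)
      then show ?thesis by (simp add: integral_mollifier)
    qed
    finally have le: "(\<integral>\<^sup>+x. ennreal ((mollify t b r w x - w x)\<^sup>2) \<partial>lborel) \<le> ennreal (e/2)" .
    then have int: "integrable lborel (\<lambda>x. (mollify t b r w x - w x)\<^sup>2)"
      by (intro integrableI_bounded) (auto simp: le_less_trans[OF le])
    have "ennreal (\<integral>x. (mollify t b r w x - w x)\<^sup>2 \<partial>lborel) \<le> ennreal (e/2)"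
      using le nn_integral_eq_integral[OF int] by simp
    then have "(\<integral>x. (mollify t b r w x - w x)\<^sup>2 \<partial>lborel) \<le> e/2" using e by simp
    then show ?thesis using int e by (auto simp: square_integrable_def)
  qed
  show thesis by (rule that[of "d/2"]) (use main d in auto)
qed

section \<open>Smoothness of mollified functions\<close>

lemma sum_axis_mult: "(\<Sum>j\<in>UNIV. axis i (1::real) $ j * c j) = c i"
proof -
  have "(\<Sum>j\<in>UNIV. axis i (1::real) $ j * c j) = (\<Sum>j\<in>UNIV. if j = i then c j else 0)"
    by (rule sum.cong) (auto simp: axis_def)
  then show ?thesis by simp
qed

lemma partial_outside_support:
  assumes "Ck (Suc 0) \<phi>" "\<And>x. norm x > R \<Longrightarrow> \<phi> x = 0" "norm x > R"
  shows "partial i \<phi> x = 0"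
proof -
  have "(\<phi> has_derivative (\<lambda>h. 0)) (at x)"
    by (rule has_derivative_transform_within_open[where f="\<lambda>x. 0" and s="- cball 0 R"])
       (use assms in auto)
  from partial_eq[OF this] show ?thesis .
qed

text \<open>The mean value theorem on a segment reduces the remainder to differences of partial
  derivatives, which are uniformly continuous because the support is bounded. The point is that
  \<open>d\<close> is independent of \<open>a\<close>, so the estimate survives integration;
  \<open>e\<close> is shared out over the coordinates.\<close>

lemma uniform_linearization:
  fixes \<phi> :: "real^'n \<Rightarrow> real"
  assumes \<phi>: "Ck (Suc 0) \<phi>" "\<And>x. norm x > R \<Longrightarrow> \<phi> x = 0" and e: "e > 0"
  obtains d where "d > 0"
    "\<And>a h. norm h < d \<Longrightarrow> \<bar>\<phi> (a + h) - \<phi> a - (\<Sum>i\<in>UNIV. h $ i * partial i \<phi> a)\<bar> \<le> e * norm h"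
proof -
  let ?N = "real CARD('n)"
  have N: "?N > 0" by simp
  have "\<exists>d>0. \<forall>x y. dist x y < d \<longrightarrow> \<bar>partial i \<phi> x - partial i \<phi> y\<bar> < e / ?N" for i
    using uniformly_continuous_compact_support[of "partial i \<phi>" R "e / ?N"]
      \<phi>(1) partial_outside_support[OF \<phi>] e N by (metis Ck.simps divide_pos_pos)
  then obtain d where d: "\<And>i. d i > 0" "\<And>i x y. dist x y < d i \<Longrightarrow> \<bar>partial i \<phi> x - partial i \<phi> y\<bar> < e / ?N"
    by metis
  define D where "D = Min (range d)"
  have D: "D > 0" "\<And>i. D \<le> d i" using d(1) by (auto simp: D_def)
  show thesis
  proof (rule that[OF D(1)])
    fix a h :: "real^'n" assume h: "norm h < D"
    define g where "g s = \<phi> (a + s *\<^sub>R h)" for s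
    have g': "(g has_derivative (\<lambda>k. k * (\<Sum>i\<in>UNIV. h $ i * partial i \<phi> (a + s *\<^sub>R h)))) (at s)" for s
    proof -
      have "\<phi> differentiable at (a + s *\<^sub>R h)" using \<phi>(1) by simp
      note D = differentiable_has_derivative_partial[OF this]
      have "((\<lambda>s. a + s *\<^sub>R h) has_derivative (\<lambda>k. k *\<^sub>R h)) (at s)"
        by (auto intro!: derivative_eq_intros)
      from has_derivative_compose[where g=\<phi>, OF this D] show ?thesis
        by (simp add: g_def[abs_def] sum_distrib_left mult.assoc)
    qed
    have "\<exists>x\<in>{0<..<1}. g 1 - g 0 = (1 - 0) * (\<Sum>i\<in>UNIV. h $ i * partial i \<phi> (a + x *\<^sub>R h))"
      by (rule mvt_simple) (use g' in \<open>auto intro: has_derivative_at_withinI\<close>)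
    then obtain \<theta> where \<theta>: "0 < \<theta>" "\<theta> < 1" "g 1 - g 0 = (\<Sum>i\<in>UNIV. h $ i * partial i \<phi> (a + \<theta> *\<^sub>R h))" by auto
    have c: "\<bar>partial i \<phi> (a + \<theta> *\<^sub>R h) - partial i \<phi> a\<bar> \<le> e / ?N" for i
    proof -
      have "\<bar>\<theta>\<bar> * norm h \<le> 1 * norm h" using \<theta> by (intro mult_right_mono) auto
      then have "dist (a + \<theta> *\<^sub>R h) a < d i" using h D(2)[of i] by (simp add: dist_norm)
      then show ?thesis using d(2) less_imp_le by blast
    qed
    have "\<bar>\<phi> (a + h) - \<phi> a - (\<Sum>i\<in>UNIV. h $ i * partial i \<phi> a)\<bar>
       = \<bar>\<Sum>i\<in>UNIV. h $ i * (partial i \<phi> (a + \<theta> *\<^sub>R h) - partial i \<phi> a)\<bar>"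
      using \<theta>(3) by (simp add: g_def sum_subtractf right_diff_distrib)
    also have "\<dots> \<le> (\<Sum>i\<in>(UNIV::'n set). norm h * (e / ?N))"
    proof (rule order_trans[OF sum_abs], rule sum_mono)
      fix i :: 'n show "\<bar>h $ i * (partial i \<phi> (a + \<theta> *\<^sub>R h) - partial i \<phi> a)\<bar> \<le> norm h * (e / ?N)"
        unfolding abs_mult by (intro mult_mono c component_le_norm_cart) auto
    qed
    also have "\<dots> = e * norm h" by simp
    finally show "\<bar>\<phi> (a + h) - \<phi> a - (\<Sum>i\<in>UNIV. h $ i * partial i \<phi> a)\<bar> \<le> e * norm h" .
  qed
qed

lemma integrable_mult_bounded:
  fixes w g :: "'a \<Rightarrow> real"
  assumes "integrable M w" "g \<in> borel_measurable M" "\<And>x. \<bar>g x\<bar> \<le> B"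
  shows "integrable M (\<lambda>x. w x * g x)"
proof (rule Bochner_Integration.integrable_bound[OF integrable_mult_right[OF assms(1), of B]])
  have "\<bar>w x\<bar> * \<bar>g x\<bar> \<le> \<bar>w x\<bar> * \<bar>B\<bar>" for x
    using assms(3)[of x] by (intro mult_left_mono) auto
  then show "AE x in M. norm (w x * g x) \<le> norm (B * w x)"
    by (auto simp: abs_mult mult.commute intro!: AE_I2)
qed (use assms in measurable)

text \<open>Differentiation under the integral sign. The Taylor remainder of \<phi> is small
  uniformly in the integration variable, so the remainder of the integral is bounded by it times the
  L1 norm of \<open>w\<close>. The factor \<open>- t\<close> is the inner derivative of
  \<open>y - t *\<^sub>R x\<close>.\<close>

lemma conv_has_derivative:
  fixes \<phi> w :: "real^'n \<Rightarrow> real"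
  assumes \<phi>: "Ck (Suc 0) \<phi>" "\<And>x. norm x > R \<Longrightarrow> \<phi> x = 0" and w: "integrable lborel w"
  shows "((\<lambda>x. \<integral>y. w y * \<phi> (y - t *\<^sub>R x) \<partial>lborel) has_derivative
     (\<lambda>h. \<Sum>i\<in>UNIV. h $ i * (- t * (\<integral>y. w y * partial i \<phi> (y - t *\<^sub>R x) \<partial>lborel)))) (at x)"
proof -
  have c0: "continuous_on UNIV \<phi>" using Ck_Suc_imp[OF \<phi>(1)] by simp
  have c1: "continuous_on UNIV (partial i \<phi>)" for i using \<phi>(1) by simp
  have [measurable]: "\<phi> \<in> borel_measurable borel" "partial i \<phi> \<in> borel_measurable borel" for i
    by (auto intro: borel_measurable_continuous_onI c0 c1)
  have [measurable]: "w \<in> borel_measurable borel" using w by simp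
  obtain B where B: "\<And>x. \<bar>\<phi> x\<bar> \<le> B" using continuous_compact_support_bounded[OF c0 \<phi>(2)] by metis
  have "\<exists>B. \<forall>x. \<bar>partial i \<phi> x\<bar> \<le> B" for i
    using continuous_compact_support_bounded[of "partial i \<phi>" R] c1 partial_outside_support[OF \<phi>] by metis
  then obtain B1 where B1: "\<And>i x. \<bar>partial i \<phi> x\<bar> \<le> B1 i" by metis
  have i0: "integrable lborel (\<lambda>y. w y * \<phi> (y - t *\<^sub>R x))" for x
    by (rule integrable_mult_bounded[OF w, where B=B]) (use B in auto)
  have i1: "integrable lborel (\<lambda>y. w y * partial i \<phi> (y - t *\<^sub>R x))" for x i
    by (rule integrable_mult_bounded[OF w, where B="B1 i"]) (use B1 in auto)
  define W where "W = (\<integral>y. \<bar>w y\<bar> \<partial>lborel)"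
  have W: "W \<ge> 0" by (simp add: W_def)
  let ?G = "\<lambda>x. \<integral>y. w y * \<phi> (y - t *\<^sub>R x) \<partial>lborel"
  let ?D = "\<lambda>h. \<Sum>i\<in>UNIV. h $ i * (- t * (\<integral>y. w y * partial i \<phi> (y - t *\<^sub>R x) \<partial>lborel))"
  have lin: "bounded_linear ?D"
    by (intro bounded_linear_sum bounded_linear_mult_const bounded_linear_vec_nth)
  show ?thesis
    unfolding has_derivative_within_alt
  proof (intro conjI allI impI lin)
    fix e :: real assume e: "e > 0"
    \<comment> \<open>Both denominators are increased by 1 so that \<open>t = 0\<close> and
      \<open>W = 0\<close> need no separate treatment.\<close>
    define e' where "e' = e / ((\<bar>t\<bar> + 1) * (W + 1))"
    have e': "e' > 0" using e W by (simp add: e'_def)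
    obtain d where d: "d > 0"
      "\<And>a h. norm h < d \<Longrightarrow> \<bar>\<phi> (a + h) - \<phi> a - (\<Sum>i\<in>UNIV. h $ i * partial i \<phi> a)\<bar> \<le> e' * norm h"
      using uniform_linearization[OF \<phi> e'] by metis
    have "norm (?G y - ?G x - ?D (y - x)) \<le> e * norm (y - x)" if y: "norm (y - x) < d / (\<bar>t\<bar> + 1)" for y
    proof -
      define h where "h = y - x"
      have "norm (- t *\<^sub>R h) \<le> (\<bar>t\<bar> + 1) * norm h" by (simp add: mult_right_mono)
      also have "\<dots> < d" using y by (simp add: h_def pos_less_divide_eq mult.commute)
      finally have hd: "norm (- t *\<^sub>R h) < d" .
      define E where "E z = \<phi> (z - t *\<^sub>R x + (- t *\<^sub>R h)) - \<phi> (z - t *\<^sub>R x) - (\<Sum>i\<in>UNIV. (- t *\<^sub>R h) $ i * partial i \<phi> (z - t *\<^sub>R x))" for z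
      have e1: "w z * E z = w z * \<phi> (z - t *\<^sub>R y) - w z * \<phi> (z - t *\<^sub>R x)
         - (\<Sum>i\<in>UNIV. h $ i * (- t) * (w z * partial i \<phi> (z - t *\<^sub>R x)))" for z
        by (simp add: E_def h_def algebra_simps sum_distrib_left)
      have iE: "integrable lborel (\<lambda>z. w z * E z)"
        unfolding e1 by (intro Bochner_Integration.integrable_diff Bochner_Integration.integrable_sum integrable_mult_right i0 i1)
      have eq: "?G y - ?G x - ?D h = (\<integral>z. w z * E z \<partial>lborel)"
        unfolding e1 using i0 i1 by (simp add: mult.assoc)
      have bound: "\<bar>w z * E z\<bar> \<le> \<bar>w z\<bar> * (e' * norm (- t *\<^sub>R h))" for z
        unfolding E_def using mult_left_mono[OF d(2)[OF hd, of "z - t *\<^sub>R x"] abs_ge_zero[of "w z"]] by (simp only: abs_mult)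
      have i2: "integrable lborel (\<lambda>z. \<bar>w z\<bar> * (e' * norm (- t *\<^sub>R h)))"
        by (intro integrable_mult_left integrable_abs w)
      have "\<bar>?G y - ?G x - ?D h\<bar> \<le> (\<integral>z. \<bar>w z * E z\<bar> \<partial>lborel)"
        unfolding eq by (rule integral_abs_bound)
      also have "\<dots> \<le> (\<integral>z. \<bar>w z\<bar> * (e' * norm (- t *\<^sub>R h)) \<partial>lborel)"
        by (rule integral_mono[OF integrable_abs[OF iE] i2 bound])
      also have "\<dots> = W * (e' * (\<bar>t\<bar> * norm h))" by (simp add: W_def)
      also have "\<dots> \<le> (W + 1) * (e' * ((\<bar>t\<bar> + 1) * norm h))"
      proof (rule mult_mono)
        show "e' * (\<bar>t\<bar> * norm h) \<le> e' * ((\<bar>t\<bar> + 1) * norm h)"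
          using e' by (intro mult_left_mono mult_right_mono) auto
      qed (use W e' in auto)
      also have "\<dots> = e * norm h"
      proof -
        have "(\<bar>t\<bar> + 1) * (W + 1) > 0" using W by (intro mult_pos_pos) auto
        then have "e' * ((\<bar>t\<bar> + 1) * (W + 1)) = e" by (metis e'_def less_irrefl nonzero_eq_divide_eq)
        moreover have "(W + 1) * (e' * ((\<bar>t\<bar> + 1) * norm h)) = (e' * ((\<bar>t\<bar> + 1) * (W + 1))) * norm h"
          by (simp only: ac_simps)
        ultimately show ?thesis by simp
      qed
      finally show ?thesis by (simp add: h_def)
    qed
    then show "\<exists>d>0. \<forall>y\<in>UNIV. norm (y - x) < d \<longrightarrow> norm (?G y - ?G x - ?D (y - x)) \<le> e * norm (y - x)"
      using d(1) by (intro exI[of _ "d / (\<bar>t\<bar> + 1)"]) auto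
  qed
qed

text \<open>One order is given away: in the base case continuity is read off from differentiability,
  which consumes a derivative of \<phi>. For a smooth kernel this costs nothing.\<close>

lemma Ck_conv:
  fixes \<phi> w :: "real^'n \<Rightarrow> real"
  assumes "Ck (Suc k) \<phi>" "\<And>x. norm x > R \<Longrightarrow> \<phi> x = 0" "integrable lborel w"
  shows "Ck k (\<lambda>x. \<integral>y. w y * \<phi> (y - t *\<^sub>R x) \<partial>lborel)"
  using assms(1,2)
proof (induction k arbitrary: \<phi>)
  case 0
  have "isCont (\<lambda>x. \<integral>y. w y * \<phi> (y - t *\<^sub>R x) \<partial>lborel) x" for x
    by (rule has_derivative_continuous[OF conv_has_derivative[OF 0 assms(3)]])
  then show ?case by (simp add: continuous_on_eq_continuous_at)
next
  case (Suc k)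
  have c: "Ck (Suc 0) \<phi>" by (rule Ck_mono[OF Suc.prems(1)]) simp
  show ?case
  proof (rule Ck_SucI[OF conv_has_derivative[OF c Suc.prems(2) assms(3)]])
    fix i :: 'n
    have "Ck k (\<lambda>x. - t * (\<integral>y. w y * partial i \<phi> (y - t *\<^sub>R x) \<partial>lborel))"
      by (intro Ck_cmult Suc.IH partial_outside_support[OF c Suc.prems(2)]) (use Suc.prems in auto)
    then show "Ck k (\<lambda>x. \<Sum>j\<in>UNIV. axis i 1 $ j * (- t * (\<integral>y. w y * partial j \<phi> (y - t *\<^sub>R x) \<partial>lborel)))"
      by (simp only: sum_axis_mult)
  qed
qed

section \<open>Mollification as convolution with a smooth kernel\<close>

definition mollifier_kernel :: "real^'n \<Rightarrow> real \<Rightarrow> real^'n \<Rightarrow> real" where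
  "mollifier_kernel b r y = (1 / r ^ CARD('n)) * mollifier ((1 / r) *\<^sub>R y + (- (1 / r)) *\<^sub>R b)"

lemma Ck_mollifier_kernel: "Ck k (mollifier_kernel b r)"
  unfolding mollifier_kernel_def by (intro Ck_cmult Ck_affine smooth_Ck smooth_mollifier)

lemma mollifier_kernel_outside:
  assumes r: "r > 0" and y: "norm (y - b) \<ge> r"
  shows "mollifier_kernel b r y = 0"
proof -
  have "norm ((1 / r) *\<^sub>R y + (- (1 / r)) *\<^sub>R b) = norm (y - b) / r"
    using r by (simp add: scaleR_diff_right[symmetric])
  then have "norm ((1 / r) *\<^sub>R y + (- (1 / r)) *\<^sub>R b) \<ge> 1" using assms by simp
  then show ?thesis by (simp only: mollifier_kernel_def mollifier_outside mult_zero_right)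
qed

lemma mollifier_kernel_outside':
  assumes "r > 0" "norm y > norm b + r"
  shows "mollifier_kernel b r y = 0"
  by (rule mollifier_kernel_outside) (use assms norm_triangle_ineq2[of y b] in auto)

text \<open>The substitution \<open>y = t *\<^sub>R x + b + r *\<^sub>R z\<close> moves
  \<open>x\<close> from the rough function \<open>w\<close> into the smooth kernel, where it can be
  differentiated.\<close>

lemma mollify_eq_kernel:
  fixes w :: "real^'n \<Rightarrow> real"
  assumes r: "r > 0" and w[measurable]: "w \<in> borel_measurable borel"
  shows "mollify t b r w x = (\<integral>y. w y * mollifier_kernel b r (y - t *\<^sub>R x) \<partial>lborel)"
proof -
  have [measurable]: "mollifier_kernel b r \<in> borel_measurable borel"
    by (rule borel_measurable_continuous_onI) (use Ck_mollifier_kernel[of 0 b r] in simp)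
  have "(\<integral>y. w y * mollifier_kernel b r (y - t *\<^sub>R x) \<partial>lborel)
    = \<bar>r\<bar> ^ DIM(real^'n) * (\<integral>z. w ((t *\<^sub>R x + b) + r *\<^sub>R z) * mollifier_kernel b r (((t *\<^sub>R x + b) + r *\<^sub>R z) - t *\<^sub>R x) \<partial>lborel)"
    by (rule lborel_integral_affine[where b="t *\<^sub>R x + b"]) (use r in auto)
  also have "\<dots> = (\<integral>z. r ^ CARD('n) * (w ((t *\<^sub>R x + b) + r *\<^sub>R z) * mollifier_kernel b r (((t *\<^sub>R x + b) + r *\<^sub>R z) - t *\<^sub>R x)) \<partial>lborel)"
    using r by simp
  also have "\<dots> = mollify t b r w x"
    unfolding mollify_def
    by (rule Bochner_Integration.integral_cong) (use r in \<open>auto simp: mollifier_kernel_def algebra_simps\<close>)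
  finally show ?thesis by simp
qed

lemma smooth_mollify:
  fixes w :: "real^'n \<Rightarrow> real"
  assumes r: "r > 0" and w: "integrable lborel w"
  shows "smooth (mollify t b r w)"
proof -
  have "mollify t b r w = (\<lambda>x. \<integral>y. w y * mollifier_kernel b r (y - t *\<^sub>R x) \<partial>lborel)"
    using mollify_eq_kernel[OF r, of w] w by (simp add: fun_eq_iff)
  then show ?thesis
    unfolding smooth_def using Ck_conv[OF Ck_mollifier_kernel mollifier_kernel_outside'[OF r] w] by simp
qed

lemma test_function_kernel:
  assumes r: "r > 0" and S: "cball (c + b) r \<subseteq> S"
  shows "(\<lambda>y. mollifier_kernel b r (y - c)) \<in> test_functions S"
proof -
  let ?f = "\<lambda>y. mollifier_kernel b r (y - c)"
  have "smooth ?f"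
    using Ck_affine[OF Ck_mollifier_kernel, of _ b r 1 "-c"] by (simp add: smooth_def)
  moreover
  have "{y. ?f y \<noteq> 0} \<subseteq> cball (c + b) r"
  proof
    fix y assume "y \<in> {y. ?f y \<noteq> 0}"
    then have "\<not> norm (y - c - b) \<ge> r" using mollifier_kernel_outside[OF r] by blast
    then show "y \<in> cball (c + b) r" by (simp add: dist_norm norm_minus_commute[of "c + b"] diff_diff_eq)
  qed
  then have cl: "closure {y. ?f y \<noteq> 0} \<subseteq> cball (c + b) r" by (rule closure_minimal) simp
  moreover have "compact (closure {y. ?f y \<noteq> 0})"
    using bounded_subset[OF bounded_cball cl] by (simp add: compact_eq_bounded_closed)
  ultimately show ?thesis using S by (auto simp: test_functions_def)
qed

text \<open>For fixed \<open>x\<close> the shifted kernel is a test function on \<open>S\<close>, so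
  the weak derivative may be moved from the kernel to \<open>w\<close>. The sign from integration by
  parts cancels the one from the chain rule, and only the dilation factor \<open>t\<close> remains.
  The hypothesis on \<open>cball\<close> says that the average at \<open>x\<close> sees nothing
  outside \<open>S\<close>.\<close>

lemma partial_mollify:
  fixes w v :: "real^'n \<Rightarrow> real"
  assumes r: "r > 0" and w: "integrable lborel w" and v: "integrable lborel v"
    and S: "cball (t *\<^sub>R x + b) r \<subseteq> S"
    and weak: "\<And>\<psi>. \<psi> \<in> test_functions S \<Longrightarrow> (\<integral>y. w y * partial i \<psi> y \<partial>lborel) = - (\<integral>y. v y * \<psi> y \<partial>lborel)"
  shows "partial i (mollify t b r w) x = t * mollify t b r v x"
proof -
  let ?k = "mollifier_kernel b r"
  have mw: "mollify t b r w = (\<lambda>x. \<integral>y. w y * ?k (y - t *\<^sub>R x) \<partial>lborel)"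
    using mollify_eq_kernel[OF r, of w] w by (simp add: fun_eq_iff)
  have "partial i (mollify t b r w) x = - t * (\<integral>y. w y * partial i ?k (y - t *\<^sub>R x) \<partial>lborel)"
    unfolding mw
    by (subst partial_eq[OF conv_has_derivative[OF Ck_mollifier_kernel mollifier_kernel_outside'[OF r] w]])
       (simp_all only: sum_axis_mult)
  also have "(\<integral>y. w y * partial i ?k (y - t *\<^sub>R x) \<partial>lborel) = (\<integral>y. w y * partial i (\<lambda>y. ?k (y - t *\<^sub>R x)) y \<partial>lborel)"
    using partial_affine[OF Ck_mollifier_kernel, of i b r 1 "- (t *\<^sub>R x)"] by simp
  also have "\<dots> = - (\<integral>y. v y * ?k (y - t *\<^sub>R x) \<partial>lborel)"
    by (rule weak[OF test_function_kernel[OF r S]])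
  also have "\<dots> = - mollify t b r v x"
    using mollify_eq_kernel[OF r, of v t b x] v by simp
  finally show ?thesis by simp
qed

section \<open>Zero extension and the fundamental lemma of the calculus of variations\<close>

text \<open>Carries functions from \<open>lebesgue_on S\<close> to the whole space, where
  translations act and where integrals over different sets can be compared.\<close>

definition zero_ext :: "'a set \<Rightarrow> ('a \<Rightarrow> real) \<Rightarrow> 'a \<Rightarrow> real" where
  "zero_ext S f x = (if x \<in> S then f x else 0)"

lemma zero_ext_simps [simp]:
  "x \<in> S \<Longrightarrow> zero_ext S f x = f x" "x \<notin> S \<Longrightarrow> zero_ext S f x = 0"
  by (auto simp: zero_ext_def)

lemma integral_zero_ext:
  fixes f :: "'a::euclidean_space \<Rightarrow> real"
  assumes "S \<in> sets lebesgue"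
  shows "integral\<^sup>L (lebesgue_on S) f = integral\<^sup>L lebesgue (zero_ext S f)"
  unfolding zero_ext_def[abs_def] using Lebesgue_Measure.integral_restrict_UNIV[OF assms] by metis

lemma integrable_zero_ext:
  fixes f :: "'a::euclidean_space \<Rightarrow> real"
  assumes "S \<in> sets lebesgue"
  shows "integrable (lebesgue_on S) f \<longleftrightarrow> integrable lebesgue (zero_ext S f)"
  unfolding zero_ext_def[abs_def] using Lebesgue_Measure.integrable_restrict_UNIV[OF assms] by metis

lemma measurable_zero_ext:
  fixes f :: "'a::euclidean_space \<Rightarrow> real"
  assumes "S \<in> sets lebesgue"
  shows "f \<in> borel_measurable (lebesgue_on S) \<longleftrightarrow> zero_ext S f \<in> borel_measurable lebesgue"
  unfolding zero_ext_def[abs_def] using borel_measurable_if_I[OF _ assms] borel_measurable_if_D by metis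

lemma AE_lebesgue_on_iff:
  fixes P :: "'a::euclidean_space \<Rightarrow> bool"
  assumes "S \<in> sets lebesgue"
  shows "(AE x in lebesgue_on S. P x) \<longleftrightarrow> (AE x in lebesgue. x \<in> S \<longrightarrow> P x)"
  using assms by (simp add: AE_restrict_space_iff)

lemma zero_ext_square: "(zero_ext S f x)\<^sup>2 = zero_ext S (\<lambda>x. (f x)\<^sup>2) x"
  by (simp add: zero_ext_def)

lemma square_integrable_zero_ext:
  fixes f :: "'a::euclidean_space \<Rightarrow> real"
  assumes "S \<in> sets lebesgue"
  shows "square_integrable (lebesgue_on S) f \<longleftrightarrow> square_integrable lebesgue (zero_ext S f)"
  unfolding square_integrable_def zero_ext_square
  by (simp add: measurable_zero_ext[OF assms] integrable_zero_ext[OF assms])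

lemma L2_iff: "u \<in> L2 S \<longleftrightarrow> square_integrable (lebesgue_on S) u"
  by (simp add: L2_def square_integrable_def)

lemma borel_imp_lebesgue_measurable: "f \<in> borel_measurable borel \<Longrightarrow> f \<in> borel_measurable lebesgue"
  by (simp add: measurable_completion)

lemma square_integrable_lborel_iff:
  fixes f :: "'a::euclidean_space \<Rightarrow> real"
  assumes [measurable]: "f \<in> borel_measurable borel"
  shows "square_integrable lebesgue f \<longleftrightarrow> square_integrable lborel f"
  by (simp add: square_integrable_def integrable_completion measurable_completion)

text \<open>The passage from Lebesgue measurable Sobolev functions to Borel functions, for which
  composition with affine maps and product measurability are unproblematic.\<close>

lemma borel_representative:
  fixes f :: "'a::euclidean_space \<Rightarrow> real"
  assumes "f \<in> borel_measurable lebesgue"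
  obtains f' where "f' \<in> borel_measurable borel" "AE x in lebesgue. f' x = f x"
proof -
  from completion_ex_borel_measurable_real[OF assms]
  obtain f' where f': "f' \<in> borel_measurable lborel" "AE x in lborel. f x = f' x" by blast
  have "AE x in lebesgue. f x = f' x" by (rule AE_completion[OF f'(2)])
  then have "AE x in lebesgue. f' x = f x" by (rule eventually_mono) simp
  with f'(1) show thesis by (intro that[of f']) simp_all
qed

lemma square_integrable_cong_AE:
  assumes "square_integrable M f" "g \<in> borel_measurable M" "AE x in M. g x = f x"
  shows "square_integrable M g"
  by (rule square_integrable_bound[OF square_integrableD(2)[OF assms(1)] assms(2)])
     (rule eventually_mono[OF assms(3)], simp)

lemma integral_lebesgue_eq_lborel:
  fixes f g :: "'a::euclidean_space \<Rightarrow> real"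
  assumes "f \<in> borel_measurable borel" "g \<in> borel_measurable lebesgue" "AE x in lebesgue. f x = g x"
  shows "integral\<^sup>L lborel f = integral\<^sup>L lebesgue g"
proof -
  have "integral\<^sup>L lborel f = integral\<^sup>L lebesgue f"
    using assms(1) by (simp add: integral_completion)
  also have "\<dots> = integral\<^sup>L lebesgue g"
    by (rule integral_cong_AE[OF borel_imp_lebesgue_measurable[OF assms(1)] assms(2,3)])
  finally show ?thesis .
qed

lemma integrable_lebesgue_iff_lborel:
  fixes f g :: "'a::euclidean_space \<Rightarrow> real"
  assumes "f \<in> borel_measurable borel" "g \<in> borel_measurable lebesgue" "AE x in lebesgue. f x = g x"
  shows "integrable lborel f \<longleftrightarrow> integrable lebesgue g"
proof -
  have "integrable lborel f \<longleftrightarrow> integrable lebesgue f"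
    using assms(1) by (simp add: integrable_completion)
  also have "\<dots> \<longleftrightarrow> integrable lebesgue g"
    by (rule integrable_cong_AE[OF borel_imp_lebesgue_measurable[OF assms(1)] assms(2,3)])
  finally show ?thesis .
qed

lemma bounded_support_integrable:
  fixes f :: "'a::euclidean_space \<Rightarrow> real"
  assumes "f \<in> borel_measurable borel" "\<And>x. \<bar>f x\<bar> \<le> B" "\<And>x. norm x > R \<Longrightarrow> f x = 0"
  shows "integrable lborel f"
proof (rule Bochner_Integration.integrable_bound)
  show "integrable lborel (\<lambda>x. B * indicator (cball (0::'a) R) x)"
    by (intro integrable_mult_right integrable_real_indicator) (use emeasure_lborel_cball_finite[of "0::'a" R] in auto)
  show "AE x in lborel. norm (f x) \<le> norm (B * indicator (cball 0 R) x)"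
  proof (rule AE_I2)
    fix x
    show "norm (f x) \<le> norm (B * indicator (cball 0 R) x)"
      using assms(2)[of x] assms(3)[of x] by (cases "norm x > R") auto
  qed
qed (use assms(1) in simp)

section \<open>Test functions and local integrability\<close>

lemma test_function_support:
  assumes "\<phi> \<in> test_functions S"
  obtains K where "compact K" "K \<subseteq> S" "\<And>x. x \<notin> K \<Longrightarrow> \<phi> x = 0" "\<And>i x. x \<notin> K \<Longrightarrow> partial i \<phi> x = 0"
proof -
  define K where "K = closure {x. \<phi> x \<noteq> 0}"
  have K: "compact K" "K \<subseteq> S" using assms by (simp_all add: test_functions_def K_def)
  have z: "\<phi> x = 0" if "x \<notin> K" for x
    using that closure_subset[of "{x. \<phi> x \<noteq> 0}"] unfolding K_def by blast
  have "partial i \<phi> x = 0" if x: "x \<notin> K" for i x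
  proof -
    have "(\<phi> has_derivative (\<lambda>h. 0)) (at x)"
    proof (rule has_derivative_transform_within_open[where f="\<lambda>x. 0" and s="- K"])
      show "open (- K)" by (intro open_Compl compact_imp_closed K)
    qed (use z x in auto)
    from partial_eq[OF this] show ?thesis .
  qed
  with K z show thesis by (rule that)
qed

lemma test_function_smooth: "\<phi> \<in> test_functions S \<Longrightarrow> smooth \<phi>"
  by (simp add: test_functions_def)

lemma test_functions_mono: "S \<subseteq> T \<Longrightarrow> test_functions S \<subseteq> test_functions T"
  by (auto simp: test_functions_def)

lemma integrable_mult_compact_support:
  fixes w g :: "real^'n \<Rightarrow> real"
  assumes "S \<in> sets lebesgue" "locally_integrable S w" "compact K" "K \<subseteq> S"
    "continuous_on UNIV g" "\<And>x. x \<notin> K \<Longrightarrow> g x = 0"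
  shows "integrable (lebesgue_on S) (\<lambda>x. w x * g x)"
proof -
  have K: "K \<in> sets lebesgue" using assms(3) by (simp add: borel_compact)
  have "bounded (g ` K)"
    by (intro compact_imp_bounded compact_continuous_image assms continuous_on_subset[OF assms(5)]) auto
  then obtain B where "\<forall>y\<in>g ` K. norm y \<le> B" unfolding bounded_iff by blast
  then have B: "\<bar>g x\<bar> \<le> max B 0" for x
    using assms(6)[of x] by (cases "x \<in> K") auto
  have gm: "g \<in> borel_measurable (lebesgue_on K)"
    using borel_imp_lebesgue_measurable[OF borel_measurable_continuous_onI[OF assms(5)]]
    by (rule measurable_restrict_space1)
  have "integrable (lebesgue_on K) w" using assms by (auto simp: locally_integrable_def)
  then have "integrable (lebesgue_on K) (\<lambda>x. w x * g x)"
    by (rule integrable_mult_bounded[OF _ gm B])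
  moreover have "zero_ext K (\<lambda>x. w x * g x) = zero_ext S (\<lambda>x. w x * g x)"
    using assms(4,6) by (auto simp: zero_ext_def fun_eq_iff)
  ultimately show ?thesis by (simp add: integrable_zero_ext[OF K] integrable_zero_ext[OF assms(1)])
qed

lemma integrable_test:
  fixes w :: "real^'n \<Rightarrow> real"
  assumes "S \<in> sets lebesgue" "locally_integrable S w" "\<phi> \<in> test_functions S"
  shows "integrable (lebesgue_on S) (\<lambda>x. w x * \<phi> x)"
    and "integrable (lebesgue_on S) (\<lambda>x. w x * partial i \<phi> x)"
proof -
  obtain K where K: "compact K" "K \<subseteq> S" "\<And>x. x \<notin> K \<Longrightarrow> \<phi> x = 0" "\<And>i x. x \<notin> K \<Longrightarrow> partial i \<phi> x = 0"
    using test_function_support[OF assms(3)] by blast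
  have s: "smooth \<phi>" by (rule test_function_smooth[OF assms(3)])
  show "integrable (lebesgue_on S) (\<lambda>x. w x * \<phi> x)"
    by (rule integrable_mult_compact_support[OF assms(1,2) K(1,2) smooth_continuous[OF s] K(3)])
  show "integrable (lebesgue_on S) (\<lambda>x. w x * partial i \<phi> x)"
    by (rule integrable_mult_compact_support[OF assms(1,2) K(1,2) smooth_continuous[OF smooth_partial[OF s]] K(4)])
qed

lemma open_lebesgue: "open S \<Longrightarrow> S \<in> sets lebesgue"
  by (simp add: borel_open)

lemma square_integrable_mono_set:
  fixes f :: "'a::euclidean_space \<Rightarrow> real"
  assumes "S \<in> sets lebesgue" "T \<in> sets lebesgue" "T \<subseteq> S" "square_integrable (lebesgue_on S) f"
  shows "square_integrable (lebesgue_on T) f"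
proof -
  have s: "square_integrable lebesgue (zero_ext S f)"
    using assms by (simp add: square_integrable_zero_ext)
  have e: "zero_ext T f = (\<lambda>x. indicator T x * zero_ext S f x)"
    using assms(3) by (auto simp: zero_ext_def fun_eq_iff indicator_def)
  have "(\<lambda>x. indicator T x * zero_ext S f x) \<in> borel_measurable lebesgue"
    using square_integrableD(1)[OF s] assms(2) by (intro borel_measurable_times borel_measurable_indicator) auto
  then have "square_integrable lebesgue (zero_ext T f)"
    unfolding e by (rule square_integrable_bound[OF square_integrableD(2)[OF s]])
       (auto simp: indicator_def intro!: AE_I2)
  then show ?thesis using assms by (simp add: square_integrable_zero_ext)
qed

lemma finite_measure_lebesgue_on_bounded:
  fixes S :: "'a::euclidean_space set"
  assumes "S \<in> sets lebesgue" "bounded S"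
  shows "finite_measure (lebesgue_on S)"
  using assms bounded_set_imp_lmeasurable finite_measure_lebesgue_on by blast

lemma L2_locally_integrable:
  fixes u :: "real^'n \<Rightarrow> real"
  assumes "S \<in> sets lebesgue" "u \<in> L2 S"
  shows "locally_integrable S u"
  unfolding locally_integrable_def
proof (intro allI impI)
  fix C assume C: "compact C \<and> C \<subseteq> S"
  then have Cs: "C \<in> sets lebesgue" by (simp add: borel_compact)
  interpret finite_measure "lebesgue_on C"
    using C Cs compact_imp_bounded by (intro finite_measure_lebesgue_on_bounded) auto
  show "integrable (lebesgue_on C) u"
    by (rule square_integrable_imp_integrable)
       (use square_integrable_mono_set[OF assms(1) Cs] C assms(2) in \<open>auto simp: L2_iff\<close>)
qed

text \<open>Local integrability speaks only of compact subsets. Exhausting \<open>S\<close> by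
  compacts exhibits the zero extension as a pointwise limit of measurable functions.\<close>

lemma locally_integrable_measurable:
  fixes u :: "real^'n \<Rightarrow> real"
  assumes "open S" "locally_integrable S u"
  shows "u \<in> borel_measurable (lebesgue_on S)"
proof -
  obtain C where C: "\<And>n. compact (C n)" "\<And>n. C n \<subseteq> S" "\<And>n. C n \<subseteq> interior (C (Suc n))" "\<Union>(range C) = S"
    using open_Union_compact_subsets[OF assms(1)] by metis
  have mono: "C n \<subseteq> C m" if "n \<le> m" for n m
    using C(3) interior_subset by (intro lift_Suc_mono_le[OF _ that]) blast
  have Cs: "C n \<in> sets lebesgue" for n using C(1) by (simp add: borel_compact)
  have "zero_ext S u \<in> borel_measurable lebesgue"
  proof (rule borel_measurable_LIMSEQ_real)
    show "zero_ext (C n) u \<in> borel_measurable lebesgue" for n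
    proof -
      have "integrable (lebesgue_on (C n)) u" using assms(2) C by (auto simp: locally_integrable_def)
      then show ?thesis using measurable_zero_ext[OF Cs] by blast
    qed
    fix x
    show "(\<lambda>n. zero_ext (C n) u x) \<longlonglongrightarrow> zero_ext S u x"
    proof (cases "x \<in> S")
      case True
      then obtain n where n: "x \<in> C n" using C(4) by blast
      then have "zero_ext (C m) u x = zero_ext S u x" if "m \<ge> n" for m
        using mono[OF that] True by (auto simp: zero_ext_def)
      then show ?thesis by (intro tendsto_eventually eventually_sequentiallyI[of n])
    next
      case False
      then have "x \<notin> C n" for n using C(2) by blast
      with False show ?thesis by simp
    qed
  qed
  then show ?thesis using assms(1) open_lebesgue by (simp add: measurable_zero_ext)
qed

section \<open>Convergence of mollifications and functions annihilated by all test functions\<close>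

lemma mollify_bounded:
  fixes w :: "real^'n \<Rightarrow> real"
  assumes [measurable]: "w \<in> borel_measurable borel" and B: "\<And>x. \<bar>w x\<bar> \<le> B"
  shows "\<bar>mollify t b r w x\<bar> \<le> B"
proof -
  have i: "integrable lborel (\<lambda>z. mollifier z * w (t *\<^sub>R x + b + r *\<^sub>R z))"
    by (rule integrable_mult_bounded[OF integrable_mollifier, where B=B]) (use B in auto)
  have "\<bar>mollify t b r w x\<bar> \<le> (\<integral>z. \<bar>mollifier z * w (t *\<^sub>R x + b + r *\<^sub>R z)\<bar> \<partial>lborel)"
    unfolding mollify_def by (rule integral_abs_bound)
  also have "\<dots> \<le> (\<integral>z. (mollifier :: real^'n \<Rightarrow> real) z * B \<partial>lborel)"
  proof (rule integral_mono[OF integrable_abs[OF i]])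
    show "integrable lborel (\<lambda>z::real^'n. mollifier z * B)"
      by (intro integrable_mult_left integrable_mollifier)
    show "\<bar>mollifier z * w (t *\<^sub>R x + b + r *\<^sub>R z)\<bar> \<le> mollifier z * B" for z
    proof -
      have "mollifier z * \<bar>w (t *\<^sub>R x + b + r *\<^sub>R z)\<bar> \<le> mollifier z * B"
        by (rule mult_left_mono[OF B mollifier_nonneg])
      then show ?thesis by (simp only: abs_mult abs_of_nonneg[OF mollifier_nonneg])
    qed
  qed
  also have "\<dots> = integral\<^sup>L lborel (mollifier :: real^'n \<Rightarrow> real) * B"
    by (rule integral_mult_left_zero)
  finally show ?thesis by (simp only: integral_mollifier mult_1)
qed

lemma mollify_outside:
  fixes w :: "real^'n \<Rightarrow> real"
  assumes "\<And>y. norm (y - (t *\<^sub>R x + b)) < r \<Longrightarrow> w y = 0" "r > 0"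
  shows "mollify t b r w x = 0"
proof -
  have "mollifier z * w (t *\<^sub>R x + b + r *\<^sub>R z) = 0" for z
  proof (cases "norm z < 1")
    case True
    then have "norm (t *\<^sub>R x + b + r *\<^sub>R z - (t *\<^sub>R x + b)) < r" using assms(2) by simp
    then show ?thesis using assms(1) by simp
  qed (simp add: mollifier_outside)
  then show ?thesis unfolding mollify_def by (simp only: Bochner_Integration.integral_zero)
qed

text \<open>Eventual square integrability is recorded next to the limit: a nonintegrable function
  has Bochner integral 0, so the limit alone would carry no information.\<close>

lemma mollify_tendsto_L2:
  fixes w :: "real^'n \<Rightarrow> real"
  assumes w: "square_integrable lborel w"
    and t: "t \<longlonglongrightarrow> 1" and b: "b \<longlonglongrightarrow> 0" and r: "r \<longlonglongrightarrow> 0" "\<And>k. r k > 0"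
  shows "(\<lambda>k. \<integral>x. (mollify (t k) (b k) (r k) w x - w x)\<^sup>2 \<partial>lborel) \<longlonglongrightarrow> 0"
    and "\<forall>\<^sub>F k in sequentially. square_integrable lborel (\<lambda>x. mollify (t k) (b k) (r k) w x - w x)"
proof -
  have close: "\<forall>\<^sub>F k in sequentially. \<bar>t k - 1\<bar> < d \<and> norm (b k) < d \<and> r k < d" if "d > 0" for d
    using tendstoD[OF t that] tendstoD[OF b that] tendstoD[OF r(1) that]
    by eventually_elim (use r(2) in \<open>auto simp: dist_real_def\<close>)
  have ex: "\<exists>d>0. \<forall>t b r. \<bar>t - 1\<bar> < d \<longrightarrow> norm b < d \<longrightarrow> 0 < r \<longrightarrow> r < d \<longrightarrow>
      square_integrable lborel (\<lambda>x. mollify t b r w x - w x) \<and> (\<integral>x. (mollify t b r w x - w x)\<^sup>2 \<partial>lborel) < e"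
    if e: "e > 0" for e
  proof (rule mollify_L2[OF w e])
    fix d :: real
    assume d: "d > 0"
      and 1: "\<And>t b r. \<bar>t - 1\<bar> < d \<Longrightarrow> norm b < d \<Longrightarrow> 0 < r \<Longrightarrow> r < d \<Longrightarrow> square_integrable lborel (\<lambda>x. mollify t b r w x - w x)"
      and 2: "\<And>t b r. \<bar>t - 1\<bar> < d \<Longrightarrow> norm b < d \<Longrightarrow> 0 < r \<Longrightarrow> r < d \<Longrightarrow> (\<integral>x. (mollify t b r w x - w x)\<^sup>2 \<partial>lborel) < e"
    show ?thesis
      by (rule exI[of _ d], intro conjI d allI impI) (rule 1 2; assumption)+
  qed
  have main: "\<forall>\<^sub>F k in sequentially. square_integrable lborel (\<lambda>x. mollify (t k) (b k) (r k) w x - w x) \<and>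
      (\<integral>x. (mollify (t k) (b k) (r k) w x - w x)\<^sup>2 \<partial>lborel) < e" if e: "e > 0" for e
  proof -
    obtain d where d: "d > 0" "\<forall>t b r. \<bar>t - 1\<bar> < d \<longrightarrow> norm b < d \<longrightarrow> 0 < r \<longrightarrow> r < d \<longrightarrow>
      square_integrable lborel (\<lambda>x. mollify t b r w x - w x) \<and> (\<integral>x. (mollify t b r w x - w x)\<^sup>2 \<partial>lborel) < e"
      using ex[OF e] by blast
    show ?thesis
      using close[OF d(1)] by (rule eventually_mono) (use d(2) r(2) in blast)
  qed
  show "\<forall>\<^sub>F k in sequentially. square_integrable lborel (\<lambda>x. mollify (t k) (b k) (r k) w x - w x)"
    using main[OF zero_less_one] by (rule eventually_mono) blast
  show "(\<lambda>k. \<integral>x. (mollify (t k) (b k) (r k) w x - w x)\<^sup>2 \<partial>lborel) \<longlonglongrightarrow> 0"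
  proof (rule tendstoI)
    fix e :: real assume e: "e > 0"
    show "\<forall>\<^sub>F k in sequentially. dist (\<integral>x. (mollify (t k) (b k) (r k) w x - w x)\<^sup>2 \<partial>lborel) 0 < e"
      using main[OF e] by (rule eventually_mono) (simp add: dist_real_def)
  qed
qed

lemma tendsto_L2_AE_subseq:
  fixes u :: "nat \<Rightarrow> 'a \<Rightarrow> real"
  assumes "\<And>n. square_integrable M (\<lambda>x. u n x - v x)"
    and "(\<lambda>n. \<integral>x. (u n x - v x)\<^sup>2 \<partial>M) \<longlonglongrightarrow> 0"
  obtains s where "strict_mono s" "AE x in M. (\<lambda>n. u (s n) x) \<longlonglongrightarrow> v x"
proof -
  have "\<exists>s::nat\<Rightarrow>nat. strict_mono s \<and> (AE x in M. (\<lambda>n. (u (s n) x - v x)\<^sup>2) \<longlonglongrightarrow> 0)"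
    by (rule tendsto_L1_AE_subseq) (use assms in \<open>auto simp: square_integrable_def\<close>)
  then obtain s :: "nat \<Rightarrow> nat" where s: "strict_mono s" "AE x in M. (\<lambda>n. (u (s n) x - v x)\<^sup>2) \<longlonglongrightarrow> 0" by blast
  have "AE x in M. (\<lambda>n. u (s n) x) \<longlonglongrightarrow> v x"
    using s(2)
  proof (rule eventually_mono)
    fix x assume "(\<lambda>n. (u (s n) x - v x)\<^sup>2) \<longlonglongrightarrow> 0"
    then have "(\<lambda>n. sqrt ((u (s n) x - v x)\<^sup>2)) \<longlonglongrightarrow> sqrt 0" by (rule tendsto_real_sqrt)
    then have "(\<lambda>n. u (s n) x - v x) \<longlonglongrightarrow> 0" by (simp add: tendsto_rabs_zero_iff)
    then show "(\<lambda>n. u (s n) x) \<longlonglongrightarrow> v x" by (simp add: LIM_zero_iff)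
  qed
  with s(1) show thesis by (rule that)
qed

text \<open>The sign of \<open>h\<close> on \<open>C\<close> would be the ideal test function. Its
  mollifications are admissible: they are smooth, bounded by 1 and supported in a closed
  neighbourhood \<open>D\<close> of \<open>C\<close> inside \<open>S\<close>. Along a subsequence
  they converge almost everywhere to the sign, so dominated convergence shows that |h| has integral
  zero over \<open>C\<close>.\<close>

lemma weak_zero_on_compact:
  fixes h :: "real^'n \<Rightarrow> real"
  assumes S: "open S" and h: "locally_integrable S h"
    and z: "\<And>\<phi>. \<phi> \<in> test_functions S \<Longrightarrow> (\<integral>x. h x * \<phi> x \<partial>lebesgue_on S) = 0"
    and C: "compact C" "C \<subseteq> S"
  shows "AE x in lebesgue. x \<in> C \<longrightarrow> h x = 0"
proof -
  obtain \<rho> where \<rho>: "\<rho> > 0" "(\<Union>x\<in>C. cball x \<rho>) \<subseteq> S"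
    using compact_subset_open_imp_cball_epsilon_subset[OF C(1) S C(2)] by blast
  define D where "D = {x + y | x y. x \<in> C \<and> y \<in> cball 0 \<rho>}"
  have Dc: "compact D" unfolding D_def by (intro compact_sums C compact_cball)
  have DI: "x \<in> D" if "y \<in> C" "dist x y \<le> \<rho>" for x y
  proof -
    have "x = y + (x - y) \<and> y \<in> C \<and> x - y \<in> cball 0 \<rho>" using that by (auto simp: dist_norm norm_minus_commute)
    then show ?thesis unfolding D_def by blast
  qed
  have DS: "D \<subseteq> S"
  proof
    fix x assume "x \<in> D"
    then obtain a b where "x = a + b" "a \<in> C" "norm b \<le> \<rho>" by (auto simp: D_def)
    then have "x \<in> cball a \<rho>" by (simp add: dist_norm)
    then show "x \<in> S" using \<rho>(2) \<open>a \<in> C\<close> by blast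
  qed
  have CD: "C \<subseteq> D" using DI \<rho>(1) by force
  have Ds: "D \<in> sets lebesgue" using Dc by (simp add: borel_compact)
  have Cb[measurable]: "C \<in> sets borel" using C(1) by (simp add: borel_compact)
  have hD: "integrable lebesgue (zero_ext D h)"
    using h Dc DS by (simp add: integrable_zero_ext[OF Ds, symmetric] locally_integrable_def)
  obtain h' where h'[measurable]: "h' \<in> borel_measurable borel" and h'eq: "AE x in lebesgue. h' x = zero_ext D h x"
    using borel_representative[OF borel_measurable_integrable[OF hD]] by blast
  have h'i: "integrable lborel h'"
    using integrable_lebesgue_iff_lborel[OF h' _ h'eq] hD by auto
  \<comment> \<open>The sign is taken of the Borel representative \<open>h'\<close>, which makes
    \<open>s\<close> Borel and hence accessible to mollification.\<close>
  define s where "s x = sgn (h' x) * indicator C x" for x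
  have [measurable]: "s \<in> borel_measurable borel" unfolding s_def by measurable
  have sb: "\<bar>s x\<bar> \<le> 1" for x by (auto simp: s_def sgn_real_def indicator_def)
  have sC: "x \<notin> C \<Longrightarrow> s x = 0" for x by (simp add: s_def)
  obtain R where R: "\<And>x. x \<in> C \<Longrightarrow> norm x \<le> R"
    using compact_imp_bounded[OF C(1)] unfolding bounded_iff by blast
  have s2: "square_integrable lborel s"
    by (rule bounded_support_square_integrable(1)[where B=1 and R=R]) (use sb sC R in \<open>auto simp: not_le[symmetric]\<close>)
  have s1: "integrable lborel s"
    by (rule bounded_support_integrable[where B=1 and R=R]) (use sb sC R in \<open>auto simp: not_le[symmetric]\<close>)
  define r where "r k = \<rho> / (real k + 1)" for k :: nat
  have r: "r k > 0" "r k \<le> \<rho>" for k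
    using \<rho>(1) by (auto simp: r_def field_simps)
  have r0: "r \<longlonglongrightarrow> 0"
    using tendsto_mult_right_zero[OF LIMSEQ_inverse_real_of_nat, of \<rho>] by (simp add: r_def[abs_def] divide_inverse add.commute)
  let ?\<psi> = "\<lambda>k. mollify 1 0 (r k) s"
  have \<psi>D: "?\<psi> k x = 0" if "x \<notin> D" for k x
  proof (rule mollify_outside[OF _ r(1)])
    fix y assume "norm (y - (1 *\<^sub>R x + 0)) < r k"
    then have "dist x y \<le> \<rho>" using r(2)[of k] by (simp add: dist_norm norm_minus_commute)
    then show "s y = 0" using DI that sC by blast
  qed
  have \<psi>t: "?\<psi> k \<in> test_functions S" for k
  proof -
    have "{x. ?\<psi> k x \<noteq> 0} \<subseteq> D" using \<psi>D by blast
    then have "closure {x. ?\<psi> k x \<noteq> 0} \<subseteq> D" by (rule closure_minimal) (use Dc compact_imp_closed in auto)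
    then show ?thesis
      using smooth_mollify[OF r(1) s1] Dc DS bounded_subset[OF compact_imp_bounded[OF Dc]]
      by (auto simp: test_functions_def compact_eq_bounded_closed)
  qed
  have \<psi>m[measurable]: "?\<psi> k \<in> borel_measurable borel" for k
    by (rule borel_measurable_continuous_onI[OF smooth_continuous[OF smooth_mollify[OF r(1) s1]]])
  have zk: "(\<integral>x. h' x * ?\<psi> k x \<partial>lborel) = 0" for k
  proof -
    have ae: "AE x in lebesgue. h' x * ?\<psi> k x = zero_ext S (\<lambda>x. h x * ?\<psi> k x) x"
      using h'eq by (rule eventually_mono) (use \<psi>D DS in \<open>auto simp: zero_ext_def\<close>)
    have "(\<lambda>x. h x * ?\<psi> k x) \<in> borel_measurable (lebesgue_on S)"
      using integrable_test(1)[OF open_lebesgue[OF S] h \<psi>t] by simp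
    then have "zero_ext S (\<lambda>x. h x * ?\<psi> k x) \<in> borel_measurable lebesgue"
      using measurable_zero_ext[OF open_lebesgue[OF S]] by blast
    from integral_lebesgue_eq_lborel[OF _ this ae] z[OF \<psi>t] show ?thesis
      by (simp add: integral_zero_ext[OF open_lebesgue[OF S]])
  qed
  have \<psi>2: "square_integrable lborel (\<lambda>x. ?\<psi> k x - s x)" for k
  proof (rule square_integrable_diff[OF _ s2])
    obtain R' where R': "\<And>x. x \<in> D \<Longrightarrow> norm x \<le> R'"
      using compact_imp_bounded[OF Dc] unfolding bounded_iff by blast
    show "square_integrable lborel (?\<psi> k)"
    proof (rule bounded_support_square_integrable(1)[where B=1 and R=R', OF \<psi>m])
      show "\<bar>?\<psi> k x\<bar> \<le> 1" for x by (rule mollify_bounded[OF _ sb]) simp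
      show "?\<psi> k x = 0" if "norm x > R'" for x using \<psi>D R' that by (meson not_le)
    qed
  qed
  obtain q where q: "strict_mono q" "AE x in lborel. (\<lambda>n. ?\<psi> (q n) x) \<longlonglongrightarrow> s x"
    using tendsto_L2_AE_subseq[OF \<psi>2 mollify_tendsto_L2(1)[OF s2 tendsto_const tendsto_const r0 r(1)]] by blast
  have "(\<lambda>n. \<integral>x. h' x * ?\<psi> (q n) x \<partial>lborel) \<longlonglongrightarrow> (\<integral>x. h' x * s x \<partial>lborel)"
  proof (rule integral_dominated_convergence[where w="\<lambda>x. \<bar>h' x\<bar>"])
    show "AE x in lborel. (\<lambda>n. h' x * ?\<psi> (q n) x) \<longlonglongrightarrow> h' x * s x"
      using q(2) by eventually_elim (rule tendsto_mult_left)
    show "AE x in lborel. norm (h' x * ?\<psi> (q n) x) \<le> \<bar>h' x\<bar>" for n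
    proof (rule AE_I2)
      fix x
      have "\<bar>?\<psi> (q n) x\<bar> \<le> 1" by (rule mollify_bounded[OF _ sb]) simp
      from mult_left_mono[OF this abs_ge_zero[of "h' x"]]
      show "norm (h' x * ?\<psi> (q n) x) \<le> \<bar>h' x\<bar>" by (simp add: abs_mult)
    qed
  qed (use h'i in auto)
  then have "(\<integral>x. h' x * s x \<partial>lborel) = 0" unfolding zk by (simp add: LIMSEQ_const_iff)
  moreover have "h' x * s x = \<bar>h' x\<bar> * indicator C x" for x
    by (simp add: s_def mult.assoc[symmetric] mult_sgn_abs abs_sgn)
  ultimately have "(\<integral>x. \<bar>h' x\<bar> * indicator C x \<partial>lborel) = 0" by simp
  moreover have "integrable lborel (\<lambda>x. \<bar>h' x\<bar> * indicator C x)"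
    using h'i by (intro integrable_real_mult_indicator) auto
  ultimately have "AE x in lborel. \<bar>h' x\<bar> * indicator C x = 0"
    by (subst (asm) integral_nonneg_eq_0_iff_AE) auto
  then have "AE x in lebesgue. \<bar>h' x\<bar> * indicator C x = 0" by (rule AE_completion)
  with h'eq show ?thesis
    by eventually_elim (use CD in \<open>auto simp: zero_ext_def indicator_def split: if_splits\<close>)
qed

lemma weak_zero:
  fixes h :: "real^'n \<Rightarrow> real"
  assumes S: "open S" and h: "locally_integrable S h"
    and z: "\<And>\<phi>. \<phi> \<in> test_functions S \<Longrightarrow> (\<integral>x. h x * \<phi> x \<partial>lebesgue_on S) = 0"
  shows "AE x in lebesgue_on S. h x = 0"
proof -
  obtain C where C: "\<And>n. compact (C n)" "\<And>n. C n \<subseteq> S" "\<And>n. C n \<subseteq> interior (C (Suc n))" "\<Union>(range C) = S"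
    using open_Union_compact_subsets[OF S] by metis
  have "AE x in lebesgue. \<forall>n. x \<in> C n \<longrightarrow> h x = 0"
    unfolding AE_all_countable using weak_zero_on_compact[OF S h z C(1,2)] by blast
  then have "AE x in lebesgue. x \<in> S \<longrightarrow> h x = 0"
    by eventually_elim (use C(4) in blast)
  then show ?thesis using AE_lebesgue_on_iff[OF open_lebesgue[OF S]] by blast
qed

section \<open>Calculus of weak derivatives\<close>

lemma locally_integrable_diff:
  "locally_integrable S u \<Longrightarrow> locally_integrable S v \<Longrightarrow> locally_integrable S (\<lambda>x. u x - v x)"
  by (auto simp: locally_integrable_def)

lemma locally_integrable_mono: "locally_integrable S u \<Longrightarrow> T \<subseteq> S \<Longrightarrow> locally_integrable T u"
  by (auto simp: locally_integrable_def)

lemma is_weak_partialD: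
  assumes "is_weak_partial S i u w"
  shows "locally_integrable S u" "locally_integrable S w"
    "\<phi> \<in> test_functions S \<Longrightarrow> (\<integral>x. u x * partial i \<phi> x \<partial>lebesgue_on S) = - (\<integral>x. w x * \<phi> x \<partial>lebesgue_on S)"
  using assms by (auto simp: is_weak_partial_def)

text \<open>Nothing is known about the value of \<open>SOME\<close> in \<open>weak_partial\<close>
  except its defining property; by uniqueness it may be replaced by any explicit weak derivative off
  a null set.\<close>

lemma is_weak_partial_unique:
  fixes u :: "real^'n \<Rightarrow> real"
  assumes S: "open S" and w: "is_weak_partial S i u w" and v: "is_weak_partial S i u v"
  shows "AE x in lebesgue_on S. w x = v x"
proof -
  note li = is_weak_partialD(2)[OF w] is_weak_partialD(2)[OF v]
  have "AE x in lebesgue_on S. w x - v x = 0"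
  proof (rule weak_zero[OF S locally_integrable_diff[OF li]])
    fix \<phi> assume \<phi>: "\<phi> \<in> test_functions S"
    note i = integrable_test(1)[OF open_lebesgue[OF S] li(1) \<phi>] integrable_test(1)[OF open_lebesgue[OF S] li(2) \<phi>]
    show "(\<integral>x. (w x - v x) * \<phi> x \<partial>lebesgue_on S) = 0"
      using is_weak_partialD(3)[OF w \<phi>] is_weak_partialD(3)[OF v \<phi>] i by (simp add: left_diff_distrib)
  qed
  then show ?thesis by (rule eventually_mono) simp
qed

lemma is_weak_partial_weak_partial:
  "is_weak_partial S i u w \<Longrightarrow> is_weak_partial S i u (weak_partial S i u)"
  unfolding weak_partial_def by (rule someI[where P="is_weak_partial S i u"])

lemma weak_partial_AE:
  fixes u :: "real^'n \<Rightarrow> real"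
  assumes "open S" "is_weak_partial S i u w"
  shows "AE x in lebesgue_on S. weak_partial S i u x = w x"
  by (rule is_weak_partial_unique[OF assms(1) is_weak_partial_weak_partial[OF assms(2)] assms(2)])

lemma is_weak_partial_diff:
  fixes u v :: "real^'n \<Rightarrow> real"
  assumes S: "open S" and u: "is_weak_partial S i u u'" and v: "is_weak_partial S i v v'"
  shows "is_weak_partial S i (\<lambda>x. u x - v x) (\<lambda>x. u' x - v' x)"
  unfolding is_weak_partial_def
proof (intro conjI ballI locally_integrable_diff is_weak_partialD[OF u] is_weak_partialD[OF v])
  fix \<phi> assume \<phi>: "\<phi> \<in> test_functions S"
  note S' = open_lebesgue[OF S]
  show "(\<integral>x. (u x - v x) * partial i \<phi> x \<partial>lebesgue_on S) = - (\<integral>x. (u' x - v' x) * \<phi> x \<partial>lebesgue_on S)"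
    using is_weak_partialD(3)[OF u \<phi>] is_weak_partialD(3)[OF v \<phi>]
      integrable_test(2)[OF S' is_weak_partialD(1)[OF u] \<phi>] integrable_test(2)[OF S' is_weak_partialD(1)[OF v] \<phi>]
      integrable_test(1)[OF S' is_weak_partialD(2)[OF u] \<phi>] integrable_test(1)[OF S' is_weak_partialD(2)[OF v] \<phi>]
    by (simp add: left_diff_distrib)
qed

lemma integral_mult_subset:
  fixes g w :: "real^'n \<Rightarrow> real"
  assumes "S \<in> sets lebesgue" "T \<in> sets lebesgue" "T \<subseteq> S" "\<And>x. x \<notin> T \<Longrightarrow> g x = 0"
  shows "(\<integral>x. w x * g x \<partial>lebesgue_on T) = (\<integral>x. w x * g x \<partial>lebesgue_on S)"
proof -
  have "zero_ext T (\<lambda>x. w x * g x) = zero_ext S (\<lambda>x. w x * g x)"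
    using assms(3,4) by (auto simp: zero_ext_def fun_eq_iff)
  then show ?thesis using assms by (simp add: integral_zero_ext)
qed

lemma is_weak_partial_subset:
  fixes u :: "real^'n \<Rightarrow> real"
  assumes "open S" "open T" "T \<subseteq> S" and u: "is_weak_partial S i u w"
  shows "is_weak_partial T i u w"
  unfolding is_weak_partial_def
proof (intro conjI ballI locally_integrable_mono[OF _ assms(3)] is_weak_partialD[OF u])
  fix \<phi> assume \<phi>: "\<phi> \<in> test_functions T"
  obtain K where K: "K \<subseteq> T" "\<And>x. x \<notin> K \<Longrightarrow> \<phi> x = 0" "\<And>i x. x \<notin> K \<Longrightarrow> partial i \<phi> x = 0"
    using test_function_support[OF \<phi>] by metis
  note m = integral_mult_subset[OF open_lebesgue[OF assms(1)] open_lebesgue[OF assms(2)] assms(3)]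
  have \<phi>S: "\<phi> \<in> test_functions S" using \<phi> test_functions_mono[OF assms(3)] by blast
  have "(\<integral>x. u x * partial i \<phi> x \<partial>lebesgue_on T) = (\<integral>x. u x * partial i \<phi> x \<partial>lebesgue_on S)"
    by (rule m) (use K in blast)
  moreover have "(\<integral>x. w x * \<phi> x \<partial>lebesgue_on T) = (\<integral>x. w x * \<phi> x \<partial>lebesgue_on S)"
    by (rule m) (use K in blast)
  ultimately show "(\<integral>x. u x * partial i \<phi> x \<partial>lebesgue_on T) = - (\<integral>x. w x * \<phi> x \<partial>lebesgue_on T)"
    using is_weak_partialD(3)[OF u \<phi>S] by simp
qed

lemma is_weak_partial_cong_on:
  fixes u v :: "real^'n \<Rightarrow> real"
  assumes "\<And>x. x \<in> S \<Longrightarrow> u x = v x"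
  shows "is_weak_partial S i u w \<longleftrightarrow> is_weak_partial S i v w"
proof -
  have "integrable (lebesgue_on C) u \<longleftrightarrow> integrable (lebesgue_on C) v" if "C \<subseteq> S" for C
    by (rule Bochner_Integration.integrable_cong) (use assms that in auto)
  moreover have "(\<integral>x. u x * g x \<partial>lebesgue_on S) = (\<integral>x. v x * g x \<partial>lebesgue_on S)" for g
    by (rule Bochner_Integration.integral_cong) (use assms in auto)
  ultimately show ?thesis unfolding is_weak_partial_def locally_integrable_def by auto
qed

text \<open>Both sides choose from the same predicate, so they are equal everywhere and not just
  almost everywhere.\<close>

lemma weak_partial_cong_on:
  fixes u v :: "real^'n \<Rightarrow> real"
  assumes "\<And>x. x \<in> S \<Longrightarrow> u x = v x"
  shows "weak_partial S i u = weak_partial S i v"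
proof -
  have "is_weak_partial S i u = is_weak_partial S i v"
    by (rule ext) (rule is_weak_partial_cong_on[OF assms])
  then show ?thesis by (simp add: weak_partial_def)
qed

lemma is_weak_partial_cong_AE:
  fixes u v :: "real^'n \<Rightarrow> real"
  assumes S: "open S" and u: "is_weak_partial S i u w" and v: "locally_integrable S v"
    and ae: "AE x in lebesgue_on S. v x = u x"
  shows "is_weak_partial S i v w"
  unfolding is_weak_partial_def
proof (intro conjI ballI v is_weak_partialD[OF u])
  fix \<phi> assume \<phi>: "\<phi> \<in> test_functions S"
  note S' = open_lebesgue[OF S]
  have "(\<integral>x. v x * partial i \<phi> x \<partial>lebesgue_on S) = (\<integral>x. u x * partial i \<phi> x \<partial>lebesgue_on S)"
  proof (rule integral_cong_AE)
    show "AE x in lebesgue_on S. v x * partial i \<phi> x = u x * partial i \<phi> x"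
      using ae by (rule eventually_mono) simp
  qed (use integrable_test(2)[OF S' v \<phi>] integrable_test(2)[OF S' is_weak_partialD(1)[OF u] \<phi>] in auto)
  then show "(\<integral>x. v x * partial i \<phi> x \<partial>lebesgue_on S) = - (\<integral>x. w x * \<phi> x \<partial>lebesgue_on S)"
    using is_weak_partialD(3)[OF u \<phi>] by simp
qed

lemma L2_cong_AE:
  fixes u v :: "real^'n \<Rightarrow> real"
  assumes "open S" "u \<in> L2 S" "locally_integrable S v" "AE x in lebesgue_on S. v x = u x"
  shows "v \<in> L2 S"
  unfolding L2_iff
  by (rule square_integrable_cong_AE[of _ u])
     (use assms locally_integrable_measurable in \<open>auto simp: L2_iff\<close>)

lemma L2_diff: "u \<in> L2 S \<Longrightarrow> v \<in> L2 S \<Longrightarrow> (\<lambda>x. u x - v x) \<in> L2 S"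
  unfolding L2_iff by (rule square_integrable_diff)

lemma L2_subset:
  fixes u :: "real^'n \<Rightarrow> real"
  shows "open S \<Longrightarrow> open T \<Longrightarrow> T \<subseteq> S \<Longrightarrow> u \<in> L2 S \<Longrightarrow> u \<in> L2 T"
  unfolding L2_iff using square_integrable_mono_set open_lebesgue by blast

lemma H1_L2: "u \<in> H1 S \<Longrightarrow> u \<in> L2 S"
  by (simp add: H1_def)

lemma H1I:
  assumes "u \<in> L2 S" "\<And>i. is_weak_partial S i u (w i)" "\<And>i. w i \<in> L2 S"
  shows "u \<in> H1 S"
  using assms by (auto simp: H1_def)

lemma H1_weak_partial:
  fixes u :: "real^'n \<Rightarrow> real"
  assumes S: "open S" and u: "u \<in> H1 S"
  shows "is_weak_partial S i u (weak_partial S i u)" and "weak_partial S i u \<in> L2 S"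
proof -
  obtain w where w: "w \<in> L2 S" "is_weak_partial S i u w" using u by (auto simp: H1_def)
  show 1: "is_weak_partial S i u (weak_partial S i u)"
    by (rule is_weak_partial_weak_partial[OF w(2)])
  show "weak_partial S i u \<in> L2 S"
    by (rule L2_cong_AE[OF S w(1) is_weak_partialD(2)[OF 1] weak_partial_AE[OF S w(2)]])
qed

text \<open>Frees \<open>H1_norm\<close> from the chosen representatives: it may be computed with
  any weak derivatives at hand.\<close>

lemma H1_norm_eq:
  fixes u :: "real^'n \<Rightarrow> real"
  assumes S: "open S" and w: "\<And>i. is_weak_partial S i u (w i)"
  shows "H1_norm S u = sqrt ((\<integral>x. (u x)\<^sup>2 \<partial>lebesgue_on S) + (\<Sum>i\<in>UNIV. \<integral>x. (w i x)\<^sup>2 \<partial>lebesgue_on S))"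
proof -
  have "(\<integral>x. (weak_partial S i u x)\<^sup>2 \<partial>lebesgue_on S) = (\<integral>x. (w i x)\<^sup>2 \<partial>lebesgue_on S)" for i
  proof (rule integral_cong_AE)
    show "(\<lambda>x. (weak_partial S i u x)\<^sup>2) \<in> borel_measurable (lebesgue_on S)"
      using locally_integrable_measurable[OF S is_weak_partialD(2)[OF is_weak_partial_weak_partial[OF w]]] by simp
    show "(\<lambda>x. (w i x)\<^sup>2) \<in> borel_measurable (lebesgue_on S)"
      using locally_integrable_measurable[OF S is_weak_partialD(2)[OF w]] by simp
    show "AE x in lebesgue_on S. (weak_partial S i u x)\<^sup>2 = (w i x)\<^sup>2"
      using weak_partial_AE[OF S w[of i]] by (rule eventually_mono) simp
  qed
  then show ?thesis by (simp add: H1_norm_def)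
qed

lemma H1_diff:
  fixes u v :: "real^'n \<Rightarrow> real"
  assumes S: "open S" and u: "u \<in> H1 S" and v: "v \<in> H1 S"
  shows "(\<lambda>x. u x - v x) \<in> H1 S"
  by (rule H1I[OF L2_diff[OF H1_L2[OF u] H1_L2[OF v]]
      is_weak_partial_diff[OF S H1_weak_partial(1)[OF S u] H1_weak_partial(1)[OF S v]]
      L2_diff[OF H1_weak_partial(2)[OF S u] H1_weak_partial(2)[OF S v]]])

lemma H1_subset:
  fixes u :: "real^'n \<Rightarrow> real"
  assumes S: "open S" and T: "open T" "T \<subseteq> S" and u: "u \<in> H1 S"
  shows "u \<in> H1 T"
  by (rule H1I[OF L2_subset[OF S T H1_L2[OF u]] is_weak_partial_subset[OF S T H1_weak_partial(1)[OF S u]]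
      L2_subset[OF S T H1_weak_partial(2)[OF S u]]])

lemma weak_partial_subset_AE:
  fixes u :: "real^'n \<Rightarrow> real"
  assumes S: "open S" and T: "open T" "T \<subseteq> S" and u: "u \<in> H1 S"
  shows "AE x in lebesgue_on T. weak_partial T i u x = weak_partial S i u x"
  by (rule weak_partial_AE[OF T(1) is_weak_partial_subset[OF S T H1_weak_partial(1)[OF S u]]])

lemma weak_partial_diff_AE:
  fixes u v :: "real^'n \<Rightarrow> real"
  assumes S: "open S" and u: "u \<in> H1 S" and v: "v \<in> H1 S"
  shows "AE x in lebesgue_on S. weak_partial S i (\<lambda>x. u x - v x) x = weak_partial S i u x - weak_partial S i v x"
  by (rule weak_partial_AE[OF S is_weak_partial_diff[OF S H1_weak_partial(1)[OF S u] H1_weak_partial(1)[OF S v]]])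

lemma H1_cong_AE:
  fixes u v :: "real^'n \<Rightarrow> real"
  assumes S: "open S" and u: "u \<in> H1 S" and v: "locally_integrable S v" "AE x in lebesgue_on S. v x = u x"
  shows "v \<in> H1 S"
  by (rule H1I[OF L2_cong_AE[OF S H1_L2[OF u] v] is_weak_partial_cong_AE[OF S H1_weak_partial(1)[OF S u] v]
      H1_weak_partial(2)[OF S u]])

lemma weak_partial_cong_AE:
  fixes u v :: "real^'n \<Rightarrow> real"
  assumes S: "open S" and u: "u \<in> H1 S" and v: "locally_integrable S v" "AE x in lebesgue_on S. v x = u x"
  shows "AE x in lebesgue_on S. weak_partial S i v x = weak_partial S i u x"
  by (rule weak_partial_AE[OF S is_weak_partial_cong_AE[OF S H1_weak_partial(1)[OF S u] v]])

lemma H2_H1: "u \<in> H2 S \<Longrightarrow> u \<in> H1 S"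
  and H2_weak_partial: "u \<in> H2 S \<Longrightarrow> weak_partial S i u \<in> H1 S"
  by (auto simp: H2_def)

lemma weak_partial_locally_integrable:
  fixes u :: "real^'n \<Rightarrow> real"
  shows "open S \<Longrightarrow> u \<in> H1 S \<Longrightarrow> locally_integrable S (weak_partial S i u)"
  using H1_weak_partial(1) is_weak_partialD(2) by blast

text \<open>Second derivatives need two steps. The first derivatives taken in \<open>T\<close> and
  in \<open>S\<close> agree only almost everywhere, and a further weak derivative does not notice
  such a change. \<open>H2_diff\<close> follows the same pattern.\<close>

lemma H2_subset:
  fixes u :: "real^'n \<Rightarrow> real"
  assumes S: "open S" and T: "open T" "T \<subseteq> S" and u: "u \<in> H2 S"
  shows "u \<in> H2 T"
    and "AE x in lebesgue_on T. weak_partial T j (weak_partial T i u) x = weak_partial S j (weak_partial S i u) x"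
proof -
  note u1 = H2_H1[OF u]
  have uT: "u \<in> H1 T" by (rule H1_subset[OF S T u1])
  have wT: "weak_partial S i u \<in> H1 T" for i by (rule H1_subset[OF S T H2_weak_partial[OF u]])
  note ae = weak_partial_subset_AE[OF S T u1] and li = weak_partial_locally_integrable[OF T(1) uT]
  show "u \<in> H2 T"
    unfolding H2_def using uT H1_cong_AE[OF T(1) wT li ae] by blast
  show "AE x in lebesgue_on T. weak_partial T j (weak_partial T i u) x = weak_partial S j (weak_partial S i u) x"
    using weak_partial_cong_AE[OF T(1) wT li ae, of j i] weak_partial_subset_AE[OF S T H2_weak_partial[OF u], of j i]
    by eventually_elim simp
qed

lemma H2_diff:
  fixes u v :: "real^'n \<Rightarrow> real"
  assumes S: "open S" and u: "u \<in> H2 S" and v: "v \<in> H2 S"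
  shows "(\<lambda>x. u x - v x) \<in> H2 S"
    and "AE x in lebesgue_on S. weak_partial S j (weak_partial S i (\<lambda>x. u x - v x)) x
      = weak_partial S j (weak_partial S i u) x - weak_partial S j (weak_partial S i v) x"
proof -
  have d: "(\<lambda>x. u x - v x) \<in> H1 S" by (rule H1_diff[OF S H2_H1[OF u] H2_H1[OF v]])
  have dd: "(\<lambda>x. weak_partial S i u x - weak_partial S i v x) \<in> H1 S" for i
    by (rule H1_diff[OF S H2_weak_partial[OF u] H2_weak_partial[OF v]])
  note ae = weak_partial_diff_AE[OF S H2_H1[OF u] H2_H1[OF v]] and li = weak_partial_locally_integrable[OF S d]
  show "(\<lambda>x. u x - v x) \<in> H2 S"
    unfolding H2_def using d H1_cong_AE[OF S dd li ae] by blast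
  show "AE x in lebesgue_on S. weak_partial S j (weak_partial S i (\<lambda>x. u x - v x)) x
      = weak_partial S j (weak_partial S i u) x - weak_partial S j (weak_partial S i v) x"
    using weak_partial_cong_AE[OF S dd[of i] li ae, of j] weak_partial_diff_AE[OF S H2_weak_partial[OF u, of i] H2_weak_partial[OF v, of i], of j]
    by eventually_elim simp
qed

section \<open>Integration by parts through difference quotients\<close>

lemma Ck1_difference_quotient:
  assumes "Ck (Suc 0) \<phi>"
  shows "(\<lambda>k. (\<phi> (x + (1 / real (Suc k)) *\<^sub>R axis i 1) - \<phi> x) * real (Suc k)) \<longlonglongrightarrow> partial i \<phi> x"
proof -
  have d: "\<phi> differentiable at x" using assms by simp
  have "((\<lambda>s. \<phi> (x + s *\<^sub>R axis i 1)) has_derivative (\<lambda>k. \<Sum>j\<in>UNIV. (k *\<^sub>R axis i 1) $ j * partial j \<phi> x)) (at 0)"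
  proof (rule has_derivative_compose[where g=\<phi>])
    show "((\<lambda>s. x + s *\<^sub>R axis i 1) has_derivative (\<lambda>k. k *\<^sub>R axis i 1)) (at 0)"
      by (auto intro!: derivative_eq_intros)
    show "(\<phi> has_derivative (\<lambda>h. \<Sum>j\<in>UNIV. h $ j * partial j \<phi> x)) (at (x + 0 *\<^sub>R axis i 1))"
      using differentiable_has_derivative_partial[OF d] by simp
  qed
  moreover have "(\<Sum>j\<in>UNIV. (k *\<^sub>R axis i 1) $ j * partial j \<phi> x) = k * partial i \<phi> x" for k
    using sum_axis_mult[of i "\<lambda>j. k * partial j \<phi> x"] by (simp add: ac_simps)
  ultimately have "((\<lambda>s. \<phi> (x + s *\<^sub>R axis i 1)) has_real_derivative partial i \<phi> x) (at 0)"
    by (simp add: has_field_derivative_def mult_commute_abs)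
  then have l: "((\<lambda>h. (\<phi> (x + h *\<^sub>R axis i 1) - \<phi> x) / h) \<longlongrightarrow> partial i \<phi> x) (at 0)"
    by (simp add: DERIV_def)
  have "filterlim (\<lambda>k. 1 / real (Suc k)) (at 0) sequentially"
    by (rule filterlim_atI) (use LIMSEQ_inverse_real_of_nat in \<open>simp_all add: divide_inverse\<close>)
  from filterlim_compose[OF l this] show ?thesis by (simp add: divide_inverse)
qed

lemma Ck1_Lipschitz:
  fixes \<phi> :: "real^'n \<Rightarrow> real"
  assumes \<phi>: "Ck (Suc 0) \<phi>" and z: "\<And>x. norm x > R \<Longrightarrow> \<phi> x = 0"
  obtains L where "L \<ge> 0" "\<And>x y. \<bar>\<phi> x - \<phi> y\<bar> \<le> L * dist x y"
proof -
  have "\<exists>B. B \<ge> 0 \<and> (\<forall>x. \<bar>partial i \<phi> x\<bar> \<le> B)" for i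
    using continuous_compact_support_bounded[of "partial i \<phi>" R] \<phi> partial_outside_support[OF \<phi> z] by (metis Ck.simps)
  then obtain B where B: "\<And>i. B i \<ge> 0" "\<And>i x. \<bar>partial i \<phi> x\<bar> \<le> B i" by metis
  let ?L = "\<Sum>i\<in>UNIV. B i"
  have "norm (\<phi> x - \<phi> y) \<le> ?L * norm (x - y)" for x y
  proof (rule differentiable_bound[OF convex_UNIV])
    show "(\<phi> has_derivative (\<lambda>h. \<Sum>i\<in>UNIV. h $ i * partial i \<phi> x)) (at x)" for x
      using \<phi> by (intro differentiable_has_derivative_partial) simp
    show "onorm (\<lambda>h. \<Sum>i\<in>UNIV. h $ i * partial i \<phi> x) \<le> ?L" for x
    proof (rule onorm_bound)
      show "?L \<ge> 0" using B(1) by (simp add: sum_nonneg)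
      fix h :: "real^'n"
      have "norm (\<Sum>i\<in>UNIV. h $ i * partial i \<phi> x) \<le> (\<Sum>i\<in>UNIV. \<bar>h $ i\<bar> * \<bar>partial i \<phi> x\<bar>)"
        using sum_abs[of "\<lambda>i. h $ i * partial i \<phi> x" UNIV] by (simp add: abs_mult)
      also have "\<dots> \<le> (\<Sum>i\<in>UNIV. norm h * B i)"
        by (intro sum_mono mult_mono component_le_norm_cart B) auto
      finally show "norm (\<Sum>i\<in>UNIV. h $ i * partial i \<phi> x) \<le> ?L * norm h"
        by (simp add: sum_distrib_left mult.commute)
    qed
  qed auto
  then show thesis using that[of ?L] B(1) by (simp add: sum_nonneg dist_norm)
qed

lemma Lipschitz_continuous:
  fixes F :: "'a::metric_space \<Rightarrow> real"
  assumes "L \<ge> 0" "\<And>x y. \<bar>F x - F y\<bar> \<le> L * dist x y"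
  shows "continuous_on S F"
proof -
  have "L-lipschitz_on S F" using assms by (intro lipschitz_onI) (auto simp: dist_real_def)
  then show ?thesis by (rule lipschitz_on_continuous_on)
qed

text \<open>By translation invariance every difference quotient of \<open>F\<close> has integral
  zero. The Lipschitz bound and the bounded support dominate them, so the limit has integral zero
  too. Convergence almost everywhere is enough, which is what makes the argument fit piecewise
  smooth functions.\<close>

lemma integral_directional_derivative_zero:
  fixes F D :: "real^'n \<Rightarrow> real"
  assumes L: "L \<ge> 0" "\<And>x y. \<bar>F x - F y\<bar> \<le> L * dist x y" and z: "\<And>x. norm x > R \<Longrightarrow> F x = 0"
    and D: "D \<in> borel_measurable lebesgue"
    and lim: "AE x in lebesgue. (\<lambda>k. (F (x + (1 / real (Suc k)) *\<^sub>R axis i 1) - F x) * real (Suc k)) \<longlonglongrightarrow> D x"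
  shows "integral\<^sup>L lebesgue D = 0"
proof -
  have c: "continuous_on UNIV F" by (rule Lipschitz_continuous[OF L])
  have [measurable]: "F \<in> borel_measurable borel" by (rule borel_measurable_continuous_onI[OF c])
  let ?h = "\<lambda>k. (1 / real (Suc k)) *\<^sub>R axis i (1::real) :: real^'n"
  let ?g = "\<lambda>k x. (F (x + ?h k) - F x) * real (Suc k)"
  have nh: "norm (?h k) \<le> 1" for k by (simp add: norm_axis_1)
  have gb: "\<bar>?g k x\<bar> \<le> L" for k x
  proof -
    have "\<bar>F (x + ?h k) - F x\<bar> \<le> L * (1 / real (Suc k))"
      using L(2)[of "x + ?h k" x] by (simp add: dist_norm norm_axis_1)
    then have "\<bar>F (x + ?h k) - F x\<bar> * real (Suc k) \<le> L * (1 / real (Suc k)) * real (Suc k)"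
      by (rule mult_right_mono) simp
    then show ?thesis by (simp add: abs_mult)
  qed
  have gz: "?g k x = 0" if "norm x > R + 1" for k x
  proof -
    have "norm (x + ?h k) > R" using norm_triangle_ineq2[of x "- ?h k"] nh[of k] that unfolding norm_minus_cancel diff_minus_eq_add by linarith
    moreover have "norm x > R" using that by simp
    ultimately show ?thesis using z by simp
  qed
  obtain B where B: "\<And>x. \<bar>F x\<bar> \<le> B" using continuous_compact_support_bounded[OF c z] by metis
  have Fi: "integrable lborel F" by (rule bounded_support_integrable[OF _ B z]) simp_all
  have g0: "integral\<^sup>L lebesgue (?g k) = 0" for k
  proof -
    have "integrable lborel (\<lambda>x. F (x + ?h k))"
      using lborel_integrable_affine_iff[of 1 F "?h k"] Fi by (simp add: add.commute)
    moreover have "(\<integral>x. F (x + ?h k) \<partial>lborel) = integral\<^sup>L lborel F"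
      using lborel_integral_affine[of 1 F "?h k"] by (simp add: add.commute)
    ultimately have "integral\<^sup>L lborel (?g k) = 0" using Fi by simp
    then show ?thesis by (subst integral_completion) auto
  qed
  have "(\<lambda>k. integral\<^sup>L lebesgue (?g k)) \<longlonglongrightarrow> integral\<^sup>L lebesgue D"
  proof (rule integral_dominated_convergence[where w="\<lambda>x. L * indicator (cball 0 (R+1)) x"])
    show "D \<in> borel_measurable lebesgue" by (rule D)
    show "?g k \<in> borel_measurable lebesgue" for k by (rule borel_imp_lebesgue_measurable) measurable
    show "integrable lebesgue (\<lambda>x. L * indicator (cball (0::real^'n) (R+1)) x)"
      by (intro integrable_mult_right integrable_real_indicator) (use emeasure_lborel_cball_finite[of "0::real^'n" "R+1"] in auto)
    show "AE x in lebesgue. norm (?g k x) \<le> L * indicator (cball 0 (R+1)) x" for k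
      using gb[of _ k] gz[of _ k] by (intro AE_I2) (auto simp: indicator_def)
  qed (use lim in simp)
  then show ?thesis unfolding g0 by (simp add: LIMSEQ_const_iff)
qed

lemma test_function_bounded_support:
  assumes "\<phi> \<in> test_functions S"
  obtains R where "\<And>x. norm x > R \<Longrightarrow> \<phi> x = 0"
proof -
  obtain K where K: "compact K" "\<And>x. x \<notin> K \<Longrightarrow> \<phi> x = 0"
    using test_function_support[OF assms] by metis
  obtain R where "\<forall>x\<in>K. norm x \<le> R" using compact_imp_bounded[OF K(1)] unfolding bounded_iff by blast
  then show thesis using that[of R] K(2) by (metis not_le)
qed

lemma test_function_integral:
  fixes w g :: "real^'n \<Rightarrow> real"
  assumes "S \<in> sets lebesgue" "\<And>x. x \<notin> S \<Longrightarrow> g x = 0"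
  shows "(\<integral>x. w x * g x \<partial>lebesgue_on S) = (\<integral>x. w x * g x \<partial>lebesgue)"
  using integral_mult_subset[of UNIV S g w] assms by (simp add: lebesgue_on_UNIV_eq)

text \<open>Both sides of the weak identity are gathered in one integral over the whole space, the
  form in which the product rule for \<open>u * \<phi>\<close> delivers them.\<close>

lemma is_weak_partialI_lebesgue:
  fixes u w :: "real^'n \<Rightarrow> real"
  assumes S: "open S" and u: "locally_integrable S u" and w: "locally_integrable S w"
    and zero: "\<And>\<phi>. \<phi> \<in> test_functions S \<Longrightarrow> (\<integral>x. u x * partial i \<phi> x + w x * \<phi> x \<partial>lebesgue) = 0"
  shows "is_weak_partial S i u w"
  unfolding is_weak_partial_def
proof (intro conjI u w ballI)
  fix \<phi> assume \<phi>: "\<phi> \<in> test_functions S"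
  obtain K where K: "K \<subseteq> S" "\<And>x. x \<notin> K \<Longrightarrow> \<phi> x = 0" "\<And>i x. x \<notin> K \<Longrightarrow> partial i \<phi> x = 0"
    using test_function_support[OF \<phi>] by metis
  note S' = open_lebesgue[OF S]
  have z: "x \<notin> S \<Longrightarrow> \<phi> x = 0" "x \<notin> S \<Longrightarrow> partial i \<phi> x = 0" for x using K by blast+
  have e: "zero_ext S (\<lambda>x. u x * partial i \<phi> x) = (\<lambda>x. u x * partial i \<phi> x)"
    "zero_ext S (\<lambda>x. w x * \<phi> x) = (\<lambda>x. w x * \<phi> x)"
    using z by (auto simp: zero_ext_def fun_eq_iff)
  have "integrable lebesgue (\<lambda>x. u x * partial i \<phi> x)" "integrable lebesgue (\<lambda>x. w x * \<phi> x)"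
    using integrable_test(2)[OF S' u \<phi>, of i] integrable_test(1)[OF S' w \<phi>] e by (simp_all add: integrable_zero_ext[OF S'])
  then show "(\<integral>x. u x * partial i \<phi> x \<partial>lebesgue_on S) = - (\<integral>x. w x * \<phi> x \<partial>lebesgue_on S)"
    using zero[OF \<phi>] by (simp add: test_function_integral[OF S'] z)
qed

lemma continuous_locally_integrable:
  fixes g :: "real^'n \<Rightarrow> real"
  assumes "continuous_on UNIV g"
  shows "locally_integrable S g"
  unfolding locally_integrable_def
proof (intro allI impI)
  fix C assume C: "compact C \<and> C \<subseteq> S"
  then have Cs: "C \<in> sets lebesgue" by (simp add: borel_compact)
  have "integrable lborel (\<lambda>x. indicator C x *\<^sub>R g x)"
    by (rule borel_integrable_compact) (use C assms in \<open>auto intro: continuous_on_subset\<close>)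
  then have "integrable lebesgue (\<lambda>x. indicator C x *\<^sub>R g x)"
    by (simp add: integrable_completion)
  then show "integrable (lebesgue_on C) g" using Cs by (simp add: integrable_restrict_space)
qed

text \<open>Multiplying \<open>q\<close> by a test function gives a C1 function of bounded support,
  hence a Lipschitz one, whatever the growth of \<open>q\<close>. The product rule turns the
  vanishing integral of its derivative into the weak identity.\<close>

lemma Ck1_is_weak_partial:
  fixes q :: "real^'n \<Rightarrow> real"
  assumes S: "open S" and q: "Ck (Suc 0) q"
  shows "is_weak_partial S i q (partial i q)"
proof (rule is_weak_partialI_lebesgue[OF S])
  show "locally_integrable S q" using Ck_Suc_imp[OF q] by (intro continuous_locally_integrable) simp
  show "locally_integrable S (partial i q)" using q by (intro continuous_locally_integrable) simp
  fix \<phi> assume \<phi>: "\<phi> \<in> test_functions S"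
  obtain R where R: "\<And>x. norm x > R \<Longrightarrow> \<phi> x = 0" using test_function_bounded_support[OF \<phi>] by metis
  have \<phi>1: "Ck (Suc 0) \<phi>" by (rule smooth_Ck[OF test_function_smooth[OF \<phi>]])
  let ?F = "\<lambda>x. q x * \<phi> x"
  have F: "Ck (Suc 0) ?F" by (rule Ck_mult[OF q \<phi>1])
  obtain L where L: "L \<ge> 0" "\<And>x y. \<bar>?F x - ?F y\<bar> \<le> L * dist x y"
    using Ck1_Lipschitz[OF F, of R] R by auto
  have "integral\<^sup>L lebesgue (partial i ?F) = 0"
  proof (rule integral_directional_derivative_zero[OF L, of R])
    show "partial i ?F \<in> borel_measurable lebesgue"
      using F by (intro borel_imp_lebesgue_measurable borel_measurable_continuous_onI) auto
  qed (use R Ck1_difference_quotient[OF F] in auto)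
  then show "(\<integral>x. q x * partial i \<phi> x + partial i q x * \<phi> x \<partial>lebesgue) = 0"
    by (simp only: partial_mult[OF q \<phi>1, abs_def])
qed

text \<open>The same product argument with difference quotients only. Differentiability along the
  axis almost everywhere enters as the hypothesis \<open>lim\<close>, so that it can be checked by
  hand for piecewise polynomials, and it identifies the weak derivative explicitly.\<close>

lemma Lipschitz_is_weak_partial:
  fixes w D :: "real^'n \<Rightarrow> real"
  assumes S: "open S" and L: "L \<ge> 0" "\<And>x y. \<bar>w x - w y\<bar> \<le> L * dist x y" and D: "D \<in> borel_measurable lebesgue"
    and lim: "AE x in lebesgue. (\<lambda>k. (w (x + (1 / real (Suc k)) *\<^sub>R axis i 1) - w x) * real (Suc k)) \<longlonglongrightarrow> D x"
  shows "AE x in lebesgue. \<bar>D x\<bar> \<le> L" and "is_weak_partial S i w D"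
proof -
  have c: "continuous_on UNIV w" by (rule Lipschitz_continuous[OF L])
  let ?h = "\<lambda>k. (1 / real (Suc k)) *\<^sub>R axis i (1::real) :: real^'n"
  have h0: "?h \<longlonglongrightarrow> 0"
    using tendsto_scaleR[OF LIMSEQ_inverse_real_of_nat tendsto_const[of "axis i (1::real)"]] by (simp add: divide_inverse)
  show b: "AE x in lebesgue. \<bar>D x\<bar> \<le> L"
    using lim
  proof (rule eventually_mono)
    fix x assume l: "(\<lambda>k. (w (x + ?h k) - w x) * real (Suc k)) \<longlonglongrightarrow> D x"
    have "\<bar>(w (x + ?h k) - w x) * real (Suc k)\<bar> \<le> L" for k
    proof -
      have "\<bar>w (x + ?h k) - w x\<bar> \<le> L * (1 / real (Suc k))"
        using L(2)[of "x + ?h k" x] by (simp add: dist_norm norm_axis_1)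
      then have "\<bar>w (x + ?h k) - w x\<bar> * real (Suc k) \<le> L * (1 / real (Suc k)) * real (Suc k)"
        by (rule mult_right_mono) simp
      then show ?thesis by (simp add: abs_mult)
    qed
    then show "\<bar>D x\<bar> \<le> L" by (intro LIMSEQ_le_const2[OF tendsto_rabs[OF l]]) auto
  qed
  show "is_weak_partial S i w D"
  proof (rule is_weak_partialI_lebesgue[OF S])
    show "locally_integrable S w" by (rule continuous_locally_integrable[OF c])
    show "locally_integrable S D"
      unfolding locally_integrable_def
    proof (intro allI impI)
      fix C assume C: "compact C \<and> C \<subseteq> S"
      then have Cs: "C \<in> sets lebesgue" by (simp add: borel_compact)
      interpret finite_measure "lebesgue_on C"
        using C Cs compact_imp_bounded by (intro finite_measure_lebesgue_on_bounded) auto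
      show "integrable (lebesgue_on C) D"
      proof (rule integrable_const_bound[where B=L])
        show "D \<in> borel_measurable (lebesgue_on C)" by (rule measurable_restrict_space1[OF D])
        show "AE x in lebesgue_on C. norm (D x) \<le> L"
          unfolding AE_lebesgue_on_iff[OF Cs] using b by (rule eventually_mono) simp
      qed
    qed
    fix \<phi> assume \<phi>: "\<phi> \<in> test_functions S"
    obtain R where R: "\<And>x. norm x > R \<Longrightarrow> \<phi> x = 0" using test_function_bounded_support[OF \<phi>] by metis
    have \<phi>1: "Ck (Suc 0) \<phi>" by (rule smooth_Ck[OF test_function_smooth[OF \<phi>]])
    have \<phi>c: "continuous_on UNIV \<phi>" by (rule smooth_continuous[OF test_function_smooth[OF \<phi>]])
    have \<phi>'c: "continuous_on UNIV (partial i \<phi>)" using \<phi>1 by simp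
    obtain L' where L': "L' \<ge> 0" "\<And>x y. \<bar>\<phi> x - \<phi> y\<bar> \<le> L' * dist x y"
      using Ck1_Lipschitz[OF \<phi>1 R] by metis
    obtain B where B: "B \<ge> 0" "\<And>x. \<bar>\<phi> x\<bar> \<le> B" using continuous_compact_support_bounded[OF \<phi>c R] by metis
    obtain W where W: "\<And>x. x \<in> cball 0 R \<Longrightarrow> \<bar>w x\<bar> \<le> W"
    proof -
      have "bounded (w ` cball 0 R)"
        by (intro compact_imp_bounded compact_continuous_image continuous_on_subset[OF c]) auto
      then obtain W where "\<forall>y\<in>w ` cball 0 R. norm y \<le> W" unfolding bounded_iff by blast
      then show thesis by (intro that[of W]) auto
    qed
    let ?F = "\<lambda>x. w x * \<phi> x"
    \<comment> \<open>\<open>w\<close> may be unbounded, so the increment is split with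
      \<open>w\<close> evaluated at \<open>x\<close> in the ball that contains the support and the
      test function at \<open>y\<close>. The remaining cases follow by symmetry or are
      trivial.\<close>
    have one: "\<bar>?F x - ?F y\<bar> \<le> (\<bar>W\<bar> * L' + B * L) * dist x y" if x: "norm x \<le> R" for x y
    proof -
      have "?F x - ?F y = w x * (\<phi> x - \<phi> y) + \<phi> y * (w x - w y)" by (simp add: algebra_simps)
      then have "\<bar>?F x - ?F y\<bar> \<le> \<bar>w x\<bar> * \<bar>\<phi> x - \<phi> y\<bar> + \<bar>\<phi> y\<bar> * \<bar>w x - w y\<bar>"
        using abs_triangle_ineq[of "w x * (\<phi> x - \<phi> y)" "\<phi> y * (w x - w y)"] by (simp add: abs_mult)
      also have "\<dots> \<le> \<bar>W\<bar> * (L' * dist x y) + B * (L * dist x y)"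
        using W[of x] x by (intro add_mono mult_mono L L' B) auto
      finally show ?thesis by (simp add: algebra_simps)
    qed
    have F: "\<bar>?F x - ?F y\<bar> \<le> (\<bar>W\<bar> * L' + B * L) * dist x y" for x y
    proof -
      consider "norm x \<le> R" | "norm y \<le> R" | "norm x > R" "norm y > R" by linarith
      then show ?thesis
      proof cases
        case 1 then show ?thesis by (rule one)
      next
        case 2 then show ?thesis using one[of y x] by (simp add: dist_commute abs_minus_commute)
      next
        case 3 then show ?thesis using R B L L' by simp
      qed
    qed
    have F0: "\<bar>W\<bar> * L' + B * L \<ge> 0" using L L' B by simp
    show "(\<integral>x. w x * partial i \<phi> x + D x * \<phi> x \<partial>lebesgue) = 0"
    proof (rule integral_directional_derivative_zero[OF F0 F])
      show "?F x = 0" if "norm x > R" for x using R[OF that] by simp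
      have m: "w \<in> borel_measurable lebesgue" "\<phi> \<in> borel_measurable lebesgue" "partial i \<phi> \<in> borel_measurable lebesgue"
        by (intro borel_imp_lebesgue_measurable borel_measurable_continuous_onI c \<phi>c \<phi>'c)+
      show "(\<lambda>x. w x * partial i \<phi> x + D x * \<phi> x) \<in> borel_measurable lebesgue"
        by (intro borel_measurable_add borel_measurable_times m D)
      \<comment> \<open>The discrete product rule. It evaluates \<open>w\<close> at the shifted
        point, so continuity of \<open>w\<close> is used in the limit.\<close>
      have eq: "(?F y - ?F x) * m = w y * ((\<phi> y - \<phi> x) * m) + (w y - w x) * m * \<phi> x" for x y m
        by (simp add: algebra_simps)
      show "AE x in lebesgue. (\<lambda>k. (?F (x + ?h k) - ?F x) * real (Suc k)) \<longlonglongrightarrow> w x * partial i \<phi> x + D x * \<phi> x"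
        using lim
      proof (rule eventually_mono)
        fix x assume l: "(\<lambda>k. (w (x + ?h k) - w x) * real (Suc k)) \<longlonglongrightarrow> D x"
        have "(\<lambda>k. x + ?h k) \<longlonglongrightarrow> x" using tendsto_add[OF tendsto_const[of x] h0] by simp
        moreover have "isCont w x" using c by (simp add: continuous_on_eq_continuous_at)
        ultimately have "(\<lambda>k. w (x + ?h k)) \<longlonglongrightarrow> w x" by (rule isCont_tendsto_compose[rotated])
        then have "(\<lambda>k. w (x + ?h k) * ((\<phi> (x + ?h k) - \<phi> x) * real (Suc k)) + (w (x + ?h k) - w x) * real (Suc k) * \<phi> x)
            \<longlonglongrightarrow> w x * partial i \<phi> x + D x * \<phi> x"
          by (intro tendsto_add tendsto_mult Ck1_difference_quotient[OF \<phi>1] l tendsto_const)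
        then show "(\<lambda>k. (?F (x + ?h k) - ?F x) * real (Suc k)) \<longlonglongrightarrow> w x * partial i \<phi> x + D x * \<phi> x"
          by (simp only: eq)
      qed
    qed
  qed
qed

section \<open>Density of smooth functions in H1 and Lipschitz functions in H10\<close>

lemma bounded_square_integrable_on:
  fixes g :: "'a::euclidean_space \<Rightarrow> real"
  assumes "S \<in> sets lebesgue" "bounded S" "g \<in> borel_measurable (lebesgue_on S)" "AE x in lebesgue_on S. \<bar>g x\<bar> \<le> B"
  shows "square_integrable (lebesgue_on S) g"
proof (rule square_integrable_bound[OF _ assms(3)])
  interpret finite_measure "lebesgue_on S" by (rule finite_measure_lebesgue_on_bounded[OF assms(1,2)])
  show "integrable (lebesgue_on S) (\<lambda>x. B\<^sup>2)" by simp
  show "AE x in lebesgue_on S. (g x)\<^sup>2 \<le> B\<^sup>2"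
    using assms(4)
  proof (rule eventually_mono)
    fix x assume "\<bar>g x\<bar> \<le> B"
    then have "\<bar>g x\<bar>\<^sup>2 \<le> B\<^sup>2" by (intro power_mono) auto
    then show "(g x)\<^sup>2 \<le> B\<^sup>2" by simp
  qed
qed

lemma continuous_L2:
  fixes g :: "real^'n \<Rightarrow> real"
  assumes "S \<in> sets lebesgue" "bounded S" "continuous_on UNIV g"
  shows "g \<in> L2 S"
proof -
  have "bounded (g ` closure S)"
    by (intro compact_imp_bounded compact_continuous_image continuous_on_subset[OF assms(3)])
       (use assms(2) in \<open>auto simp: compact_closure\<close>)
  then obtain B where B: "\<forall>y\<in>g ` closure S. norm y \<le> B" unfolding bounded_iff by blast
  have "AE x in lebesgue_on S. \<bar>g x\<bar> \<le> B"
    by (rule AE_I2) (use B closure_subset[of S] in auto)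
  moreover have "g \<in> borel_measurable (lebesgue_on S)"
    by (intro measurable_restrict_space1 borel_imp_lebesgue_measurable borel_measurable_continuous_onI assms(3))
  ultimately show ?thesis
    unfolding L2_iff by (intro bounded_square_integrable_on assms)
qed

lemma smooth_H1:
  fixes q :: "real^'n \<Rightarrow> real"
  assumes "open S" "bounded S" "smooth q"
  shows "q \<in> H1 S"
  by (rule H1I[of _ _ "\<lambda>i. partial i q"])
     (intro continuous_L2 open_lebesgue Ck1_is_weak_partial assms smooth_continuous smooth_Ck smooth_partial)+

lemma smooth_H2:
  fixes q :: "real^'n \<Rightarrow> real"
  assumes "open S" "bounded S" "smooth q"
  shows "q \<in> H2 S"
proof -
  have q: "q \<in> H1 S" by (rule smooth_H1[OF assms])
  have "weak_partial S i q \<in> H1 S" for i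
    by (rule H1_cong_AE[OF assms(1) smooth_H1[OF assms(1,2) smooth_partial[OF assms(3)]]
          weak_partial_locally_integrable[OF assms(1) q] weak_partial_AE[OF assms(1) Ck1_is_weak_partial[OF assms(1) smooth_Ck[OF assms(3)]]]])
  with q show ?thesis by (simp add: H2_def)
qed

lemma H2_cong_on:
  fixes u v :: "real^'n \<Rightarrow> real"
  assumes "\<And>x. x \<in> S \<Longrightarrow> u x = v x" "v \<in> H2 S" "S \<in> sets lebesgue"
  shows "u \<in> H2 S"
proof -
  have w: "is_weak_partial S i u w \<longleftrightarrow> is_weak_partial S i v w" for i w
    by (rule is_weak_partial_cong_on[OF assms(1)])
  have wp: "weak_partial S i u = weak_partial S i v" for i
    by (rule weak_partial_cong_on[OF assms(1)])
  have "zero_ext S u = zero_ext S v" using assms(1) by (auto simp: zero_ext_def fun_eq_iff)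
  then have "u \<in> L2 S \<longleftrightarrow> v \<in> L2 S"
    by (simp add: L2_iff square_integrable_zero_ext[OF assms(3)])
  then show ?thesis using assms(2) unfolding H2_def H1_def by (simp add: w wp)
qed

lemma L2_borel_representative:
  fixes f :: "real^'n \<Rightarrow> real"
  assumes S: "open S" "bounded S" and f: "f \<in> L2 S"
  obtains f' where "square_integrable lborel f'" "integrable lborel f'" "AE x in lebesgue. f' x = zero_ext S f x"
proof -
  note S' = open_lebesgue[OF S(1)]
  interpret finite_measure "lebesgue_on S" by (rule finite_measure_lebesgue_on_bounded[OF S' S(2)])
  have sq: "square_integrable lebesgue (zero_ext S f)"
    using f by (simp add: L2_iff square_integrable_zero_ext[OF S'])
  have "integrable (lebesgue_on S) f"
    using f by (intro square_integrable_imp_integrable) (simp add: L2_iff)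
  then have i: "integrable lebesgue (zero_ext S f)" by (simp add: integrable_zero_ext[OF S'])
  obtain f' where f': "f' \<in> borel_measurable borel" "AE x in lebesgue. f' x = zero_ext S f x"
    using borel_representative[OF square_integrableD(1)[OF sq]] by blast
  have "square_integrable lebesgue f'"
    by (rule square_integrable_cong_AE[OF sq borel_imp_lebesgue_measurable[OF f'(1)] f'(2)])
  then have "square_integrable lborel f'" by (simp add: square_integrable_lborel_iff[OF f'(1)])
  moreover have "integrable lborel f'"
    using integrable_lebesgue_iff_lborel[OF f'(1) square_integrableD(1)[OF sq] f'(2)] i by blast
  ultimately show thesis using f'(2) by (rule that)
qed

lemma integral_square_on_le:
  fixes f g :: "real^'n \<Rightarrow> real"
  assumes S: "S \<in> sets lebesgue" and f: "f \<in> borel_measurable (lebesgue_on S)"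
    and g: "square_integrable lborel g" and e: "AE x in lebesgue. x \<in> S \<longrightarrow> f x = g x"
  shows "(\<integral>x. (f x)\<^sup>2 \<partial>lebesgue_on S) \<le> (\<integral>x. (g x)\<^sup>2 \<partial>lborel)"
proof -
  have gm: "g \<in> borel_measurable borel" using square_integrableD(1)[OF g] by simp
  have gl: "square_integrable lebesgue g" using g by (simp add: square_integrable_lborel_iff[OF gm])
  have "(\<integral>x. (f x)\<^sup>2 \<partial>lebesgue_on S) = (\<integral>x. zero_ext S (\<lambda>x. (f x)\<^sup>2) x \<partial>lebesgue)"
    by (rule integral_zero_ext[OF S])
  also have "\<dots> \<le> (\<integral>x. (g x)\<^sup>2 \<partial>lebesgue)"
  proof (rule integral_mono_AE)
    have m: "zero_ext S (\<lambda>x. (f x)\<^sup>2) \<in> borel_measurable lebesgue"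
      using f measurable_zero_ext[OF S, of "\<lambda>x. (f x)\<^sup>2"] by simp
    show le: "AE x in lebesgue. zero_ext S (\<lambda>x. (f x)\<^sup>2) x \<le> (g x)\<^sup>2"
      using e by (rule eventually_mono) (simp add: zero_ext_def)
    show "integrable lebesgue (\<lambda>x. (g x)\<^sup>2)" by (rule square_integrableD(2)[OF gl])
    then show "integrable lebesgue (zero_ext S (\<lambda>x. (f x)\<^sup>2))"
    proof (rule Bochner_Integration.integrable_bound[OF _ m])
      show "AE x in lebesgue. norm (zero_ext S (\<lambda>x. (f x)\<^sup>2) x) \<le> norm ((g x)\<^sup>2)"
        using le by (rule eventually_mono) (simp add: zero_ext_def)
    qed
  qed
  also have "\<dots> = (\<integral>x. (g x)\<^sup>2 \<partial>lborel)"
    by (rule integral_completion) (use gm in simp)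
  finally show ?thesis .
qed

text \<open>By hypothesis \<open>d\<close> the derivative of the mollification is \<open>t k\<close>
  times the mollified derivative, so its error splits into \<open>t k\<close> times a mollification
  error plus \<open>(t k - 1) * v' i\<close>. The functions \<open>w'\<close> and \<open>v'\<close>
  are tied to \<open>w\<close> and \<open>v\<close> only on \<open>S\<close>; their values outside
  are left to the application.\<close>

lemma mollify_H1_norm_tendsto:
  fixes w w' :: "real^'n \<Rightarrow> real" and v v' :: "'n \<Rightarrow> real^'n \<Rightarrow> real"
  assumes S: "open S" "bounded S"
    and w: "\<And>i. is_weak_partial S i w (v i)"
    and w': "square_integrable lborel w'" "integrable lborel w'" "AE x in lebesgue. x \<in> S \<longrightarrow> w' x = w x"
    and v': "\<And>i. square_integrable lborel (v' i)" "\<And>i. AE x in lebesgue. x \<in> S \<longrightarrow> v' i x = v i x"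
    and t: "t \<longlonglongrightarrow> 1" and b: "b \<longlonglongrightarrow> 0" and r: "r \<longlonglongrightarrow> 0" "\<And>k. r k > 0"
    and d: "\<And>k i x. x \<in> S \<Longrightarrow> partial i (mollify (t k) (b k) (r k) w') x = t k * mollify (t k) (b k) (r k) (v' i) x"
  shows "(\<lambda>k. H1_norm S (\<lambda>x. mollify (t k) (b k) (r k) w' x - w x)) \<longlonglongrightarrow> 0"
proof -
  note S' = open_lebesgue[OF S(1)]
  let ?M = "\<lambda>k. mollify (t k) (b k) (r k)"
  have sm: "smooth (?M k w')" for k by (rule smooth_mollify[OF r(2) w'(2)])
  have wp: "is_weak_partial S i (\<lambda>x. ?M k w' x - w x) (\<lambda>x. partial i (?M k w') x - v i x)" for i k
    by (rule is_weak_partial_diff[OF S(1) Ck1_is_weak_partial[OF S(1) smooth_Ck[OF sm]] w])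
  have n: "H1_norm S (\<lambda>x. ?M k w' x - w x) = sqrt ((\<integral>x. (?M k w' x - w x)\<^sup>2 \<partial>lebesgue_on S)
      + (\<Sum>i\<in>UNIV. \<integral>x. (partial i (?M k w') x - v i x)\<^sup>2 \<partial>lebesgue_on S))" for k
    by (rule H1_norm_eq[OF S(1) wp])
  have l0: "(\<lambda>k. \<integral>x. (?M k w' x - w x)\<^sup>2 \<partial>lebesgue_on S) \<longlonglongrightarrow> 0"
  proof (rule tendsto_sandwich[OF _ _ tendsto_const mollify_tendsto_L2(1)[OF w'(1) t b r]])
    show "\<forall>\<^sub>F k in sequentially. (\<integral>x. (?M k w' x - w x)\<^sup>2 \<partial>lebesgue_on S) \<le> (\<integral>x. (?M k w' x - w' x)\<^sup>2 \<partial>lborel)"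
      using mollify_tendsto_L2(2)[OF w'(1) t b r]
    proof (rule eventually_mono)
      fix k assume sq: "square_integrable lborel (\<lambda>x. ?M k w' x - w' x)"
      show "(\<integral>x. (?M k w' x - w x)\<^sup>2 \<partial>lebesgue_on S) \<le> (\<integral>x. (?M k w' x - w' x)\<^sup>2 \<partial>lborel)"
      proof (rule integral_square_on_le[OF S' _ sq])
        show "(\<lambda>x. ?M k w' x - w x) \<in> borel_measurable (lebesgue_on S)"
          by (rule locally_integrable_measurable[OF S(1) is_weak_partialD(1)[OF wp]])
        show "AE x in lebesgue. x \<in> S \<longrightarrow> ?M k w' x - w x = ?M k w' x - w' x"
          using w'(3) by (rule eventually_mono) simp
      qed
    qed
  qed simp
  have l1: "(\<lambda>k. \<integral>x. (partial i (?M k w') x - v i x)\<^sup>2 \<partial>lebesgue_on S) \<longlonglongrightarrow> 0" for i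
  proof -
    have lim: "(\<lambda>k. 2 * ((t k)\<^sup>2 * (\<integral>x. (?M k (v' i) x - v' i x)\<^sup>2 \<partial>lborel)) + 2 * ((t k - 1)\<^sup>2 * (\<integral>x. (v' i x)\<^sup>2 \<partial>lborel)))
       \<longlonglongrightarrow> 2 * (1\<^sup>2 * 0) + 2 * ((1 - 1)\<^sup>2 * (\<integral>x. (v' i x)\<^sup>2 \<partial>lborel))"
      by (intro tendsto_intros t mollify_tendsto_L2(1)[OF v'(1) t b r])
    show ?thesis
    proof (rule tendsto_sandwich[OF _ _ tendsto_const])
      show "(\<lambda>k. 2 * ((t k)\<^sup>2 * (\<integral>x. (?M k (v' i) x - v' i x)\<^sup>2 \<partial>lborel)) + 2 * ((t k - 1)\<^sup>2 * (\<integral>x. (v' i x)\<^sup>2 \<partial>lborel))) \<longlonglongrightarrow> 0"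
        using lim by simp
      show "\<forall>\<^sub>F k in sequentially. (\<integral>x. (partial i (?M k w') x - v i x)\<^sup>2 \<partial>lebesgue_on S)
        \<le> 2 * ((t k)\<^sup>2 * (\<integral>x. (?M k (v' i) x - v' i x)\<^sup>2 \<partial>lborel)) + 2 * ((t k - 1)\<^sup>2 * (\<integral>x. (v' i x)\<^sup>2 \<partial>lborel))"
        using mollify_tendsto_L2(2)[OF v'(1)[of i] t b r]
      proof (rule eventually_mono)
        fix k assume sq: "square_integrable lborel (\<lambda>x. ?M k (v' i) x - v' i x)"
        have sq2: "square_integrable lborel (\<lambda>x. t k * (?M k (v' i) x - v' i x) + (t k - 1) * v' i x)"
          by (intro square_integrable_add square_integrable_cmult sq v')
        have "(\<integral>x. (partial i (?M k w') x - v i x)\<^sup>2 \<partial>lebesgue_on S)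
          \<le> (\<integral>x. (t k * (?M k (v' i) x - v' i x) + (t k - 1) * v' i x)\<^sup>2 \<partial>lborel)"
        proof (rule integral_square_on_le[OF S' _ sq2])
          show "(\<lambda>x. partial i (?M k w') x - v i x) \<in> borel_measurable (lebesgue_on S)"
            by (rule locally_integrable_measurable[OF S(1) is_weak_partialD(2)[OF wp]])
          show "AE x in lebesgue. x \<in> S \<longrightarrow> partial i (?M k w') x - v i x = t k * (?M k (v' i) x - v' i x) + (t k - 1) * v' i x"
            using v'(2)[of i] by (rule eventually_mono) (simp add: d algebra_simps)
        qed
        also have "\<dots> \<le> 2 * (\<integral>x. (t k * (?M k (v' i) x - v' i x))\<^sup>2 \<partial>lborel) + 2 * (\<integral>x. ((t k - 1) * v' i x)\<^sup>2 \<partial>lborel)"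
          by (intro integral_square_add_le square_integrable_cmult sq v')
        finally show "(\<integral>x. (partial i (?M k w') x - v i x)\<^sup>2 \<partial>lebesgue_on S)
          \<le> 2 * ((t k)\<^sup>2 * (\<integral>x. (?M k (v' i) x - v' i x)\<^sup>2 \<partial>lborel)) + 2 * ((t k - 1)\<^sup>2 * (\<integral>x. (v' i x)\<^sup>2 \<partial>lborel))"
          by (simp only: power_mult_distrib integral_mult_right_zero)
      qed
    qed simp
  qed
  have "(\<lambda>k. sqrt ((\<integral>x. (?M k w' x - w x)\<^sup>2 \<partial>lebesgue_on S)
      + (\<Sum>i\<in>UNIV. \<integral>x. (partial i (?M k w') x - v i x)\<^sup>2 \<partial>lebesgue_on S))) \<longlonglongrightarrow> sqrt (0 + (\<Sum>i\<in>(UNIV::'n set). 0))"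
    by (intro tendsto_intros l0 l1)
  then show ?thesis by (simp add: n)
qed

text \<open>The average at \<open>x\<close> is taken about
  \<open>(1 - s) *\<^sub>R x + s *\<^sub>R x0\<close> with radius \<open>s * \<rho>\<close>. By
  convexity this ball lies in \<open>S\<close> for every \<open>x\<close> in \<open>S\<close>, so
  the formula for the derivative holds on all of \<open>S\<close>, while the approximants are smooth
  on the whole space and thus have boundary values.\<close>

lemma smooth_dense_H1:
  fixes w :: "real^'n \<Rightarrow> real"
  assumes S: "open S" "bounded S" "convex S" "S \<noteq> {}" and w: "w \<in> H1 S"
  obtains \<phi> where "\<And>k::nat. smooth (\<phi> k)" "(\<lambda>k. H1_norm S (\<lambda>x. \<phi> k x - w x)) \<longlonglongrightarrow> 0"
proof -
  note S' = open_lebesgue[OF S(1)]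
  obtain x0 where "x0 \<in> S" using S(4) by blast
  then obtain \<rho> where \<rho>: "\<rho> > 0" "cball x0 \<rho> \<subseteq> S" using S(1) open_contains_cball by blast
  let ?v = "\<lambda>i. weak_partial S i w"
  note wp = H1_weak_partial(1)[OF S(1) w]
  obtain w' where w': "square_integrable lborel w'" "integrable lborel w'" "AE x in lebesgue. w' x = zero_ext S w x"
    using L2_borel_representative[OF S(1,2) H1_L2[OF w]] by blast
  have "\<exists>v'. square_integrable lborel v' \<and> integrable lborel v' \<and> (AE x in lebesgue. v' x = zero_ext S (?v i) x)" for i
    using L2_borel_representative[OF S(1,2) H1_weak_partial(2)[OF S(1) w]] by blast
  then obtain v' where v': "\<And>i. square_integrable lborel (v' i)" "\<And>i. integrable lborel (v' i)"
      "\<And>i. AE x in lebesgue. v' i x = zero_ext S (?v i) x"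
    by metis
  \<comment> \<open>The sequence starts at 1/2, so \<open>s k < 1\<close> and the dilation factor
    \<open>t k\<close> stays positive.\<close>
  define s where "s k = inverse (real (Suc (Suc k)))" for k
  have s: "0 < s k" "s k < 1" for k by (auto simp: s_def inverse_less_1_iff)
  have s0: "s \<longlonglongrightarrow> 0"
    unfolding s_def using LIMSEQ_Suc[OF LIMSEQ_inverse_real_of_nat] by simp
  define t where "t k = 1 - s k" for k
  define b where "b k = s k *\<^sub>R x0" for k
  define r where "r k = s k * \<rho>" for k
  have t: "t \<longlonglongrightarrow> 1" unfolding t_def using tendsto_diff[OF tendsto_const[of 1] s0] by simp
  have b: "b \<longlonglongrightarrow> 0" unfolding b_def using tendsto_scaleR[OF s0 tendsto_const[of x0]] by simp
  have r: "r \<longlonglongrightarrow> 0" "\<And>k. r k > 0" unfolding r_def using tendsto_mult_left_zero[OF s0, of \<rho>] s \<rho>(1) by auto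
  have sub: "cball (t k *\<^sub>R x + b k) (r k) \<subseteq> S" if x: "x \<in> S" for k x
  proof
    fix y assume y: "y \<in> cball (t k *\<^sub>R x + b k) (r k)"
    \<comment> \<open>The point of \<open>cball x0 \<rho>\<close> for which \<open>y\<close> is the
      convex combination of \<open>x\<close> and \<open>z\<close> with weight \<open>s k\<close> on
      \<open>z\<close>.\<close>
    define z where "z = x0 + (1 / s k) *\<^sub>R (y - (t k *\<^sub>R x + b k))"
    have "dist x0 z = norm (y - (t k *\<^sub>R x + b k)) / s k"
      using s(1)[of k] by (simp add: z_def dist_norm)
    also have "\<dots> \<le> r k / s k"
      using y s(1)[of k] by (intro divide_right_mono) (auto simp: dist_norm norm_minus_commute)
    also have "\<dots> = \<rho>" using s(1)[of k] by (simp add: r_def)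
    finally have "z \<in> S" using \<rho>(2) by auto
    moreover have "y = (1 - s k) *\<^sub>R x + s k *\<^sub>R z"
      using s(1)[of k] by (simp add: z_def t_def b_def algebra_simps)
    ultimately show "y \<in> S" using x s[of k] S(3) by (auto intro: convexD_alt)
  qed
  have weak: "(\<integral>y. w' y * partial i \<psi> y \<partial>lborel) = - (\<integral>y. v' i y * \<psi> y \<partial>lborel)" if \<psi>: "\<psi> \<in> test_functions S" for \<psi> i
  proof -
    have sm: "smooth \<psi>" by (rule test_function_smooth[OF \<psi>])
    have m: "\<psi> \<in> borel_measurable borel" "partial i \<psi> \<in> borel_measurable borel"
      by (intro borel_measurable_continuous_onI smooth_continuous sm smooth_partial)+
    have m': "w' \<in> borel_measurable borel" "v' i \<in> borel_measurable borel"
      using w'(2) v'(2)[of i] by auto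
    obtain K where K: "K \<subseteq> S" "\<And>x. x \<notin> K \<Longrightarrow> \<psi> x = 0" "\<And>i x. x \<notin> K \<Longrightarrow> partial i \<psi> x = 0"
      using test_function_support[OF \<psi>] by metis
    have "(\<integral>y. w' y * partial i \<psi> y \<partial>lborel) = (\<integral>y. w y * partial i \<psi> y \<partial>lebesgue_on S)"
      unfolding integral_zero_ext[OF S']
    proof (rule integral_lebesgue_eq_lborel)
      show "zero_ext S (\<lambda>y. w y * partial i \<psi> y) \<in> borel_measurable lebesgue"
        using integrable_test(2)[OF S' is_weak_partialD(1)[OF wp] \<psi>] measurable_zero_ext[OF S'] borel_measurable_integrable by blast
      show "AE y in lebesgue. w' y * partial i \<psi> y = zero_ext S (\<lambda>y. w y * partial i \<psi> y) y"
        using w'(3) by (rule eventually_mono) (simp add: zero_ext_def)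
    qed (use m m' in measurable)
    moreover have "(\<integral>y. v' i y * \<psi> y \<partial>lborel) = (\<integral>y. ?v i y * \<psi> y \<partial>lebesgue_on S)"
      unfolding integral_zero_ext[OF S']
    proof (rule integral_lebesgue_eq_lborel)
      show "zero_ext S (\<lambda>y. ?v i y * \<psi> y) \<in> borel_measurable lebesgue"
        using integrable_test(1)[OF S' is_weak_partialD(2)[OF wp] \<psi>] measurable_zero_ext[OF S'] borel_measurable_integrable by blast
      show "AE y in lebesgue. v' i y * \<psi> y = zero_ext S (\<lambda>y. ?v i y * \<psi> y) y"
        using v'(3)[of i] by (rule eventually_mono) (simp add: zero_ext_def)
    qed (use m m' in measurable)
    ultimately show ?thesis using is_weak_partialD(3)[OF wp \<psi>] by simp
  qed
  have "(\<lambda>k. H1_norm S (\<lambda>x. mollify (t k) (b k) (r k) w' x - w x)) \<longlonglongrightarrow> 0"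
  proof (rule mollify_H1_norm_tendsto[OF S(1,2) wp w'(1,2) _ v'(1) _ t b r])
    show "AE x in lebesgue. x \<in> S \<longrightarrow> w' x = w x"
      using w'(3) by (rule eventually_mono) simp
    show "AE x in lebesgue. x \<in> S \<longrightarrow> v' i x = ?v i x" for i
      using v'(3)[of i] by (rule eventually_mono) simp
    show "partial i (mollify (t k) (b k) (r k) w') x = t k * mollify (t k) (b k) (r k) (v' i) x" if "x \<in> S" for k i x
      by (rule partial_mollify[OF r(2) w'(2) v'(2) sub[OF that] weak])
  qed
  moreover have "smooth (mollify (t k) (b k) (r k) w')" for k
    by (rule smooth_mollify[OF r(2) w'(2)])
  ultimately show thesis by (intro that)
qed

text \<open>Here the argument is expanded: \<open>t *\<^sub>R x + b\<close> equals
  \<open>x0 + (1 + s) *\<^sub>R (x - x0)\<close>, so the dilated function lives on a contracted copy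
  of \<open>S\<close>. The gap to the boundary is proportional to \<open>s\<close>, and a
  mollification radius \<open>s * \<rho>\<close> fits into it. The averages may leave
  \<open>S\<close>, therefore the weak derivative of \<open>w\<close> on the whole space is
  used.\<close>

lemma Lipschitz_H10:
  fixes w :: "real^'n \<Rightarrow> real" and D :: "'n \<Rightarrow> real^'n \<Rightarrow> real"
  assumes S: "open S" "bounded S" "convex S" "S \<noteq> {}"
    and L: "L \<ge> 0" "\<And>x y. \<bar>w x - w y\<bar> \<le> L * dist x y" and z: "\<And>x. x \<notin> S \<Longrightarrow> w x = 0"
    and D: "\<And>i. D i \<in> borel_measurable lebesgue"
    and lim: "\<And>i. AE x in lebesgue. (\<lambda>k. (w (x + (1 / real (Suc k)) *\<^sub>R axis i 1) - w x) * real (Suc k)) \<longlonglongrightarrow> D i x"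
  shows "w \<in> H10 S"
proof -
  note S' = open_lebesgue[OF S(1)]
  obtain R where R: "\<And>x. x \<in> S \<Longrightarrow> norm x \<le> R" using S(2) unfolding bounded_iff by blast
  have wR: "w x = 0" if "norm x > R" for x using z R[of x] that by force
  have c: "continuous_on UNIV w" by (rule Lipschitz_continuous[OF L])
  have wm: "w \<in> borel_measurable borel" by (rule borel_measurable_continuous_onI[OF c])
  obtain B where B: "\<And>x. \<bar>w x\<bar> \<le> B" using continuous_compact_support_bounded[OF c wR] by metis
  have wi: "integrable lborel w" by (rule bounded_support_integrable[OF wm B wR])
  have w2: "square_integrable lborel w" by (rule bounded_support_square_integrable(1)[OF wm B wR])
  note DL = Lipschitz_is_weak_partial(1)[OF open_UNIV L D lim]
  have wpU: "is_weak_partial UNIV i w (D i)" for i by (rule Lipschitz_is_weak_partial(2)[OF open_UNIV L D lim])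
  have wp: "is_weak_partial S i w (D i)" for i by (rule Lipschitz_is_weak_partial(2)[OF S(1) L D lim])
  have DS: "D i \<in> L2 S" for i
    unfolding L2_iff
  proof (rule bounded_square_integrable_on[OF S' S(2)])
    show "D i \<in> borel_measurable (lebesgue_on S)" by (rule measurable_restrict_space1[OF D])
    show "AE x in lebesgue_on S. \<bar>D i x\<bar> \<le> L"
      unfolding AE_lebesgue_on_iff[OF S'] using DL[of i] by (rule eventually_mono) simp
  qed
  have wH: "w \<in> H1 S" by (rule H1I[OF continuous_L2[OF S' S(2) c] wp DS])
  have D0: "AE x in lebesgue. norm x > R \<longrightarrow> D i x = 0" for i
    using lim[of i]
  proof (rule eventually_mono)
    fix x :: "real^'n"
    assume l: "(\<lambda>k. (w (x + (1 / real (Suc k)) *\<^sub>R axis i 1) - w x) * real (Suc k)) \<longlonglongrightarrow> D i x"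
    show "norm x > R \<longrightarrow> D i x = 0"
    proof
      assume x: "norm x > R"
      have "(\<lambda>k. inverse (real (Suc k))) \<longlonglongrightarrow> 0" by (rule LIMSEQ_inverse_real_of_nat)
      then have "\<forall>\<^sub>F k in sequentially. inverse (real (Suc k)) < norm x - R"
        using x by (intro order_tendstoD(2)) auto
      then have "\<forall>\<^sub>F k in sequentially. (w (x + (1 / real (Suc k)) *\<^sub>R axis i 1) - w x) * real (Suc k) = 0"
      proof (rule eventually_mono)
        fix k assume "inverse (real (Suc k)) < norm x - R"
        moreover have "norm x - norm ((1 / real (Suc k)) *\<^sub>R axis i (1::real) :: real^'n) \<le> norm (x + (1 / real (Suc k)) *\<^sub>R axis i 1)"
          using norm_triangle_ineq2[of x "- ((1 / real (Suc k)) *\<^sub>R axis i (1::real))"] by simp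
        moreover have "norm ((1 / real (Suc k)) *\<^sub>R axis i (1::real) :: real^'n) = inverse (real (Suc k))"
          by (simp add: norm_axis_1 divide_inverse)
        ultimately have "norm (x + (1 / real (Suc k)) *\<^sub>R axis i 1) > R" by linarith
        then show "(w (x + (1 / real (Suc k)) *\<^sub>R axis i 1) - w x) * real (Suc k) = 0"
          using wR x by simp
      qed
      then have "(\<lambda>k. (w (x + (1 / real (Suc k)) *\<^sub>R axis i 1) - w x) * real (Suc k)) \<longlonglongrightarrow> 0"
        by (rule tendsto_eventually)
      with l show "D i x = 0" by (rule LIMSEQ_unique)
    qed
  qed
  have "\<exists>D'. square_integrable lborel D' \<and> integrable lborel D' \<and> (AE x in lebesgue. D' x = D i x)" for i
  proof -
    obtain D1 where D1[measurable]: "D1 \<in> borel_measurable borel" and D1e: "AE x in lebesgue. D1 x = D i x"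
      using borel_representative[OF D] by blast
    \<comment> \<open>\<open>D i\<close> is bounded by \<open>L\<close> and vanishes beyond radius
      \<open>R\<close> only almost everywhere. Clamping and cutting off change it on a null set and
      make both bounds hold everywhere.\<close>
    define D' where "D' x = indicator (cball 0 R) x * max (-L) (min L (D1 x))" for x
    have D'm: "D' \<in> borel_measurable borel"
      unfolding D'_def[abs_def]
      by (intro borel_measurable_times borel_measurable_indicator borel_measurable_max borel_measurable_min borel_measurable_const D1) simp
    have b: "\<bar>D' x\<bar> \<le> L" "norm x > R \<Longrightarrow> D' x = 0" for x
      using L(1) by (auto simp: D'_def indicator_def)
    have "AE x in lebesgue. D' x = D i x"
      using D1e DL[of i] D0[of i]
      by eventually_elim (auto simp: D'_def indicator_def not_le)
    moreover have "square_integrable lborel D'" "integrable lborel D'"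
      by (rule bounded_support_square_integrable(1)[OF D'm b] bounded_support_integrable[OF D'm b]; simp)+
    ultimately show ?thesis by blast
  qed
  then obtain D' where D': "\<And>i. square_integrable lborel (D' i)" "\<And>i. integrable lborel (D' i)"
      "\<And>i. AE x in lebesgue. D' i x = D i x"
    by metis
  obtain x0 where "x0 \<in> S" using S(4) by blast
  then obtain \<rho> where \<rho>: "\<rho> > 0" "cball x0 \<rho> \<subseteq> S" using S(1) open_contains_cball by blast
  have x0i: "cball x0 \<rho> \<subseteq> interior S" using \<rho>(2) S(1) by (simp add: interior_open)
  define s where "s k = inverse (real (Suc k))" for k
  have s: "0 < s k" for k by (simp add: s_def)
  have s0: "s \<longlonglongrightarrow> 0" unfolding s_def by (rule LIMSEQ_inverse_real_of_nat)
  define t where "t k = 1 + s k" for k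
  define b where "b k = (- s k) *\<^sub>R x0" for k
  define r where "r k = s k * \<rho>" for k
  have t: "t \<longlonglongrightarrow> 1" unfolding t_def using tendsto_add[OF tendsto_const[of 1] s0] by simp
  have b: "b \<longlonglongrightarrow> 0" unfolding b_def using tendsto_scaleR[OF tendsto_minus[OF s0] tendsto_const[of x0]] by simp
  have r: "r \<longlonglongrightarrow> 0" "\<And>k. r k > 0" unfolding r_def using tendsto_mult_left_zero[OF s0, of \<rho>] s \<rho>(1) by auto
  let ?\<phi> = "\<lambda>k. mollify (t k) (b k) (r k) w"
  have weak: "(\<integral>y. w y * partial i \<psi> y \<partial>lborel) = - (\<integral>y. D' i y * \<psi> y \<partial>lborel)" if \<psi>: "\<psi> \<in> test_functions UNIV" for \<psi> i
  proof -
    have sm: "smooth \<psi>" by (rule test_function_smooth[OF \<psi>])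
    have m[measurable]: "\<psi> \<in> borel_measurable borel" "partial i \<psi> \<in> borel_measurable borel"
      by (intro borel_measurable_continuous_onI smooth_continuous sm smooth_partial)+
    note wm[measurable]
    have m'[measurable]: "D' i \<in> borel_measurable borel" using D'(2)[of i] by auto
    have "(\<integral>y. w y * partial i \<psi> y \<partial>lborel) = (\<integral>y. w y * partial i \<psi> y \<partial>lebesgue)"
      by (rule integral_completion[symmetric]) measurable
    moreover have "(\<integral>y. D' i y * \<psi> y \<partial>lborel) = (\<integral>y. D i y * \<psi> y \<partial>lebesgue)"
    proof (rule integral_lebesgue_eq_lborel)
      show "(\<lambda>y. D i y * \<psi> y) \<in> borel_measurable lebesgue"
        by (intro borel_measurable_times D borel_imp_lebesgue_measurable m)
      show "AE y in lebesgue. D' i y * \<psi> y = D i y * \<psi> y"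
        using D'(3)[of i] by (rule eventually_mono) simp
    qed measurable
    ultimately show ?thesis using is_weak_partialD(3)[OF wpU \<psi>] by (simp add: lebesgue_on_UNIV_eq)
  qed
  have conv: "(\<lambda>k. H1_norm S (\<lambda>x. ?\<phi> k x - w x)) \<longlonglongrightarrow> 0"
  proof (rule mollify_H1_norm_tendsto[OF S(1,2) wp w2 wi _ D'(1) _ t b r])
    show "AE x in lebesgue. x \<in> S \<longrightarrow> D' i x = D i x" for i
      using D'(3)[of i] by (rule eventually_mono) simp
    show "partial i (mollify (t k) (b k) (r k) w) x = t k * mollify (t k) (b k) (r k) (D' i) x" for k i x
      by (rule partial_mollify[OF r(2) wi D'(2) subset_UNIV weak])
  qed simp
  have sm: "smooth (?\<phi> k)" for k by (rule smooth_mollify[OF r(2) wi])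
  have test: "?\<phi> k \<in> test_functions S" for k
  proof -
    \<comment> \<open>From \<open>t *\<^sub>R x = y + s *\<^sub>R q\<close> it follows that
      \<open>x\<close> is the convex combination of \<open>y\<close> and \<open>q\<close> with
      weight \<open>s / t\<close> on \<open>q\<close>, because \<open>1 / t = 1 - s / t\<close> for
      \<open>t = 1 + s\<close>.\<close>
    define e where "e = s k / t k"
    have tk: "t k > 0" using s[of k] by (simp add: t_def)
    have e: "0 < e" "e \<le> 1" using s[of k] tk by (auto simp: e_def t_def)
    define K where "K = (\<lambda>p. (1 - e) *\<^sub>R fst p + e *\<^sub>R snd p) ` (closure S \<times> cball x0 \<rho>)"
    have Kc: "compact K" unfolding K_def
      by (intro compact_continuous_image compact_Times continuous_intros)
         (use S(2) in \<open>auto simp: compact_closure\<close>)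
    have KS: "K \<subseteq> S"
    proof
      fix y assume "y \<in> K"
      then obtain p q where y: "p \<in> closure S" "q \<in> cball x0 \<rho>" "y = (1 - e) *\<^sub>R p + e *\<^sub>R q" by (auto simp: K_def)
      have "p - e *\<^sub>R (p - q) \<in> interior S"
        by (rule mem_interior_closure_convex_shrink[OF S(3)]) (use y x0i e in auto)
      moreover have "p - e *\<^sub>R (p - q) = y" using y(3) by (simp add: algebra_simps)
      ultimately show "y \<in> S" using interior_subset by blast
    qed
    have out: "?\<phi> k x = 0" if x: "x \<notin> K" for x
    proof (rule mollify_outside[OF _ r(2)])
      fix y assume y: "norm (y - (t k *\<^sub>R x + b k)) < r k"
      show "w y = 0"
      proof (rule z, rule notI)
        assume yS: "y \<in> S"
        \<comment> \<open>\<open>q\<close> absorbs the offset of \<open>y\<close> from the centre of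
          the averaging ball; the radius \<open>s * \<rho>\<close> is chosen so that
          \<open>q\<close> stays within \<rho> of \<open>x0\<close>.\<close>
        define q where "q = x0 - (1 / s k) *\<^sub>R (y - (t k *\<^sub>R x + b k))"
        have "dist x0 q = norm (y - (t k *\<^sub>R x + b k)) / s k"
          using s[of k] by (simp add: q_def dist_norm)
        also have "\<dots> \<le> r k / s k" using y s[of k] by (intro divide_right_mono) auto
        also have "\<dots> = \<rho>" using s[of k] by (simp add: r_def)
        finally have q: "q \<in> cball x0 \<rho>" by simp
        have "s k *\<^sub>R q = s k *\<^sub>R x0 - (y - (t k *\<^sub>R x + b k))"
          using s[of k] by (simp add: q_def scaleR_diff_right)
        then have "t k *\<^sub>R x = y + s k *\<^sub>R q" by (simp add: b_def)
        then have "(1 / t k) *\<^sub>R (t k *\<^sub>R x) = (1 / t k) *\<^sub>R (y + s k *\<^sub>R q)" by simp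
        then have "x = (1 / t k) *\<^sub>R y + (s k / t k) *\<^sub>R q" using tk by (simp add: scaleR_add_right)
        moreover have "1 / t k = 1 - e" using tk by (simp add: e_def t_def field_simps)
        ultimately have "x = (1 - e) *\<^sub>R fst (y, q) + e *\<^sub>R snd (y, q)" by (simp add: e_def)
        moreover have "(y, q) \<in> closure S \<times> cball x0 \<rho>" using yS q closure_subset by auto
        ultimately have "x \<in> K" unfolding K_def by (rule image_eqI)
        then show False using x by simp
      qed
    qed
    then have "{x. ?\<phi> k x \<noteq> 0} \<subseteq> K" by blast
    then have cl: "closure {x. ?\<phi> k x \<noteq> 0} \<subseteq> K"
      by (rule closure_minimal) (rule compact_imp_closed[OF Kc])
    then have "compact (closure {x. ?\<phi> k x \<noteq> 0})"
      using bounded_subset[OF compact_imp_bounded[OF Kc]] by (simp add: compact_eq_bounded_closed)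
    with cl sm KS show ?thesis by (auto simp: test_functions_def)
  qed
  \<comment> \<open>\<open>H10\<close> measures \<open>w\<close> minus the test function, the limit
    the opposite difference. The weak derivatives of the two are independent choices, so symmetry is
    verified through explicit representatives.\<close>
  have sym: "H1_norm S (\<lambda>x. w x - ?\<phi> k x) = H1_norm S (\<lambda>x. ?\<phi> k x - w x)" for k
  proof -
    note sp = Ck1_is_weak_partial[OF S(1) smooth_Ck[OF sm[of k]]]
    have "H1_norm S (\<lambda>x. w x - ?\<phi> k x) = sqrt ((\<integral>x. (w x - ?\<phi> k x)\<^sup>2 \<partial>lebesgue_on S)
      + (\<Sum>i\<in>UNIV. \<integral>x. (D i x - partial i (?\<phi> k) x)\<^sup>2 \<partial>lebesgue_on S))"
      by (rule H1_norm_eq[OF S(1) is_weak_partial_diff[OF S(1) wp sp]])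
    moreover have "H1_norm S (\<lambda>x. ?\<phi> k x - w x) = sqrt ((\<integral>x. (?\<phi> k x - w x)\<^sup>2 \<partial>lebesgue_on S)
      + (\<Sum>i\<in>UNIV. \<integral>x. (partial i (?\<phi> k) x - D i x)\<^sup>2 \<partial>lebesgue_on S))"
      by (rule H1_norm_eq[OF S(1) is_weak_partial_diff[OF S(1) sp wp]])
    ultimately show ?thesis by (simp only: power2_commute)
  qed
  have "\<exists>\<phi>\<in>test_functions S. H1_norm S (\<lambda>x. w x - \<phi> x) < e" if e: "e > 0" for e
  proof -
    have "\<forall>\<^sub>F k in sequentially. H1_norm S (\<lambda>x. ?\<phi> k x - w x) < e"
      by (rule order_tendstoD(2)[OF conv e])
    then obtain k where "H1_norm S (\<lambda>x. ?\<phi> k x - w x) < e" by (auto simp: eventually_sequentially)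
    then show ?thesis using test sym by metis
  qed
  with wH show ?thesis by (simp add: H10_def)
qed

section \<open>Surface measure on hyperplanes and the trace inequality\<close>

lemma nn_integral_lborel_shift:
  fixes f :: "'a::euclidean_space \<Rightarrow> ennreal"
  assumes [measurable]: "f \<in> borel_measurable borel"
  shows "(\<integral>\<^sup>+x. f (x + c) \<partial>lborel) = (\<integral>\<^sup>+x. f x \<partial>lborel)"
proof -
  have "(\<integral>\<^sup>+x. f x \<partial>lborel) = (\<integral>\<^sup>+x. f x \<partial>distr lborel borel ((+) c))"
    by (simp add: lborel_distr_plus)
  also have "\<dots> = (\<integral>\<^sup>+x. f (c + x) \<partial>lborel)"
    by (rule nn_integral_distr) measurable
  finally show ?thesis by (simp add: add.commute)
qed

definition hproj :: "'a::euclidean_space \<Rightarrow> real \<Rightarrow> 'a \<Rightarrow> 'a" where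
  "hproj n \<beta> y = y - (n \<bullet> y - \<beta>) *\<^sub>R n"

lemma hproj_measurable[measurable]: "hproj n \<beta> \<in> borel_measurable borel"
  unfolding hproj_def by measurable

lemma hproj_shift:
  assumes "norm n = 1"
  shows "hproj n \<beta> (y + r *\<^sub>R n) = hproj n \<beta> y" "n \<bullet> (y + r *\<^sub>R n) = n \<bullet> y + r"
  using assms by (simp_all add: hproj_def inner_add_right dot_square_norm algebra_simps)

lemma closest_point_hyperplane:
  assumes "norm n = 1"
  shows "closest_point {x. n \<bullet> x = \<beta>} y = hproj n \<beta> y" "dist y (hproj n \<beta> y) = \<bar>n \<bullet> y - \<beta>\<bar>"
proof -
  show d: "dist y (hproj n \<beta> y) = \<bar>n \<bullet> y - \<beta>\<bar>" using assms by (simp add: hproj_def dist_norm)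
  have "hproj n \<beta> y = closest_point {x. n \<bullet> x = \<beta>} y"
  proof (rule closest_point_unique)
    show "hproj n \<beta> y \<in> {x. n \<bullet> x = \<beta>}"
      using assms by (simp add: hproj_def inner_diff_right dot_square_norm)
    show "\<forall>z\<in>{x. n \<bullet> x = \<beta>}. dist y (hproj n \<beta> y) \<le> dist y z"
    proof
      fix z assume "z \<in> {x. n \<bullet> x = \<beta>}"
      then have "n \<bullet> (y - z) = n \<bullet> y - \<beta>" by (simp add: inner_diff_right)
      then have "\<bar>n \<bullet> y - \<beta>\<bar> \<le> norm n * norm (y - z)"
        using Cauchy_Schwarz_ineq2[of n "y - z"] by simp
      then show "dist y (hproj n \<beta> y) \<le> dist y z" unfolding d using assms by (simp add: dist_norm)
    qed
  qed (simp_all add: convex_hyperplane closed_hyperplane)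
  then show "closest_point {x. n \<bullet> x = \<beta>} y = hproj n \<beta> y" by simp
qed

lemma face_measure_hyperplane:
  fixes e :: "(real^'n) set"
  assumes n: "norm n = 1" and e: "affine hull e = {x. n \<bullet> x = \<beta>}"
  shows "face_measure e = distr (restrict_space lborel {y. hproj n \<beta> y \<in> e \<and> \<bar>n \<bullet> y - \<beta>\<bar> \<le> 1/2}) borel (hproj n \<beta>)"
proof -
  have "closest_point {x. n \<bullet> x = \<beta>} = hproj n \<beta>"
    using closest_point_hyperplane(1)[OF n] by blast
  then show ?thesis
    unfolding face_measure_def e Let_def by (simp add: closest_point_hyperplane(2)[OF n])
qed

text \<open>Every facet integral becomes a volume integral over the prism of height 1, so from here
  on surface measure is handled by translations and Tonelli in the full space.\<close>

lemma nn_integral_face_measure: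
  fixes e :: "(real^'n) set"
  assumes n: "norm n = 1" and e: "affine hull e = {x. n \<bullet> x = \<beta>}" and [measurable]: "e \<in> sets borel"
    and [measurable]: "f \<in> borel_measurable borel"
  shows "(\<integral>\<^sup>+x. f x \<partial>face_measure e)
    = (\<integral>\<^sup>+y. f (hproj n \<beta> y) * indicator {y. hproj n \<beta> y \<in> e \<and> \<bar>n \<bullet> y - \<beta>\<bar> \<le> 1/2} y \<partial>lborel)"
proof -
  have "(\<integral>\<^sup>+x. f x \<partial>face_measure e)
    = (\<integral>\<^sup>+y. f (hproj n \<beta> y) \<partial>restrict_space lborel {y. hproj n \<beta> y \<in> e \<and> \<bar>n \<bullet> y - \<beta>\<bar> \<le> 1/2})"
    unfolding face_measure_hyperplane[OF n e]
    by (rule nn_integral_distr) (auto intro!: measurable_restrict_space1)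
  also have "\<dots> = (\<integral>\<^sup>+y. f (hproj n \<beta> y) * indicator {y. hproj n \<beta> y \<in> e \<and> \<bar>n \<bullet> y - \<beta>\<bar> \<le> 1/2} y \<partial>lborel)"
    by (rule nn_integral_restrict_space) simp
  finally show ?thesis .
qed

lemma abs_le_iff_mem_Icc: "\<bar>s\<bar> \<le> d \<longleftrightarrow> s \<in> {- d .. d}" for s d :: real
  by auto

lemma nn_integral_window:
  fixes s d :: real
  assumes "d > 0"
  shows "(\<integral>\<^sup>+r. indicator {r. \<bar>s - r\<bar> \<le> d} r \<partial>lborel) = ennreal (2 * d)"
proof -
  have "{r. \<bar>s - r\<bar> \<le> d} = {s - d .. s + d}" by auto
  then show ?thesis using assms by simp
qed

text \<open>Averaging over translations along \<open>n\<close> replaces Fubini's theorem in coordinates adapted to the hyperplane.\<close>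

lemma nn_integral_prism_fubini:
  fixes F :: "real^'n \<Rightarrow> real \<Rightarrow> ennreal"
  assumes n: "norm n = 1" and [measurable]: "(\<lambda>(x, r). F x r) \<in> borel_measurable (borel \<Otimes>\<^sub>M borel)"
  shows "(\<integral>\<^sup>+y. (\<integral>\<^sup>+r. F (hproj n \<beta> y) r \<partial>lborel) * indicator {y. \<bar>n \<bullet> y - \<beta>\<bar> \<le> 1/2} y \<partial>lborel)
    = (\<integral>\<^sup>+y. F (hproj n \<beta> y) (n \<bullet> y - \<beta>) \<partial>lborel)"
proof -
  let ?s = "\<lambda>y. n \<bullet> y - \<beta>"
  let ?I = "\<lambda>s. indicator {- (1/2) .. 1/2 :: real} s :: ennreal"
  have I: "indicator {y. \<bar>?s y\<bar> \<le> 1/2} y = ?I (?s y)" for y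
    by (simp only: indicator_def mem_Collect_eq abs_le_iff_mem_Icc)
  have "(\<integral>\<^sup>+y. (\<integral>\<^sup>+r. F (hproj n \<beta> y) r \<partial>lborel) * indicator {y. \<bar>?s y\<bar> \<le> 1/2} y \<partial>lborel)
    = (\<integral>\<^sup>+y. (\<integral>\<^sup>+r. F (hproj n \<beta> y) (r + ?s y) * ?I (?s y) \<partial>lborel) \<partial>lborel)"
  proof (rule nn_integral_cong)
    fix y
    have "(\<integral>\<^sup>+r. F (hproj n \<beta> y) (r + ?s y) \<partial>lborel) = (\<integral>\<^sup>+r. F (hproj n \<beta> y) r \<partial>lborel)"
      by (rule nn_integral_lborel_shift) measurable
    moreover have "(\<integral>\<^sup>+r. F (hproj n \<beta> y) (r + ?s y) * ?I (?s y) \<partial>lborel) = (\<integral>\<^sup>+r. F (hproj n \<beta> y) (r + ?s y) \<partial>lborel) * ?I (?s y)"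
      by (rule nn_integral_multc) measurable
    ultimately show "(\<integral>\<^sup>+r. F (hproj n \<beta> y) r \<partial>lborel) * indicator {y. \<bar>?s y\<bar> \<le> 1/2} y
      = (\<integral>\<^sup>+r. F (hproj n \<beta> y) (r + ?s y) * ?I (?s y) \<partial>lborel)"
      by (simp only: I)
  qed
  also have "\<dots> = (\<integral>\<^sup>+r. (\<integral>\<^sup>+y. F (hproj n \<beta> y) (r + ?s y) * ?I (?s y) \<partial>lborel) \<partial>lborel)"
    by (rule lborel_pair.Fubini'[symmetric]) measurable
  \<comment> \<open>A shift by \<open>r *\<^sub>R n\<close> keeps the projection and adds
    \<open>r\<close> to the height. Afterwards \<open>r\<close> occurs only in a window of length 1
    around the height, which integrates to 1.\<close>
  also have "\<dots> = (\<integral>\<^sup>+r. (\<integral>\<^sup>+y. F (hproj n \<beta> y) (?s y) * ?I (?s y - r) \<partial>lborel) \<partial>lborel)"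
  proof (rule nn_integral_cong)
    fix r :: real
    have sh: "?s (y + r *\<^sub>R n) = r + ?s y" for y using hproj_shift(2)[OF n, of y r] by simp
    have "(\<integral>\<^sup>+y. F (hproj n \<beta> (y + r *\<^sub>R n)) (?s (y + r *\<^sub>R n)) * ?I (?s (y + r *\<^sub>R n) - r) \<partial>lborel)
      = (\<integral>\<^sup>+y. F (hproj n \<beta> y) (?s y) * ?I (?s y - r) \<partial>lborel)"
      by (rule nn_integral_lborel_shift) measurable
    then show "(\<integral>\<^sup>+y. F (hproj n \<beta> y) (r + ?s y) * ?I (?s y) \<partial>lborel)
      = (\<integral>\<^sup>+y. F (hproj n \<beta> y) (?s y) * ?I (?s y - r) \<partial>lborel)"
      by (simp only: hproj_shift(1)[OF n] sh add_diff_cancel_left')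
  qed
  also have "\<dots> = (\<integral>\<^sup>+y. (\<integral>\<^sup>+r. F (hproj n \<beta> y) (?s y) * ?I (?s y - r) \<partial>lborel) \<partial>lborel)"
    by (rule lborel_pair.Fubini') measurable
  also have "\<dots> = (\<integral>\<^sup>+y. F (hproj n \<beta> y) (?s y) \<partial>lborel)"
  proof (rule nn_integral_cong)
    fix y
    have "?I (?s y - r) = indicator {r. \<bar>?s y - r\<bar> \<le> 1/2} r" for r
      by (simp only: indicator_def mem_Collect_eq abs_le_iff_mem_Icc)
    then show "(\<integral>\<^sup>+r. F (hproj n \<beta> y) (?s y) * ?I (?s y - r) \<partial>lborel) = F (hproj n \<beta> y) (?s y)"
      using nn_integral_window[of "1/2" "?s y"] by (simp add: nn_integral_cmult)
  qed
  finally show ?thesis .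
qed

text \<open>A smeared version of the shear that moves \<open>y\<close> along \<open>b\<close> by its
  height over the hyperplane: the amount \<open>r\<close> ranges within \<open>d\<close> of the
  height. For fixed \<open>r\<close> this is a translation parallel to the hyperplane, which
  preserves Lebesgue measure and leaves the window unchanged.\<close>

lemma nn_integral_shear_average:
  fixes f :: "real^'n \<Rightarrow> ennreal" and d :: real
  assumes b: "n \<bullet> b = 0" and d: "d > 0" and [measurable]: "f \<in> borel_measurable borel"
  shows "(\<integral>\<^sup>+y. (\<integral>\<^sup>+r. f (y + r *\<^sub>R b) * indicator {- d .. d} (n \<bullet> y - \<beta> - r) \<partial>lborel) \<partial>lborel)
    = ennreal (2 * d) * (\<integral>\<^sup>+y. f y \<partial>lborel)"
proof -
  let ?I = "\<lambda>y r. indicator {- d .. d} (n \<bullet> y - \<beta> - r) :: ennreal"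
  have "(\<integral>\<^sup>+y. (\<integral>\<^sup>+r. f (y + r *\<^sub>R b) * ?I y r \<partial>lborel) \<partial>lborel)
    = (\<integral>\<^sup>+r. (\<integral>\<^sup>+y. f (y + r *\<^sub>R b) * ?I y r \<partial>lborel) \<partial>lborel)"
    by (rule lborel_pair.Fubini'[symmetric]) measurable
  also have "\<dots> = (\<integral>\<^sup>+r. (\<integral>\<^sup>+y. f y * ?I y r \<partial>lborel) \<partial>lborel)"
  proof (rule nn_integral_cong)
    fix r :: real
    have "(\<integral>\<^sup>+y. f (y + r *\<^sub>R b) * ?I (y + r *\<^sub>R b) r \<partial>lborel) = (\<integral>\<^sup>+y. f y * ?I y r \<partial>lborel)"
      by (rule nn_integral_lborel_shift) measurable
    then show "(\<integral>\<^sup>+y. f (y + r *\<^sub>R b) * ?I y r \<partial>lborel) = (\<integral>\<^sup>+y. f y * ?I y r \<partial>lborel)"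
      by (simp add: inner_add_right b)
  qed
  also have "\<dots> = (\<integral>\<^sup>+y. (\<integral>\<^sup>+r. f y * ?I y r \<partial>lborel) \<partial>lborel)"
    by (rule lborel_pair.Fubini') measurable
  also have "\<dots> = (\<integral>\<^sup>+y. f y * ennreal (2 * d) \<partial>lborel)"
  proof (rule nn_integral_cong)
    fix y
    have "?I y r = indicator {r. \<bar>n \<bullet> y - \<beta> - r\<bar> \<le> d} r" for r
      by (simp only: indicator_def mem_Collect_eq abs_le_iff_mem_Icc)
    then show "(\<integral>\<^sup>+r. f y * ?I y r \<partial>lborel) = f y * ennreal (2 * d)"
      using nn_integral_window[OF d, of "n \<bullet> y - \<beta>"] by (simp add: nn_integral_cmult)
  qed
  also have "\<dots> = ennreal (2 * d) * (\<integral>\<^sup>+y. f y \<partial>lborel)"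
    by (simp add: nn_integral_multc mult.commute)
  finally show ?thesis .
qed

text \<open>The exact shear is reached as the window shrinks: lower semicontinuity bounds the
  sheared \<open>f\<close> by the limit inferior of the normalised averages, and Fatou's lemma gives
  the inequality. Measure preservation of the shear thus comes from translations alone, in the one
  direction that the trace estimate uses.\<close>

lemma nn_integral_shear_le:
  fixes f :: "real^'n \<Rightarrow> ennreal"
  assumes b: "n \<bullet> b = 0" and [measurable]: "f \<in> borel_measurable borel"
    and lsc: "\<And>y c. c < f y \<Longrightarrow> \<exists>\<delta>>0. \<forall>z. dist z y < \<delta> \<longrightarrow> c < f z"
  shows "(\<integral>\<^sup>+y. f (y + (n \<bullet> y - \<beta>) *\<^sub>R b) \<partial>lborel) \<le> (\<integral>\<^sup>+y. f y \<partial>lborel)"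
proof -
  let ?s = "\<lambda>y. n \<bullet> y - \<beta>"
  define d where "d k = inverse (real (Suc k))" for k
  have d: "d k > 0" for k by (simp add: d_def)
  have d0: "d \<longlonglongrightarrow> 0" unfolding d_def by (rule LIMSEQ_inverse_real_of_nat)
  let ?A = "\<lambda>k y. ennreal (1 / (2 * d k)) * (\<integral>\<^sup>+r. f (y + r *\<^sub>R b) * indicator {- d k .. d k} (?s y - r) \<partial>lborel)"
  have A: "(\<integral>\<^sup>+y. ?A k y \<partial>lborel) = (\<integral>\<^sup>+y. f y \<partial>lborel)" for k
  proof -
    have "(\<integral>\<^sup>+y. ?A k y \<partial>lborel) = ennreal (1 / (2 * d k)) * (ennreal (2 * d k) * (\<integral>\<^sup>+y. f y \<partial>lborel))"
      by (subst nn_integral_cmult) (simp_all add: nn_integral_shear_average[OF b d])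
    also have "\<dots> = (\<integral>\<^sup>+y. f y \<partial>lborel)"
      using d[of k] by (simp add: mult.assoc[symmetric] ennreal_mult[symmetric])
    finally show ?thesis .
  qed
  have le: "f (y + ?s y *\<^sub>R b) \<le> liminf (\<lambda>k. ?A k y)" for y
    unfolding le_Liminf_iff
  proof (intro allI impI)
    fix c assume "c < f (y + ?s y *\<^sub>R b)"
    then obtain c' where c': "c < c'" "c' < f (y + ?s y *\<^sub>R b)" using dense by blast
    from lsc[OF c'(2)] obtain \<delta> where \<delta>: "\<delta> > 0" "\<And>z. dist z (y + ?s y *\<^sub>R b) < \<delta> \<Longrightarrow> c' < f z" by blast
    have "\<forall>\<^sub>F k in sequentially. d k < \<delta> / (norm b + 1)"
      using \<delta>(1) by (intro order_tendstoD(2)[OF d0]) (simp add: add_nonneg_pos)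
    then show "\<forall>\<^sub>F k in sequentially. c < ?A k y"
    proof (rule eventually_mono)
      fix k assume k: "d k < \<delta> / (norm b + 1)"
      have "c' * ennreal (2 * d k) = (\<integral>\<^sup>+r. c' * indicator {r. \<bar>?s y - r\<bar> \<le> d k} r \<partial>lborel)"
        using nn_integral_window[OF d, of "?s y" k] by (simp add: nn_integral_cmult)
      also have "\<dots> \<le> (\<integral>\<^sup>+r. f (y + r *\<^sub>R b) * indicator {- d k .. d k} (?s y - r) \<partial>lborel)"
      proof (rule nn_integral_mono)
        fix r :: real
        show "c' * indicator {r. \<bar>?s y - r\<bar> \<le> d k} r \<le> f (y + r *\<^sub>R b) * indicator {- d k .. d k} (?s y - r)"
        proof (cases "\<bar>?s y - r\<bar> \<le> d k")
          case True
          have "dist (y + r *\<^sub>R b) (y + ?s y *\<^sub>R b) = \<bar>?s y - r\<bar> * norm b"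
            by (simp add: dist_norm scaleR_diff_left[symmetric] abs_minus_commute)
          also have "\<dots> \<le> d k * (norm b + 1)" using True d[of k] by (intro mult_mono) auto
          also have "\<dots> < \<delta>" using k by (simp add: pos_less_divide_eq add_nonneg_pos)
          finally have "c' < f (y + r *\<^sub>R b)" by (rule \<delta>(2))
          then show ?thesis using True by (auto simp: indicator_def)
        qed simp
      qed
      finally have "ennreal (1 / (2 * d k)) * (c' * ennreal (2 * d k)) \<le> ?A k y"
        by (rule mult_left_mono) simp
      moreover have "ennreal (1 / (2 * d k)) * (c' * ennreal (2 * d k)) = c'"
      proof -
        have "ennreal (1 / (2 * d k)) * ennreal (2 * d k) = 1"
          using d[of k] by (simp add: ennreal_mult[symmetric])
        then show ?thesis by (metis mult.commute mult.left_commute mult_1)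
      qed
      ultimately show "c < ?A k y" using c'(1) by simp
    qed
  qed
  have "(\<integral>\<^sup>+y. f (y + ?s y *\<^sub>R b) \<partial>lborel) \<le> (\<integral>\<^sup>+y. liminf (\<lambda>k. ?A k y) \<partial>lborel)"
    by (rule nn_integral_mono) (rule le)
  also have "\<dots> \<le> liminf (\<lambda>k. \<integral>\<^sup>+y. ?A k y \<partial>lborel)"
    by (rule nn_integral_liminf) measurable
  also have "\<dots> = (\<integral>\<^sup>+y. f y \<partial>lborel)" by (simp only: A Liminf_const[OF trivial_limit_sequentially])
  finally show ?thesis .
qed

text \<open>Openness of \<open>U\<close> gives lower semicontinuity of the cut-off function; this is
  why energies are integrated over the interior of a simplex.\<close>

lemma lsc_indicator_mult:
  fixes G :: "'a::metric_space \<Rightarrow> real"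
  assumes "open U" "continuous_on UNIV G" "c < ennreal (G y) * indicator U y"
  shows "\<exists>\<delta>>0. \<forall>z. dist z y < \<delta> \<longrightarrow> c < ennreal (G z) * indicator U z"
proof -
  have y: "y \<in> U" using assms(3) by (cases "y \<in> U") auto
  have "(G \<longlongrightarrow> G y) (at y)"
    using assms(2) by (simp add: continuous_on_eq_continuous_at isCont_def)
  then have "((\<lambda>z. ennreal (G z)) \<longlongrightarrow> ennreal (G y)) (at y)" by (rule tendsto_ennrealI)
  then have "\<forall>\<^sub>F z in at y. c < ennreal (G z)"
    by (rule order_tendstoD(1)) (use assms(3) y in simp)
  then have "\<forall>\<^sub>F z in nhds y. c < ennreal (G z)"
    using assms(3) y by (simp add: eventually_nhds_conv_at)
  moreover have "\<forall>\<^sub>F z in nhds y. z \<in> U" using assms(1) y by (rule eventually_nhds_in_open)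
  ultimately have "\<forall>\<^sub>F z in nhds y. c < ennreal (G z) * indicator U z"
    by eventually_elim simp
  then show ?thesis by (simp add: eventually_nhds_metric)
qed

section \<open>The trace inequality for smooth functions on lines and on part of a facet\<close>

definition energy :: "(real^'n \<Rightarrow> real) \<Rightarrow> real^'n \<Rightarrow> real" where
  "energy \<phi> x = (\<phi> x)\<^sup>2 + (\<Sum>i\<in>UNIV. (partial i \<phi> x)\<^sup>2)"

lemma energy_nonneg: "energy \<phi> x \<ge> 0"
  by (simp add: energy_def sum_nonneg)

lemma energy_continuous: "Ck (Suc 0) \<phi> \<Longrightarrow> continuous_on S (energy \<phi>)"
  unfolding energy_def using Ck_Suc_imp[of 0 \<phi>]
  by (intro continuous_intros) (auto intro: continuous_on_subset)

text \<open>Integrating the derivative of \<open>(1 - r / \<sigma>) (\<phi> (x + r d))\<^sup>2\<close> over \<open>[0, \<sigma>]\<close>.\<close>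

lemma trace_inequality_1d:
  fixes \<phi> :: "real^'n \<Rightarrow> real"
  assumes \<phi>: "Ck (Suc 0) \<phi>" and \<sigma>: "\<sigma> > 0"
  shows "ennreal ((\<phi> x)\<^sup>2) \<le> (\<integral>\<^sup>+r. ennreal ((1 / \<sigma> + 1 + (norm d)\<^sup>2) * energy \<phi> (x + r *\<^sub>R d)) * indicator {0..\<sigma>} r \<partial>lborel)"
proof -
  define D where "D r = (\<Sum>i\<in>UNIV. d $ i * partial i \<phi> (x + r *\<^sub>R d))" for r
  define G where "G r = (1 - r / \<sigma>) * (\<phi> (x + r *\<^sub>R d))\<^sup>2" for r
  define g where "g r = (- 1 / \<sigma>) * (\<phi> (x + r *\<^sub>R d))\<^sup>2 + (1 - r / \<sigma>) * (2 * \<phi> (x + r *\<^sub>R d) * D r)" for r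
  define h where "h r = (1 / \<sigma> + 1 + (norm d)\<^sup>2) * energy \<phi> (x + r *\<^sub>R d)" for r
  have c0: "continuous_on UNIV \<phi>" using Ck_Suc_imp[OF \<phi>] by simp
  have c1: "continuous_on UNIV (partial i \<phi>)" for i using \<phi> by simp
  have lc: "continuous_on UNIV (\<lambda>r. f (x + r *\<^sub>R d))" if "continuous_on UNIV f" for f :: "real^'n \<Rightarrow> real"
    by (rule continuous_on_compose2[OF that]) (auto intro!: continuous_intros)
  have \<phi>': "((\<lambda>r. \<phi> (x + r *\<^sub>R d)) has_real_derivative D r) (at r)" for r
  proof -
    have dd: "\<phi> differentiable at (x + r *\<^sub>R d)" using \<phi> by simp
    have l: "((\<lambda>r. x + r *\<^sub>R d) has_derivative (\<lambda>k. k *\<^sub>R d)) (at r)" by (auto intro!: derivative_eq_intros)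
    from has_derivative_compose[where g=\<phi>, OF l differentiable_has_derivative_partial[OF dd]]
    have "((\<lambda>r. \<phi> (x + r *\<^sub>R d)) has_derivative (\<lambda>k. \<Sum>i\<in>UNIV. (k *\<^sub>R d) $ i * partial i \<phi> (x + r *\<^sub>R d))) (at r)" .
    moreover have "(\<Sum>i\<in>UNIV. (k *\<^sub>R d) $ i * partial i \<phi> (x + r *\<^sub>R d)) = D r * k" for k
      by (simp add: D_def sum_distrib_left mult.assoc mult.commute[of _ k])
    ultimately show ?thesis by (simp add: has_field_derivative_def)
  qed
  have G': "(G has_real_derivative g r) (at r)" for r
    unfolding G_def g_def
    by (rule derivative_eq_intros \<phi>' refl | use \<sigma> in simp)+
  have gc: "continuous_on UNIV g"
    unfolding g_def D_def using \<sigma> by (intro continuous_intros lc c0 c1) auto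
  have hc: "continuous_on UNIV h"
    unfolding h_def by (intro continuous_intros lc energy_continuous \<phi>)
  have "(\<integral>r. g r * indicator {0..\<sigma>} r \<partial>lborel) = G \<sigma> - G 0"
    by (rule integral_FTC_Icc_real) (use \<sigma> G' gc in \<open>auto simp: continuous_on_eq_continuous_at\<close>)
  then have FTC: "(\<phi> x)\<^sup>2 = (\<integral>r. - (g r * indicator {0..\<sigma>} r) \<partial>lborel)"
    using \<sigma> by (simp add: G_def)
  have ib: "integrable lborel (\<lambda>r. f r * indicator {0..\<sigma>} r)" if "continuous_on UNIV f" for f :: "real \<Rightarrow> real"
  proof -
    have "integrable lborel (\<lambda>r. indicator {0..\<sigma>} r *\<^sub>R f r)"
      by (rule borel_integrable_compact[OF compact_Icc]) (rule continuous_on_subset[OF that], simp)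
    then show ?thesis by (simp add: mult.commute)
  qed
  have D2: "(D r)\<^sup>2 \<le> (norm d)\<^sup>2 * (\<Sum>i\<in>UNIV. (partial i \<phi> (x + r *\<^sub>R d))\<^sup>2)" for r
  proof -
    have "D r = d \<bullet> (\<chi> i. partial i \<phi> (x + r *\<^sub>R d))" by (simp add: D_def inner_vec_def)
    then show ?thesis
      using Cauchy_Schwarz_ineq[of d "\<chi> i. partial i \<phi> (x + r *\<^sub>R d)"]
      by (simp add: dot_square_norm[symmetric]) (simp add: inner_vec_def power2_eq_square)
  qed
  have bound: "- g r \<le> h r" if r: "0 \<le> r" "r \<le> \<sigma>" for r
  proof -
    let ?p = "\<phi> (x + r *\<^sub>R d)" and ?S = "\<Sum>i\<in>UNIV. (partial i \<phi> (x + r *\<^sub>R d))\<^sup>2"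
    have S: "?S \<ge> 0" by (simp add: sum_nonneg)
    have w: "0 \<le> 1 - r / \<sigma>" "1 - r / \<sigma> \<le> 1" using r \<sigma> by auto
    have "- (2 * ?p * D r) \<le> ?p\<^sup>2 + (D r)\<^sup>2"
      using zero_le_power2[of "?p + D r"] by (simp add: power2_eq_square algebra_simps)
    then have "(1 - r / \<sigma>) * (- (2 * ?p * D r)) \<le> (1 - r / \<sigma>) * (?p\<^sup>2 + (D r)\<^sup>2)"
      using w by (intro mult_left_mono) auto
    also have "\<dots> \<le> 1 * (?p\<^sup>2 + (D r)\<^sup>2)" using w by (intro mult_right_mono) auto
    finally have "- g r \<le> (1 / \<sigma>) * ?p\<^sup>2 + ?p\<^sup>2 + (norm d)\<^sup>2 * ?S"
      using D2[of r] by (simp add: g_def)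
    also have "\<dots> \<le> h r"
    proof -
      have "0 \<le> (1 / \<sigma>) * ?S + ?S + (norm d)\<^sup>2 * ?p\<^sup>2" using S \<sigma> by simp
      then show ?thesis by (simp add: h_def energy_def algebra_simps)
    qed
    finally show ?thesis .
  qed
  have "(\<phi> x)\<^sup>2 \<le> (\<integral>r. h r * indicator {0..\<sigma>} r \<partial>lborel)"
    unfolding FTC
  proof (rule integral_mono)
    show "- (g r * indicator {0..\<sigma>} r) \<le> h r * indicator {0..\<sigma>} r" for r
      using bound[of r] by (auto simp: indicator_def)
  qed (use ib[OF gc] ib[OF hc] in simp_all)
  then have "ennreal ((\<phi> x)\<^sup>2) \<le> ennreal (\<integral>r. h r * indicator {0..\<sigma>} r \<partial>lborel)" by (rule ennreal_leI)
  also have "\<dots> = (\<integral>\<^sup>+r. ennreal (h r * indicator {0..\<sigma>} r) \<partial>lborel)"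
  proof (rule nn_integral_eq_integral[symmetric, OF ib[OF hc]], rule AE_I2)
    show "0 \<le> h r * indicator {0..\<sigma>} r" for r
      unfolding h_def using \<sigma> by (intro mult_nonneg_nonneg energy_nonneg) auto
  qed
  also have "\<dots> = (\<integral>\<^sup>+r. ennreal (h r) * indicator {0..\<sigma>} r \<partial>lborel)"
    by (intro nn_integral_cong) (auto simp: indicator_def)
  finally show ?thesis by (simp only: h_def)
qed

text \<open>From a point of the piece, the segment in direction \<open>d\<close> up to length
  \<sigma> runs in the interior of \<open>K\<close> by convexity. The line estimate is integrated
  over the piece; since \<open>n \<bullet> d = 1\<close>, the parameter on the segment is the
  height, and Tonelli in foot and height turns the double integral into a volume integral. The
  oblique direction leaves the shear along \<open>d - n\<close>, which does not increase it.\<close>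

lemma trace_inequality_piece:
  fixes K e :: "(real^'n) set" and \<phi> :: "real^'n \<Rightarrow> real"
  assumes \<phi>: "Ck (Suc 0) \<phi>" and \<sigma>: "\<sigma> > 0" and n: "norm n = 1" and e: "affine hull e = {x. n \<bullet> x = \<beta>}"
    and eb[measurable]: "e \<in> sets borel" and K: "convex K" "e \<subseteq> K" and d: "n \<bullet> d = 1"
  shows "(\<integral>\<^sup>+x. ennreal ((\<phi> x)\<^sup>2) * indicator {x \<in> e. x + \<sigma> *\<^sub>R d \<in> interior K} x \<partial>face_measure e)
    \<le> ennreal (1 / \<sigma> + 1 + (norm d)\<^sup>2) * (\<integral>\<^sup>+x. ennreal (energy \<phi> x) * indicator (interior K) x \<partial>lborel)"
proof -
  let ?C = "1 / \<sigma> + 1 + (norm d)\<^sup>2"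
  have C: "?C \<ge> 0" using \<sigma> by simp
  have c0: "continuous_on UNIV \<phi>" using Ck_Suc_imp[OF \<phi>] by simp
  have [measurable]: "\<phi> \<in> borel_measurable borel" by (rule borel_measurable_continuous_onI[OF c0])
  have Gc: "continuous_on UNIV (energy \<phi>)" by (rule energy_continuous[OF \<phi>])
  have [measurable]: "energy \<phi> \<in> borel_measurable borel" by (rule borel_measurable_continuous_onI[OF Gc])
  have [measurable]: "interior K \<in> sets borel" by (rule borel_open[OF open_interior])
  define e' where "e' = {x \<in> e. x + \<sigma> *\<^sub>R d \<in> interior K}"
  have [measurable]: "e' \<in> sets borel"
  proof -
    have "open ((\<lambda>x. x + \<sigma> *\<^sub>R d) -` interior K)"
      by (rule open_vimage[OF open_interior]) (intro continuous_intros)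
    moreover have "e' = e \<inter> (\<lambda>x. x + \<sigma> *\<^sub>R d) -` interior K" by (auto simp: e'_def)
    ultimately show ?thesis using eb by (simp add: borel_open)
  qed
  define f where "f x = ennreal (energy \<phi> x) * indicator (interior K) x" for x
  have fm[measurable]: "f \<in> borel_measurable borel" unfolding f_def by measurable
  define F where "F x r = ennreal (?C * energy \<phi> (x + r *\<^sub>R d)) * indicator {0..\<sigma>} r * indicator e' x" for x and r :: real
  have Fm: "(\<lambda>(x, r). F x r) \<in> borel_measurable (borel \<Otimes>\<^sub>M borel)"
    unfolding F_def by measurable
  let ?P = "hproj n \<beta>" and ?s = "\<lambda>y. n \<bullet> y - \<beta>"
  have "(\<integral>\<^sup>+x. ennreal ((\<phi> x)\<^sup>2) * indicator e' x \<partial>face_measure e)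
    = (\<integral>\<^sup>+y. (ennreal ((\<phi> (?P y))\<^sup>2) * indicator e' (?P y)) * indicator {y. ?P y \<in> e \<and> \<bar>?s y\<bar> \<le> 1/2} y \<partial>lborel)"
    by (rule nn_integral_face_measure[OF n e eb]) measurable
  also have "\<dots> \<le> (\<integral>\<^sup>+y. (\<integral>\<^sup>+r. F (?P y) r \<partial>lborel) * indicator {y. \<bar>?s y\<bar> \<le> 1/2} y \<partial>lborel)"
  proof (rule nn_integral_mono)
    fix y
    have "ennreal ((\<phi> (?P y))\<^sup>2) * indicator e' (?P y) \<le> (\<integral>\<^sup>+r. F (?P y) r \<partial>lborel)"
    proof -
      have "ennreal ((\<phi> (?P y))\<^sup>2) * indicator e' (?P y) \<le>
        (\<integral>\<^sup>+r. ennreal (?C * energy \<phi> (?P y + r *\<^sub>R d)) * indicator {0..\<sigma>} r \<partial>lborel) * indicator e' (?P y)"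
        by (rule mult_right_mono[OF trace_inequality_1d[OF \<phi> \<sigma>]]) simp
      also have "\<dots> = (\<integral>\<^sup>+r. F (?P y) r \<partial>lborel)"
        unfolding F_def by (rule nn_integral_multc[symmetric]) measurable
      finally show ?thesis .
    qed
    then show "(ennreal ((\<phi> (?P y))\<^sup>2) * indicator e' (?P y)) * indicator {y. ?P y \<in> e \<and> \<bar>?s y\<bar> \<le> 1/2} y
      \<le> (\<integral>\<^sup>+r. F (?P y) r \<partial>lborel) * indicator {y. \<bar>?s y\<bar> \<le> 1/2} y"
      by (auto simp: indicator_def)
  qed
  also have "\<dots> = (\<integral>\<^sup>+y. F (?P y) (?s y) \<partial>lborel)"
    by (rule nn_integral_prism_fubini[OF n Fm])
  also have "\<dots> \<le> (\<integral>\<^sup>+y. ennreal ?C * f (y + ?s y *\<^sub>R (d - n)) \<partial>lborel)"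
  proof (rule nn_integral_mono_AE)
    \<comment> \<open>At height zero the segment starts on the boundary of \<open>K\<close>, where
      membership in the interior fails; the hyperplane is discarded as a null set.\<close>
    have "AE y in lborel. y \<notin> {y. n \<bullet> y = \<beta>}"
    proof -
      have "n \<noteq> 0" using n by auto
      then have "negligible {y. n \<bullet> y = \<beta>}" by (intro negligible_hyperplane) simp
      then have "{y. n \<bullet> y = \<beta>} \<in> null_sets lebesgue" by (simp add: negligible_iff_null_sets)
      from AE_not_in[OF this] show ?thesis by (simp add: AE_completion_iff)
    qed
    then show "AE y in lborel. F (?P y) (?s y) \<le> ennreal ?C * f (y + ?s y *\<^sub>R (d - n))"
    proof (rule eventually_mono)
      fix y assume "y \<notin> {y. n \<bullet> y = \<beta>}"
      then have s0: "?s y \<noteq> 0" by simp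
      have eq: "?P y + ?s y *\<^sub>R d = y + ?s y *\<^sub>R (d - n)" by (simp add: hproj_def algebra_simps)
      show "F (?P y) (?s y) \<le> ennreal ?C * f (y + ?s y *\<^sub>R (d - n))"
      proof (cases "?P y \<in> e' \<and> 0 \<le> ?s y \<and> ?s y \<le> \<sigma>")
        case True
        have "?P y - (?s y / \<sigma>) *\<^sub>R (?P y - (?P y + \<sigma> *\<^sub>R d)) \<in> interior K"
          by (rule mem_interior_convex_shrink[OF K(1)]) (use True s0 \<sigma> K(2) in \<open>auto simp: e'_def\<close>)
        then have "y + ?s y *\<^sub>R (d - n) \<in> interior K" using \<sigma> eq by simp
        then show ?thesis using True C
          by (simp add: F_def f_def eq ennreal_mult energy_nonneg)
      next
        case False
        then have "F (?P y) (?s y) = 0" by (auto simp: F_def indicator_def)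
        then show ?thesis by simp
      qed
    qed
  qed
  also have "\<dots> = ennreal ?C * (\<integral>\<^sup>+y. f (y + ?s y *\<^sub>R (d - n)) \<partial>lborel)"
    by (rule nn_integral_cmult) measurable
  also have "\<dots> \<le> ennreal ?C * (\<integral>\<^sup>+y. f y \<partial>lborel)"
  proof (rule mult_left_mono)
    show "(\<integral>\<^sup>+y. f (y + ?s y *\<^sub>R (d - n)) \<partial>lborel) \<le> (\<integral>\<^sup>+y. f y \<partial>lborel)"
    proof (rule nn_integral_shear_le)
      show "n \<bullet> (d - n) = 0" using d n by (simp add: inner_diff_right dot_square_norm)
      show "\<exists>\<delta>>0. \<forall>z. dist z y < \<delta> \<longrightarrow> c < f z" if "c < f y" for y c
        unfolding f_def by (rule lsc_indicator_mult[OF open_interior Gc]) (use that in \<open>simp add: f_def\<close>)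
    qed measurable
  qed simp
  finally show ?thesis by (simp only: e'_def f_def)
qed

section \<open>Facets of simplices\<close>

lemma nn_integral_face_measure_on:
  fixes e :: "(real^'n) set"
  assumes n: "norm n = 1" and e: "affine hull e = {x. n \<bullet> x = \<beta>}" and eb[measurable]: "e \<in> sets borel"
    and [measurable]: "f \<in> borel_measurable borel"
  shows "(\<integral>\<^sup>+x. f x \<partial>face_measure e) = (\<integral>\<^sup>+x. f x * indicator e x \<partial>face_measure e)"
proof -
  have "(\<integral>\<^sup>+x. f x * indicator e x \<partial>face_measure e)
    = (\<integral>\<^sup>+y. (f (hproj n \<beta> y) * indicator e (hproj n \<beta> y)) * indicator {y. hproj n \<beta> y \<in> e \<and> \<bar>n \<bullet> y - \<beta>\<bar> \<le> 1/2} y \<partial>lborel)"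
    by (rule nn_integral_face_measure[OF n e eb]) measurable
  also have "\<dots> = (\<integral>\<^sup>+y. f (hproj n \<beta> y) * indicator {y. hproj n \<beta> y \<in> e \<and> \<bar>n \<bullet> y - \<beta>\<bar> \<le> 1/2} y \<partial>lborel)"
    by (rule nn_integral_cong) (auto simp: indicator_def)
  also have "\<dots> = (\<integral>\<^sup>+x. f x \<partial>face_measure e)"
    by (rule nn_integral_face_measure[OF n e eb, symmetric]) measurable
  finally show ?thesis by simp
qed

lemma sets_face_measure [simp, measurable_cong]: "sets (face_measure e) = sets borel"
  by (simp add: face_measure_def Let_def)

lemma space_face_measure [simp]: "space (face_measure e) = UNIV"
  by (simp add: face_measure_def Let_def)

lemma measurable_face_measure [simp]: "f \<in> borel_measurable (face_measure e) \<longleftrightarrow> f \<in> borel_measurable borel"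
  by (simp cong: measurable_cong_sets)

lemma face_measure_AE_finite:
  fixes e :: "(real^'n) set"
  assumes n: "norm n = 1" and e: "affine hull e = {x. n \<bullet> x = \<beta>}" and c: "compact e"
  shows "AE x in face_measure e. x \<in> e" and "finite_measure (face_measure e)"
proof -
  have eb[measurable]: "e \<in> sets borel" using c by (simp add: borel_compact)
  have "emeasure (face_measure e) (- e) = (\<integral>\<^sup>+x. indicator (- e) x \<partial>face_measure e)"
    using eb by simp
  also have "\<dots> = (\<integral>\<^sup>+x. indicator (- e) x * indicator e x \<partial>face_measure e)"
    by (rule nn_integral_face_measure_on[OF n e eb]) measurable
  also have "\<dots> = (\<integral>\<^sup>+x. 0 \<partial>face_measure e)"
    by (rule nn_integral_cong) (auto simp: indicator_def)
  finally have "emeasure (face_measure e) (- e) = 0" by simp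
  then show "AE x in face_measure e. x \<in> e"
    using eb by (subst AE_iff_measurable[where N="- e"]) auto
  obtain R where R: "\<And>x. x \<in> e \<Longrightarrow> norm x \<le> R" using compact_imp_bounded[OF c] unfolding bounded_iff by blast
  have "emeasure (face_measure e) UNIV = (\<integral>\<^sup>+x. 1 \<partial>face_measure e)" by simp
  also have "\<dots> = (\<integral>\<^sup>+y. 1 * indicator {y. hproj n \<beta> y \<in> e \<and> \<bar>n \<bullet> y - \<beta>\<bar> \<le> 1/2} y \<partial>lborel)"
    by (rule nn_integral_face_measure[OF n e eb]) measurable
  also have "\<dots> \<le> (\<integral>\<^sup>+y. indicator (cball (0::real^'n) (R + 1/2)) y \<partial>lborel)"
  proof (rule nn_integral_mono)
    fix y :: "real^'n"
    have "y \<in> cball 0 (R + 1/2)" if "hproj n \<beta> y \<in> e" "\<bar>n \<bullet> y - \<beta>\<bar> \<le> 1/2"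
      using closest_point_hyperplane(2)[OF n, of y \<beta>] R[OF that(1)] that(2)
        norm_triangle_ineq2[of y "hproj n \<beta> y"] by (simp add: dist_norm)
    then show "1 * indicator {y. hproj n \<beta> y \<in> e \<and> \<bar>n \<bullet> y - \<beta>\<bar> \<le> 1/2} y \<le> (indicator (cball 0 (R + 1/2)) y :: ennreal)"
      by (auto simp: indicator_def)
  qed
  also have "\<dots> < \<infinity>" using emeasure_lborel_cball_finite[of "0::real^'n" "R + 1/2"] by simp
  finally show "finite_measure (face_measure e)"
    by (intro finite_measureI) auto
qed

lemma simplex_interior_nonempty:
  fixes K :: "(real^'n) set"
  assumes "int CARD('n) simplex K"
  shows "interior K \<noteq> {}"
proof -
  have "aff_dim K = int CARD('n)" by (rule aff_dim_simplex[OF assms])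
  then have "affine hull K = UNIV" by (simp add: aff_dim_eq_full[symmetric])
  then have "rel_interior K = interior K" by (rule rel_interior_interior)
  moreover have "K \<noteq> {}" using \<open>affine hull K = UNIV\<close> by auto
  ultimately show ?thesis using rel_interior_eq_empty[OF convex_simplex[OF assms]] by simp
qed

lemma simplex_facet:
  fixes K e :: "(real^'n) set"
  assumes K: "int CARD('n) simplex K" and e: "e facet_of K"
  obtains n \<beta> A where "norm n = 1" "affine hull e = {x. n \<bullet> x = \<beta>}" "finite A" "A \<noteq> {}" "e = convex hull A"
    "\<And>x. x \<in> K \<Longrightarrow> n \<bullet> x \<ge> \<beta>" "\<And>x. x \<in> interior K \<Longrightarrow> n \<bullet> x > \<beta>"
proof -
  obtain C where C: "finite C" "\<not> affine_dependent C" "int (card C) = int CARD('n) + 1" "K = convex hull C"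
    using K unfolding simplex by blast
  have "2 \<le> card C \<and> (\<exists>u. u \<in> C \<and> e = convex hull (C - {u}))"
    using e facet_of_convex_hull_affine_independent_alt[OF C(2)] unfolding C(4) by blast
  then obtain u where u: "u \<in> C" "e = convex hull (C - {u})" by blast
  have "aff_dim e = int DIM(real^'n) - 1"
    using e aff_dim_simplex[OF K] by (simp add: facet_of_def)
  then obtain a b where a: "a \<noteq> 0" "affine hull e = {x. a \<bullet> x = b}"
    using aff_dim_eq_hyperplane[of e] by auto
  have ene: "e \<noteq> {}" using e by (simp add: facet_of_def)
  \<comment> \<open>Orients the normal towards the vertex \<open>u\<close> opposite to the facet;
    all other vertices lie on the hyperplane itself, so \<open>K\<close> is on the nonnegative
    side.\<close>
  define sg where "sg = (if a \<bullet> u \<ge> b then 1 else - 1 :: real)"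
  define c where "c = sg / norm a"
  define n where "n = c *\<^sub>R a"
  define \<beta> where "\<beta> = c * b"
  have c0: "c \<noteq> 0" using a(1) by (auto simp: c_def sg_def)
  have n: "norm n = 1" using a(1) by (auto simp: n_def c_def sg_def)
  have H: "affine hull e = {x. n \<bullet> x = \<beta>}"
    using a(2) c0 by (simp add: n_def \<beta>_def)
  have eH: "n \<bullet> x = \<beta>" if "x \<in> e" for x
    using hull_subset[of e affine] that H by blast
  have "sg * (a \<bullet> u) \<ge> sg * b" by (simp add: sg_def)
  then have "sg * (a \<bullet> u) / norm a \<ge> sg * b / norm a" by (rule divide_right_mono) simp
  then have nu: "n \<bullet> u \<ge> \<beta>" by (simp add: n_def \<beta>_def c_def)
  have "C \<subseteq> {x. n \<bullet> x \<ge> \<beta>}"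
  proof
    fix x assume "x \<in> C"
    then have "x = u \<or> x \<in> e" using u(2) hull_subset[of "C - {u}" convex] by blast
    then show "x \<in> {x. n \<bullet> x \<ge> \<beta>}" using nu eH by auto
  qed
  then have KH: "K \<subseteq> {x. n \<bullet> x \<ge> \<beta>}"
    unfolding C(4) by (rule hull_minimal) (rule convex_halfspace_ge)
  have "n \<noteq> 0" using n by auto
  then have "interior K \<subseteq> {x. n \<bullet> x > \<beta>}"
    using interior_mono[OF KH] by (simp add: interior_halfspace_ge)
  show thesis
  proof (rule that[OF n H _ _ u(2)])
    show "C - {u} \<noteq> {}" using ene u(2) by auto
  qed (use C(1) KH \<open>interior K \<subseteq> _\<close> in auto)
qed

text \<open>Some barycentric weight of \<open>x\<close> is at least \<open>1 / card A\<close>.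
  Taking off half of that bound leaves room for renormalisation: the remaining mass
  \<open>1 - c\<close> is positive even when \<open>A\<close> has a single element.\<close>

lemma convex_hull_weight_shift:
  assumes A: "finite A" "A \<noteq> {}" and x: "x \<in> convex hull A"
  obtains a p where "a \<in> A" "p \<in> convex hull A"
    "x = (1 - 1 / (2 * real (card A))) *\<^sub>R p + (1 / (2 * real (card A))) *\<^sub>R a"
proof -
  define c where "c = 1 / (2 * real (card A))"
  have N: "real (card A) \<ge> 1" using A by (simp add: Suc_le_eq card_gt_0_iff)
  have c: "0 < c" "c < 1" using N by (auto simp: c_def divide_simps)
  obtain w where w: "\<And>a. a \<in> A \<Longrightarrow> w a \<ge> 0" "sum w A = 1" "(\<Sum>a\<in>A. w a *\<^sub>R a) = x"
    using x unfolding convex_hull_finite[OF A(1)] by blast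
  have "\<exists>a\<in>A. w a \<ge> c"
  proof (rule ccontr)
    assume "\<not> ?thesis"
    then have "sum w A \<le> (\<Sum>a\<in>A. c)" by (intro sum_mono) auto
    also have "\<dots> = 1 / 2" using N by (simp add: c_def)
    finally show False using w(2) by simp
  qed
  then obtain a where a: "a \<in> A" "w a \<ge> c" by blast
  define w' where "w' b = (w b - (if b = a then c else 0)) / (1 - c)" for b
  have s1: "sum w' A = 1"
    using A(1) a(1) c w(2) by (simp add: w'_def sum_divide_distrib[symmetric] sum_subtractf)
  define p where "p = (\<Sum>b\<in>A. w' b *\<^sub>R b)"
  have "p \<in> convex hull A"
    unfolding convex_hull_finite[OF A(1)]
    using w(1) a c s1 by (intro CollectI exI[of _ w']) (auto simp: w'_def p_def)
  moreover have "(1 - c) *\<^sub>R p = x - c *\<^sub>R a"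
  proof -
    have "(1 - c) *\<^sub>R p = (\<Sum>b\<in>A. (w b - (if b = a then c else 0)) *\<^sub>R b)"
      using c by (simp add: p_def w'_def scaleR_sum_right)
    also have "\<dots> = (\<Sum>b\<in>A. w b *\<^sub>R b) - (\<Sum>b\<in>A. (if b = a then c else 0) *\<^sub>R b)"
      by (simp add: scaleR_diff_left sum_subtractf)
    also have "(\<Sum>b\<in>A. (if b = a then c else 0) *\<^sub>R b) = (\<Sum>b\<in>A. if b = a then c *\<^sub>R a else 0)"
      by (rule sum.cong) auto
    also have "\<dots> = c *\<^sub>R a" using A(1) a(1) by simp
    finally show ?thesis using w(3) by simp
  qed
  ultimately show thesis using a(1) by (intro that[of a p]) (auto simp: c_def)
qed

text \<open>Sections of a simplex parallel to a facet shrink, so in general one translation does not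
  carry the whole facet into the interior. The facet is therefore covered by pieces, one for each of
  its vertices \<open>a\<close>: where the weight of \<open>a\<close> is at least \<open>c\<close>,
  replacing that share of \<open>a\<close> by the interior point \<open>z\<close> lands in the
  interior. The constants of the pieces are added.\<close>

lemma trace_inequality:
  fixes K e :: "(real^'n) set"
  assumes K: "int CARD('n) simplex K" and e: "e facet_of K"
  obtains C where "C \<ge> 0" "\<And>\<phi>. Ck (Suc 0) \<phi> \<Longrightarrow> (\<integral>\<^sup>+x. ennreal ((\<phi> x)\<^sup>2) \<partial>face_measure e)
    \<le> ennreal C * (\<integral>\<^sup>+x. ennreal (energy \<phi> x) * indicator (interior K) x \<partial>lborel)"
proof -
  obtain n \<beta> A where n: "norm n = 1" "affine hull e = {x. n \<bullet> x = \<beta>}" and A: "finite A" "A \<noteq> {}" "e = convex hull A"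
    and KH: "\<And>x. x \<in> interior K \<Longrightarrow> n \<bullet> x > \<beta>"
    using simplex_facet[OF K e] by metis
  obtain z where z: "z \<in> interior K" using simplex_interior_nonempty[OF K] by blast
  have eK: "e \<subseteq> K" by (rule facet_of_imp_subset[OF e])
  have ec: "compact e" unfolding A(3) by (rule finite_imp_compact_convex_hull[OF A(1)])
  then have eb[measurable]: "e \<in> sets borel" by (simp add: borel_compact)
  define h where "h = n \<bullet> z - \<beta>"
  have h: "h > 0" using KH[OF z] by (simp add: h_def)
  define c where "c = 1 / (2 * real (card A))"
  have N: "real (card A) \<ge> 1" using A by (simp add: Suc_le_eq card_gt_0_iff)
  have c: "0 < c" "c \<le> 1" using N by (auto simp: c_def divide_simps)
  \<comment> \<open>With this length the displacement \<open>\<sigma> *\<^sub>R d a\<close> is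
    \<open>c *\<^sub>R (z - a)\<close>; the division by \<open>h\<close> in \<open>d\<close>
    normalises the height gained per unit to 1.\<close>
  define \<sigma> where "\<sigma> = c * h"
  have \<sigma>: "\<sigma> > 0" using c h by (simp add: \<sigma>_def)
  define d where "d a = (1 / h) *\<^sub>R (z - a)" for a
  have eH: "n \<bullet> x = \<beta>" if "x \<in> e" for x
    using hull_subset[of e affine] that n(2) by blast
  have nd: "n \<bullet> d a = 1" if "a \<in> A" for a
  proof -
    have "a \<in> e" using that hull_subset[of A convex] A(3) by blast
    then show ?thesis using eH[of a] h by (simp add: d_def inner_diff_right h_def[symmetric])
  qed
  define E where "E a = {x \<in> e. x + \<sigma> *\<^sub>R d a \<in> interior K}" for a
  have cover: "\<exists>a\<in>A. x \<in> E a" if x: "x \<in> e" for x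
  proof -
    obtain a p where a: "a \<in> A" "p \<in> convex hull A" "x = (1 - c) *\<^sub>R p + c *\<^sub>R a"
      using convex_hull_weight_shift[OF A(1,2), of x] x A(3) unfolding c_def by blast
    have "p \<in> K" using a(2) A(3) eK by blast
    then have "p - c *\<^sub>R (p - z) \<in> interior K"
      by (rule mem_interior_convex_shrink[OF convex_simplex[OF K] z _ c])
    moreover have "x + \<sigma> *\<^sub>R d a = p - c *\<^sub>R (p - z)"
      using h by (simp add: \<sigma>_def d_def a(3) algebra_simps)
    ultimately have "x + \<sigma> *\<^sub>R d a \<in> interior K" by (simp only:)
    with a(1) x show ?thesis unfolding E_def by blast
  qed
  define B where "B a = 1 / \<sigma> + 1 + (norm (d a))\<^sup>2" for a
  have B: "B a \<ge> 0" for a using \<sigma> by (simp add: B_def)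
  show thesis
  proof (rule that[of "\<Sum>a\<in>A. B a"])
    show "(\<Sum>a\<in>A. B a) \<ge> 0" using B by (simp add: sum_nonneg)
    fix \<phi> :: "real^'n \<Rightarrow> real" assume \<phi>: "Ck (Suc 0) \<phi>"
    have c0: "continuous_on UNIV \<phi>" using Ck_Suc_imp[OF \<phi>] by simp
    have [measurable]: "\<phi> \<in> borel_measurable borel" by (rule borel_measurable_continuous_onI[OF c0])
    have Eb[measurable]: "E a \<in> sets borel" for a
    proof -
      have "open ((\<lambda>x. x + \<sigma> *\<^sub>R d a) -` interior K)"
        by (rule open_vimage[OF open_interior]) (intro continuous_intros)
      moreover have "E a = e \<inter> (\<lambda>x. x + \<sigma> *\<^sub>R d a) -` interior K" by (auto simp: E_def)
      ultimately show ?thesis using eb by (simp add: borel_open)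
    qed
    let ?I = "\<integral>\<^sup>+x. ennreal (energy \<phi> x) * indicator (interior K) x \<partial>lborel"
    have "(\<integral>\<^sup>+x. ennreal ((\<phi> x)\<^sup>2) \<partial>face_measure e) = (\<integral>\<^sup>+x. ennreal ((\<phi> x)\<^sup>2) * indicator e x \<partial>face_measure e)"
      by (rule nn_integral_face_measure_on[OF n eb]) measurable
    also have "\<dots> \<le> (\<integral>\<^sup>+x. (\<Sum>a\<in>A. ennreal ((\<phi> x)\<^sup>2) * indicator (E a) x) \<partial>face_measure e)"
    proof (rule nn_integral_mono)
      fix x
      show "ennreal ((\<phi> x)\<^sup>2) * indicator e x \<le> (\<Sum>a\<in>A. ennreal ((\<phi> x)\<^sup>2) * indicator (E a) x)"
      proof (cases "x \<in> e")
        case True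
        then obtain a where a: "a \<in> A" "x \<in> E a" using cover by blast
        have "ennreal ((\<phi> x)\<^sup>2) * indicator (E a) x \<le> (\<Sum>a\<in>A. ennreal ((\<phi> x)\<^sup>2) * indicator (E a) x)"
          by (rule member_le_sum[OF a(1)]) (use A(1) in auto)
        then show ?thesis using a(2) True by simp
      qed simp
    qed
    also have "\<dots> = (\<Sum>a\<in>A. \<integral>\<^sup>+x. ennreal ((\<phi> x)\<^sup>2) * indicator (E a) x \<partial>face_measure e)"
      by (rule nn_integral_sum) measurable
    also have "\<dots> \<le> (\<Sum>a\<in>A. ennreal (B a) * ?I)"
    proof (rule sum_mono)
      fix a assume a: "a \<in> A"
      show "(\<integral>\<^sup>+x. ennreal ((\<phi> x)\<^sup>2) * indicator (E a) x \<partial>face_measure e) \<le> ennreal (B a) * ?I"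
        unfolding E_def B_def
        by (rule trace_inequality_piece[OF \<phi> \<sigma> n eb convex_simplex[OF K] eK nd[OF a]])
    qed
    also have "\<dots> = ennreal (\<Sum>a\<in>A. B a) * ?I"
      using B by (simp add: sum_distrib_right[symmetric] sum_ennreal)
    finally show "(\<integral>\<^sup>+x. ennreal ((\<phi> x)\<^sup>2) \<partial>face_measure e) \<le> ennreal (\<Sum>a\<in>A. B a) * ?I" .
  qed
qed

lemma facet_measure_facts:
  fixes K e :: "(real^'n) set"
  assumes K: "int CARD('n) simplex K" and e: "e facet_of K"
  shows "compact e" "AE x in face_measure e. x \<in> e" "finite_measure (face_measure e)"
proof -
  obtain n \<beta> A where n: "norm n = 1" "affine hull e = {x. n \<bullet> x = \<beta>}" and A: "finite A" "e = convex hull A"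
    using simplex_facet[OF K e] by metis
  show c: "compact e" unfolding A(2) by (rule finite_imp_compact_convex_hull[OF A(1)])
  show "AE x in face_measure e. x \<in> e" "finite_measure (face_measure e)"
    using face_measure_AE_finite[OF n c] by auto
qed

lemma H1_norm_square:
  fixes u :: "real^'n \<Rightarrow> real"
  assumes S: "open S" and w: "\<And>i. is_weak_partial S i u (w i)"
  shows "(H1_norm S u)\<^sup>2 = (\<integral>x. (u x)\<^sup>2 \<partial>lebesgue_on S) + (\<Sum>i\<in>UNIV. \<integral>x. (w i x)\<^sup>2 \<partial>lebesgue_on S)"
  unfolding H1_norm_eq[OF S w]
  by (rule real_sqrt_pow2) (intro add_nonneg_nonneg sum_nonneg integral_nonneg_AE AE_I2 zero_le_power2)

lemma H1_norm_diff_square_le: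
  fixes u v :: "real^'n \<Rightarrow> real"
  assumes S: "open S" and u: "u \<in> H1 S" and v: "v \<in> H1 S"
  shows "(H1_norm S (\<lambda>x. u x - v x))\<^sup>2 \<le> 2 * (H1_norm S u)\<^sup>2 + 2 * (H1_norm S v)\<^sup>2"
proof -
  note wu = H1_weak_partial[OF S u] and wv = H1_weak_partial[OF S v]
  let ?u = "\<lambda>i. weak_partial S i u" and ?v = "\<lambda>i. weak_partial S i v"
  have "(H1_norm S (\<lambda>x. u x - v x))\<^sup>2 = (\<integral>x. (u x - v x)\<^sup>2 \<partial>lebesgue_on S) + (\<Sum>i\<in>UNIV. \<integral>x. (?u i x - ?v i x)\<^sup>2 \<partial>lebesgue_on S)"
    by (rule H1_norm_square[OF S is_weak_partial_diff[OF S wu(1) wv(1)]])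
  also have "\<dots> \<le> (2 * (\<integral>x. (u x)\<^sup>2 \<partial>lebesgue_on S) + 2 * (\<integral>x. (v x)\<^sup>2 \<partial>lebesgue_on S))
     + (\<Sum>i\<in>UNIV. 2 * (\<integral>x. (?u i x)\<^sup>2 \<partial>lebesgue_on S) + 2 * (\<integral>x. (?v i x)\<^sup>2 \<partial>lebesgue_on S))"
    by (intro add_mono sum_mono integral_square_diff_le)
       (use H1_L2[OF u] H1_L2[OF v] wu(2) wv(2) in \<open>simp_all add: L2_iff\<close>)
  also have "\<dots> = 2 * (H1_norm S u)\<^sup>2 + 2 * (H1_norm S v)\<^sup>2"
    unfolding H1_norm_square[OF S wu(1)] H1_norm_square[OF S wv(1)]
    by (simp add: sum.distrib sum_distrib_left algebra_simps)
  finally show ?thesis .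
qed

lemma energy_H1_norm:
  fixes \<phi> :: "real^'n \<Rightarrow> real"
  assumes S: "open S" "bounded S" and \<phi>: "smooth \<phi>"
  shows "(\<integral>\<^sup>+x. ennreal (energy \<phi> x) * indicator S x \<partial>lborel) = ennreal ((H1_norm S \<phi>)\<^sup>2)"
proof -
  note S' = open_lebesgue[OF S(1)]
  have c: "continuous_on UNIV (energy \<phi>)" by (rule energy_continuous[OF smooth_Ck[OF \<phi>]])
  have [measurable]: "energy \<phi> \<in> borel_measurable borel" by (rule borel_measurable_continuous_onI[OF c])
  have [measurable]: "S \<in> sets borel" using S(1) by simp
  have i: "integrable (lebesgue_on S) (\<lambda>x. (f x)\<^sup>2)" if "continuous_on UNIV f" for f :: "real^'n \<Rightarrow> real"
    using continuous_L2[OF S' S(2) that] by (simp add: L2_def)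
  have cp: "continuous_on UNIV \<phi>" "continuous_on UNIV (partial i \<phi>)" for i
    using smooth_continuous[OF \<phi>] smooth_continuous[OF smooth_partial[OF \<phi>]] by auto
  have ie: "integrable (lebesgue_on S) (energy \<phi>)"
    unfolding energy_def by (intro Bochner_Integration.integrable_add Bochner_Integration.integrable_sum i cp)
  have "(H1_norm S \<phi>)\<^sup>2 = (\<integral>x. (\<phi> x)\<^sup>2 \<partial>lebesgue_on S) + (\<Sum>i\<in>UNIV. \<integral>x. (partial i \<phi> x)\<^sup>2 \<partial>lebesgue_on S)"
    by (rule H1_norm_square[OF S(1) Ck1_is_weak_partial[OF S(1) smooth_Ck[OF \<phi>]]])
  also have "\<dots> = (\<integral>x. energy \<phi> x \<partial>lebesgue_on S)"
    unfolding energy_def using i[OF cp(1)] i[OF cp(2)] by simp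
  also have "\<dots> = (\<integral>x. zero_ext S (energy \<phi>) x \<partial>lebesgue)" by (rule integral_zero_ext[OF S'])
  also have "zero_ext S (energy \<phi>) = (\<lambda>x. energy \<phi> x * indicator S x)"
    by (auto simp: zero_ext_def indicator_def fun_eq_iff)
  finally have H: "(H1_norm S \<phi>)\<^sup>2 = (\<integral>x. energy \<phi> x * indicator S x \<partial>lebesgue)" .
  have "integrable lebesgue (zero_ext S (energy \<phi>))" using ie by (simp add: integrable_zero_ext[OF S'])
  also have "zero_ext S (energy \<phi>) = (\<lambda>x. energy \<phi> x * indicator S x)"
    by (auto simp: zero_ext_def indicator_def fun_eq_iff)
  finally have "integrable lebesgue (\<lambda>x. energy \<phi> x * indicator S x)" .
  then have ib: "integrable lborel (\<lambda>x. energy \<phi> x * indicator S x)" by (subst (asm) integrable_completion) simp_all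
  have "(\<integral>\<^sup>+x. ennreal (energy \<phi> x) * indicator S x \<partial>lborel) = (\<integral>\<^sup>+x. ennreal (energy \<phi> x * indicator S x) \<partial>lborel)"
    by (rule nn_integral_cong) (auto simp: indicator_def)
  also have "\<dots> = ennreal (\<integral>x. energy \<phi> x * indicator S x \<partial>lborel)"
    by (rule nn_integral_eq_integral[OF ib]) (simp add: energy_nonneg)
  also have "(\<integral>x. energy \<phi> x * indicator S x \<partial>lborel) = (\<integral>x. energy \<phi> x * indicator S x \<partial>lebesgue)"
    by (rule integral_completion[symmetric]) simp
  finally show ?thesis by (simp only: H)
qed

lemma facet_smooth_square_integrable:
  fixes K e :: "(real^'n) set"
  assumes K: "int CARD('n) simplex K" and e: "e facet_of K" and \<phi>: "continuous_on UNIV \<phi>"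
  shows "square_integrable (face_measure e) \<phi>"
proof -
  note f = facet_measure_facts[OF K e]
  interpret finite_measure "face_measure e" by (rule f(3))
  have "bounded (\<phi> ` e)"
    by (intro compact_imp_bounded compact_continuous_image f(1) continuous_on_subset[OF \<phi>]) auto
  then obtain B where B: "\<forall>y\<in>\<phi> ` e. norm y \<le> B" unfolding bounded_iff by blast
  show ?thesis
  proof (rule square_integrable_bound[where g="\<lambda>_. B\<^sup>2"])
    show "\<phi> \<in> borel_measurable (face_measure e)" by (simp add: borel_measurable_continuous_onI[OF \<phi>])
    show "AE x in face_measure e. (\<phi> x)\<^sup>2 \<le> B\<^sup>2"
      using f(2)
    proof (rule eventually_mono)
      fix x assume "x \<in> e"
      then have "\<bar>\<phi> x\<bar> \<le> B" using B by simp
      then have "\<bar>\<phi> x\<bar>\<^sup>2 \<le> B\<^sup>2" by (intro power_mono) auto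
      then show "(\<phi> x)\<^sup>2 \<le> B\<^sup>2" by simp
    qed
  qed simp
qed

lemma trace_inequality_H1:
  fixes K e :: "(real^'n) set"
  assumes K: "int CARD('n) simplex K" and e: "e facet_of K"
  obtains C where "C \<ge> 0" "\<And>\<phi>. smooth \<phi> \<Longrightarrow> (\<integral>x. (\<phi> x)\<^sup>2 \<partial>face_measure e) \<le> C * (H1_norm (interior K) \<phi>)\<^sup>2"
proof -
  have b: "bounded (interior K)"
    using bounded_subset[OF compact_imp_bounded[OF compact_simplex[OF K]] interior_subset] .
  obtain C where C: "C \<ge> 0" "\<And>\<phi>. Ck (Suc 0) \<phi> \<Longrightarrow> (\<integral>\<^sup>+x. ennreal ((\<phi> x)\<^sup>2) \<partial>face_measure e)
    \<le> ennreal C * (\<integral>\<^sup>+x. ennreal (energy \<phi> x) * indicator (interior K) x \<partial>lborel)"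
    using trace_inequality[OF K e] by blast
  show thesis
  proof (rule that[OF C(1)])
    fix \<phi> :: "real^'n \<Rightarrow> real" assume \<phi>: "smooth \<phi>"
    have "ennreal (\<integral>x. (\<phi> x)\<^sup>2 \<partial>face_measure e) = (\<integral>\<^sup>+x. ennreal ((\<phi> x)\<^sup>2) \<partial>face_measure e)"
      by (rule nn_integral_eq_integral[symmetric, OF square_integrableD(2)[OF facet_smooth_square_integrable[OF K e smooth_continuous[OF \<phi>]]]]) simp
    also have "\<dots> \<le> ennreal C * ennreal ((H1_norm (interior K) \<phi>)\<^sup>2)"
      using C(2)[OF smooth_Ck[OF \<phi>]] by (simp only: energy_H1_norm[OF open_interior b \<phi>])
    also have "\<dots> = ennreal (C * (H1_norm (interior K) \<phi>)\<^sup>2)"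
      by (rule ennreal_mult[symmetric]) (use C(1) in simp_all)
    finally show "(\<integral>x. (\<phi> x)\<^sup>2 \<partial>face_measure e) \<le> C * (H1_norm (interior K) \<phi>)\<^sup>2"
      using C(1) by (subst (asm) ennreal_le_iff) auto
  qed
qed

section \<open>Traces on facets\<close>

text \<open>On a finite measure an L2 Cauchy sequence is L1 Cauchy, hence has a subsequence
  converging almost everywhere. Fatou's lemma along that subsequence upgrades the pointwise limit to
  an L2 limit of the whole sequence.\<close>

lemma (in finite_measure) L2_complete:
  fixes f :: "nat \<Rightarrow> 'a \<Rightarrow> real"
  assumes si: "\<And>k. square_integrable M (f k)"
    and cauchy: "\<And>\<epsilon>. \<epsilon> > 0 \<Longrightarrow> \<exists>N. \<forall>k\<ge>N. \<forall>l\<ge>N. (\<integral>x. (f k x - f l x)\<^sup>2 \<partial>M) < \<epsilon>"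
  obtains t where "square_integrable M t" "(\<lambda>k. \<integral>x. (f k x - t x)\<^sup>2 \<partial>M) \<longlonglongrightarrow> 0"
proof -
  have fm[measurable]: "f k \<in> borel_measurable M" for k using square_integrableD(1)[OF si] .
  have fi: "integrable M (f k)" for k by (rule square_integrable_imp_integrable[OF si])
  have sd: "integrable M (\<lambda>x. (f k x - f l x)\<^sup>2)" for k l
    by (rule square_integrableD(2)[OF square_integrable_diff[OF si si]])
  let ?V = "measure M (space M)"
  have l1: "\<exists>N. \<forall>i\<ge>N. \<forall>j\<ge>N. (\<integral>x. norm (f i x - f j x) \<partial>M) < \<epsilon>" if \<epsilon>: "\<epsilon> > 0" for \<epsilon> :: real
  proof -
    \<comment> \<open>In the bound of |a| by \<eta> + a^2 / \<eta> the first term integrates to less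
      than \<epsilon>/2 by this choice, and the L2 Cauchy property at level \<eta> * (\<epsilon>/2)
      takes care of the second.\<close>
    define \<eta> where "\<eta> = \<epsilon> / (2 * (?V + 1))"
    have V: "?V + 1 > 0" by (simp add: add_nonneg_pos)
    have \<eta>: "\<eta> > 0" using \<epsilon> V by (simp add: \<eta>_def)
    have \<eta>V: "\<eta> * ?V < \<epsilon> / 2"
    proof -
      have "\<eta> * ?V < \<eta> * (?V + 1)" using \<eta> by simp
      also have "\<dots> = \<epsilon> / 2" using V by (simp add: \<eta>_def divide_simps)
      finally show ?thesis .
    qed
    obtain N where N: "\<And>k l. k \<ge> N \<Longrightarrow> l \<ge> N \<Longrightarrow> (\<integral>x. (f k x - f l x)\<^sup>2 \<partial>M) < \<eta> * (\<epsilon> / 2)"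
      using cauchy[of "\<eta> * (\<epsilon> / 2)"] \<eta> \<epsilon> by auto
    have "(\<integral>x. norm (f i x - f j x) \<partial>M) < \<epsilon>" if ij: "i \<ge> N" "j \<ge> N" for i j
    proof -
      have "(\<integral>x. norm (f i x - f j x) \<partial>M) \<le> (\<integral>x. \<eta> + (1 / \<eta>) * (f i x - f j x)\<^sup>2 \<partial>M)"
      proof (rule integral_mono)
        show "norm (f i x - f j x) \<le> \<eta> + (1 / \<eta>) * (f i x - f j x)\<^sup>2" for x
        proof -
          define a where "a = \<bar>f i x - f j x\<bar>"
          have a: "a \<ge> 0" by (simp add: a_def)
          have "a \<le> \<eta> + (1 / \<eta>) * a\<^sup>2"
          proof (cases "a \<le> \<eta>")
            case True then show ?thesis using \<eta> by (simp add: add_increasing2)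
          next
            case False
            then have "\<eta> * a \<le> a * a" using a by (intro mult_right_mono) auto
            then have "a \<le> (1 / \<eta>) * a\<^sup>2" using \<eta> by (simp add: field_simps power2_eq_square)
            then show ?thesis using \<eta> by linarith
          qed
          then show ?thesis by (simp add: a_def)
        qed
      qed (use fi sd in auto)
      also have "\<dots> = \<eta> * ?V + (1 / \<eta>) * (\<integral>x. (f i x - f j x)\<^sup>2 \<partial>M)"
        using sd by (simp add: mult.commute)
      also have "(1 / \<eta>) * (\<integral>x. (f i x - f j x)\<^sup>2 \<partial>M) \<le> (1 / \<eta>) * (\<eta> * (\<epsilon> / 2))"
        using N[OF ij] \<eta> by (intro mult_left_mono) auto
      also have "(1 / \<eta>) * (\<eta> * (\<epsilon> / 2)) = \<epsilon> / 2" using \<eta> by simp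
      finally show ?thesis using \<eta>V by simp
    qed
    then show ?thesis by blast
  qed
  obtain r where r: "strict_mono r" "AE x in M. Cauchy (\<lambda>i. f (r i) x)"
    by (rule cauchy_L1_AE_cauchy_subseq[of M f, OF fi], rule l1, assumption, rule that, assumption, assumption)
  define t where "t x = lim (\<lambda>i. f (r i) x)" for x
  have [measurable]: "t \<in> borel_measurable M"
    unfolding t_def by (rule borel_measurable_lim_metric) measurable
  have lim: "AE x in M. (\<lambda>i. f (r i) x) \<longlonglongrightarrow> t x"
    using r(2) by (rule eventually_mono) (simp add: t_def Cauchy_convergent_iff convergent_LIMSEQ_iff)
  \<comment> \<open>Stated with the extended integral because integrability of the difference to
    \<open>t\<close> is derived from this very bound.\<close>
  have key: "\<exists>N. \<forall>k\<ge>N. (\<integral>\<^sup>+x. ennreal ((f k x - t x)\<^sup>2) \<partial>M) \<le> ennreal \<epsilon>" if \<epsilon>: "\<epsilon> > 0" for \<epsilon>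
  proof -
    obtain N where N: "\<And>k l. k \<ge> N \<Longrightarrow> l \<ge> N \<Longrightarrow> (\<integral>x. (f k x - f l x)\<^sup>2 \<partial>M) < \<epsilon>"
      using cauchy[OF \<epsilon>] by blast
    have "(\<integral>\<^sup>+x. ennreal ((f k x - t x)\<^sup>2) \<partial>M) \<le> ennreal \<epsilon>" if k: "k \<ge> N" for k
    proof -
      have "(\<integral>\<^sup>+x. ennreal ((f k x - t x)\<^sup>2) \<partial>M) = (\<integral>\<^sup>+x. liminf (\<lambda>i. ennreal ((f k x - f (r i) x)\<^sup>2)) \<partial>M)"
      proof (rule nn_integral_cong_AE)
        show "AE x in M. ennreal ((f k x - t x)\<^sup>2) = liminf (\<lambda>i. ennreal ((f k x - f (r i) x)\<^sup>2))"
          using lim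
        proof (rule eventually_mono)
          fix x assume "(\<lambda>i. f (r i) x) \<longlonglongrightarrow> t x"
          then have "(\<lambda>i. ennreal ((f k x - f (r i) x)\<^sup>2)) \<longlonglongrightarrow> ennreal ((f k x - t x)\<^sup>2)"
            by (intro tendsto_ennrealI tendsto_power tendsto_diff tendsto_const)
          then show "ennreal ((f k x - t x)\<^sup>2) = liminf (\<lambda>i. ennreal ((f k x - f (r i) x)\<^sup>2))"
            using lim_imp_Liminf[OF trivial_limit_sequentially] by metis
        qed
      qed
      also have "\<dots> \<le> liminf (\<lambda>i. \<integral>\<^sup>+x. ennreal ((f k x - f (r i) x)\<^sup>2) \<partial>M)"
        by (rule nn_integral_liminf) measurable
      also have "\<dots> \<le> limsup (\<lambda>i. \<integral>\<^sup>+x. ennreal ((f k x - f (r i) x)\<^sup>2) \<partial>M)"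
        by (rule Liminf_le_Limsup) simp
      also have "\<dots> \<le> ennreal \<epsilon>"
      proof (rule Limsup_bounded, rule eventually_sequentiallyI[of N])
        fix i assume "i \<ge> N"
        then have "r i \<ge> N" using strict_mono_imp_increasing[OF r(1)] le_trans by blast
        then have "(\<integral>x. (f k x - f (r i) x)\<^sup>2 \<partial>M) \<le> \<epsilon>" using N[OF k] less_imp_le by blast
        then show "(\<integral>\<^sup>+x. ennreal ((f k x - f (r i) x)\<^sup>2) \<partial>M) \<le> ennreal \<epsilon>"
          using nn_integral_eq_integral[OF sd[of k "r i"]] by (simp add: ennreal_leI)
      qed
      finally show ?thesis .
    qed
    then show ?thesis by blast
  qed
  have int: "integrable M (\<lambda>x. (f k x - t x)\<^sup>2)" if "(\<integral>\<^sup>+x. ennreal ((f k x - t x)\<^sup>2) \<partial>M) \<le> ennreal \<epsilon>" for k \<epsilon>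
    by (rule integrableI_bounded) (use that in \<open>auto simp: le_less_trans[OF that ennreal_less_top]\<close>)
  obtain N where N: "(\<integral>\<^sup>+x. ennreal ((f N x - t x)\<^sup>2) \<partial>M) \<le> ennreal 1"
    using key[of 1] by auto
  have "square_integrable M (\<lambda>x. f N x - t x)"
    unfolding square_integrable_def using int[OF N] by simp
  then have "square_integrable M (\<lambda>x. f N x - (f N x - t x))" by (rule square_integrable_diff[OF si])
  then have st: "square_integrable M t" by simp
  have "(\<lambda>k. \<integral>x. (f k x - t x)\<^sup>2 \<partial>M) \<longlonglongrightarrow> 0"
  proof (rule LIMSEQ_I)
    fix \<epsilon> :: real assume \<epsilon>: "\<epsilon> > 0"
    obtain N where N: "\<And>k. k \<ge> N \<Longrightarrow> (\<integral>\<^sup>+x. ennreal ((f k x - t x)\<^sup>2) \<partial>M) \<le> ennreal (\<epsilon> / 2)"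
      using key[of "\<epsilon> / 2"] \<epsilon> by auto
    have "(\<integral>x. (f k x - t x)\<^sup>2 \<partial>M) \<le> \<epsilon> / 2" if "k \<ge> N" for k
      using N[OF that] nn_integral_eq_integral[OF int[OF N[OF that]]] \<epsilon> by simp
    then have "norm ((\<integral>x. (f k x - t x)\<^sup>2 \<partial>M) - 0) < \<epsilon>" if "k \<ge> N" for k
      using that \<epsilon> by (force simp: abs_of_nonneg)
    then show "\<exists>no. \<forall>n\<ge>no. norm ((\<integral>x. (f n x - t x)\<^sup>2 \<partial>M) - 0) < \<epsilon>" by blast
  qed
  with st show thesis by (rule that)
qed

lemma L2_limit_unique:
  fixes f :: "nat \<Rightarrow> 'a \<Rightarrow> real"
  assumes f: "\<And>k. square_integrable M (f k)" and s: "square_integrable M s" and t: "square_integrable M t"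
    and "(\<lambda>k. \<integral>x. (f k x - s x)\<^sup>2 \<partial>M) \<longlonglongrightarrow> 0" "(\<lambda>k. \<integral>x. (f k x - t x)\<^sup>2 \<partial>M) \<longlonglongrightarrow> 0"
  shows "AE x in M. s x = t x"
proof -
  have "(\<integral>x. (t x - s x)\<^sup>2 \<partial>M) \<le> 2 * (\<integral>x. (f k x - s x)\<^sup>2 \<partial>M) + 2 * (\<integral>x. (f k x - t x)\<^sup>2 \<partial>M)" for k
    using integral_square_diff_le[OF square_integrable_diff[OF f s] square_integrable_diff[OF f t], of k k] by simp
  moreover have "(\<lambda>k. 2 * (\<integral>x. (f k x - s x)\<^sup>2 \<partial>M) + 2 * (\<integral>x. (f k x - t x)\<^sup>2 \<partial>M)) \<longlonglongrightarrow> 2 * 0 + 2 * 0"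
    by (intro tendsto_intros assms)
  ultimately have "(\<integral>x. (t x - s x)\<^sup>2 \<partial>M) \<le> 2 * 0 + 2 * 0"
    by (intro LIMSEQ_le_const) auto
  moreover have "(\<integral>x. (t x - s x)\<^sup>2 \<partial>M) \<ge> 0" by simp
  ultimately have "(\<integral>x. (t x - s x)\<^sup>2 \<partial>M) = 0" by linarith
  then have "AE x in M. (t x - s x)\<^sup>2 = 0"
    using integral_nonneg_eq_0_iff_AE[OF square_integrableD(2)[OF square_integrable_diff[OF t s]]] by simp
  then show ?thesis by (rule eventually_mono) simp
qed

lemma is_face_trace_iff:
  "is_face_trace K e w t \<longleftrightarrow> w \<in> H1 (interior K) \<and> square_integrable (face_measure e) t \<and>
     (\<exists>\<phi> :: nat \<Rightarrow> real^'n \<Rightarrow> real. (\<forall>k. smooth (\<phi> k)) \<and>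
        (\<lambda>k. H1_norm (interior K) (\<lambda>x. \<phi> k x - w x)) \<longlonglongrightarrow> 0 \<and>
        (\<lambda>k. integral\<^sup>L (face_measure e) (\<lambda>x. (\<phi> k x - t x)\<^sup>2)) \<longlonglongrightarrow> 0)"
  unfolding is_face_trace_def square_integrable_def by auto

lemma H1_norm_cong_AE:
  fixes u v :: "real^'n \<Rightarrow> real"
  assumes S: "open S" and u: "u \<in> H1 S" and v: "v \<in> H1 S" and ae: "AE x in lebesgue_on S. v x = u x"
  shows "H1_norm S (\<lambda>x. v x) = H1_norm S u"
proof -
  have li: "locally_integrable S v" by (rule L2_locally_integrable[OF open_lebesgue[OF S] H1_L2[OF v]])
  have "(\<integral>x. (v x)\<^sup>2 \<partial>lebesgue_on S) = (\<integral>x. (u x)\<^sup>2 \<partial>lebesgue_on S)"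
  proof (rule integral_cong_AE)
    show "AE x in lebesgue_on S. (v x)\<^sup>2 = (u x)\<^sup>2" using ae by (rule eventually_mono) simp
  qed (use H1_L2[OF u] H1_L2[OF v] in \<open>auto simp: L2_iff square_integrable_def\<close>)
  then show ?thesis
    unfolding H1_norm_eq[OF S H1_weak_partial(1)[OF S u]] H1_norm_eq[OF S is_weak_partial_cong_AE[OF S H1_weak_partial(1)[OF S u] li ae]]
    by simp
qed

section \<open>Traces from one simplex onto one of its facets\<close>

locale simplex_facet_pair =
  fixes K e :: "(real^'n) set"
  assumes K: "int CARD('n) simplex K" and e: "e facet_of K"
begin

lemma bounded_interior: "bounded (interior K)"
  using bounded_subset[OF compact_imp_bounded[OF compact_simplex[OF K]] interior_subset] .

lemma interior_nonempty: "interior K \<noteq> {}"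
  by (rule simplex_interior_nonempty[OF K])

lemma smooth_in_H1: "smooth \<phi> \<Longrightarrow> \<phi> \<in> H1 (interior K)"
  by (rule smooth_H1[OF open_interior bounded_interior])

lemma smooth_square_integrable: "smooth \<phi> \<Longrightarrow> square_integrable (face_measure e) \<phi>"
  by (rule facet_smooth_square_integrable[OF K e smooth_continuous])

lemma H1_norm_smooth_diff_le:
  assumes "smooth \<phi>" "smooth \<psi>" "w \<in> H1 (interior K)"
  shows "(H1_norm (interior K) (\<lambda>x. \<phi> x - \<psi> x))\<^sup>2 \<le>
    2 * (H1_norm (interior K) (\<lambda>x. \<phi> x - w x))\<^sup>2 + 2 * (H1_norm (interior K) (\<lambda>x. \<psi> x - w x))\<^sup>2"
  using H1_norm_diff_square_le[OF open_interior H1_diff[OF open_interior smooth_in_H1[OF assms(1)] assms(3)]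
      H1_diff[OF open_interior smooth_in_H1[OF assms(2)] assms(3)]] by simp

text \<open>The trace inequality makes the restrictions of smooth H1 approximants a Cauchy sequence
  in L2 of the facet. Existence is what gives the \<open>SOME\<close> in \<open>face_trace\<close>
  its meaning.\<close>

lemma trace_exists:
  assumes w: "w \<in> H1 (interior K)"
  obtains t where "is_face_trace K e w t"
proof -
  interpret finite_measure "face_measure e" by (rule facet_measure_facts(3)[OF K e])
  obtain \<phi> where \<phi>: "\<And>k::nat. smooth (\<phi> k)" "(\<lambda>k. H1_norm (interior K) (\<lambda>x. \<phi> k x - w x)) \<longlonglongrightarrow> 0"
    using smooth_dense_H1[OF open_interior bounded_interior convex_interior[OF convex_simplex[OF K]] interior_nonempty w] by blast
  obtain C where C: "C \<ge> 0" "\<And>\<phi>. smooth \<phi> \<Longrightarrow> (\<integral>x. (\<phi> x)\<^sup>2 \<partial>face_measure e) \<le> C * (H1_norm (interior K) \<phi>)\<^sup>2"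
    using trace_inequality_H1[OF K e] by blast
  have "\<exists>N. \<forall>k\<ge>N. \<forall>l\<ge>N. (\<integral>x. (\<phi> k x - \<phi> l x)\<^sup>2 \<partial>face_measure e) < \<epsilon>" if \<epsilon>: "\<epsilon> > 0" for \<epsilon>
  proof -
    have "(\<lambda>k. 2 * C * (H1_norm (interior K) (\<lambda>x. \<phi> k x - w x))\<^sup>2) \<longlonglongrightarrow> 2 * C * 0\<^sup>2"
      by (intro tendsto_intros \<phi>(2))
    then have "\<forall>\<^sub>F k in sequentially. 2 * C * (H1_norm (interior K) (\<lambda>x. \<phi> k x - w x))\<^sup>2 < \<epsilon> / 2"
      using \<epsilon> by (intro order_tendstoD(2)[where y="2 * C * 0\<^sup>2"]) auto
    then obtain N where N: "\<And>k. k \<ge> N \<Longrightarrow> 2 * C * (H1_norm (interior K) (\<lambda>x. \<phi> k x - w x))\<^sup>2 < \<epsilon> / 2"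
      unfolding eventually_sequentially by blast
    have "(\<integral>x. (\<phi> k x - \<phi> l x)\<^sup>2 \<partial>face_measure e) < \<epsilon>" if "k \<ge> N" "l \<ge> N" for k l
    proof -
      have "(\<integral>x. (\<phi> k x - \<phi> l x)\<^sup>2 \<partial>face_measure e) \<le> C * (H1_norm (interior K) (\<lambda>x. \<phi> k x - \<phi> l x))\<^sup>2"
        by (rule C(2)[OF smooth_diff[OF \<phi>(1) \<phi>(1)]])
      also have "\<dots> \<le> C * (2 * (H1_norm (interior K) (\<lambda>x. \<phi> k x - w x))\<^sup>2 + 2 * (H1_norm (interior K) (\<lambda>x. \<phi> l x - w x))\<^sup>2)"
        by (rule mult_left_mono[OF H1_norm_smooth_diff_le[OF \<phi>(1) \<phi>(1) w] C(1)])
      also have "\<dots> = 2 * C * (H1_norm (interior K) (\<lambda>x. \<phi> k x - w x))\<^sup>2 + 2 * C * (H1_norm (interior K) (\<lambda>x. \<phi> l x - w x))\<^sup>2"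
        by (simp add: algebra_simps)
      finally show ?thesis using N[OF that(1)] N[OF that(2)] by linarith
    qed
    then show ?thesis by blast
  qed
  then obtain t where t: "square_integrable (face_measure e) t" "(\<lambda>k. \<integral>x. (\<phi> k x - t x)\<^sup>2 \<partial>face_measure e) \<longlonglongrightarrow> 0"
    using L2_complete[of \<phi>, OF smooth_square_integrable[OF \<phi>(1)]] by blast
  then show thesis using that[of t] w \<phi> unfolding is_face_trace_iff by blast
qed

lemma is_face_trace_face_trace:
  assumes "w \<in> H1 (interior K)"
  shows "is_face_trace K e w (face_trace K e w)"
  using trace_exists[OF assms] unfolding face_trace_def by (metis someI_ex)

lemma trace_square_integrable: "is_face_trace K e w t \<Longrightarrow> square_integrable (face_measure e) t"
  by (simp add: is_face_trace_iff)

text \<open>A trace comes with one approximating sequence of its own; the trace inequality transfers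
  the convergence to every other smooth sequence with the same H1 limit. Hence traces are unique,
  and one common sequence can be used on both sides of a face.\<close>

lemma trace_limit:
  assumes t: "is_face_trace K e w t" and \<phi>: "\<And>k::nat. smooth (\<phi> k)" "(\<lambda>k. H1_norm (interior K) (\<lambda>x. \<phi> k x - w x)) \<longlonglongrightarrow> 0"
  shows "(\<lambda>k. \<integral>x. (\<phi> k x - t x)\<^sup>2 \<partial>face_measure e) \<longlonglongrightarrow> 0"
proof -
  obtain C where C: "C \<ge> 0" "\<And>\<phi>. smooth \<phi> \<Longrightarrow> (\<integral>x. (\<phi> x)\<^sup>2 \<partial>face_measure e) \<le> C * (H1_norm (interior K) \<phi>)\<^sup>2"
    using trace_inequality_H1[OF K e] by blast
  have w: "w \<in> H1 (interior K)" and ts: "square_integrable (face_measure e) t" using t by (auto simp: is_face_trace_iff)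
  obtain \<psi> :: "nat \<Rightarrow> real^'n \<Rightarrow> real" where \<psi>: "\<And>k. smooth (\<psi> k)" "(\<lambda>k. H1_norm (interior K) (\<lambda>x. \<psi> k x - w x)) \<longlonglongrightarrow> 0"
    "(\<lambda>k. \<integral>x. (\<psi> k x - t x)\<^sup>2 \<partial>face_measure e) \<longlonglongrightarrow> 0"
    using t unfolding is_face_trace_iff by blast
  have le: "(\<integral>x. (\<phi> k x - t x)\<^sup>2 \<partial>face_measure e) \<le>
     2 * (C * (2 * (H1_norm (interior K) (\<lambda>x. \<phi> k x - w x))\<^sup>2 + 2 * (H1_norm (interior K) (\<lambda>x. \<psi> k x - w x))\<^sup>2))
     + 2 * (\<integral>x. (\<psi> k x - t x)\<^sup>2 \<partial>face_measure e)" for k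
  proof -
    have "(\<integral>x. (\<phi> k x - t x)\<^sup>2 \<partial>face_measure e) = (\<integral>x. ((\<phi> k x - \<psi> k x) + (\<psi> k x - t x))\<^sup>2 \<partial>face_measure e)" by simp
    also have "\<dots> \<le> 2 * (\<integral>x. (\<phi> k x - \<psi> k x)\<^sup>2 \<partial>face_measure e) + 2 * (\<integral>x. (\<psi> k x - t x)\<^sup>2 \<partial>face_measure e)"
      by (intro integral_square_add_le square_integrable_diff smooth_square_integrable \<phi> \<psi> ts)
    also have "(\<integral>x. (\<phi> k x - \<psi> k x)\<^sup>2 \<partial>face_measure e) \<le> C * (H1_norm (interior K) (\<lambda>x. \<phi> k x - \<psi> k x))\<^sup>2"
      by (rule C(2)[OF smooth_diff[OF \<phi>(1) \<psi>(1)]])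
    also have "\<dots> \<le> C * (2 * (H1_norm (interior K) (\<lambda>x. \<phi> k x - w x))\<^sup>2 + 2 * (H1_norm (interior K) (\<lambda>x. \<psi> k x - w x))\<^sup>2)"
      by (rule mult_left_mono[OF H1_norm_smooth_diff_le[OF \<phi>(1) \<psi>(1) w] C(1)])
    finally show ?thesis by simp
  qed
  have "(\<lambda>k. 2 * (C * (2 * (H1_norm (interior K) (\<lambda>x. \<phi> k x - w x))\<^sup>2 + 2 * (H1_norm (interior K) (\<lambda>x. \<psi> k x - w x))\<^sup>2))
     + 2 * (\<integral>x. (\<psi> k x - t x)\<^sup>2 \<partial>face_measure e)) \<longlonglongrightarrow> 2 * (C * (2 * 0\<^sup>2 + 2 * 0\<^sup>2)) + 2 * 0"
    by (intro tendsto_intros \<phi>(2) \<psi>(2,3))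
  then have lim: "(\<lambda>k. 2 * (C * (2 * (H1_norm (interior K) (\<lambda>x. \<phi> k x - w x))\<^sup>2 + 2 * (H1_norm (interior K) (\<lambda>x. \<psi> k x - w x))\<^sup>2))
     + 2 * (\<integral>x. (\<psi> k x - t x)\<^sup>2 \<partial>face_measure e)) \<longlonglongrightarrow> 0" by simp
  show ?thesis
    by (rule tendsto_sandwich[OF _ _ tendsto_const lim]) (use le in simp_all)
qed

lemma trace_unique:
  assumes s: "is_face_trace K e w s" and t: "is_face_trace K e w t"
  shows "AE x in face_measure e. s x = t x"
proof -
  obtain \<phi> :: "nat \<Rightarrow> real^'n \<Rightarrow> real" where \<phi>: "\<And>k. smooth (\<phi> k)" "(\<lambda>k. H1_norm (interior K) (\<lambda>x. \<phi> k x - w x)) \<longlonglongrightarrow> 0"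
    using s unfolding is_face_trace_iff by blast
  show ?thesis
    by (rule L2_limit_unique[OF smooth_square_integrable[OF \<phi>(1)] trace_square_integrable[OF s] trace_square_integrable[OF t]
          trace_limit[OF s \<phi>] trace_limit[OF t \<phi>]])
qed

lemma trace_diff:
  assumes u: "is_face_trace K e u s" and v: "is_face_trace K e v t"
  shows "is_face_trace K e (\<lambda>x. u x - v x) (\<lambda>x. s x - t x)"
proof -
  have uH: "u \<in> H1 (interior K)" and vH: "v \<in> H1 (interior K)" using u v by (auto simp: is_face_trace_iff)
  have sq: "square_integrable (face_measure e) s" "square_integrable (face_measure e) t"
    using u v by (auto simp: is_face_trace_iff)
  obtain \<phi> :: "nat \<Rightarrow> real^'n \<Rightarrow> real" where \<phi>: "\<And>k. smooth (\<phi> k)" "(\<lambda>k. H1_norm (interior K) (\<lambda>x. \<phi> k x - u x)) \<longlonglongrightarrow> 0"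
    "(\<lambda>k. \<integral>x. (\<phi> k x - s x)\<^sup>2 \<partial>face_measure e) \<longlonglongrightarrow> 0"
    using u unfolding is_face_trace_iff by blast
  obtain \<psi> :: "nat \<Rightarrow> real^'n \<Rightarrow> real" where \<psi>: "\<And>k. smooth (\<psi> k)" "(\<lambda>k. H1_norm (interior K) (\<lambda>x. \<psi> k x - v x)) \<longlonglongrightarrow> 0"
    "(\<lambda>k. \<integral>x. (\<psi> k x - t x)\<^sup>2 \<partial>face_measure e) \<longlonglongrightarrow> 0"
    using v unfolding is_face_trace_iff by blast
  have "(\<lambda>k. H1_norm (interior K) (\<lambda>x. (\<phi> k x - \<psi> k x) - (u x - v x))) \<longlonglongrightarrow> 0"
  proof -
    have le: "(H1_norm (interior K) (\<lambda>x. (\<phi> k x - \<psi> k x) - (u x - v x)))\<^sup>2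
      \<le> 2 * (H1_norm (interior K) (\<lambda>x. \<phi> k x - u x))\<^sup>2 + 2 * (H1_norm (interior K) (\<lambda>x. \<psi> k x - v x))\<^sup>2" for k
    proof -
      have "(\<lambda>x. (\<phi> k x - \<psi> k x) - (u x - v x)) = (\<lambda>x. (\<phi> k x - u x) - (\<psi> k x - v x))" by (simp add: algebra_simps)
      then show ?thesis
        using H1_norm_diff_square_le[OF open_interior H1_diff[OF open_interior smooth_in_H1[OF \<phi>(1)] uH]
            H1_diff[OF open_interior smooth_in_H1[OF \<psi>(1)] vH], of k k] by simp
    qed
    have "(\<lambda>k. 2 * (H1_norm (interior K) (\<lambda>x. \<phi> k x - u x))\<^sup>2 + 2 * (H1_norm (interior K) (\<lambda>x. \<psi> k x - v x))\<^sup>2) \<longlonglongrightarrow> 2 * 0\<^sup>2 + 2 * 0\<^sup>2"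
      by (intro tendsto_intros \<phi>(2) \<psi>(2))
    then have lim: "(\<lambda>k. 2 * (H1_norm (interior K) (\<lambda>x. \<phi> k x - u x))\<^sup>2 + 2 * (H1_norm (interior K) (\<lambda>x. \<psi> k x - v x))\<^sup>2) \<longlonglongrightarrow> 0" by simp
    have "(\<lambda>k. (H1_norm (interior K) (\<lambda>x. (\<phi> k x - \<psi> k x) - (u x - v x)))\<^sup>2) \<longlonglongrightarrow> 0"
      by (rule tendsto_sandwich[OF _ _ tendsto_const lim]) (use le in simp_all)
    then have "(\<lambda>k. sqrt ((H1_norm (interior K) (\<lambda>x. (\<phi> k x - \<psi> k x) - (u x - v x)))\<^sup>2)) \<longlonglongrightarrow> sqrt 0"
      by (rule tendsto_real_sqrt)
    then show ?thesis by (simp add: tendsto_rabs_zero_iff)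
  qed
  moreover have "(\<lambda>k. \<integral>x. ((\<phi> k x - \<psi> k x) - (s x - t x))\<^sup>2 \<partial>face_measure e) \<longlonglongrightarrow> 0"
  proof -
    have le: "(\<integral>x. ((\<phi> k x - \<psi> k x) - (s x - t x))\<^sup>2 \<partial>face_measure e)
       \<le> 2 * (\<integral>x. (\<phi> k x - s x)\<^sup>2 \<partial>face_measure e) + 2 * (\<integral>x. (\<psi> k x - t x)\<^sup>2 \<partial>face_measure e)" for k
    proof -
      have "(\<phi> k x - \<psi> k x) - (s x - t x) = (\<phi> k x - s x) - (\<psi> k x - t x)" for x by simp
      then show ?thesis
        using integral_square_diff_le[OF square_integrable_diff[OF smooth_square_integrable[OF \<phi>(1)] sq(1)]
            square_integrable_diff[OF smooth_square_integrable[OF \<psi>(1)] sq(2)], of k k] by (simp only:)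
    qed
    have "(\<lambda>k. 2 * (\<integral>x. (\<phi> k x - s x)\<^sup>2 \<partial>face_measure e) + 2 * (\<integral>x. (\<psi> k x - t x)\<^sup>2 \<partial>face_measure e)) \<longlonglongrightarrow> 2 * 0 + 2 * 0"
      by (intro tendsto_intros \<phi>(3) \<psi>(3))
    then have lim: "(\<lambda>k. 2 * (\<integral>x. (\<phi> k x - s x)\<^sup>2 \<partial>face_measure e) + 2 * (\<integral>x. (\<psi> k x - t x)\<^sup>2 \<partial>face_measure e)) \<longlonglongrightarrow> 0" by simp
    show ?thesis
      by (rule tendsto_sandwich[OF _ _ tendsto_const lim]) (use le in simp_all)
  qed
  ultimately show ?thesis
    unfolding is_face_trace_iff using H1_diff[OF open_interior uH vH] square_integrable_diff[OF sq] smooth_diff[OF \<phi>(1) \<psi>(1)]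
    by (intro conjI exI[of _ "\<lambda>k x. \<phi> k x - \<psi> k x"]) auto
qed

lemma trace_cong_AE:
  assumes t: "is_face_trace K e u t" and v: "v \<in> H1 (interior K)" and ae: "AE x in lebesgue_on (interior K). v x = u x"
  shows "is_face_trace K e v t"
proof -
  have u: "u \<in> H1 (interior K)" using t by (simp add: is_face_trace_iff)
  obtain \<phi> :: "nat \<Rightarrow> real^'n \<Rightarrow> real" where \<phi>: "\<And>k. smooth (\<phi> k)" "(\<lambda>k. H1_norm (interior K) (\<lambda>x. \<phi> k x - u x)) \<longlonglongrightarrow> 0"
    "(\<lambda>k. \<integral>x. (\<phi> k x - t x)\<^sup>2 \<partial>face_measure e) \<longlonglongrightarrow> 0"
    using t unfolding is_face_trace_iff by blast
  have "H1_norm (interior K) (\<lambda>x. \<phi> k x - v x) = H1_norm (interior K) (\<lambda>x. \<phi> k x - u x)" for k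
  proof (rule H1_norm_cong_AE[OF open_interior])
    show "AE x in lebesgue_on (interior K). \<phi> k x - v x = \<phi> k x - u x" using ae by (rule eventually_mono) simp
  qed (intro H1_diff open_interior smooth_in_H1 \<phi> u v)+
  then show ?thesis
    unfolding is_face_trace_iff using \<phi> v trace_square_integrable[OF t]
    by (intro conjI exI[of _ \<phi>]) simp_all
qed

lemma normal_derivative_square_integrable:
  assumes "u \<in> H2 (interior K)"
  shows "square_integrable (face_measure e) (normal_derivative K e u)"
  unfolding normal_derivative_def
  by (intro square_integrable_sum square_integrable_cmult
      trace_square_integrable[OF is_face_trace_face_trace[OF H2_weak_partial[OF assms]]])

text \<open>The traces of \<open>u\<close>, \<open>v\<close> and their difference are separate
  choices of derivatives and of traces; linearity is recovered by uniqueness at both levels.\<close>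

lemma normal_derivative_diff:
  assumes u: "u \<in> H2 (interior K)" and v: "v \<in> H2 (interior K)"
  shows "AE x in face_measure e. normal_derivative K e (\<lambda>x. u x - v x) x = normal_derivative K e u x - normal_derivative K e v x"
proof -
  let ?S = "interior K"
  have tr: "AE x in face_measure e. face_trace K e (weak_partial ?S i (\<lambda>x. u x - v x)) x
     = face_trace K e (weak_partial ?S i u) x - face_trace K e (weak_partial ?S i v) x" for i
  proof (rule trace_unique[OF is_face_trace_face_trace])
    show d: "weak_partial ?S i (\<lambda>x. u x - v x) \<in> H1 ?S"
      by (rule H2_weak_partial[OF H2_diff(1)[OF open_interior u v]])
    show "is_face_trace K e (weak_partial ?S i (\<lambda>x. u x - v x))
       (\<lambda>x. face_trace K e (weak_partial ?S i u) x - face_trace K e (weak_partial ?S i v) x)"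
      by (rule trace_cong_AE[OF trace_diff[OF is_face_trace_face_trace[OF H2_weak_partial[OF u]]
              is_face_trace_face_trace[OF H2_weak_partial[OF v]]] d
            weak_partial_diff_AE[OF open_interior H2_H1[OF u] H2_H1[OF v]]])
  qed
  have "AE x in face_measure e. \<forall>i\<in>UNIV. face_trace K e (weak_partial ?S i (\<lambda>x. u x - v x)) x
     = face_trace K e (weak_partial ?S i u) x - face_trace K e (weak_partial ?S i v) x"
    by (rule AE_finite_allI) (use tr in auto)
  then show ?thesis
    by (rule eventually_mono) (simp add: normal_derivative_def right_diff_distrib sum_subtractf)
qed

end

lemma H1_norm_mono:
  fixes u :: "real^'n \<Rightarrow> real"
  assumes S: "open S" and T: "open T" "T \<subseteq> S" and u: "u \<in> H1 S"
  shows "H1_norm T u \<le> H1_norm S u"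
proof -
  have le: "(\<integral>x. (f x)\<^sup>2 \<partial>lebesgue_on T) \<le> (\<integral>x. (f x)\<^sup>2 \<partial>lebesgue_on S)" if f: "f \<in> L2 S" for f
  proof -
    have i: "integrable lebesgue (zero_ext S (\<lambda>x. (f x)\<^sup>2))" "integrable lebesgue (zero_ext T (\<lambda>x. (f x)\<^sup>2))"
      using f L2_subset[OF S T f] open_lebesgue[OF S] open_lebesgue[OF T(1)]
      by (auto simp: L2_def integrable_zero_ext[symmetric])
    show ?thesis
      unfolding integral_zero_ext[OF open_lebesgue[OF S]] integral_zero_ext[OF open_lebesgue[OF T(1)]]
      by (rule integral_mono[OF i(2,1)]) (use T(2) in \<open>auto simp: zero_ext_def\<close>)
  qed
  note w = H1_weak_partial[OF S u]
  show ?thesis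
    unfolding H1_norm_eq[OF S w(1)] H1_norm_eq[OF T(1) is_weak_partial_subset[OF S T w(1)]]
    by (intro real_sqrt_le_mono add_mono sum_mono le H1_L2[OF u] w(2))
qed

lemma trace_from_both_sides:
  fixes \<Omega> :: "(real^'n) set"
  assumes \<Omega>: "open \<Omega>" "bounded \<Omega>" "convex \<Omega>" "\<Omega> \<noteq> {}" and w: "w \<in> H1 \<Omega>"
    and K: "int CARD('n) simplex K" "e facet_of K" "interior K \<subseteq> \<Omega>"
    and K': "int CARD('n) simplex K'" "e facet_of K'" "interior K' \<subseteq> \<Omega>"
    and s: "is_face_trace K e w s" and t: "is_face_trace K' e w t"
  shows "AE x in face_measure e. s x = t x"
proof -
  interpret A: simplex_facet_pair K e by unfold_locales (rule K)+
  interpret B: simplex_facet_pair K' e by unfold_locales (rule K')+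
  obtain \<phi> where \<phi>: "\<And>k::nat. smooth (\<phi> k)" "(\<lambda>k. H1_norm \<Omega> (\<lambda>x. \<phi> k x - w x)) \<longlonglongrightarrow> 0"
    using smooth_dense_H1[OF \<Omega> w] by blast
  have sub: "(\<lambda>k. H1_norm T (\<lambda>x. \<phi> k x - w x)) \<longlonglongrightarrow> 0" if T: "open T" "T \<subseteq> \<Omega>" for T
  proof (rule tendsto_sandwich[OF _ _ tendsto_const \<phi>(2)])
    show "\<forall>\<^sub>F k in sequentially. H1_norm T (\<lambda>x. \<phi> k x - w x) \<le> H1_norm \<Omega> (\<lambda>x. \<phi> k x - w x)"
      by (intro always_eventually allI H1_norm_mono[OF \<Omega>(1) T] H1_diff \<Omega> smooth_H1 \<phi> w)
    show "\<forall>\<^sub>F k in sequentially. 0 \<le> H1_norm T (\<lambda>x. \<phi> k x - w x)"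
      by (simp add: H1_norm_def sum_nonneg)
  qed
  show ?thesis
    by (rule L2_limit_unique[OF A.smooth_square_integrable[OF \<phi>(1)] A.trace_square_integrable[OF s] B.trace_square_integrable[OF t]
          A.trace_limit[OF s \<phi>(1) sub[OF open_interior K(3)]] B.trace_limit[OF t \<phi>(1) sub[OF open_interior K'(3)]]])
qed

section \<open>Normal derivatives across interior faces\<close>

text \<open>The part of \<open>m\<close> orthogonal to \<open>n\<close> is a direction inside the
  affine hull of \<open>e\<close>, hence orthogonal to \<open>m\<close>. This forces the cosine
  \<open>c\<close> between the unit vectors to satisfy \<open>c * c = 1\<close>.\<close>

lemma hyperplane_unit_normal_unique:
  fixes n m :: "real^'n"
  assumes n: "norm n = 1" and e: "affine hull e = {x. n \<bullet> x = \<beta>}" and m: "norm m = 1"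
    and x0: "x0 \<in> e" and orth: "\<And>y. y \<in> e \<Longrightarrow> (y - x0) \<bullet> m = 0"
  shows "m = n \<or> m = - n"
proof -
  have "e \<subseteq> {p. m \<bullet> p = m \<bullet> x0}"
  proof
    fix y assume "y \<in> e"
    from orth[OF this] show "y \<in> {p. m \<bullet> p = m \<bullet> x0}" by (simp add: inner_diff_left inner_commute[of m])
  qed
  then have sub: "affine hull e \<subseteq> {p. m \<bullet> p = m \<bullet> x0}"
    by (rule hull_minimal) (rule affine_hyperplane)
  have nx0: "n \<bullet> x0 = \<beta>" using hull_inc[OF x0, of affine] e by auto
  define c where "c = n \<bullet> m"
  have nn: "n \<bullet> n = 1" "m \<bullet> m = 1" using n m by (simp_all add: dot_square_norm)
  have "x0 + (m - c *\<^sub>R n) \<in> affine hull e"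
    unfolding e using nx0 nn by (simp add: inner_add_right inner_diff_right c_def)
  then have "m \<bullet> (x0 + (m - c *\<^sub>R n)) = m \<bullet> x0" using sub by blast
  then have c2: "c * c = 1" using nn by (simp add: inner_add_right inner_diff_right c_def inner_commute[of m n])
  have "(m - c *\<^sub>R n) \<bullet> (m - c *\<^sub>R n) = 0"
    using nn c2 by (simp add: inner_diff_left inner_diff_right c_def inner_commute[of m n])
  then have "m = c *\<^sub>R n" by simp
  moreover have "c = 1 \<or> c = - 1" using c2 by (simp add: square_eq_1_iff)
  ultimately show ?thesis by auto
qed

text \<open>For the \<open>THE\<close>: applying the sign condition to both orders of two points of
  \<open>e\<close> gives orthogonality and leaves only \<open>n\<close> and \<open>- n\<close>; the
  point \<open>z\<close> strictly inside the half-space excludes \<open>n\<close>.\<close>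

lemma outward_normal_eq:
  fixes K e :: "(real^'n) set"
  assumes n: "norm n = 1" and e: "affine hull e = {x. n \<bullet> x = \<beta>}" and ne: "e \<noteq> {}"
    and K: "\<And>x. x \<in> K \<Longrightarrow> n \<bullet> x \<ge> \<beta>" "e \<subseteq> K" and z: "z \<in> K" "n \<bullet> z > \<beta>"
  shows "outward_normal K e = - n"
  unfolding outward_normal_def
proof (rule the_equality)
  have eH: "n \<bullet> x = \<beta>" if "x \<in> e" for x using hull_inc[OF that, of affine] e by auto
  show "norm (- n) = 1 \<and> (\<forall>x\<in>e. \<forall>y\<in>K. (y - x) \<bullet> - n \<le> 0)"
  proof (intro conjI ballI)
    fix x y assume "x \<in> e" "y \<in> K"
    then have "n \<bullet> x = \<beta>" "n \<bullet> y \<ge> \<beta>" using eH K(1) by blast+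
    then show "(y - x) \<bullet> - n \<le> 0" by (simp add: inner_diff_left inner_commute[of n])
  qed (simp add: n)
  fix m assume m: "norm m = 1 \<and> (\<forall>x\<in>e. \<forall>y\<in>K. (y - x) \<bullet> m \<le> 0)"
  obtain x0 where x0: "x0 \<in> e" using ne by blast
  have "(y - x0) \<bullet> m = 0" if y: "y \<in> e" for y
  proof -
    have "(y - x0) \<bullet> m \<le> 0" "(x0 - y) \<bullet> m \<le> 0" using m x0 y K(2) by blast+
    moreover have "(x0 - y) \<bullet> m = - ((y - x0) \<bullet> m)" by (simp add: inner_diff_left)
    ultimately show ?thesis by linarith
  qed
  then have "m = n \<or> m = - n" using hyperplane_unit_normal_unique[OF n e _ x0] m by blast
  moreover have "m \<noteq> n"
  proof
    assume "m = n"
    then have "(z - x0) \<bullet> n \<le> 0" using m x0 z(1) by blast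
    then show False using z(2) eH[OF x0] by (simp add: inner_diff_left inner_commute[of n])
  qed
  ultimately show "m = - n" by blast
qed

lemma simplex_outward_normal:
  fixes K e :: "(real^'n) set"
  assumes K: "int CARD('n) simplex K" and e: "e facet_of K"
  obtains n \<beta> z where "norm n = 1" "affine hull e = {x. n \<bullet> x = \<beta>}" "outward_normal K e = - n"
    "\<And>x. x \<in> K \<Longrightarrow> n \<bullet> x \<ge> \<beta>" "z \<in> interior K" "n \<bullet> z > \<beta>"
proof -
  obtain n \<beta> A where n: "norm n = 1" "affine hull e = {x. n \<bullet> x = \<beta>}"
    and KH: "\<And>x. x \<in> K \<Longrightarrow> n \<bullet> x \<ge> \<beta>" "\<And>x. x \<in> interior K \<Longrightarrow> n \<bullet> x > \<beta>"
    using simplex_facet[OF K e] by metis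
  obtain z where z: "z \<in> interior K" using simplex_interior_nonempty[OF K] by blast
  have "outward_normal K e = - n"
    by (rule outward_normal_eq[OF n _ KH(1) facet_of_imp_subset[OF e] _ KH(2)[OF z]])
       (use e z interior_subset in \<open>auto simp: facet_of_def\<close>)
  with n KH(1) z KH(2)[OF z] show thesis by (intro that)
qed

lemma full_dim_face:
  fixes K F :: "(real^'n) set"
  assumes K: "int CARD('n) simplex K" and F: "F face_of K" and d: "aff_dim F \<ge> int CARD('n)"
  shows "F = K"
proof (rule ccontr)
  assume "F \<noteq> K"
  then have "aff_dim F < aff_dim K" by (rule face_of_aff_dim_lt[OF convex_simplex[OF K] F])
  then show False using d aff_dim_simplex[OF K] by simp
qed

text \<open>If two simplices lay on the same side of a common facet, they would overlap near a relative
  interior point \<open>x0\<close> of it: \<open>q = x0 + \<tau> (z' - x0)\<close> belongs to both for small \<open>\<tau>\<close>.\<close>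

lemma same_side_imp_eq:
  fixes K K' e :: "(real^'n) set"
  assumes K: "int CARD('n) simplex K" "e facet_of K" and K': "int CARD('n) simplex K'" "e facet_of K'"
    and int: "(K \<inter> K') face_of K" "(K' \<inter> K) face_of K'"
    and e: "affine hull e = {x. n \<bullet> x = \<beta>}"
    and z: "z \<in> K" "n \<bullet> z > \<beta>" and z': "z' \<in> K'" "n \<bullet> z' > \<beta>"
  shows "K = K'"
proof -
  have eK: "e \<subseteq> K" "e \<subseteq> K'" using K K' facet_of_imp_subset by blast+
  have "e \<noteq> {}" using K(2) by (simp add: facet_of_def)
  moreover have "convex e" using K(2) convex_simplex[OF K(1)] facet_of_imp_face_of face_of_imp_convex by blast
  ultimately obtain x0 where x0: "x0 \<in> rel_interior e" using rel_interior_eq_empty by blast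
  then obtain \<epsilon> where x0e: "x0 \<in> e" and \<epsilon>: "\<epsilon> > 0" "ball x0 \<epsilon> \<inter> affine hull e \<subseteq> e" by (auto simp: mem_rel_interior_ball)
  have nx0: "n \<bullet> x0 = \<beta>" using hull_inc[OF x0e, of affine] e by auto
  \<comment> \<open>The ratio of the heights of \<open>z'\<close> and \<open>z\<close>, chosen so
    that subtracting \<open>l\<close> times the direction to \<open>z\<close> makes \<open>h\<close>
    parallel to the facet.\<close>
  define l where "l = (n \<bullet> z' - \<beta>) / (n \<bullet> z - \<beta>)"
  have l: "l > 0" using z z' by (simp add: l_def)
  define h where "h = (z' - x0) - l *\<^sub>R (z - x0)"
  have nh: "n \<bullet> h = 0" using z nx0 by (simp add: h_def inner_diff_right l_def)
  \<comment> \<open>The three bounds keep \<open>q\<close> on the segment from \<open>x0\<close> to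
    \<open>z'\<close>, keep \<open>1 - \<tau> * l\<close> at least 1/2, and keep \<open>p\<close>
    within \<epsilon> of \<open>x0\<close>.\<close>
  define \<tau> where "\<tau> = min (1/2) (min (1 / (2 * l)) (\<epsilon> / (4 * (norm h + 1))))"
  have hp: "norm h + 1 > 0" by (simp add: add_nonneg_pos)
  have \<tau>0: "\<tau> > 0" using l \<epsilon>(1) hp by (simp add: \<tau>_def)
  have \<tau>1: "\<tau> \<le> 1/2" unfolding \<tau>_def by (rule min.cobounded1)
  have "\<tau> \<le> 1 / (2 * l)" unfolding \<tau>_def by (rule min.coboundedI2[OF min.cobounded1])
  then have \<tau>l: "\<tau> * l \<le> 1/2" using l by (simp add: field_simps)
  have "\<tau> \<le> \<epsilon> / (4 * (norm h + 1))" unfolding \<tau>_def by (rule min.coboundedI2[OF min.cobounded2])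
  then have \<tau>h: "\<tau> * (norm h + 1) \<le> \<epsilon> / 4" using hp by (simp add: field_simps)
  \<comment> \<open>The solution of
    \<open>q = (1 - \<tau> * l) *\<^sub>R p + (\<tau> * l) *\<^sub>R z\<close>. It lies in the
    hyperplane and close to the relative interior point \<open>x0\<close>, hence in the facet, so
    that \<open>q\<close> belongs to \<open>K\<close> as well.\<close>
  define p where "p = x0 + (\<tau> / (1 - \<tau> * l)) *\<^sub>R h"
  have d: "1 - \<tau> * l \<ge> 1/2" using \<tau>l by simp
  have pe: "p \<in> e"
  proof -
    have "\<tau> / (1 - \<tau> * l) \<le> \<tau> / (1/2)" using d \<tau>0 by (intro divide_left_mono) auto
    then have t2: "\<tau> / (1 - \<tau> * l) \<le> 2 * \<tau>" by simp
    have "dist x0 p = (\<tau> / (1 - \<tau> * l)) * norm h" using \<tau>0 d by (simp add: p_def dist_norm)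
    also have "\<dots> \<le> (2 * \<tau>) * (norm h + 1)" using t2 \<tau>0 by (intro mult_mono) auto
    also have "\<dots> < \<epsilon>" using \<tau>h \<epsilon>(1) by simp
    finally have "p \<in> ball x0 \<epsilon>" by simp
    moreover have "p \<in> affine hull e" unfolding e using nx0 nh by (simp add: p_def inner_add_right)
    ultimately show ?thesis using \<epsilon>(2) by blast
  qed
  define q where "q = x0 + \<tau> *\<^sub>R (z' - x0)"
  have q1: "q = (1 - \<tau>) *\<^sub>R x0 + \<tau> *\<^sub>R z'" by (simp add: q_def algebra_simps)
  have "(1 - \<tau> * l) *\<^sub>R p = (1 - \<tau> * l) *\<^sub>R x0 + \<tau> *\<^sub>R h"
    using d by (simp add: p_def scaleR_add_right)
  then have q2: "q = (1 - \<tau> * l) *\<^sub>R p + (\<tau> * l) *\<^sub>R z"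
    by (simp add: q_def h_def algebra_simps)
  have "q \<in> K'" unfolding q1
    by (rule convexD_alt[OF convex_simplex[OF K'(1)]]) (use x0e eK z' \<tau>0 \<tau>1 in auto)
  moreover have "q \<in> K" unfolding q2
    by (rule convexD_alt[OF convex_simplex[OF K(1)]]) (use pe eK z \<tau>0 \<tau>l l in auto)
  ultimately have sub: "insert q e \<subseteq> K \<inter> K'" using eK by blast
  have "n \<bullet> q = \<beta> + \<tau> * (n \<bullet> z' - \<beta>)" by (simp add: q_def inner_add_right inner_diff_right nx0)
  moreover have "\<tau> * (n \<bullet> z' - \<beta>) > 0" using \<tau>0 z'(2) by simp
  ultimately have "n \<bullet> q > \<beta>" by linarith
  then have "q \<notin> affine hull e" unfolding e by simp
  then have "aff_dim (insert q e) = aff_dim e + 1" by (simp add: aff_dim_insert)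
  moreover have "aff_dim e = int CARD('n) - 1" using K(2) aff_dim_simplex[OF K(1)] by (simp add: facet_of_def)
  ultimately have ge: "aff_dim (K \<inter> K') \<ge> int CARD('n)" using aff_dim_subset[OF sub] by simp
  have "K \<inter> K' = K" by (rule full_dim_face[OF K(1) int(1) ge])
  moreover have "K' \<inter> K = K'" by (rule full_dim_face[OF K'(1) int(2)]) (use ge in \<open>simp add: Int_commute\<close>)
  ultimately show ?thesis by blast
qed

lemma outward_normal_opposite:
  fixes K K' e :: "(real^'n) set"
  assumes K: "int CARD('n) simplex K" "e facet_of K" and K': "int CARD('n) simplex K'" "e facet_of K'"
    and int: "(K \<inter> K') face_of K" "(K' \<inter> K) face_of K'" and ne: "K \<noteq> K'"
  shows "outward_normal K' e = - outward_normal K e"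
proof -
  obtain n \<beta> z where n: "norm n = 1" "affine hull e = {x. n \<bullet> x = \<beta>}" "outward_normal K e = - n"
    and z: "z \<in> interior K" "n \<bullet> z > \<beta>"
    using simplex_outward_normal[OF K] by metis
  obtain n' \<beta>' z' where n': "norm n' = 1" "affine hull e = {x. n' \<bullet> x = \<beta>'}" "outward_normal K' e = - n'"
    and z': "z' \<in> interior K'" "n' \<bullet> z' > \<beta>'"
    using simplex_outward_normal[OF K'] by metis
  obtain x0 where x0: "x0 \<in> e" using K(2) by (auto simp: facet_of_def)
  have H: "n \<bullet> x = \<beta>" "n' \<bullet> x = \<beta>'" if "x \<in> e" for x
    using hull_inc[OF that, of affine] n(2) n'(2) by auto
  have "n' = n \<or> n' = - n"
    by (rule hyperplane_unit_normal_unique[OF n(1,2) n'(1) x0])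
       (simp add: inner_diff_right inner_commute[of _ n'] H x0)
  moreover have "n' \<noteq> n"
  proof
    assume eq: "n' = n"
    then have "\<beta>' = \<beta>" using H[OF x0] by simp
    then have "K = K'"
      using same_side_imp_eq[OF K K' int n(2) _ z(2), of z'] z(1) z' eq interior_subset[of K] interior_subset[of K'] by blast
    with ne show False by simp
  qed
  ultimately have "n' = - n" by blast
  then show ?thesis using n(3) n'(3) by simp
qed

lemma norm_matrix_square: "(norm (M :: real^'m^'k))\<^sup>2 = (\<Sum>i\<in>UNIV. \<Sum>j\<in>UNIV. (M $ i $ j)\<^sup>2)"
  unfolding dot_square_norm[symmetric] by (simp add: inner_vec_def power2_eq_square)

section \<open>Interior faces, jumps and the piecewise Hessian on a mesh\<close>

locale mesh =
  fixes \<Omega> :: "(real^'n) set" and \<T> :: "(real^'n) set set"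
  assumes dom: "polytopal_domain \<Omega>" and mesh: "simplicial_mesh \<Omega> \<T>"
begin

lemma domain: "open \<Omega>" "bounded \<Omega>" "convex \<Omega>" "\<Omega> \<noteq> {}"
  using dom by (auto simp: polytopal_domain_def)

lemma finite_mesh: "finite \<T>"
  using mesh by (simp add: simplicial_mesh_def triangulation_def)

lemma simplex: "K \<in> \<T> \<Longrightarrow> int CARD('n) simplex K"
  using mesh by (simp add: simplicial_mesh_def)

lemma union_mesh: "\<Union>\<T> = closure \<Omega>"
  using mesh by (simp add: simplicial_mesh_def)

lemma inter_face: "K \<in> \<T> \<Longrightarrow> K' \<in> \<T> \<Longrightarrow> (K \<inter> K') face_of K"
  using mesh by (simp add: simplicial_mesh_def triangulation_def)

lemma pair: "K \<in> \<T> \<Longrightarrow> e facet_of K \<Longrightarrow> simplex_facet_pair K e"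
  by unfold_locales (rule simplex)

lemma interior_subset_domain: "K \<in> \<T> \<Longrightarrow> interior K \<subseteq> \<Omega>"
proof -
  assume "K \<in> \<T>"
  then have "interior K \<subseteq> interior (closure \<Omega>)" using union_mesh by (intro interior_mono) blast
  then show ?thesis using convex_interior_closure[OF domain(3)] domain(1) by (simp add: interior_open)
qed

text \<open>Distinct simplices on a face have opposite normals. A third one would have a normal
  opposite to two mutually opposite vectors, which a unit vector cannot be; so exactly two simplices
  meet and the sum in \<open>jump_normal\<close> has two terms.\<close>

lemma interior_face_simplices:
  assumes "e \<in> interior_faces \<T>"
  obtains K K' where "K \<in> \<T>" "K' \<in> \<T>" "K \<noteq> K'" "e facet_of K" "e facet_of K'"
    "{K \<in> \<T>. e facet_of K} = {K, K'}" "outward_normal K' e = - outward_normal K e"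
proof -
  obtain K K' where K: "K \<in> \<T>" "K' \<in> \<T>" "K \<noteq> K'" "e facet_of K" "e facet_of K'"
    using assms by (auto simp: interior_faces_def)
  have opp: "outward_normal B e = - outward_normal A e" if "A \<in> \<T>" "B \<in> \<T>" "A \<noteq> B" "e facet_of A" "e facet_of B" for A B
    by (rule outward_normal_opposite) (use that simplex inter_face in auto)
  have "norm (outward_normal K e) = 1"
    using simplex_outward_normal[OF simplex[OF K(1)] K(4)] by (metis norm_minus_cancel)
  then have nz: "outward_normal K e \<noteq> 0" by auto
  have "A = K \<or> A = K'" if A: "A \<in> \<T>" "e facet_of A" for A
  proof (rule ccontr)
    assume "\<not> ?thesis"
    then have 1: "outward_normal A e = - outward_normal K e" and 2: "outward_normal A e = - outward_normal K' e"
      using opp[OF K(1) A(1)] opp[OF K(2) A(1)] K A by auto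
    have 3: "outward_normal K' e = - outward_normal K e" by (rule opp[OF K])
    from 1 2 3 have "- outward_normal K e = outward_normal K e" by simp
    then show False using nz by (simp add: vec_eq_iff)
  qed
  then have "{K \<in> \<T>. e facet_of K} = {K, K'}" using K by blast
  with K opp[OF K] show thesis by (intro that)
qed

lemma jump_normal_solution:
  assumes u: "u \<in> H2 \<Omega>" and e: "e \<in> interior_faces \<T>"
  shows "AE x in face_measure e. jump_normal \<T> e u x = 0"
proof -
  obtain K K' where K: "K \<in> \<T>" "K' \<in> \<T>" "K \<noteq> K'" "e facet_of K" "e facet_of K'"
    "{K \<in> \<T>. e facet_of K} = {K, K'}" and N: "outward_normal K' e = - outward_normal K e"
    by (rule interior_face_simplices[OF e])
  \<comment> \<open>\<open>jump_normal\<close> takes traces of derivatives computed separately in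
    each simplex. Both are recognised as traces of the single function
    \<open>weak_partial \<Omega> i u\<close>, which makes the two sides comparable.\<close>
  have tr: "is_face_trace A e (weak_partial \<Omega> i u) (face_trace A e (weak_partial (interior A) i u))"
    if A: "A \<in> \<T>" "e facet_of A" for A i
  proof -
    interpret simplex_facet_pair A e by (rule pair[OF A])
    note sub = domain(1) open_interior interior_subset_domain[OF A(1)]
    show ?thesis
    proof (rule trace_cong_AE[OF is_face_trace_face_trace])
      show "weak_partial (interior A) i u \<in> H1 (interior A)"
        by (rule H2_weak_partial[OF H2_subset(1)[OF sub u]])
      show "weak_partial \<Omega> i u \<in> H1 (interior A)"
        by (rule H1_subset[OF sub H2_weak_partial[OF u]])
      show "AE x in lebesgue_on (interior A). weak_partial \<Omega> i u x = weak_partial (interior A) i u x"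
        using weak_partial_subset_AE[OF sub H2_H1[OF u], of i] by (rule eventually_mono) simp
    qed
  qed
  have "AE x in face_measure e. face_trace K e (weak_partial (interior K) i u) x = face_trace K' e (weak_partial (interior K') i u) x" for i
    by (rule trace_from_both_sides[OF domain H2_weak_partial[OF u] simplex[OF K(1)] K(4) interior_subset_domain[OF K(1)]
          simplex[OF K(2)] K(5) interior_subset_domain[OF K(2)] tr[OF K(1,4)] tr[OF K(2,5)]])
  then have "AE x in face_measure e. \<forall>i\<in>UNIV. face_trace K e (weak_partial (interior K) i u) x = face_trace K' e (weak_partial (interior K') i u) x"
    by (intro AE_finite_allI) auto
  then show ?thesis
  proof (rule eventually_mono)
    fix x assume eq: "\<forall>i\<in>UNIV. face_trace K e (weak_partial (interior K) i u) x = face_trace K' e (weak_partial (interior K') i u) x"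
    have "jump_normal \<T> e u x = normal_derivative K e u x + normal_derivative K' e u x"
      unfolding jump_normal_def K(6) using K(3) by simp
    also have "\<dots> = 0" using eq by (simp add: normal_derivative_def N sum_negf)
    finally show "jump_normal \<T> e u x = 0" .
  qed
qed

lemma finite_facet_simplices: "finite {K \<in> \<T>. e facet_of K}"
  using finite_mesh by simp

lemma jump_normal_square_integrable:
  assumes v: "\<And>K. K \<in> \<T> \<Longrightarrow> v \<in> H2 (interior K)"
  shows "square_integrable (face_measure e) (jump_normal \<T> e v)"
  unfolding jump_normal_def
  by (intro square_integrable_sum simplex_facet_pair.normal_derivative_square_integrable[OF pair]) (auto intro: v)

lemma jump_normal_diff:
  assumes u: "\<And>K. K \<in> \<T> \<Longrightarrow> u \<in> H2 (interior K)" and v: "\<And>K. K \<in> \<T> \<Longrightarrow> v \<in> H2 (interior K)"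
  shows "AE x in face_measure e. jump_normal \<T> e (\<lambda>x. u x - v x) x = jump_normal \<T> e u x - jump_normal \<T> e v x"
proof -
  have "AE x in face_measure e. \<forall>K\<in>{K \<in> \<T>. e facet_of K}.
      normal_derivative K e (\<lambda>x. u x - v x) x = normal_derivative K e u x - normal_derivative K e v x"
  proof (rule AE_finite_allI[OF finite_facet_simplices])
    fix K assume "K \<in> {K \<in> \<T>. e facet_of K}"
    then show "AE x in face_measure e. normal_derivative K e (\<lambda>x. u x - v x) x = normal_derivative K e u x - normal_derivative K e v x"
      by (intro simplex_facet_pair.normal_derivative_diff[OF pair] u v) auto
  qed
  then show ?thesis
    by (rule eventually_mono) (simp add: jump_normal_def sum_subtractf)
qed

text \<open>An overlap of interiors would make the common face full-dimensional, and the only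
  full-dimensional face of a simplex is the simplex itself.\<close>

lemma interior_disjoint:
  assumes "K \<in> \<T>" "K' \<in> \<T>" "K \<noteq> K'"
  shows "interior K \<inter> interior K' = {}"
proof (rule ccontr)
  assume "interior K \<inter> interior K' \<noteq> {}"
  then have "interior (K \<inter> K') \<noteq> {}" by simp
  then have "affine hull (K \<inter> K') = UNIV" by (rule affine_hull_nonempty_interior)
  then have d: "aff_dim (K \<inter> K') \<ge> int CARD('n)" by (simp add: aff_dim_eq_full[symmetric])
  have "K \<inter> K' = K" by (rule full_dim_face[OF simplex[OF assms(1)] inter_face[OF assms(1,2)] d])
  moreover have "K' \<inter> K = K'"
    by (rule full_dim_face[OF simplex[OF assms(2)] inter_face[OF assms(2,1)]]) (use d in \<open>simp add: Int_commute\<close>)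
  ultimately show False using assms(3) by blast
qed

lemma sum_indicator_interior:
  assumes "K \<in> \<T>" "x \<in> interior K"
  shows "(\<Sum>K\<in>\<T>. indicator (interior K) x *\<^sub>R F K) = (F K :: 'b::real_vector)"
proof -
  have "(\<Sum>K\<in>\<T>. indicator (interior K) x *\<^sub>R F K) = (\<Sum>K'\<in>\<T>. if K' = K then F K else 0)"
    using interior_disjoint[OF assms(1)] assms(2) by (intro sum.cong) (auto simp: indicator_def)
  then show ?thesis using assms(1) finite_mesh by simp
qed

lemma hessian_h_interior:
  "K \<in> \<T> \<Longrightarrow> x \<in> interior K \<Longrightarrow> hessian_h \<T> v x = weak_hessian (interior K) v x"
  unfolding hessian_h_def by (rule sum_indicator_interior)

text \<open>Frontiers of convex sets are negligible and there are finitely many elements. Stating it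
  on the closure of the domain covers the boundary points too, as is convenient for zero
  extensions.\<close>

lemma AE_in_interior: "AE x in lebesgue. x \<in> closure \<Omega> \<longrightarrow> (\<exists>K\<in>\<T>. x \<in> interior K)"
proof -
  have "negligible (\<Union>K\<in>\<T>. frontier K)"
    by (rule negligible_Union) (use finite_mesh simplex convex_simplex negligible_convex_frontier in auto)
  then have "AE x in lebesgue. x \<notin> (\<Union>K\<in>\<T>. frontier K)"
    by (intro AE_not_in) (simp add: negligible_iff_null_sets)
  then show ?thesis
  proof (rule eventually_mono)
    fix x assume x: "x \<notin> (\<Union>K\<in>\<T>. frontier K)"
    show "x \<in> closure \<Omega> \<longrightarrow> (\<exists>K\<in>\<T>. x \<in> interior K)"
    proof
      assume "x \<in> closure \<Omega>"
      then obtain K where K: "K \<in> \<T>" "x \<in> K" using union_mesh by blast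
      then have "x \<notin> frontier K" "x \<in> closure K" using x closure_subset[of K] by blast+
      then have "x \<in> interior K" by (simp add: frontier_def)
      with K(1) show "\<exists>K\<in>\<T>. x \<in> interior K" by blast
    qed
  qed
qed

lemma AE_mesh:
  assumes "\<And>K. K \<in> \<T> \<Longrightarrow> AE x in lebesgue_on (interior K). P x"
  shows "AE x in lebesgue_on \<Omega>. P x"
proof -
  have "AE x in lebesgue. \<forall>K\<in>\<T>. x \<in> interior K \<longrightarrow> P x"
  proof (rule AE_finite_allI[OF finite_mesh])
    fix K assume "K \<in> \<T>"
    from assms[OF this] show "AE x in lebesgue. x \<in> interior K \<longrightarrow> P x"
      by (simp add: AE_lebesgue_on_iff[OF open_lebesgue[OF open_interior[of K]]])
  qed
  then have "AE x in lebesgue. x \<in> \<Omega> \<longrightarrow> P x"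
    using AE_in_interior
  proof eventually_elim
    case (elim x)
    then show ?case using closure_subset[of \<Omega>] by blast
  qed
  then show ?thesis by (simp add: AE_lebesgue_on_iff[OF open_lebesgue[OF domain(1)]])
qed

lemma hessian_h_diff:
  assumes u: "\<And>K. K \<in> \<T> \<Longrightarrow> u \<in> H2 (interior K)" and v: "\<And>K. K \<in> \<T> \<Longrightarrow> v \<in> H2 (interior K)"
  shows "AE x in lebesgue_on \<Omega>. hessian_h \<T> (\<lambda>x. u x - v x) x = hessian_h \<T> u x - hessian_h \<T> v x"
proof (rule AE_mesh)
  fix K assume K: "K \<in> \<T>"
  let ?S = "interior K"
  have "AE x in lebesgue_on ?S. \<forall>i\<in>UNIV. \<forall>j\<in>UNIV. weak_partial ?S j (weak_partial ?S i (\<lambda>x. u x - v x)) x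
      = weak_partial ?S j (weak_partial ?S i u) x - weak_partial ?S j (weak_partial ?S i v) x"
    by (intro AE_finite_allI H2_diff(2) open_interior u v K) auto
  moreover have "AE x in lebesgue_on ?S. x \<in> ?S" by (rule AE_I2) simp
  ultimately show "AE x in lebesgue_on ?S. hessian_h \<T> (\<lambda>x. u x - v x) x = hessian_h \<T> u x - hessian_h \<T> v x"
    by eventually_elim (simp add: hessian_h_interior[OF K] weak_hessian_def vec_eq_iff)
qed

lemma hessian_h_solution:
  assumes u: "u \<in> H2 \<Omega>"
  shows "AE x in lebesgue_on \<Omega>. hessian_h \<T> u x = weak_hessian \<Omega> u x"
proof (rule AE_mesh)
  fix K assume K: "K \<in> \<T>"
  let ?S = "interior K"
  have "AE x in lebesgue_on ?S. \<forall>i\<in>UNIV. \<forall>j\<in>UNIV. weak_partial ?S j (weak_partial ?S i u) x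
      = weak_partial \<Omega> j (weak_partial \<Omega> i u) x"
    by (intro AE_finite_allI H2_subset(2)[OF domain(1) open_interior interior_subset_domain[OF K] u]) auto
  moreover have "AE x in lebesgue_on ?S. x \<in> ?S" by (rule AE_I2) simp
  ultimately show "AE x in lebesgue_on ?S. hessian_h \<T> u x = weak_hessian \<Omega> u x"
    by eventually_elim (simp add: hessian_h_interior[OF K] weak_hessian_def vec_eq_iff)
qed

lemma hessian_h_square_integrable:
  assumes v: "\<And>K. K \<in> \<T> \<Longrightarrow> v \<in> H2 (interior K)"
  shows "integrable (lebesgue_on \<Omega>) (\<lambda>x. (norm (hessian_h \<T> v x))\<^sup>2)"
proof -
  note \<Omega>' = open_lebesgue[OF domain(1)]
  have "square_integrable (lebesgue_on \<Omega>) (\<lambda>x. hessian_h \<T> v x $ i $ j)" for i j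
  proof -
    have "square_integrable (lebesgue_on \<Omega>) (\<lambda>x. indicator (interior K) x * weak_partial (interior K) j (weak_partial (interior K) i v) x)"
      if K: "K \<in> \<T>" for K
    proof -
      let ?f = "weak_partial (interior K) j (weak_partial (interior K) i v)"
      have "?f \<in> L2 (interior K)"
        by (rule H1_weak_partial(2)[OF open_interior H2_weak_partial[OF v[OF K]]])
      then have "square_integrable lebesgue (zero_ext (interior K) ?f)"
        using square_integrable_zero_ext[OF open_lebesgue[OF open_interior[of K]], of ?f] by (simp add: L2_iff)
      also have "zero_ext (interior K) ?f = zero_ext \<Omega> (\<lambda>x. indicator (interior K) x * ?f x)"
        using interior_subset_domain[OF K] by (auto simp: zero_ext_def indicator_def fun_eq_iff)
      finally show ?thesis by (simp add: square_integrable_zero_ext[OF \<Omega>'])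
    qed
    then have "square_integrable (lebesgue_on \<Omega>) (\<lambda>x. \<Sum>K\<in>\<T>. indicator (interior K) x * weak_partial (interior K) j (weak_partial (interior K) i v) x)"
      by (rule square_integrable_sum)
    then show ?thesis by (simp add: hessian_h_def weak_hessian_def)
  qed
  then show ?thesis
    unfolding norm_matrix_square by (intro Bochner_Integration.integrable_sum) (simp add: square_integrable_def)
qed

end

section \<open>The finite element space and the error estimate\<close>

lemma polynomials_le_smooth: "q \<in> polynomials_le p \<Longrightarrow> smooth q"
  unfolding polynomials_le_def smooth_def
  by (auto intro!: Ck_sum Ck_cmult Ck_prod Ck_power Ck_coord)

lemma polynomials_le_diff:
  assumes "q \<in> polynomials_le p" "r \<in> polynomials_le p"
  shows "(\<lambda>x. q x - r x) \<in> polynomials_le p"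
proof -
  obtain c where c: "q = (\<lambda>x. \<Sum>m | (\<Sum>i\<in>UNIV. m i) \<le> p. c m * (\<Prod>i\<in>UNIV. (x $ i) ^ m i))"
    using assms(1) by (auto simp: polynomials_le_def)
  obtain d where d: "r = (\<lambda>x. \<Sum>m | (\<Sum>i\<in>UNIV. m i) \<le> p. d m * (\<Prod>i\<in>UNIV. (x $ i) ^ m i))"
    using assms(2) by (auto simp: polynomials_le_def)
  show ?thesis
    unfolding polynomials_le_def
    by (intro CollectI exI[of _ "\<lambda>m. c m - d m"]) (simp add: c d left_diff_distrib sum_subtractf)
qed

lemma V_h_diff:
  assumes "v \<in> V_h \<Omega> p \<T>" "w \<in> V_h \<Omega> p \<T>"
  shows "(\<lambda>x. v x - w x) \<in> V_h \<Omega> p \<T>"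
  unfolding V_h_def
proof (intro CollectI conjI ballI)
  show "continuous_on (closure \<Omega>) (\<lambda>x. v x - w x)"
    using assms by (auto simp: V_h_def intro: continuous_on_diff)
  fix K assume K: "K \<in> \<T>"
  obtain q where q: "q \<in> polynomials_le p" "\<forall>x\<in>K. v x = q x" using assms(1) K by (auto simp: V_h_def)
  obtain r where r: "r \<in> polynomials_le p" "\<forall>x\<in>K. w x = r x" using assms(2) K by (auto simp: V_h_def)
  show "\<exists>q\<in>polynomials_le p. \<forall>x\<in>K. v x - w x = q x"
    by (rule bexI[OF _ polynomials_le_diff[OF q(1) r(1)]]) (use q r in simp)
qed

lemma smooth_Lipschitz_on_compact:
  fixes q :: "real^'n \<Rightarrow> real"
  assumes q: "smooth q" and K: "compact K" "convex K"
  obtains L where "L \<ge> 0" "\<And>x y. x \<in> K \<Longrightarrow> y \<in> K \<Longrightarrow> \<bar>q x - q y\<bar> \<le> L * dist x y"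
proof -
  have "\<exists>B\<ge>0. \<forall>x\<in>K. \<bar>partial i q x\<bar> \<le> B" for i
  proof -
    have "bounded (partial i q ` K)"
      by (intro compact_imp_bounded compact_continuous_image smooth_continuous smooth_partial q K)
    then obtain B where "\<forall>y\<in>partial i q ` K. norm y \<le> B" unfolding bounded_iff by blast
    then have "\<forall>x\<in>K. \<bar>partial i q x\<bar> \<le> max B 0" by (auto intro: max.coboundedI1)
    then show ?thesis by (intro exI[of _ "max B 0"]) simp
  qed
  then obtain B where B: "\<And>i. B i \<ge> 0" "\<And>i x. x \<in> K \<Longrightarrow> \<bar>partial i q x\<bar> \<le> B i" by metis
  let ?L = "\<Sum>i\<in>UNIV. B i"
  have L0: "?L \<ge> 0" using B(1) by (simp add: sum_nonneg)
  have "norm (q x - q y) \<le> ?L * norm (x - y)" if "x \<in> K" "y \<in> K" for x y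
  proof (rule differentiable_bound[OF K(2)])
    fix x assume x: "x \<in> K"
    have "q differentiable at x" using smooth_Ck[OF q, of "Suc 0"] by simp
    then show "(q has_derivative (\<lambda>h. \<Sum>i\<in>UNIV. h $ i * partial i q x)) (at x within K)"
      by (rule has_derivative_at_withinI[OF differentiable_has_derivative_partial])
    show "onorm (\<lambda>h. \<Sum>i\<in>UNIV. h $ i * partial i q x) \<le> ?L"
    proof (rule onorm_bound[OF L0])
      fix h :: "real^'n"
      have "norm (\<Sum>i\<in>UNIV. h $ i * partial i q x) \<le> (\<Sum>i\<in>UNIV. \<bar>h $ i\<bar> * \<bar>partial i q x\<bar>)"
        using sum_abs[of "\<lambda>i. h $ i * partial i q x" UNIV] by (simp add: abs_mult)
      also have "\<dots> \<le> (\<Sum>i\<in>UNIV. norm h * B i)"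
        by (intro sum_mono mult_mono component_le_norm_cart B x) auto
      finally show "norm (\<Sum>i\<in>UNIV. h $ i * partial i q x) \<le> ?L * norm h"
        by (simp add: sum_distrib_left mult.commute)
    qed
  qed (rule that)+
  then show thesis using that[of ?L] L0 by (simp add: dist_norm)
qed

lemma H10_cong_on:
  fixes u v :: "real^'n \<Rightarrow> real"
  assumes eq: "\<And>x. x \<in> S \<Longrightarrow> u x = v x" and S: "S \<in> sets lebesgue" and v: "v \<in> H10 S"
  shows "u \<in> H10 S"
proof -
  have "zero_ext S u = zero_ext S v" using eq by (auto simp: zero_ext_def fun_eq_iff)
  then have L2: "u \<in> L2 S \<longleftrightarrow> v \<in> L2 S"
    by (simp add: L2_iff square_integrable_zero_ext[OF S])
  have "is_weak_partial S i u w \<longleftrightarrow> is_weak_partial S i v w" for i w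
    by (rule is_weak_partial_cong_on[OF eq])
  then have H1: "u \<in> H1 S \<longleftrightarrow> v \<in> H1 S" by (simp add: H1_def L2)
  have "H1_norm S (\<lambda>x. u x - \<phi> x) = H1_norm S (\<lambda>x. v x - \<phi> x)" for \<phi>
  proof -
    have "weak_partial S i (\<lambda>x. u x - \<phi> x) = weak_partial S i (\<lambda>x. v x - \<phi> x)" for i
      by (rule weak_partial_cong_on) (simp add: eq)
    moreover have "(\<integral>x. (u x - \<phi> x)\<^sup>2 \<partial>lebesgue_on S) = (\<integral>x. (v x - \<phi> x)\<^sup>2 \<partial>lebesgue_on S)"
      by (rule Bochner_Integration.integral_cong) (auto simp: eq)
    ultimately show ?thesis by (simp add: H1_norm_def)
  qed
  then show ?thesis using v H1 by (simp add: H10_def)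
qed

section \<open>Finite element functions, boundary values and the mesh-dependent norm\<close>

context mesh
begin

lemma V_h_H2:
  assumes v: "v \<in> V_h \<Omega> p \<T>" and K: "K \<in> \<T>"
  shows "v \<in> H2 (interior K)"
proof -
  obtain q where q: "q \<in> polynomials_le p" "\<forall>x\<in>K. v x = q x" using v K by (auto simp: V_h_def)
  have b: "bounded (interior K)"
    using bounded_subset[OF compact_imp_bounded[OF compact_simplex[OF simplex[OF K]]] interior_subset] .
  show ?thesis
    by (rule H2_cong_on[OF _ smooth_H2[OF open_interior b polynomials_le_smooth[OF q(1)]] open_lebesgue[OF open_interior]])
       (use q(2) interior_subset[of K] in blast)
qed

lemma closed_element: "K \<in> \<T> \<Longrightarrow> closed K"
  using closed_simplex simplex by blast

text \<open>An element may touch the boundary, but there \<open>w\<close> vanishes, so the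
  polynomial of the element describes the zero extension on the whole closed element.\<close>

lemma zero_ext_on_element:
  assumes "K \<in> \<T>" "x \<in> K" and z: "\<And>x. x \<in> frontier \<Omega> \<Longrightarrow> w x = 0"
  shows "zero_ext \<Omega> w x = w x"
proof (cases "x \<in> \<Omega>")
  case False
  have "x \<in> closure \<Omega>" using assms(1,2) union_mesh by blast
  then have "x \<in> frontier \<Omega>" using False domain(1) by (simp add: frontier_def interior_open)
  then show ?thesis using z False by simp
qed simp

text \<open>Each segment is covered by finitely many closed pieces: its intersections with the
  elements and with the complement of the domain. On each piece the extension is Lipschitz with the
  common constant \<open>L\<close>, the sum of the element constants, and on an interval such bounds
  glue together.\<close>

lemma zero_ext_Lipschitz:
  assumes w: "w \<in> V_h \<Omega> p \<T>" and z: "\<And>x. x \<in> frontier \<Omega> \<Longrightarrow> w x = 0"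
  obtains L where "L \<ge> 0" "\<And>x y. \<bar>zero_ext \<Omega> w x - zero_ext \<Omega> w y\<bar> \<le> L * dist x y"
proof -
  let ?w = "zero_ext \<Omega> w"
  have "\<exists>L\<ge>0. \<forall>x\<in>K. \<forall>y\<in>K. \<bar>?w x - ?w y\<bar> \<le> L * dist x y" if K: "K \<in> \<T>" for K
  proof -
    obtain q where q: "q \<in> polynomials_le p" "\<forall>x\<in>K. w x = q x" using w K by (auto simp: V_h_def)
    obtain L where L: "L \<ge> 0" "\<And>x y. x \<in> K \<Longrightarrow> y \<in> K \<Longrightarrow> \<bar>q x - q y\<bar> \<le> L * dist x y"
      using smooth_Lipschitz_on_compact[OF polynomials_le_smooth[OF q(1)] compact_simplex[OF simplex[OF K]] convex_simplex[OF simplex[OF K]]]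
      by blast
    have "\<bar>?w x - ?w y\<bar> \<le> L * dist x y" if "x \<in> K" "y \<in> K" for x y
      using L(2)[OF that] that q(2) zero_ext_on_element[OF K _ z] by simp
    then show ?thesis using L(1) by blast
  qed
  then obtain l where l: "\<And>K. K \<in> \<T> \<Longrightarrow> l K \<ge> 0"
    "\<And>K x y. K \<in> \<T> \<Longrightarrow> x \<in> K \<Longrightarrow> y \<in> K \<Longrightarrow> \<bar>?w x - ?w y\<bar> \<le> l K * dist x y" by metis
  define L where "L = (\<Sum>K\<in>\<T>. l K)"
  have L: "L \<ge> 0" unfolding L_def using l(1) by (rule sum_nonneg)
  have "\<bar>?w x - ?w y\<bar> \<le> L * dist x y" for x y
  proof -
    let ?p = "\<lambda>s::real. x + s *\<^sub>R (y - x)"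
    \<comment> \<open>Pulling back to the parameter interval reduces the gluing to one dimension;
      the factor \<open>norm (y - x)\<close> is the speed of the parametrisation.\<close>
    have "lipschitz_on (L * norm (y - x)) {0..1} (\<lambda>s. ?w (?p s))"
    proof (rule lipschitz_on_closed_Union[where I="insert (- \<Omega>) \<T>" and U="\<lambda>S. ?p -` S"])
      show "closed (?p -` S)" if "S \<in> insert (- \<Omega>) \<T>" for S
        using that domain(1) closed_element by (intro closed_vimage continuous_intros) (auto simp: closed_Compl)
      show "lipschitz_on (L * norm (y - x)) (?p -` S) (\<lambda>s. ?w (?p s))" if S: "S \<in> insert (- \<Omega>) \<T>" for S
      proof (rule lipschitz_onI)
        fix s r assume sr: "s \<in> ?p -` S" "r \<in> ?p -` S"
        show "dist (?w (?p s)) (?w (?p r)) \<le> L * norm (y - x) * dist s r"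
        proof (cases "S \<in> \<T>")
          case True
          have "?p s \<in> S" "?p r \<in> S" using sr by auto
          then have "\<bar>?w (?p s) - ?w (?p r)\<bar> \<le> l S * dist (?p s) (?p r)" by (rule l(2)[OF True])
          also have "\<dots> \<le> L * dist (?p s) (?p r)"
            unfolding L_def by (intro mult_right_mono member_le_sum True l(1) finite_mesh) auto
          also have "dist (?p s) (?p r) = norm (y - x) * dist s r"
            by (simp add: dist_norm scaleR_diff_left[symmetric] dist_real_def mult.commute)
          finally show ?thesis by (simp add: dist_real_def mult.assoc)
        next
          case False
          then have "?p s \<notin> \<Omega>" "?p r \<notin> \<Omega>" using S sr by auto
          then show ?thesis using L by simp
        qed
      qed (use L in simp)
      show "{0..1} \<subseteq> (\<Union>S\<in>insert (- \<Omega>) \<T>. ?p -` S)"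
      proof
        fix s :: real
        have "?p s \<in> - \<Omega> \<or> ?p s \<in> \<Union>\<T>" using union_mesh closure_subset by blast
        then show "s \<in> (\<Union>S\<in>insert (- \<Omega>) \<T>. ?p -` S)" by blast
      qed
    qed (use finite_mesh L in auto)
    then have "dist (?w (?p 0)) (?w (?p 1)) \<le> L * norm (y - x) * dist (0::real) 1"
      by (rule lipschitz_onD) auto
    then show ?thesis by (simp add: dist_norm norm_minus_commute)
  qed
  with L show thesis by (rule that)
qed

text \<open>Boundary data are compared pointwise on the frontier, whereas the test space asks for
  \<open>H10\<close>. To apply \<open>Lipschitz_H10\<close>, axis derivatives are found inside each
  element from its polynomial and off the closure of the domain as zero; the points left over form a
  null set.\<close>

lemma vanishing_V_h_in_H10:
  assumes w: "w \<in> V_h \<Omega> p \<T>" and z: "\<And>x. x \<in> frontier \<Omega> \<Longrightarrow> w x = 0"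
  shows "w \<in> H10 \<Omega>"
proof -
  let ?w = "zero_ext \<Omega> w"
  obtain L where L: "L \<ge> 0" "\<And>x y. \<bar>?w x - ?w y\<bar> \<le> L * dist x y"
    using zero_ext_Lipschitz[OF w z] by blast
  have "\<exists>q. smooth q \<and> (\<forall>x\<in>K. ?w x = q x)" if K: "K \<in> \<T>" for K
  proof -
    obtain q where q: "q \<in> polynomials_le p" "\<forall>x\<in>K. w x = q x" using w K by (auto simp: V_h_def)
    then show ?thesis using polynomials_le_smooth[OF q(1)] zero_ext_on_element[OF K _ z] by auto
  qed
  then obtain q where q: "\<And>K. K \<in> \<T> \<Longrightarrow> smooth (q K)" "\<And>K x. K \<in> \<T> \<Longrightarrow> x \<in> K \<Longrightarrow> ?w x = q K x" by metis
  define D where "D i x = (\<Sum>K\<in>\<T>. indicator (interior K) x *\<^sub>R partial i (q K) x)" for i x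
  have Dm: "D i \<in> borel_measurable lebesgue" for i
    unfolding D_def
    by (intro borel_imp_lebesgue_measurable borel_measurable_sum borel_measurable_scaleR borel_measurable_indicator
        borel_open open_interior borel_measurable_continuous_onI smooth_continuous smooth_partial q)
  let ?h = "\<lambda>i k. (1 / real (Suc k)) *\<^sub>R axis i (1::real) :: real^'n"
  have h0: "(\<lambda>k. x + ?h i k) \<longlonglongrightarrow> x" for x i
    using tendsto_add[OF tendsto_const[of x] tendsto_scaleR[OF LIMSEQ_inverse_real_of_nat tendsto_const[of "axis i (1::real)"]]]
    by (simp add: divide_inverse)
  have lim: "AE x in lebesgue. (\<lambda>k. (?w (x + ?h i k) - ?w x) * real (Suc k)) \<longlonglongrightarrow> D i x" for i
    using AE_in_interior
  proof (rule eventually_mono)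
    fix x assume x: "x \<in> closure \<Omega> \<longrightarrow> (\<exists>K\<in>\<T>. x \<in> interior K)"
    show "(\<lambda>k. (?w (x + ?h i k) - ?w x) * real (Suc k)) \<longlonglongrightarrow> D i x"
    proof (cases "x \<in> closure \<Omega>")
      case True
      then obtain K where K: "K \<in> \<T>" "x \<in> interior K" using x by blast
      have "\<forall>\<^sub>F k in sequentially. x + ?h i k \<in> interior K"
        by (rule topological_tendstoD[OF h0 open_interior K(2)])
      then have ev: "\<forall>\<^sub>F k in sequentially. (q K (x + ?h i k) - q K x) * real (Suc k) = (?w (x + ?h i k) - ?w x) * real (Suc k)"
      proof (rule eventually_mono)
        fix k assume "x + ?h i k \<in> interior K"
        then have "x + ?h i k \<in> K" "x \<in> K" using interior_subset K(2) by blast+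
        then show "(q K (x + ?h i k) - q K x) * real (Suc k) = (?w (x + ?h i k) - ?w x) * real (Suc k)"
          using q(2)[OF K(1)] by simp
      qed
      have "(\<lambda>k. (q K (x + ?h i k) - q K x) * real (Suc k)) \<longlonglongrightarrow> partial i (q K) x"
        by (rule Ck1_difference_quotient[OF smooth_Ck[OF q(1)[OF K(1)]]])
      then have "(\<lambda>k. (?w (x + ?h i k) - ?w x) * real (Suc k)) \<longlonglongrightarrow> partial i (q K) x"
        by (rule Lim_transform_eventually[OF _ ev])
      then show ?thesis unfolding D_def sum_indicator_interior[OF K, of "\<lambda>K. partial i (q K) x"] .
    next
      case False
      then have "x \<in> - closure \<Omega>" by simp
      then have "\<forall>\<^sub>F k in sequentially. x + ?h i k \<in> - closure \<Omega>"
        by (intro topological_tendstoD[OF h0]) auto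
      then have "\<forall>\<^sub>F k in sequentially. (?w (x + ?h i k) - ?w x) * real (Suc k) = 0"
      proof (rule eventually_mono)
        fix k assume "x + ?h i k \<in> - closure \<Omega>"
        then have "x + ?h i k \<notin> \<Omega>" "x \<notin> \<Omega>" using closure_subset False by blast+
        then show "(?w (x + ?h i k) - ?w x) * real (Suc k) = 0" by simp
      qed
      then have "(\<lambda>k. (?w (x + ?h i k) - ?w x) * real (Suc k)) \<longlonglongrightarrow> 0" by (rule tendsto_eventually)
      moreover have "D i x = 0"
        unfolding D_def
      proof (rule sum.neutral, rule ballI)
        fix K assume "K \<in> \<T>"
        then have "x \<notin> interior K" using interior_subset_domain closure_subset False by blast
        then show "indicator (interior K) x *\<^sub>R partial i (q K) x = 0" by simp
      qed
      ultimately show ?thesis by simp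
    qed
  qed
  have "?w \<in> H10 \<Omega>"
    by (rule Lipschitz_H10[OF domain L _ Dm lim]) simp
  then show ?thesis
    by (rule H10_cong_on[OF _ open_lebesgue[OF domain(1)], rotated]) simp
qed

lemma face_weight_nonneg:
  assumes "\<sigma> \<ge> 0" and e: "e \<in> interior_faces \<T>"
  shows "0 \<le> \<sigma> / diameter e"
proof -
  obtain K where "K \<in> \<T>" "e facet_of K" using e by (auto simp: interior_faces_def)
  then have "bounded e"
    using bounded_subset[OF compact_imp_bounded[OF compact_simplex[OF simplex]] facet_of_imp_subset] by blast
  then show ?thesis using assms(1) diameter_ge_0 by (intro divide_nonneg_nonneg) auto
qed

lemma norm_h_square:
  assumes "\<sigma> \<ge> 0"
  shows "(norm_h \<Omega> \<sigma> \<T> v)\<^sup>2 = (\<integral>x. (norm (hessian_h \<T> v x))\<^sup>2 \<partial>lebesgue_on \<Omega>) +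
      (\<Sum>e\<in>interior_faces \<T>. \<sigma> / diameter e * (\<integral>x. (jump_normal \<T> e v x)\<^sup>2 \<partial>face_measure e))"
  unfolding norm_h_def
proof (rule real_sqrt_pow2, intro add_nonneg_nonneg sum_nonneg mult_nonneg_nonneg)
  fix e assume "e \<in> interior_faces \<T>"
  then show "0 \<le> \<sigma> / diameter e" by (rule face_weight_nonneg[OF assms])
qed simp_all

lemma norm_h_nonneg: "norm_h \<Omega> \<sigma> \<T> v \<ge> 0" if "\<sigma> \<ge> 0"
proof -
  have "(norm_h \<Omega> \<sigma> \<T> v)\<^sup>2 \<ge> 0" by simp
  then show ?thesis unfolding norm_h_square[OF that] by (simp add: norm_h_def)
qed

text \<open>The piecewise Hessian and the jumps respect differences only almost everywhere, so the
  triangle inequality is obtained in squared form under each integral. The factors 2 reappear in the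
  final constant.\<close>

lemma norm_h_diff_square_le:
  assumes \<sigma>: "\<sigma> \<ge> 0" and a: "\<And>K. K \<in> \<T> \<Longrightarrow> a \<in> H2 (interior K)" and b: "\<And>K. K \<in> \<T> \<Longrightarrow> b \<in> H2 (interior K)"
  shows "(norm_h \<Omega> \<sigma> \<T> (\<lambda>x. a x - b x))\<^sup>2 \<le> 2 * (norm_h \<Omega> \<sigma> \<T> a)\<^sup>2 + 2 * (norm_h \<Omega> \<sigma> \<T> b)\<^sup>2"
proof -
  have ab: "(\<lambda>x. a x - b x) \<in> H2 (interior K)" if "K \<in> \<T>" for K
    by (rule H2_diff(1)[OF open_interior a[OF that] b[OF that]])
  have i: "integrable (lebesgue_on \<Omega>) (\<lambda>x. (norm (hessian_h \<T> a x))\<^sup>2)"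
    "integrable (lebesgue_on \<Omega>) (\<lambda>x. (norm (hessian_h \<T> b x))\<^sup>2)"
    by (rule hessian_h_square_integrable, erule a b)+
  have hd: "AE x in lebesgue_on \<Omega>. hessian_h \<T> (\<lambda>x. a x - b x) x = hessian_h \<T> a x - hessian_h \<T> b x"
    by (rule hessian_h_diff[OF a b])
  have "(\<integral>x. (norm (hessian_h \<T> (\<lambda>x. a x - b x) x))\<^sup>2 \<partial>lebesgue_on \<Omega>)
    \<le> (\<integral>x. 2 * (norm (hessian_h \<T> a x))\<^sup>2 + 2 * (norm (hessian_h \<T> b x))\<^sup>2 \<partial>lebesgue_on \<Omega>)"
  proof (rule integral_mono_AE)
    show "AE x in lebesgue_on \<Omega>. (norm (hessian_h \<T> (\<lambda>x. a x - b x) x))\<^sup>2 \<le> 2 * (norm (hessian_h \<T> a x))\<^sup>2 + 2 * (norm (hessian_h \<T> b x))\<^sup>2"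
      using hd
    proof (rule eventually_mono)
      fix x assume eq: "hessian_h \<T> (\<lambda>x. a x - b x) x = hessian_h \<T> a x - hessian_h \<T> b x"
      have "(norm (hessian_h \<T> a x - hessian_h \<T> b x))\<^sup>2 \<le> (norm (hessian_h \<T> a x) + norm (hessian_h \<T> b x))\<^sup>2"
        by (intro power_mono norm_triangle_ineq4 norm_ge_zero)
      also have "\<dots> \<le> 2 * (norm (hessian_h \<T> a x))\<^sup>2 + 2 * (norm (hessian_h \<T> b x))\<^sup>2" by (rule sum_square_le)
      finally show "(norm (hessian_h \<T> (\<lambda>x. a x - b x) x))\<^sup>2 \<le> 2 * (norm (hessian_h \<T> a x))\<^sup>2 + 2 * (norm (hessian_h \<T> b x))\<^sup>2"
        unfolding eq .
    qed
    show "integrable (lebesgue_on \<Omega>) (\<lambda>x. (norm (hessian_h \<T> (\<lambda>x. a x - b x) x))\<^sup>2)"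
      by (rule hessian_h_square_integrable[OF ab])
  qed (use i in simp)
  also have "\<dots> = 2 * (\<integral>x. (norm (hessian_h \<T> a x))\<^sup>2 \<partial>lebesgue_on \<Omega>) + 2 * (\<integral>x. (norm (hessian_h \<T> b x))\<^sup>2 \<partial>lebesgue_on \<Omega>)"
    using i by simp
  finally have h: "(\<integral>x. (norm (hessian_h \<T> (\<lambda>x. a x - b x) x))\<^sup>2 \<partial>lebesgue_on \<Omega>)
     \<le> 2 * (\<integral>x. (norm (hessian_h \<T> a x))\<^sup>2 \<partial>lebesgue_on \<Omega>) + 2 * (\<integral>x. (norm (hessian_h \<T> b x))\<^sup>2 \<partial>lebesgue_on \<Omega>)" .
  have s: "square_integrable (face_measure e) (jump_normal \<T> e a)" "square_integrable (face_measure e) (jump_normal \<T> e b)"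
    "square_integrable (face_measure e) (jump_normal \<T> e (\<lambda>x. a x - b x))" for e
    by (rule jump_normal_square_integrable, erule a b ab)+
  have j: "\<sigma> / diameter e * (\<integral>x. (jump_normal \<T> e (\<lambda>x. a x - b x) x)\<^sup>2 \<partial>face_measure e)
     \<le> 2 * (\<sigma> / diameter e * (\<integral>x. (jump_normal \<T> e a x)\<^sup>2 \<partial>face_measure e)) + 2 * (\<sigma> / diameter e * (\<integral>x. (jump_normal \<T> e b x)\<^sup>2 \<partial>face_measure e))"
    if e: "e \<in> interior_faces \<T>" for e
  proof -
    have "(\<integral>x. (jump_normal \<T> e (\<lambda>x. a x - b x) x)\<^sup>2 \<partial>face_measure e) = (\<integral>x. (jump_normal \<T> e a x - jump_normal \<T> e b x)\<^sup>2 \<partial>face_measure e)"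
    proof (rule integral_cong_AE)
      show "AE x in face_measure e. (jump_normal \<T> e (\<lambda>x. a x - b x) x)\<^sup>2 = (jump_normal \<T> e a x - jump_normal \<T> e b x)\<^sup>2"
      proof (rule eventually_mono)
        show "AE x in face_measure e. jump_normal \<T> e (\<lambda>x. a x - b x) x = jump_normal \<T> e a x - jump_normal \<T> e b x"
          by (rule jump_normal_diff[OF a b])
      qed simp
      show "(\<lambda>x. (jump_normal \<T> e (\<lambda>x. a x - b x) x)\<^sup>2) \<in> borel_measurable (face_measure e)"
        by (rule borel_measurable_integrable[OF square_integrableD(2)[OF s(3)]])
      show "(\<lambda>x. (jump_normal \<T> e a x - jump_normal \<T> e b x)\<^sup>2) \<in> borel_measurable (face_measure e)"
        by (rule borel_measurable_integrable[OF square_integrableD(2)[OF square_integrable_diff[OF s(1,2)]]])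
    qed
    also have "\<dots> \<le> 2 * (\<integral>x. (jump_normal \<T> e a x)\<^sup>2 \<partial>face_measure e) + 2 * (\<integral>x. (jump_normal \<T> e b x)\<^sup>2 \<partial>face_measure e)"
      by (rule integral_square_diff_le[OF s(1,2)])
    finally have "\<sigma> / diameter e * (\<integral>x. (jump_normal \<T> e (\<lambda>x. a x - b x) x)\<^sup>2 \<partial>face_measure e)
      \<le> \<sigma> / diameter e * (2 * (\<integral>x. (jump_normal \<T> e a x)\<^sup>2 \<partial>face_measure e) + 2 * (\<integral>x. (jump_normal \<T> e b x)\<^sup>2 \<partial>face_measure e))"
      by (rule mult_left_mono[OF _ face_weight_nonneg[OF \<sigma> e]])
    then show ?thesis by (simp only: distrib_left mult.left_commute[of _ 2])
  qed
  have "(norm_h \<Omega> \<sigma> \<T> (\<lambda>x. a x - b x))\<^sup>2 \<le> (2 * (\<integral>x. (norm (hessian_h \<T> a x))\<^sup>2 \<partial>lebesgue_on \<Omega>) + 2 * (\<integral>x. (norm (hessian_h \<T> b x))\<^sup>2 \<partial>lebesgue_on \<Omega>))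
    + (\<Sum>e\<in>interior_faces \<T>. 2 * (\<sigma> / diameter e * (\<integral>x. (jump_normal \<T> e a x)\<^sup>2 \<partial>face_measure e)) + 2 * (\<sigma> / diameter e * (\<integral>x. (jump_normal \<T> e b x)\<^sup>2 \<partial>face_measure e)))"
    unfolding norm_h_square[OF \<sigma>] by (rule add_mono[OF h sum_mono[OF j]])
  also have "\<dots> = 2 * (norm_h \<Omega> \<sigma> \<T> a)\<^sup>2 + 2 * (norm_h \<Omega> \<sigma> \<T> b)\<^sup>2"
    unfolding norm_h_square[OF \<sigma>] sum.distrib sum_distrib_left[symmetric] distrib_left by linarith
  finally show ?thesis .
qed

end

section \<open>Pointwise estimates for the renormalised operator\<close>

lemma inner_mat_1: "M \<bullet> mat 1 = trace (M :: real^'n^'n)"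
  by (simp add: inner_vec_def mat_def trace_def if_distrib[of "\<lambda>c. _ * c"] cong: if_cong)

lemma norm_mat_1: "norm (mat 1 :: real^'n^'n) = sqrt (real CARD('n))"
proof -
  have "(mat 1 :: real^'n^'n) \<bullet> mat 1 = real CARD('n)"
    unfolding inner_mat_1 by (simp add: trace_def mat_def)
  then show ?thesis by (simp add: norm_eq_sqrt_inner)
qed

lemma abs_trace_le: "\<bar>trace (M :: real^'n^'n)\<bar> \<le> sqrt (real CARD('n)) * norm M"
  using Cauchy_Schwarz_ineq2[of M "mat 1"] by (simp add: inner_mat_1 norm_mat_1 mult.commute)

text \<open>\<open>gamma M\<close> scales like the inverse of \<open>norm M\<close>: Cauchy-Schwarz
  against the identity gives |trace M| \<le> sqrt d |M|, and the size of \<open>M\<close> cancels.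
  For \<open>M = 0\<close> the division convention makes the left side 0.\<close>

lemma gamma_bound:
  fixes M X :: "real^'n^'n"
  shows "\<bar>gamma M * (M \<bullet> X)\<bar> \<le> sqrt (real CARD('n)) * norm X"
proof (cases "M = 0")
  case True
  then show ?thesis by (simp add: gamma_def)
next
  case False
  then have n: "norm M > 0" by simp
  have "\<bar>gamma M * (M \<bullet> X)\<bar> = \<bar>trace M\<bar> / (norm M)\<^sup>2 * \<bar>M \<bullet> X\<bar>"
    by (simp add: gamma_def inner_mat_1 dot_square_norm abs_mult)
  also have "\<dots> \<le> (sqrt (real CARD('n)) * norm M) / (norm M)\<^sup>2 * (norm M * norm X)"
    by (intro mult_mono divide_right_mono abs_trace_le Cauchy_Schwarz_ineq2) auto
  also have "\<dots> = sqrt (real CARD('n)) * norm X" using n by (simp add: power2_eq_square)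
  finally show ?thesis .
qed

lemma elliptic_gamma_nonneg:
  fixes M :: "real^'n^'n"
  assumes "\<And>\<xi>. \<mu> * (norm \<xi>)\<^sup>2 \<le> \<xi> \<bullet> (M *v \<xi>)" "\<mu> \<ge> 0"
  shows "gamma M \<ge> 0"
proof -
  have "M $ i $ i \<ge> 0" for i
  proof -
    have "axis i 1 \<bullet> (M *v axis i 1) = M $ i $ i"
      by (simp add: inner_axis' matrix_vector_mult_basis column_def)
    then show ?thesis using assms(1)[of "axis i 1"] assms(2) by (simp add: norm_axis_1)
  qed
  then have "trace M \<ge> 0" by (simp add: trace_def sum_nonneg)
  then show ?thesis by (simp add: gamma_def inner_mat_1)
qed

text \<open>Rescaling by the nonnegative weights \<open>g\<close> preserves the equation \<open>sup L = 0\<close> because the supremum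
  is attained.\<close>

lemma rescaled_sup_bound:
  fixes L G g :: "'l \<Rightarrow> real"
  assumes a0: "a0 \<in> \<Lambda>" "L a0 = 0" and L: "\<And>a. a \<in> \<Lambda> \<Longrightarrow> L a \<le> 0" and g: "\<And>a. a \<in> \<Lambda> \<Longrightarrow> g a \<ge> 0"
    and G: "\<And>a. a \<in> \<Lambda> \<Longrightarrow> \<bar>G a - g a * L a\<bar> \<le> B"
  shows "\<bar>SUP a\<in>\<Lambda>. G a\<bar> \<le> B"
proof -
  have le: "G a \<le> B" if "a \<in> \<Lambda>" for a
  proof -
    have "g a * L a \<le> 0" using g[OF that] L[OF that] by (rule mult_nonneg_nonpos)
    then show ?thesis using G[OF that] by linarith
  qed
  have bdd: "bdd_above (G ` \<Lambda>)" using le by (intro bdd_aboveI2)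
  have "(SUP a\<in>\<Lambda>. G a) \<le> B" using a0(1) le by (intro cSUP_least) auto
  moreover have "- B \<le> G a0" using G[OF a0(1)] a0(2) by simp
  moreover have "G a0 \<le> (SUP a\<in>\<Lambda>. G a)" by (rule cSUP_upper[OF a0(1) bdd])
  ultimately show ?thesis by linarith
qed

text \<open>A real \<open>SUP\<close> over an unbounded set is an unspecified number, so its being 0
  says nothing by itself; compactness makes it a maximum. The singleton alternative serves
  discontinuous coefficients, since every function on one point is continuous.\<close>

lemma sup_attained:
  fixes L :: "'l::metric_space \<Rightarrow> real"
  assumes "compact \<Lambda>" "\<Lambda> \<noteq> {}" "continuous_on \<Lambda> L \<or> (\<exists>a. \<Lambda> = {a})" "(SUP a\<in>\<Lambda>. L a) = 0"
  obtains a0 where "a0 \<in> \<Lambda>" "L a0 = 0" "\<And>a. a \<in> \<Lambda> \<Longrightarrow> L a \<le> 0"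
proof -
  have "continuous_on \<Lambda> L" using assms(3) by auto
  then obtain a0 where a0: "a0 \<in> \<Lambda>" "\<And>a. a \<in> \<Lambda> \<Longrightarrow> L a \<le> L a0"
    using continuous_attains_sup[OF assms(1,2)] by blast
  have "(SUP a\<in>\<Lambda>. L a) = L a0" by (rule cSup_eq_maximum) (use a0 in auto)
  then show thesis using that[of a0] a0 assms(4) by simp
qed

text \<open>If \<open>f\<close> is not integrable its integral is 0 by convention and the bound
  persists. A supremum over an uncountable set can thus be estimated without discussing its
  measurability.\<close>

lemma abs_integral_le:
  fixes f g :: "'a \<Rightarrow> real"
  assumes g: "integrable M g" and le: "AE x in M. \<bar>f x\<bar> \<le> g x"
  shows "\<bar>integral\<^sup>L M f\<bar> \<le> integral\<^sup>L M g"
proof (cases "integrable M f")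
  case True
  have "\<bar>integral\<^sup>L M f\<bar> \<le> (\<integral>x. \<bar>f x\<bar> \<partial>M)" by (rule integral_abs_bound)
  also have "\<dots> \<le> integral\<^sup>L M g" by (rule integral_mono_AE) (use True g le in auto)
  finally show ?thesis .
next
  case False
  have "AE x in M. 0 \<le> g x" using le by (rule eventually_mono) (auto intro: order_trans[OF abs_ge_zero])
  then have "0 \<le> integral\<^sup>L M g" by (rule integral_nonneg_AE)
  then show ?thesis using False by (simp add: not_integrable_integral_eq)
qed

lemma Young_weighted:
  fixes a b c d :: real
  assumes "c > 0"
  shows "d * (a * b) \<le> d\<^sup>2 / (2 * c) * a\<^sup>2 + c / 2 * b\<^sup>2"
proof -
  have "0 \<le> (d * a - c * b)\<^sup>2 / (2 * c)" using assms by simp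
  also have "\<dots> = d\<^sup>2 / (2 * c) * a\<^sup>2 + c / 2 * b\<^sup>2 - d * (a * b)"
    using assms by (simp add: power2_eq_square field_simps)
  finally show ?thesis by simp
qed

context mesh
begin

lemma F_gamma_bound:
  fixes \<Lambda> :: "'l::metric_space set"
  assumes \<Lambda>: "compact \<Lambda>" "\<Lambda> \<noteq> {}" and reg: "coefficients_regular \<Omega> \<Lambda> A f"
    and \<mu>: "0 < \<mu>1" and ell: "uniformly_elliptic \<Omega> \<Lambda> A \<mu>1 \<mu>2" and u: "strong_solution \<Omega> \<Lambda> A f g u"
  shows "AE x in lebesgue_on \<Omega>. \<bar>F_gamma \<Lambda> A f \<T> v x\<bar> \<le> sqrt (real CARD('n)) * norm (hessian_h \<T> u x - hessian_h \<T> v x)"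
proof -
  have uH2: "u \<in> H2 \<Omega>" using u by (simp add: strong_solution_def)
  have sup: "AE x in lebesgue_on \<Omega>. (SUP \<alpha>\<in>\<Lambda>. A x \<alpha> \<bullet> weak_hessian \<Omega> u x - f x \<alpha>) = 0"
    using u by (simp add: strong_solution_def)
  have inD: "AE x in lebesgue_on \<Omega>. x \<in> \<Omega>" by (rule AE_I2) simp
  show ?thesis
    using sup inD ell[unfolded uniformly_elliptic_def] hessian_h_solution[OF uH2]
  proof eventually_elim
    fix x
    assume s: "(SUP \<alpha>\<in>\<Lambda>. A x \<alpha> \<bullet> weak_hessian \<Omega> u x - f x \<alpha>) = 0" and x: "x \<in> \<Omega>"
      and el: "\<forall>\<alpha>\<in>\<Lambda>. \<forall>\<xi>. \<mu>1 * (norm \<xi>)\<^sup>2 \<le> \<xi> \<bullet> (A x \<alpha> *v \<xi>) \<and> \<xi> \<bullet> (A x \<alpha> *v \<xi>) \<le> \<mu>2 * (norm \<xi>)\<^sup>2"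
      and hu: "hessian_h \<T> u x = weak_hessian \<Omega> u x"
    let ?L = "\<lambda>\<alpha>. A x \<alpha> \<bullet> weak_hessian \<Omega> u x - f x \<alpha>"
    have "continuous_on \<Lambda> ?L \<or> (\<exists>a. \<Lambda> = {a})"
      using reg unfolding coefficients_regular_def
    proof (elim disjE conjE exE)
      assume cA: "continuous_on (closure \<Omega> \<times> \<Lambda>) (\<lambda>(x, \<alpha>). A x \<alpha>)" and cf: "continuous_on (closure \<Omega> \<times> \<Lambda>) (\<lambda>(x, \<alpha>). f x \<alpha>)"
      have sub: "(\<lambda>\<alpha>. (x, \<alpha>)) ` \<Lambda> \<subseteq> closure \<Omega> \<times> \<Lambda>" using x closure_subset by auto
      have p: "continuous_on \<Lambda> (\<lambda>\<alpha>. (x, \<alpha>))" by (intro continuous_intros)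
      have "continuous_on \<Lambda> (\<lambda>\<alpha>. A x \<alpha>)" "continuous_on \<Lambda> (\<lambda>\<alpha>. f x \<alpha>)"
        using continuous_on_compose2[OF cA p sub] continuous_on_compose2[OF cf p sub] by simp_all
      then have "continuous_on \<Lambda> ?L" by (intro continuous_intros)
      then show ?thesis by blast
    qed auto
    from sup_attained[OF \<Lambda> this s] obtain a0 where a0: "a0 \<in> \<Lambda>" "?L a0 = 0" "\<And>a. a \<in> \<Lambda> \<Longrightarrow> ?L a \<le> 0" by blast
    show "\<bar>F_gamma \<Lambda> A f \<T> v x\<bar> \<le> sqrt (real CARD('n)) * norm (hessian_h \<T> u x - hessian_h \<T> v x)"
      unfolding F_gamma_def
    proof (rule rescaled_sup_bound[where L="?L" and g="\<lambda>a. gamma (A x a)", OF a0])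
      show "gamma (A x a) \<ge> 0" if "a \<in> \<Lambda>" for a
        by (rule elliptic_gamma_nonneg[of \<mu>1]) (use el that \<mu> in auto)
      fix a assume "a \<in> \<Lambda>"
      \<comment> \<open>The source term is the same for \<open>u\<close> and \<open>v\<close> and
        cancels, leaving the coefficient applied to the difference of the Hessians.\<close>
      have "gamma (A x a) * (A x a \<bullet> hessian_h \<T> v x - f x a) - gamma (A x a) * ?L a
        = gamma (A x a) * (A x a \<bullet> (hessian_h \<T> v x - hessian_h \<T> u x))"
        by (simp add: hu inner_diff_right algebra_simps)
      then show "\<bar>gamma (A x a) * (A x a \<bullet> hessian_h \<T> v x - f x a) - gamma (A x a) * ?L a\<bar>
        \<le> sqrt (real CARD('n)) * norm (hessian_h \<T> u x - hessian_h \<T> v x)"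
        using gamma_bound[of "A x a" "hessian_h \<T> v x - hessian_h \<T> u x"] by (simp only: norm_minus_commute)
    qed
  qed
qed

text \<open>The constant \<open>c\<close> is a free parameter of Young's inequality. Instantiated
  with the monotonicity constant, the term in \<open>w\<close> is half of what monotonicity
  provides. Volume and face terms get the same two constants, so they add up to squares of
  \<open>norm_h\<close>.\<close>

lemma a_h_bound:
  fixes \<Lambda> :: "'l::metric_space set"
  assumes \<Lambda>: "compact \<Lambda>" "\<Lambda> \<noteq> {}" and reg: "coefficients_regular \<Omega> \<Lambda> A f"
    and \<mu>: "0 < \<mu>1" and ell: "uniformly_elliptic \<Omega> \<Lambda> A \<mu>1 \<mu>2" and sol: "strong_solution \<Omega> \<Lambda> A f g u"
    and \<sigma>: "\<sigma> \<ge> 0" and v: "\<And>K. K \<in> \<T> \<Longrightarrow> v \<in> H2 (interior K)" and w: "\<And>K. K \<in> \<T> \<Longrightarrow> w \<in> H2 (interior K)"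
    and c: "c > 0"
  shows "\<bar>a_h \<Omega> \<Lambda> A f \<sigma> \<T> v w\<bar> \<le> (real CARD('n))\<^sup>2 / (2 * c) * (norm_h \<Omega> \<sigma> \<T> (\<lambda>x. u x - v x))\<^sup>2 + c / 2 * (norm_h \<Omega> \<sigma> \<T> w)\<^sup>2"
proof -
  let ?d = "real CARD('n)"
  let ?D = "?d\<^sup>2 / (2 * c)"
  have d1: "?d \<ge> 1" by (simp add: Suc_le_eq)
  have uH2: "u \<in> H2 \<Omega>" using sol by (simp add: strong_solution_def)
  have u: "u \<in> H2 (interior K)" if "K \<in> \<T>" for K
    by (rule H2_subset(1)[OF domain(1) open_interior interior_subset_domain[OF that] uH2])
  let ?uv = "\<lambda>x. u x - v x"
  have uv: "?uv \<in> H2 (interior K)" if "K \<in> \<T>" for K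
    by (rule H2_diff(1)[OF open_interior u[OF that] v[OF that]])
  have hd: "AE x in lebesgue_on \<Omega>. hessian_h \<T> ?uv x = hessian_h \<T> u x - hessian_h \<T> v x"
    by (rule hessian_h_diff[OF u v])
  have hi: "integrable (lebesgue_on \<Omega>) (\<lambda>x. (norm (hessian_h \<T> ?uv x))\<^sup>2)"
    "integrable (lebesgue_on \<Omega>) (\<lambda>x. (norm (hessian_h \<T> w x))\<^sup>2)"
    by (rule hessian_h_square_integrable, erule uv w)+
  have I: "\<bar>\<integral>x. F_gamma \<Lambda> A f \<T> v x * laplacian_h \<T> w x \<partial>lebesgue_on \<Omega>\<bar>
     \<le> (\<integral>x. ?D * (norm (hessian_h \<T> ?uv x))\<^sup>2 + c / 2 * (norm (hessian_h \<T> w x))\<^sup>2 \<partial>lebesgue_on \<Omega>)"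
  proof (rule abs_integral_le)
    show "integrable (lebesgue_on \<Omega>) (\<lambda>x. ?D * (norm (hessian_h \<T> ?uv x))\<^sup>2 + c / 2 * (norm (hessian_h \<T> w x))\<^sup>2)"
      by (intro Bochner_Integration.integrable_add integrable_mult_right hi)
    show "AE x in lebesgue_on \<Omega>. \<bar>F_gamma \<Lambda> A f \<T> v x * laplacian_h \<T> w x\<bar>
       \<le> ?D * (norm (hessian_h \<T> ?uv x))\<^sup>2 + c / 2 * (norm (hessian_h \<T> w x))\<^sup>2"
      using F_gamma_bound[OF \<Lambda> reg \<mu> ell sol, of v] hd
    proof eventually_elim
      fix x assume F: "\<bar>F_gamma \<Lambda> A f \<T> v x\<bar> \<le> sqrt ?d * norm (hessian_h \<T> u x - hessian_h \<T> v x)"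
        and eq: "hessian_h \<T> ?uv x = hessian_h \<T> u x - hessian_h \<T> v x"
      have "\<bar>F_gamma \<Lambda> A f \<T> v x * laplacian_h \<T> w x\<bar> = \<bar>F_gamma \<Lambda> A f \<T> v x\<bar> * \<bar>trace (hessian_h \<T> w x)\<bar>"
        by (simp add: abs_mult laplacian_h_def)
      \<comment> \<open>One factor \<open>sqrt ?d\<close> comes from the bound on
        \<open>F_gamma\<close>, the other from estimating the Laplacian, a trace, by the Frobenius
        norm.\<close>
      also have "\<dots> \<le> (sqrt ?d * norm (hessian_h \<T> ?uv x)) * (sqrt ?d * norm (hessian_h \<T> w x))"
        by (intro mult_mono F[folded eq] abs_trace_le) auto
      also have "\<dots> = (sqrt ?d * sqrt ?d) * (norm (hessian_h \<T> ?uv x) * norm (hessian_h \<T> w x))"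
        by (simp only: ac_simps)
      also have "sqrt ?d * sqrt ?d = ?d" by simp
      also have "?d * (norm (hessian_h \<T> ?uv x) * norm (hessian_h \<T> w x)) \<le> ?D * (norm (hessian_h \<T> ?uv x))\<^sup>2 + c / 2 * (norm (hessian_h \<T> w x))\<^sup>2"
        by (rule Young_weighted[OF c])
      finally show "\<bar>F_gamma \<Lambda> A f \<T> v x * laplacian_h \<T> w x\<bar>
        \<le> ?D * (norm (hessian_h \<T> ?uv x))\<^sup>2 + c / 2 * (norm (hessian_h \<T> w x))\<^sup>2" .
    qed
  qed
  also have "\<dots> = ?D * (\<integral>x. (norm (hessian_h \<T> ?uv x))\<^sup>2 \<partial>lebesgue_on \<Omega>) + c / 2 * (\<integral>x. (norm (hessian_h \<T> w x))\<^sup>2 \<partial>lebesgue_on \<Omega>)"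
    using hi by simp
  finally have I': "\<bar>\<integral>x. F_gamma \<Lambda> A f \<T> v x * laplacian_h \<T> w x \<partial>lebesgue_on \<Omega>\<bar>
     \<le> ?D * (\<integral>x. (norm (hessian_h \<T> ?uv x))\<^sup>2 \<partial>lebesgue_on \<Omega>) + c / 2 * (\<integral>x. (norm (hessian_h \<T> w x))\<^sup>2 \<partial>lebesgue_on \<Omega>)" .
  let ?J = "\<lambda>e v. \<integral>x. (jump_normal \<T> e v x)\<^sup>2 \<partial>face_measure e"
  have J: "\<bar>\<sigma> / diameter e * (\<integral>x. jump_normal \<T> e v x * jump_normal \<T> e w x \<partial>face_measure e)\<bar>
     \<le> ?D * (\<sigma> / diameter e * ?J e ?uv) + c / 2 * (\<sigma> / diameter e * ?J e w)"
    if e: "e \<in> interior_faces \<T>" for e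
  proof -
    have i: "integrable (face_measure e) (\<lambda>x. (jump_normal \<T> e ?uv x)\<^sup>2)" "integrable (face_measure e) (\<lambda>x. (jump_normal \<T> e w x)\<^sup>2)"
      by (rule square_integrableD(2), rule jump_normal_square_integrable, erule uv w)+
    have jd: "AE x in face_measure e. jump_normal \<T> e ?uv x = jump_normal \<T> e u x - jump_normal \<T> e v x"
      by (rule jump_normal_diff[OF u v])
    have "\<bar>\<integral>x. jump_normal \<T> e v x * jump_normal \<T> e w x \<partial>face_measure e\<bar>
       \<le> (\<integral>x. ?D * (jump_normal \<T> e ?uv x)\<^sup>2 + c / 2 * (jump_normal \<T> e w x)\<^sup>2 \<partial>face_measure e)"
    proof (rule abs_integral_le)
      show "integrable (face_measure e) (\<lambda>x. ?D * (jump_normal \<T> e ?uv x)\<^sup>2 + c / 2 * (jump_normal \<T> e w x)\<^sup>2)"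
        by (intro Bochner_Integration.integrable_add integrable_mult_right i)
      show "AE x in face_measure e. \<bar>jump_normal \<T> e v x * jump_normal \<T> e w x\<bar>
         \<le> ?D * (jump_normal \<T> e ?uv x)\<^sup>2 + c / 2 * (jump_normal \<T> e w x)\<^sup>2"
        using jd jump_normal_solution[OF uH2 e]
      proof eventually_elim
        fix x assume eq: "jump_normal \<T> e ?uv x = jump_normal \<T> e u x - jump_normal \<T> e v x" and z: "jump_normal \<T> e u x = 0"
        let ?a = "\<bar>jump_normal \<T> e ?uv x\<bar>" and ?b = "\<bar>jump_normal \<T> e w x\<bar>"
        have "\<bar>jump_normal \<T> e v x * jump_normal \<T> e w x\<bar> = 1 * (?a * ?b)"
          by (simp add: eq z abs_mult)
        \<comment> \<open>The face terms would do with the constant 1; enlarging it to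
          \<open>?d\<close> matches the volume term, so that both parts combine into the
          norm.\<close>
        also have "\<dots> \<le> ?d * (?a * ?b)" using d1 by (intro mult_right_mono) auto
        also have "\<dots> \<le> ?D * ?a\<^sup>2 + c / 2 * ?b\<^sup>2" by (rule Young_weighted[OF c])
        finally show "\<bar>jump_normal \<T> e v x * jump_normal \<T> e w x\<bar>
           \<le> ?D * (jump_normal \<T> e ?uv x)\<^sup>2 + c / 2 * (jump_normal \<T> e w x)\<^sup>2"
          by (simp only: power2_abs)
      qed
    qed
    also have "\<dots> = ?D * ?J e ?uv + c / 2 * ?J e w" using i by simp
    finally have "\<sigma> / diameter e * \<bar>\<integral>x. jump_normal \<T> e v x * jump_normal \<T> e w x \<partial>face_measure e\<bar>
       \<le> \<sigma> / diameter e * (?D * ?J e ?uv + c / 2 * ?J e w)"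
      by (rule mult_left_mono[OF _ face_weight_nonneg[OF \<sigma> e]])
    also have "\<dots> = ?D * (\<sigma> / diameter e * ?J e ?uv) + c / 2 * (\<sigma> / diameter e * ?J e w)"
      by (simp only: distrib_left mult.left_commute)
    finally show ?thesis by (simp only: abs_mult abs_of_nonneg[OF face_weight_nonneg[OF \<sigma> e]])
  qed
  have S: "\<bar>\<Sum>e\<in>interior_faces \<T>. \<sigma> / diameter e * (\<integral>x. jump_normal \<T> e v x * jump_normal \<T> e w x \<partial>face_measure e)\<bar>
    \<le> ?D * (\<Sum>e\<in>interior_faces \<T>. \<sigma> / diameter e * ?J e ?uv) + c / 2 * (\<Sum>e\<in>interior_faces \<T>. \<sigma> / diameter e * ?J e w)"
  proof -
    have "\<bar>\<Sum>e\<in>interior_faces \<T>. \<sigma> / diameter e * (\<integral>x. jump_normal \<T> e v x * jump_normal \<T> e w x \<partial>face_measure e)\<bar>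
      \<le> (\<Sum>e\<in>interior_faces \<T>. ?D * (\<sigma> / diameter e * ?J e ?uv) + c / 2 * (\<sigma> / diameter e * ?J e w))"
      by (rule order_trans[OF sum_abs sum_mono[OF J]])
    then show ?thesis by (simp only: sum.distrib sum_distrib_left[symmetric])
  qed
  show ?thesis
    unfolding a_h_def norm_h_square[OF \<sigma>] distrib_left
    using I' S by linarith
qed

end

theorem theorem3p2:
  fixes \<Omega> :: "(real^'n) set"
    and \<Lambda> :: "'l::metric_space set"
    and A :: "real^'n \<Rightarrow> 'l \<Rightarrow> real^'n^'n"
    and f :: "real^'n \<Rightarrow> 'l \<Rightarrow> real"
    and g u :: "real^'n \<Rightarrow> real"
    and \<mu>1 \<mu>2 \<epsilon> \<sigma> :: real
    and p :: nat
    and \<TT> :: "(real^'n) set set set"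
  assumes "CARD('n) \<in> {2, 3}"
    and "polytopal_domain \<Omega>"
    and "g \<in> H2 \<Omega>"
    and "compact \<Lambda>" and "\<Lambda> \<noteq> {}"
    and "coefficients_regular \<Omega> \<Lambda> A f"
    and "0 < \<mu>1" and "\<mu>1 \<le> \<mu>2" and "uniformly_elliptic \<Omega> \<Lambda> A \<mu>1 \<mu>2"
    and "0 < \<epsilon>" and "\<epsilon> \<le> 1" and "cordes \<Omega> \<Lambda> A \<epsilon>"
    and "\<forall>\<T>\<in>\<TT>. simplicial_mesh \<Omega> \<T>" and "shape_regular \<TT>"
    and "p \<ge> 2"
    and "\<sigma> > 0" and "sufficiently_large \<Omega> \<Lambda> A f \<epsilon> p \<TT> \<sigma>"
    and "strong_solution \<Omega> \<Lambda> A f g u"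
  shows "\<exists>C>0. \<forall>\<T>\<in>\<TT>. \<forall>g_h\<in>V_h \<Omega> p \<T>. \<forall>u_h\<in>V_h \<Omega> p \<T>.
           (\<forall>v\<in>V_h0 \<Omega> p \<T>. a_h \<Omega> \<Lambda> A f \<sigma> \<T> u_h v = 0) \<and>
           (\<forall>x\<in>frontier \<Omega>. u_h x = g_h x) \<longrightarrow>
           norm_h \<Omega> \<sigma> \<T> (\<lambda>x. u x - u_h x) \<le>
             C * (INF v \<in> {v \<in> V_h \<Omega> p \<T>. \<forall>x\<in>frontier \<Omega>. v x = g_h x}.
                    norm_h \<Omega> \<sigma> \<T> (\<lambda>x. u x - v x))"
proof -
  obtain \<delta> \<sigma>0 where \<delta>: "0 < \<delta>" and thr: "penalty_threshold \<Omega> \<Lambda> A f \<epsilon> p \<TT> \<delta> \<sigma>0" and \<sigma>0: "\<sigma> \<ge> \<sigma>0"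
    using assms(17) by (auto simp: sufficiently_large_def)
  define c where "c = \<delta> * (1 - sqrt (1 - \<epsilon>))"
  have c: "c > 0" using \<delta> assms(10,11) by (simp add: c_def)
  \<comment> \<open>The squared error is at most twice the squared error of \<open>v\<close> plus
    twice the squared norm of \<open>u_h - v\<close>, and the latter is at most d^2 / c^2 times the
    former.\<close>
  define C where "C = sqrt (2 + 2 * ((real CARD('n))\<^sup>2 / c\<^sup>2))"
  have C2: "C\<^sup>2 = 2 + 2 * ((real CARD('n))\<^sup>2 / c\<^sup>2)" unfolding C_def by (rule real_sqrt_pow2) simp
  have C: "C > 0" unfolding C_def by (rule real_sqrt_gt_zero) (simp add: add_pos_nonneg)
  have \<sigma>: "\<sigma> \<ge> 0" using assms(16) by simp
  show ?thesis
  proof (rule exI[of _ C], intro conjI C ballI impI)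
    fix \<T> g_h u_h
    assume \<T>: "\<T> \<in> \<TT>" and g_h: "g_h \<in> V_h \<Omega> p \<T>" and u_h: "u_h \<in> V_h \<Omega> p \<T>"
      and sol: "(\<forall>v\<in>V_h0 \<Omega> p \<T>. a_h \<Omega> \<Lambda> A f \<sigma> \<T> u_h v = 0) \<and> (\<forall>x\<in>frontier \<Omega>. u_h x = g_h x)"
    interpret mesh \<Omega> \<T> by unfold_locales (use assms(2,13) \<T> in auto)
    have uH2: "u \<in> H2 \<Omega>" using assms(18) by (simp add: strong_solution_def)
    have uK: "u \<in> H2 (interior K)" if "K \<in> \<T>" for K
      by (rule H2_subset(1)[OF domain(1) open_interior interior_subset_domain[OF that] uH2])
    have main: "norm_h \<Omega> \<sigma> \<T> (\<lambda>x. u x - u_h x) \<le> C * norm_h \<Omega> \<sigma> \<T> (\<lambda>x. u x - v x)"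
      if v: "v \<in> V_h \<Omega> p \<T>" and vg: "\<forall>x\<in>frontier \<Omega>. v x = g_h x" for v
    proof -
      let ?w = "\<lambda>x. u_h x - v x"
      have wV: "?w \<in> V_h \<Omega> p \<T>" by (rule V_h_diff[OF u_h v])
      \<comment> \<open>Both functions coincide with \<open>g_h\<close> on the frontier, so their
        difference vanishes there pointwise and may be used as a test function.\<close>
      have "?w \<in> H10 \<Omega>" by (rule vanishing_V_h_in_H10[OF wV]) (use sol vg in simp)
      then have w0: "?w \<in> V_h0 \<Omega> p \<T>" using wV by (simp add: V_h0_def)
      let ?N = "(norm_h \<Omega> \<sigma> \<T> (\<lambda>x. u x - v x))\<^sup>2" and ?W = "(norm_h \<Omega> \<sigma> \<T> ?w)\<^sup>2"
      have "a_h \<Omega> \<Lambda> A f \<sigma> \<T> u_h ?w - a_h \<Omega> \<Lambda> A f \<sigma> \<T> v ?w \<ge> \<delta> * (1 - sqrt (1 - \<epsilon>)) * ?W"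
        using thr \<sigma>0 \<T> u_h v w0 unfolding penalty_threshold_def by blast
      moreover have "a_h \<Omega> \<Lambda> A f \<sigma> \<T> u_h ?w = 0" using sol w0 by blast
      moreover have "\<bar>a_h \<Omega> \<Lambda> A f \<sigma> \<T> v ?w\<bar> \<le> (real CARD('n))\<^sup>2 / (2 * c) * ?N + c / 2 * ?W"
        by (rule a_h_bound[OF assms(4-7,9,18) \<sigma> V_h_H2[OF v] V_h_H2[OF wV] c])
      ultimately have "c * ?W \<le> (real CARD('n))\<^sup>2 / (2 * c) * ?N + c / 2 * ?W"
        unfolding c_def by linarith
      then have "c / 2 * ?W \<le> (real CARD('n))\<^sup>2 / (2 * c) * ?N" by (simp add: algebra_simps)
      then have "2 / c * (c / 2 * ?W) \<le> 2 / c * ((real CARD('n))\<^sup>2 / (2 * c) * ?N)"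
        using c by (intro mult_left_mono) auto
      then have W: "?W \<le> (real CARD('n))\<^sup>2 / c\<^sup>2 * ?N" using c by (simp add: power2_eq_square)
      have "(\<lambda>x. u x - u_h x) = (\<lambda>x. (u x - v x) - ?w x)" by simp
      then have "(norm_h \<Omega> \<sigma> \<T> (\<lambda>x. u x - u_h x))\<^sup>2 \<le> 2 * ?N + 2 * ?W"
        using norm_h_diff_square_le[OF \<sigma> H2_diff(1)[OF open_interior uK V_h_H2[OF v]] V_h_H2[OF wV]] by simp
      also have "\<dots> \<le> C\<^sup>2 * ?N" unfolding C2 distrib_right using W by simp
      finally have "(norm_h \<Omega> \<sigma> \<T> (\<lambda>x. u x - u_h x))\<^sup>2 \<le> (C * norm_h \<Omega> \<sigma> \<T> (\<lambda>x. u x - v x))\<^sup>2"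
        by (simp only: power_mult_distrib)
      then show ?thesis
        by (rule power2_le_imp_le) (intro mult_nonneg_nonneg less_imp_le[OF C] norm_h_nonneg \<sigma>)
    qed
    let ?S = "{v \<in> V_h \<Omega> p \<T>. \<forall>x\<in>frontier \<Omega>. v x = g_h x}"
    have "norm_h \<Omega> \<sigma> \<T> (\<lambda>x. u x - u_h x) / C \<le> (INF v \<in> ?S. norm_h \<Omega> \<sigma> \<T> (\<lambda>x. u x - v x))"
    proof (rule cINF_greatest)
      \<comment> \<open>The boundary approximation \<open>g_h\<close> is itself a competitor;
        nonemptiness is what gives the real infimum its meaning as a greatest lower bound.\<close>
      show "?S \<noteq> {}" using g_h by blast
      fix v assume "v \<in> ?S"
      then have "norm_h \<Omega> \<sigma> \<T> (\<lambda>x. u x - u_h x) \<le> C * norm_h \<Omega> \<sigma> \<T> (\<lambda>x. u x - v x)" using main by blast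
      then show "norm_h \<Omega> \<sigma> \<T> (\<lambda>x. u x - u_h x) / C \<le> norm_h \<Omega> \<sigma> \<T> (\<lambda>x. u x - v x)"
        using C by (simp add: pos_divide_le_eq mult.commute)
    qed
    then show "norm_h \<Omega> \<sigma> \<T> (\<lambda>x. u x - u_h x) \<le> C * (INF v \<in> ?S. norm_h \<Omega> \<sigma> \<T> (\<lambda>x. u x - v x))"
      using C by (simp add: pos_divide_le_eq mult.commute)
  qed
qed

end
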